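(* Let $s\in(0,1)$. If $(\bar{\mathsf u},\bar{\mathsf z})\in\mathbb H^s(\Omega)\times\mathsf Z_{ad}$ is the optimal solution of the fractional optimal control problem and $(\bar{\mathcal U},\bar{\mathsf q})\in\mathring H^1_L(y^\alpha,\mathcal C)\times\mathsf Z_{ad}$ is the optimal solution of the extended optimal control problem, then $\bar{\mathsf z}=\bar{\mathsf q}$ and $\operatorname{tr}_\Omega\bar{\mathcal U}=\bar{\mathsf u}$.
   Context: Let $n\ge1$, $\Omega\subset\mathbb R^n$ open, bounded, connected with polyhedral boundary. Let $\mathcal L w=-\mathrm{div}_{x'}(A\nabla_{x'}w)+cw$ with $0\le c\in L^\infty(\Omega)$, $A\in C^{0,1}(\Omega,\mathrm{GL}(n,\mathbb R))$ symmetric, uniformly positive definite, with homogeneous Dirichlet boundary conditions; let $\{\lambda_k,\varphi_k\}$ be its Dirichlet eigenpairs with $\{\varphi_k\}$ orthonormal in $L^2(\Omega)$. For $\sigma\ge0$, $\mathbb H^\sigma(\Omega)=\{w=\sum_kw_k\varphi_k:\sum_k\lambda_k^\sigma w_k^2<\infty\}$, $\mathbb H^{-\sigma}(\Omega)$ its dual, $\langle\cdot,\cdot\rangle$ the $\mathbb H^{-s}$–$\mathbb H^s$ duality, and $\mathcal L^sw=\sum_k\lambda_k^sw_k\varphi_k$. The operator $\mathbf S$ maps $\mathsf z\in\mathbb H^{-s}(\Omega)$ to the unique $\mathsf u\in\mathbb H^s(\Omega)$ with $\mathcal L^s\mathsf u=\mathsf z$. Fix $\mu>0$, $\mathsf u_d\in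 L^2(\Omega)$, $\mathsf a,\mathsf b\in L^2(\Omega)$ with $\mathsf a\le\mathsf b$; $J(\mathsf u,\mathsf z)=\tfrac12\|\mathsf u-\mathsf u_d\|^2_{L^2(\Omega)}+\tfrac\mu2\|\mathsf z\|^2_{L^2(\Omega)}$, $\mathsf Z_{ad}=\{\mathsf w\in L^2(\Omega):\mathsf a\le\mathsf w\le\mathsf b\text{ a.e.}\}$. Fractional optimal control problem: minimize $J(\mathbf S\mathsf z,\mathsf z)$ over $\mathsf z\in\mathsf Z_{ad}$, with optimal solution $(\mathbf S\bar{\mathsf z},\bar{\mathsf z})$. Extended problem: let $\alpha=1-2s$, $d_s=2^\alpha\Gamma(1-s)/\Gamma(s)$, $\mathcal C=\Omega\times(0,\infty)$ with points $(x',y)$; $H^1(y^\alpha,\mathcal C)$ is the space of $w$ with $\int_{\mathcal C}y^\alpha(w^2+|\nabla w|^2)<\infty$; $\mathring H^1_L(y^\alpha,\mathcal C)=\{w\in H^1(y^\alpha,\mathcal C):w=0\text{ on }\partial\Omega\times[0,\infty)\}$; $\operatorname{tr}_\Omega$ is the trace on $\Omega\times\{0\}$; $\mathbf A=\mathrm{diag}\{A,1\}$; $a(w,\phi)=\frac1{d_s}\int_{\mathcal C}y^\alpha\mathbf A\nabla w\cdot\nabla\phi+y^\alpha cw\phi$. For $\mathsf q\in\mathbb H^{-s}(\Omega)$, $\mathcal U(\mathsf q)\in\mathring H^1_L(y^\alpha,\mathcal C)$ solves $a(\mathcal U(\mathsf q),\phi)=\langle\mathsf q,\operatorname{tr}_\Omega\phi\rangle$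 for all $\phi\in\mathring H^1_L(y^\alpha,\mathcal C)$. The extended optimal control problem: minimize $J(\operatorname{tr}_\Omega\mathcal U(\mathsf q),\mathsf q)$ over $\mathsf q\in\mathsf Z_{ad}$, with optimal solution $(\bar{\mathcal U},\bar{\mathsf q})=(\mathcal U(\bar{\mathsf q}),\bar{\mathsf q})$. *)

theory Defs
  imports "HOL-Analysis.Analysis"
begin

definition pderiv_dir :: "('a::euclidean_space \<Rightarrow> real) \<Rightarrow> 'a \<Rightarrow> 'a \<Rightarrow> real" where
  "pderiv_dir f i x = frechet_derivative f (at x) i"

definition cgrad :: "('a::euclidean_space \<Rightarrow> real) \<Rightarrow> 'a \<Rightarrow> 'a" where
  "cgrad f x = (\<Sum>i\<in>Basis. pderiv_dir f i x *\<^sub>R i)"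

fun Ck :: "nat \<Rightarrow> ('a::euclidean_space \<Rightarrow> real) \<Rightarrow> bool" where
  "Ck 0 f \<longleftrightarrow> continuous_on UNIV f"
| "Ck (Suc k) f \<longleftrightarrow> (\<forall>x. f differentiable (at x)) \<and> continuous_on UNIV f \<and>
       (\<forall>i\<in>Basis. Ck k (pderiv_dir f i))"

definition smooth_fun :: "('a::euclidean_space \<Rightarrow> real) \<Rightarrow> bool" where
  "smooth_fun f \<longleftrightarrow> (\<forall>k. Ck k f)"

definition tsupport :: "('a::euclidean_space \<Rightarrow> real) \<Rightarrow> 'a set" where
  "tsupport f = closure {x. f x \<noteq> 0}"

definition test_fn :: "'a::euclidean_space set \<Rightarrow> ('a \<Rightarrow> real) \<Rightarrow> bool" where
  "test_fn U f \<longleftrightarrow> smooth_fun f \<and> compact (tsupport f) \<and> tsupport f \<subseteq> U"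

definition weak_gradient :: "'a::euclidean_space set \<Rightarrow> ('a \<Rightarrow> real) \<Rightarrow> ('a \<Rightarrow> 'a) \<Rightarrow> bool" where
  "weak_gradient U f G \<longleftrightarrow>
     f \<in> borel_measurable lborel \<and> G \<in> borel_measurable lborel \<and>
     (\<forall>K. compact K \<and> K \<subseteq> U \<longrightarrow> set_integrable lborel K f \<and> set_integrable lborel K G) \<and>
     (\<forall>\<phi>. test_fn U \<phi> \<longrightarrow> (\<forall>i\<in>Basis.
        set_lebesgue_integral lborel U (\<lambda>x. f x * pderiv_dir \<phi> i x)
        = - set_lebesgue_integral lborel U (\<lambda>x. (G x \<bullet> i) * \<phi> x)))"

definition L2 :: "'a::euclidean_space set \<Rightarrow> ('a \<Rightarrow> real) \<Rightarrow> bool" where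
  "L2 U f \<longleftrightarrow> f \<in> borel_measurable lborel \<and>
     set_nn_integral lborel U (\<lambda>x. ennreal ((f x)\<^sup>2)) < \<infinity>"

definition H1 :: "'a::euclidean_space set \<Rightarrow> ('a \<Rightarrow> real) \<Rightarrow> ('a \<Rightarrow> 'a) \<Rightarrow> bool" where
  "H1 U w G \<longleftrightarrow> L2 U w \<and> weak_gradient U w G \<and>
     set_nn_integral lborel U (\<lambda>x. ennreal ((norm (G x))\<^sup>2)) < \<infinity>"

definition H10 :: "'a::euclidean_space set \<Rightarrow> ('a \<Rightarrow> real) \<Rightarrow> ('a \<Rightarrow> 'a) \<Rightarrow> bool" where
  "H10 U w G \<longleftrightarrow> H1 U w G \<and>
     (\<exists>\<psi>. (\<forall>j. test_fn U (\<psi> j)) \<and>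
        (\<lambda>j. set_nn_integral lborel U
           (\<lambda>x. ennreal ((w x - \<psi> j x)\<^sup>2 + (norm (G x - cgrad (\<psi> j) x))\<^sup>2)))
        \<longlonglongrightarrow> 0)"

definition polyhedral_boundary :: "'a::euclidean_space set \<Rightarrow> bool" where
  "polyhedral_boundary U \<longleftrightarrow> (\<exists>\<F>. finite \<F> \<and> frontier U = \<Union>\<F> \<and>
     (\<forall>F\<in>\<F>. polytope F \<and> aff_dim F = int DIM('a) - 1))"

(* Dirichlet bilinear form of  L w = -div(A grad w) + c w  on \<Omega> *)
definition a_Omega :: "(real^'n) set \<Rightarrow> (real^'n \<Rightarrow> real^'n^'n) \<Rightarrow> (real^'n \<Rightarrow> real)
     \<Rightarrow> (real^'n \<Rightarrow> real) \<Rightarrow> (real^'n \<Rightarrow> real^'n) \<Rightarrow> (real^'n \<Rightarrow> real) \<Rightarrow> (real^'n \<Rightarrow> real^'n) \<Rightarrow> real" where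
  "a_Omega \<Omega> A c w Gw v Gv = set_lebesgue_integral lborel \<Omega>
      (\<lambda>x. (A x *v Gw x) \<bullet> Gv x + c x * w x * v x)"

definition setting :: "(real^'n) set \<Rightarrow> (real^'n \<Rightarrow> real^'n^'n) \<Rightarrow> (real^'n \<Rightarrow> real)
     \<Rightarrow> (nat \<Rightarrow> real) \<Rightarrow> (nat \<Rightarrow> real^'n \<Rightarrow> real) \<Rightarrow> bool" where
  "setting \<Omega> A c lam phi \<longleftrightarrow>
     open \<Omega> \<and> bounded \<Omega> \<and> connected \<Omega> \<and> \<Omega> \<noteq> {} \<and> polyhedral_boundary \<Omega> \<and>
     (\<exists>L. lipschitz_on L \<Omega> A) \<and>
     (\<forall>x\<in>\<Omega>. transpose (A x) = A x) \<and>
     (\<exists>\<theta>>0. \<forall>x\<in>\<Omega>. \<forall>\<xi>. \<xi> \<bullet> (A x *v \<xi>) \<ge> \<theta> * (norm \<xi>)\<^sup>2) \<and>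
     c \<in> borel_measurable lborel \<and>
     (\<exists>M. AE x in lborel. x \<in> \<Omega> \<longrightarrow> 0 \<le> c x \<and> c x \<le> M) \<and>
     \<comment> \<open>Dirichlet eigenpairs\<close>
     (\<forall>k. \<exists>G. H10 \<Omega> (phi k) G \<and>
        (\<forall>v Gv. H10 \<Omega> v Gv \<longrightarrow>
           a_Omega \<Omega> A c (phi k) G v Gv
           = lam k * set_lebesgue_integral lborel \<Omega> (\<lambda>x. phi k x * v x))) \<and>
     \<comment> \<open>orthonormal in L^2\<close>
     (\<forall>j k. set_lebesgue_integral lborel \<Omega> (\<lambda>x. phi j x * phi k x) = (if j = k then 1 else 0)) \<and>
     \<comment> \<open>complete (all eigenpairs, counted with multiplicity): Parseval\<close>
     (\<forall>f. L2 \<Omega> f \<longrightarrow>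
        (\<lambda>k. (set_lebesgue_integral lborel \<Omega> (\<lambda>x. f x * phi k x))\<^sup>2)
          sums set_lebesgue_integral lborel \<Omega> (\<lambda>x. (f x)\<^sup>2))"

definition coef :: "(real^'n) set \<Rightarrow> (nat \<Rightarrow> real^'n \<Rightarrow> real) \<Rightarrow> (real^'n \<Rightarrow> real) \<Rightarrow> nat \<Rightarrow> real" where
  "coef \<Omega> phi f k = set_lebesgue_integral lborel \<Omega> (\<lambda>x. f x * phi k x)"

definition Hsig :: "(real^'n) set \<Rightarrow> (nat \<Rightarrow> real) \<Rightarrow> (nat \<Rightarrow> real^'n \<Rightarrow> real) \<Rightarrow> real
     \<Rightarrow> (real^'n \<Rightarrow> real) \<Rightarrow> bool" where
  "Hsig \<Omega> lam phi \<sigma> w \<longleftrightarrow> L2 \<Omega> w \<and> summable (\<lambda>k. lam k powr \<sigma> * (coef \<Omega> phi w k)\<^sup>2)"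

(* u = S z, i.e. u \<in> \<bbbH>^s and L^s u = z (z \<in> L^2 \<subseteq> \<bbbH>^{-s}); equality in \<bbbH>^{-s}
   is equality of all spectral coefficients *)
definition frac_state :: "(real^'n) set \<Rightarrow> (nat \<Rightarrow> real) \<Rightarrow> (nat \<Rightarrow> real^'n \<Rightarrow> real) \<Rightarrow> real
     \<Rightarrow> (real^'n \<Rightarrow> real) \<Rightarrow> (real^'n \<Rightarrow> real) \<Rightarrow> bool" where
  "frac_state \<Omega> lam phi s z u \<longleftrightarrow> Hsig \<Omega> lam phi s u \<and>
     (\<forall>k. lam k powr s * coef \<Omega> phi u k = coef \<Omega> phi z k)"

definition Jcost :: "(real^'n) set \<Rightarrow> real \<Rightarrow> (real^'n \<Rightarrow> real) \<Rightarrow> (real^'n \<Rightarrow> real)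
     \<Rightarrow> (real^'n \<Rightarrow> real) \<Rightarrow> real" where
  "Jcost \<Omega> \<mu> ud u z =
     1/2 * set_lebesgue_integral lborel \<Omega> (\<lambda>x. (u x - ud x)\<^sup>2)
     + \<mu>/2 * set_lebesgue_integral lborel \<Omega> (\<lambda>x. (z x)\<^sup>2)"

definition Zad :: "(real^'n) set \<Rightarrow> (real^'n \<Rightarrow> real) \<Rightarrow> (real^'n \<Rightarrow> real) \<Rightarrow> (real^'n \<Rightarrow> real) set" where
  "Zad \<Omega> a b = {w. L2 \<Omega> w \<and> (AE x in lborel. x \<in> \<Omega> \<longrightarrow> a x \<le> w x \<and> w x \<le> b x)}"

definition cyl :: "(real^'n) set \<Rightarrow> ((real^'n) \<times> real) set" where
  "cyl \<Omega> = \<Omega> \<times> {0<..}"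

definition H1w :: "(real^'n) set \<Rightarrow> real \<Rightarrow> ((real^'n) \<times> real \<Rightarrow> real)
     \<Rightarrow> ((real^'n) \<times> real \<Rightarrow> (real^'n) \<times> real) \<Rightarrow> bool" where
  "H1w \<Omega> \<alpha> w G \<longleftrightarrow> weak_gradient (cyl \<Omega>) w G \<and>
     set_nn_integral lborel (cyl \<Omega>)
       (\<lambda>p. ennreal (snd p powr \<alpha> * ((w p)\<^sup>2 + (norm (G p))\<^sup>2))) < \<infinity>"

(* smooth functions with compact support in \<Omega> \<times> \<real> (they vanish near the
   lateral boundary \<partial>\<Omega> \<times> [0,\<infinity>) but not necessarily near y = 0) *)
definition lat_test :: "(real^'n) set \<Rightarrow> ((real^'n) \<times> real \<Rightarrow> real) \<Rightarrow> bool" where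
  "lat_test \<Omega> \<psi> \<longleftrightarrow> test_fn (\<Omega> \<times> UNIV) \<psi>"

definition wconv :: "(real^'n) set \<Rightarrow> real \<Rightarrow> ((real^'n) \<times> real \<Rightarrow> real)
     \<Rightarrow> ((real^'n) \<times> real \<Rightarrow> (real^'n) \<times> real) \<Rightarrow> (nat \<Rightarrow> (real^'n) \<times> real \<Rightarrow> real) \<Rightarrow> bool" where
  "wconv \<Omega> \<alpha> w G \<psi> \<longleftrightarrow>
     (\<lambda>j. set_nn_integral lborel (cyl \<Omega>)
        (\<lambda>p. ennreal (snd p powr \<alpha> * ((w p - \<psi> j p)\<^sup>2 + (norm (G p - cgrad (\<psi> j) p))\<^sup>2))))
     \<longlonglongrightarrow> 0"

(* w \<in> \<ring>H^1_L(y^\<alpha>,\<C>): w \<in> H^1(y^\<alpha>,\<C>) vanishing on the lateral boundary,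
   i.e. in the closure of the lateral test functions *)
definition HL :: "(real^'n) set \<Rightarrow> real \<Rightarrow> ((real^'n) \<times> real \<Rightarrow> real)
     \<Rightarrow> ((real^'n) \<times> real \<Rightarrow> (real^'n) \<times> real) \<Rightarrow> bool" where
  "HL \<Omega> \<alpha> w G \<longleftrightarrow> H1w \<Omega> \<alpha> w G \<and> (\<exists>\<psi>. (\<forall>j. lat_test \<Omega> (\<psi> j)) \<and> wconv \<Omega> \<alpha> w G \<psi>)"

(* t = tr_\<Omega> w : limit in L^2(\<Omega>) of the restrictions to y = 0 of any
   approximating sequence of smooth functions (trace defined by density) *)
definition trace_of :: "(real^'n) set \<Rightarrow> real \<Rightarrow> ((real^'n) \<times> real \<Rightarrow> real)
     \<Rightarrow> (real^'n \<Rightarrow> real) \<Rightarrow> bool" where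
  "trace_of \<Omega> \<alpha> w t \<longleftrightarrow> L2 \<Omega> t \<and>
     (\<exists>G \<psi>. HL \<Omega> \<alpha> w G \<and> (\<forall>j. lat_test \<Omega> (\<psi> j)) \<and> wconv \<Omega> \<alpha> w G \<psi> \<and>
        (\<lambda>j. set_nn_integral lborel \<Omega> (\<lambda>x. ennreal ((\<psi> j (x, 0) - t x)\<^sup>2))) \<longlonglongrightarrow> 0)"

definition d_s :: "real \<Rightarrow> real" where
  "d_s s = 2 powr (1 - 2 * s) * Gamma (1 - s) / Gamma s"

definition a_ext :: "(real^'n) set \<Rightarrow> (real^'n \<Rightarrow> real^'n^'n) \<Rightarrow> (real^'n \<Rightarrow> real) \<Rightarrow> real
     \<Rightarrow> ((real^'n) \<times> real \<Rightarrow> real) \<Rightarrow> ((real^'n) \<times> real \<Rightarrow> (real^'n) \<times> real)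
     \<Rightarrow> ((real^'n) \<times> real \<Rightarrow> real) \<Rightarrow> ((real^'n) \<times> real \<Rightarrow> (real^'n) \<times> real) \<Rightarrow> real" where
  "a_ext \<Omega> A c s w Gw v Gv = 1 / d_s s * set_lebesgue_integral lborel (cyl \<Omega>)
      (\<lambda>p. snd p powr (1 - 2 * s) *
         ((A (fst p) *v fst (Gw p)) \<bullet> fst (Gv p) + snd (Gw p) * snd (Gv p)
          + c (fst p) * w p * v p))"

definition ext_state :: "(real^'n) set \<Rightarrow> (real^'n \<Rightarrow> real^'n^'n) \<Rightarrow> (real^'n \<Rightarrow> real) \<Rightarrow> real
     \<Rightarrow> (real^'n \<Rightarrow> real) \<Rightarrow> ((real^'n) \<times> real \<Rightarrow> real) \<Rightarrow> bool" where
  "ext_state \<Omega> A c s q W \<longleftrightarrow>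
     (\<exists>GW. HL \<Omega> (1 - 2 * s) W GW \<and>
        (\<forall>\<phi> G\<phi> t. HL \<Omega> (1 - 2 * s) \<phi> G\<phi> \<and> trace_of \<Omega> (1 - 2 * s) \<phi> t \<longrightarrow>
           a_ext \<Omega> A c s W GW \<phi> G\<phi> = set_lebesgue_integral lborel \<Omega> (\<lambda>x. q x * t x)))"

end

theory Submission
  imports Defs
begin

text \<open>
  Both problems minimize the same strictly convex reduced cost once the Dirichlet-to-Neumann identity
  \<open>lam k powr s * coef (tr U) = coef q\<close> is known for the extension \<open>U\<close> of \<open>q\<close>; the two minimizers are then
  compared through their midpoint.
  To obtain the identity without Bessel functions, the extended equation is tested with
  \<open>phi k x * exp (- y^2 / (4 * t))\<close> for every \<open>t > 0\<close>. Integrating by parts in \<open>y\<close>, the pairing with a smooth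
  \<open>\<psi>\<close> is \<open>- exp (lam k * t) * t powr (1 - s)\<close> times the \<open>t\<close>-derivative of
  \<open>t powr (s - 1) * exp (- lam k * t) * \<integral>\<integral> y powr (1 - 2 * s) * \<psi> * phi k * exp (- y^2 / (4 * t))\<close>. This expression
  vanishes as \<open>t\<close> tends to infinity and tends to \<open>2 powr (1 - 2 * s) * Gamma (1 - s)\<close> times the coefficient of the
  trace as \<open>t\<close> tends to 0. Integration over \<open>t\<close> therefore equates that multiple with
  \<open>d_s s * Gamma s * lam k powr (- s)\<close> times the coefficient of \<open>q\<close>, which is where \<open>d_s s\<close> comes from.
  Existence of the extension of an arbitrary square integrable \<open>q\<close> comes from a minimizing sequence of the
  energy, which is Cauchy by coercivity. Well-definedness of the trace, also along different approximating
  sequences and weak gradients, follows from a trace inequality in which the gradient term has an arbitrarily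
  small factor.
\<close>

subsection \<open>Square integrable functions\<close>

text \<open>For a fixed t the Gaussian test shows no trace at all: y powr (1 - 2 s) times its
  y-derivative vanishes at y = 0, so integration by parts leaves no boundary term. The trace emerges
  only as t tends to 0, where t powr (s - 1) times the profile concentrates at y = 0. The
  computation is made for smooth functions while the solution is only a limit of them, so the error
  has to be controlled for all t at once: the energy norm of the profile is at most a constant times
  (1 + t) * t powr (- s / 2), which remains integrable against t powr (s - 1) * exp (- lam k * t).
  The definitions carry a function and its weak gradient as separate data, and a trace may come with
  another gradient. Both are packed into one square integrable map, the \<open>jet\<close>, and all
  limits are taken in L2; uniqueness of weak gradients is never invoked. Extensions must exist
  because optimality in the extended problem speaks only of controls that have one, and
  \<open>zbar\<close> must be among these competitors. Parseval turns equal spectral coefficients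
  into equality almost everywhere.\<close>

definition sq_int :: "'a measure \<Rightarrow> ('a \<Rightarrow> 'b::real_normed_vector) \<Rightarrow> bool" where
  "sq_int M f \<longleftrightarrow> f \<in> borel_measurable M \<and> (\<integral>\<^sup>+x. ennreal ((norm (f x))\<^sup>2) \<partial>M) < \<infinity>"

text \<open>The Bochner integral of a non-integrable function is 0, so this is a norm only together
  with \<open>sq_int\<close>; the two always travel as a pair.\<close>

definition l2n :: "'a measure \<Rightarrow> ('a \<Rightarrow> 'b::real_normed_vector) \<Rightarrow> real" where
  "l2n M f = sqrt (\<integral>x. (norm (f x))\<^sup>2 \<partial>M)"

lemma sq_int_measurable[measurable_dest]: "sq_int M f \<Longrightarrow> f \<in> borel_measurable M"
  by (simp add: sq_int_def)

lemma sq_int_iff: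
  "sq_int M f \<longleftrightarrow> f \<in> borel_measurable M \<and> integrable M (\<lambda>x. (norm (f x))\<^sup>2)"
  unfolding sq_int_def by (auto simp: integrable_iff_bounded)

lemma l2n_nonneg [simp]: "l2n M f \<ge> 0"
  by (simp add: l2n_def)

lemma l2n_sq: "(l2n M f)\<^sup>2 = (\<integral>x. (norm (f x))\<^sup>2 \<partial>M)"
  by (simp add: l2n_def)

lemma nn_integral_sq_eq:
  "sq_int M f \<Longrightarrow> (\<integral>\<^sup>+x. ennreal ((norm (f x))\<^sup>2) \<partial>M) = ennreal ((l2n M f)\<^sup>2)"
  unfolding l2n_sq by (intro nn_integral_eq_integral) (auto simp: sq_int_iff)

lemma l2n_le_iff_nn_integral:
  assumes "sq_int M f" "B \<ge> 0"
  shows "(\<integral>\<^sup>+x. ennreal ((norm (f x))\<^sup>2) \<partial>M) \<le> ennreal (B\<^sup>2) \<longleftrightarrow> l2n M f \<le> B"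
  using assms by (simp add: nn_integral_sq_eq)

text \<open>Cauchy-Schwarz for anything dominated by a product of norms, so that one statement
  serves inner products, integration by parts and local integrability alike.\<close>

lemma integrable_prod_bound:
  fixes f :: "'a \<Rightarrow> 'b::real_normed_vector" and g :: "'a \<Rightarrow> 'c::real_normed_vector"
    and h :: "'a \<Rightarrow> 'd::{banach, second_countable_topology}"
  assumes f: "sq_int M f" and g: "sq_int M g" and [measurable]: "h \<in> borel_measurable M"
    and K: "K \<ge> 0" and b: "AE x in M. norm (h x) \<le> K * (norm (f x) * norm (g x))"
  shows "integrable M h" and "norm (\<integral>x. h x \<partial>M) \<le> K * (l2n M f * l2n M g)"
proof -
  note [measurable] = sq_int_measurable[OF f] sq_int_measurable[OF g]
  have fi: "integrable M (\<lambda>x. (norm (f x))\<^sup>2)" and gi: "integrable M (\<lambda>x. (norm (g x))\<^sup>2)"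
    using f g by (auto simp: sq_int_iff)
  \<comment> \<open>Integrability of the product comes first, from 2ab <= a^2 + b^2; only then can
    the nonnegative integral in Cauchy-Schwarz be read as a Bochner integral.\<close>
  have P: "integrable M (\<lambda>x. norm (f x) * norm (g x))"
  proof (rule Bochner_Integration.integrable_bound)
    show "integrable M (\<lambda>x. (norm (f x))\<^sup>2 + (norm (g x))\<^sup>2)" using fi gi by simp
    show "AE x in M. norm (norm (f x) * norm (g x)) \<le> norm ((norm (f x))\<^sup>2 + (norm (g x))\<^sup>2)"
    proof (rule AE_I2)
      fix x
      have "2 * (norm (f x) * norm (g x)) \<le> (norm (f x))\<^sup>2 + (norm (g x))\<^sup>2"
        using sum_squares_bound[of "norm (f x)" "norm (g x)"] by simp
      moreover have "0 \<le> norm (f x) * norm (g x)" by simp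
      ultimately show "norm (norm (f x) * norm (g x)) \<le> norm ((norm (f x))\<^sup>2 + (norm (g x))\<^sup>2)"
        unfolding real_norm_def by linarith
    qed
  qed simp
  have "(\<integral>\<^sup>+x. ennreal (norm (f x)) * ennreal (norm (g x)) \<partial>M)\<^sup>2 \<le>
      (\<integral>\<^sup>+x. (ennreal (norm (f x)))\<^sup>2 \<partial>M) * (\<integral>\<^sup>+x. (ennreal (norm (g x)))\<^sup>2 \<partial>M)"
    by (rule Cauchy_Schwarz_nn_integral) auto
  also have "\<dots> = ennreal ((l2n M f)\<^sup>2) * ennreal ((l2n M g)\<^sup>2)"
    using nn_integral_sq_eq[OF f] nn_integral_sq_eq[OF g] by (simp add: ennreal_power)
  also have "\<dots> = ennreal ((l2n M f * l2n M g)\<^sup>2)"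
    by (simp add: power_mult_distrib ennreal_mult)
  also have "(\<integral>\<^sup>+x. ennreal (norm (f x)) * ennreal (norm (g x)) \<partial>M)
      = ennreal (\<integral>x. norm (f x) * norm (g x) \<partial>M)"
    using nn_integral_eq_integral[OF P] by (simp add: ennreal_mult)
  finally have "(\<integral>x. norm (f x) * norm (g x) \<partial>M)\<^sup>2 \<le> (l2n M f * l2n M g)\<^sup>2"
    by (simp add: ennreal_power)
  then have le: "(\<integral>x. norm (f x) * norm (g x) \<partial>M) \<le> l2n M f * l2n M g"
    by (rule power2_le_imp_le) simp
  show hi: "integrable M h"
    by (rule Bochner_Integration.integrable_bound[OF integrable_mult_right[OF P, of K]])
       (use b K in \<open>auto simp: abs_mult\<close>)
  have "norm (\<integral>x. h x \<partial>M) \<le> (\<integral>x. norm (h x) \<partial>M)" by (rule integral_norm_bound)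
  also have "\<dots> \<le> (\<integral>x. K * (norm (f x) * norm (g x)) \<partial>M)"
    by (rule integral_mono_AE) (use hi P b in auto)
  also have "\<dots> \<le> K * (l2n M f * l2n M g)"
    using le K by (simp add: mult_left_mono)
  finally show "norm (\<integral>x. h x \<partial>M) \<le> K * (l2n M f * l2n M g)" .
qed

lemma sq_int_bound:
  assumes g: "sq_int M g" and f: "f \<in> borel_measurable M" and K: "K \<ge> 0"
    and b: "AE x in M. norm (f x) \<le> K * norm (g x)"
  shows "sq_int M f" and "l2n M f \<le> K * l2n M g"
proof -
  have gi: "integrable M (\<lambda>x. (norm (g x))\<^sup>2)" using g by (simp add: sq_int_iff)
  have b2: "AE x in M. (norm (f x))\<^sup>2 \<le> K\<^sup>2 * (norm (g x))\<^sup>2"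
    using b by eventually_elim (metis norm_ge_zero power_mono power_mult_distrib)
  have "integrable M (\<lambda>x. (norm (f x))\<^sup>2)"
    by (rule Bochner_Integration.integrable_bound[OF integrable_mult_right[OF gi, of "K\<^sup>2"]])
       (use b2 f in auto)
  with f show F: "sq_int M f" by (simp add: sq_int_iff)
  have "(l2n M f)\<^sup>2 \<le> (\<integral>x. K\<^sup>2 * (norm (g x))\<^sup>2 \<partial>M)"
    unfolding l2n_sq by (rule integral_mono_AE) (use F gi b2 in \<open>auto simp: sq_int_iff\<close>)
  also have "\<dots> = (K * l2n M g)\<^sup>2" by (simp add: l2n_sq power_mult_distrib)
  finally show "l2n M f \<le> K * l2n M g"
    by (rule power2_le_imp_le) (use K in simp)
qed

lemma sq_int_zero [simp]: "sq_int M (\<lambda>x. 0)" "l2n M (\<lambda>x. 0) = 0"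
  by (auto simp: sq_int_def l2n_def)

lemma sq_int_scaleR:
  assumes f: "sq_int M f" shows "sq_int M (\<lambda>x. r *\<^sub>R f x)" "l2n M (\<lambda>x. r *\<^sub>R f x) = \<bar>r\<bar> * l2n M f"
proof -
  show "sq_int M (\<lambda>x. r *\<^sub>R f x)" using f
    by (auto simp: sq_int_iff power_mult_distrib)
  show "l2n M (\<lambda>x. r *\<^sub>R f x) = \<bar>r\<bar> * l2n M f"
    by (simp add: l2n_def power_mult_distrib real_sqrt_mult)
qed

lemma sq_int_add:
  fixes f g :: "'a \<Rightarrow> 'b::{real_normed_vector, second_countable_topology}"
  assumes f: "sq_int M f" and g: "sq_int M g"
  shows "sq_int M (\<lambda>x. f x + g x)" and "l2n M (\<lambda>x. f x + g x) \<le> l2n M f + l2n M g"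
proof -
  note [measurable] = sq_int_measurable[OF f] sq_int_measurable[OF g]
  have fi: "integrable M (\<lambda>x. (norm (f x))\<^sup>2)" and gi: "integrable M (\<lambda>x. (norm (g x))\<^sup>2)"
    using f g by (auto simp: sq_int_iff)
  have P: "integrable M (\<lambda>x. norm (f x) * norm (g x))"
    by (rule integrable_prod_bound[OF f g, where K = 1]) simp_all
  have P2: "norm (\<integral>x. norm (f x) * norm (g x) \<partial>M) \<le> 1 * (l2n M f * l2n M g)"
    by (rule integrable_prod_bound[OF f g]) simp_all
  have b: "(norm (f x + g x))\<^sup>2 \<le> (norm (f x))\<^sup>2 + 2 * (norm (f x) * norm (g x)) + (norm (g x))\<^sup>2" for x
  proof -
    have "(norm (f x + g x))\<^sup>2 \<le> (norm (f x) + norm (g x))\<^sup>2"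
      by (intro power_mono norm_triangle_ineq) simp
    then show ?thesis by (simp add: power2_sum)
  qed
  have I: "integrable M (\<lambda>x. (norm (f x))\<^sup>2 + 2 * (norm (f x) * norm (g x)) + (norm (g x))\<^sup>2)"
    using fi gi P by auto
  have J: "integrable M (\<lambda>x. (norm (f x + g x))\<^sup>2)"
    by (rule Bochner_Integration.integrable_bound[OF I]) (auto intro!: AE_I2 order_trans[OF b])
  then show "sq_int M (\<lambda>x. f x + g x)" by (simp add: sq_int_iff)
  have "(l2n M (\<lambda>x. f x + g x))\<^sup>2
      \<le> (\<integral>x. (norm (f x))\<^sup>2 + 2 * (norm (f x) * norm (g x)) + (norm (g x))\<^sup>2 \<partial>M)"
    unfolding l2n_sq by (rule integral_mono[OF J I]) (rule b)
  also have "\<dots> = (l2n M f)\<^sup>2 + 2 * (\<integral>x. norm (f x) * norm (g x) \<partial>M) + (l2n M g)\<^sup>2"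
    using fi gi P by (simp add: l2n_sq)
  also have "\<dots> \<le> (l2n M f + l2n M g)\<^sup>2"
    using P2 by (simp add: power2_sum)
  finally show "l2n M (\<lambda>x. f x + g x) \<le> l2n M f + l2n M g"
    by (rule power2_le_imp_le) simp
qed

lemma sq_int_diff:
  fixes f g :: "'a \<Rightarrow> 'b::{real_normed_vector, second_countable_topology}"
  assumes f: "sq_int M f" and g: "sq_int M g"
  shows "sq_int M (\<lambda>x. f x - g x)" and "l2n M (\<lambda>x. f x - g x) \<le> l2n M f + l2n M g"
  using sq_int_add[OF f sq_int_scaleR(1)[OF g, of "-1"]] sq_int_scaleR(2)[OF g, of "-1"] by auto

lemma l2n_minus_commute: "l2n M (\<lambda>x. f x - g x) = l2n M (\<lambda>x. g x - f x)"
  by (simp add: l2n_def norm_minus_commute)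

lemma l2n_diff_triangle:
  fixes f g h :: "'a \<Rightarrow> 'b::{real_normed_vector, second_countable_topology}"
  assumes f: "sq_int M f" and g: "sq_int M g" and h: "sq_int M h"
  shows "l2n M (\<lambda>x. f x - h x) \<le> l2n M (\<lambda>x. f x - g x) + l2n M (\<lambda>x. g x - h x)"
  using sq_int_add(2)[OF sq_int_diff(1)[OF f g] sq_int_diff(1)[OF g h]] by simp

lemma l2n_conv_nn_integral:
  assumes "\<And>j. sq_int M (F j)"
  shows "(\<lambda>j. \<integral>\<^sup>+x. ennreal ((norm (F j x))\<^sup>2) \<partial>M) \<longlonglongrightarrow> 0 \<longleftrightarrow> (\<lambda>j. l2n M (F j)) \<longlonglongrightarrow> 0"
proof -
  have "(\<lambda>j. \<integral>\<^sup>+x. ennreal ((norm (F j x))\<^sup>2) \<partial>M) \<longlonglongrightarrow> 0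
      \<longleftrightarrow> (\<lambda>j. ennreal ((l2n M (F j))\<^sup>2)) \<longlonglongrightarrow> ennreal 0"
    by (simp add: nn_integral_sq_eq[OF assms])
  also have "\<dots> \<longleftrightarrow> (\<lambda>j. (l2n M (F j))\<^sup>2) \<longlonglongrightarrow> 0"
    by (subst tendsto_ennreal_iff) auto
  also have "\<dots> \<longleftrightarrow> (\<lambda>j. l2n M (F j)) \<longlonglongrightarrow> 0"
    using tendsto_power[of "\<lambda>j. l2n M (F j)" 0 sequentially 2]
      tendsto_real_sqrt[of "\<lambda>j. (l2n M (F j))\<^sup>2" 0 sequentially]
    by (auto simp: real_sqrt_abs)
  finally show ?thesis .
qed

text \<open>One index at distance below 1 suffices: \<open>g\<close> is then a square integrable
  function plus a square integrable error. This recovers integrability from a hypothesis that only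
  speaks of distances.\<close>

lemma sq_int_of_close:
  fixes f :: "nat \<Rightarrow> 'a \<Rightarrow> 'b::{real_normed_vector, second_countable_topology}"
  assumes f: "\<And>j. sq_int M (f j)" and g: "g \<in> borel_measurable M"
    and lim: "(\<lambda>j. \<integral>\<^sup>+x. ennreal ((norm (g x - f j x))\<^sup>2) \<partial>M) \<longlonglongrightarrow> 0"
  shows "sq_int M g" "(\<lambda>j. l2n M (\<lambda>x. g x - f j x)) \<longlonglongrightarrow> 0"
proof -
  note [measurable] = f[THEN sq_int_measurable] g
  have "\<forall>\<^sub>F j in sequentially. (\<integral>\<^sup>+x. ennreal ((norm (g x - f j x))\<^sup>2) \<partial>M) < 1"
    using lim by (rule order_tendstoD) simp
  then obtain j where "(\<integral>\<^sup>+x. ennreal ((norm (g x - f j x))\<^sup>2) \<partial>M) < 1"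
    by (auto simp: eventually_sequentially)
  then have "sq_int M (\<lambda>x. g x - f j x)"
    unfolding sq_int_def by (auto intro: less_trans)
  from sq_int_add(1)[OF this f[of j]] show g': "sq_int M g" by simp
  show "(\<lambda>j. l2n M (\<lambda>x. g x - f j x)) \<longlonglongrightarrow> 0"
    using lim sq_int_diff(1)[OF g' f] by (subst (asm) l2n_conv_nn_integral) auto
qed

text \<open>Riesz-Fischer: a fast subsequence converges almost everywhere, and Fatou's lemma carries
  the Cauchy estimates over to its pointwise limit.\<close>

lemma l2_complete:
  fixes f :: "nat \<Rightarrow> 'a \<Rightarrow> 'b::{banach, second_countable_topology}"
  assumes f: "\<And>j. sq_int M (f j)"
    and C: "\<And>e. e > 0 \<Longrightarrow> \<exists>N. \<forall>i\<ge>N. \<forall>j\<ge>N. l2n M (\<lambda>x. f i x - f j x) < e"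
  shows "\<exists>g. sq_int M g \<and> (\<lambda>j. l2n M (\<lambda>x. g x - f j x)) \<longlonglongrightarrow> 0"
proof -
  note [measurable] = f[THEN sq_int_measurable]
  have "\<forall>n. \<exists>N. \<forall>i\<ge>N. \<forall>j\<ge>N. l2n M (\<lambda>x. f i x - f j x) < (1/2)^n"
    using C by simp
  then obtain N where N: "\<And>n i j. i \<ge> N n \<Longrightarrow> j \<ge> N n \<Longrightarrow> l2n M (\<lambda>x. f i x - f j x) < (1/2)^n"
    by metis
  \<comment> \<open>Summing the thresholds gives indices with \<open>r m \<ge> N n\<close> whenever
    n <= m. The sequence may repeat values, which does no harm.\<close>
  define r where "r n = (\<Sum>k\<le>n. N k)" for n
  have r_ge: "r m \<ge> N n" if "n \<le> m" for n m
    using that unfolding r_def by (intro member_le_sum) auto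
  define d where "d n x = norm (f (r (Suc n)) x - f (r n) x)" for n x
  have [measurable]: "d n \<in> borel_measurable M" for n unfolding d_def by measurable
  have dn: "(\<integral>\<^sup>+x. ennreal ((d n x)\<^sup>2) \<partial>M) \<le> ennreal ((1/4)^n)" for n
  proof -
    have "(\<integral>\<^sup>+x. ennreal ((d n x)\<^sup>2) \<partial>M) = ennreal ((l2n M (\<lambda>x. f (r (Suc n)) x - f (r n) x))\<^sup>2)"
      unfolding d_def by (rule nn_integral_sq_eq) (intro sq_int_diff f)
    also have "\<dots> \<le> ennreal (((1/2)^n)\<^sup>2)"
      by (intro ennreal_leI power_mono less_imp_le[OF N] r_ge) auto
    also have "((1/2)^n)\<^sup>2 = (1/4::real)^n"
      by (simp add: power_mult[symmetric] mult.commute power2_eq_square power_mult_distrib[symmetric])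
    finally show ?thesis .
  qed
  \<comment> \<open>The weight 2^n is affordable because the squares integrate to at most (1/4)^n,
    and it is what later turns summability of squares into summability of \<open>d n x\<close>
    itself.\<close>
  have e1: "(\<integral>\<^sup>+x. (\<Sum>n. ennreal (2^n * (d n x)\<^sup>2)) \<partial>M) = (\<Sum>n. \<integral>\<^sup>+x. ennreal (2^n * (d n x)\<^sup>2) \<partial>M)"
    by (rule nn_integral_suminf) auto
  have e2: "(\<Sum>n. \<integral>\<^sup>+x. ennreal (2^n * (d n x)\<^sup>2) \<partial>M) \<le> (\<Sum>n. ennreal ((1/2)^n))"
  proof (rule suminf_le)
    fix n
    have "(\<integral>\<^sup>+x. ennreal (2^n * (d n x)\<^sup>2) \<partial>M) = ennreal (2^n) * (\<integral>\<^sup>+x. ennreal ((d n x)\<^sup>2) \<partial>M)"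
      by (subst nn_integral_cmult[symmetric]) (auto simp: ennreal_mult)
    also have "\<dots> \<le> ennreal (2^n) * ennreal ((1/4)^n)"
      by (intro mult_left_mono dn) auto
    also have "\<dots> = ennreal ((1/2)^n)"
      by (subst ennreal_mult[symmetric]) (auto simp: power_mult_distrib[symmetric])
    finally show "(\<integral>\<^sup>+x. ennreal (2^n * (d n x)\<^sup>2) \<partial>M) \<le> ennreal ((1/2)^n)" .
  qed (rule summableI)+
  have e3: "(\<Sum>n. ennreal ((1/2)^n)) < \<infinity>"
  proof -
    have "(\<Sum>n. ennreal ((1/2)^n)) = ennreal (\<Sum>n. (1/2)^n)"
      by (rule suminf_ennreal2) (simp_all add: summable_geometric)
    then show ?thesis by (simp only: ennreal_less_top infinity_ennreal_def)
  qed
  have "(\<integral>\<^sup>+x. (\<Sum>n. ennreal (2^n * (d n x)\<^sup>2)) \<partial>M) < \<infinity>"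
    using le_less_trans[OF e2 e3] unfolding e1 .
  then have "AE x in M. (\<Sum>n. ennreal (2^n * (d n x)\<^sup>2)) \<noteq> \<infinity>"
    by (intro nn_integral_PInf_AE) auto
  then have ae: "AE x in M. Cauchy (\<lambda>n. f (r n) x)"
  proof eventually_elim
    case (elim x)
    then have sm: "summable (\<lambda>n. 2^n * (d n x)\<^sup>2)"
      using summable_suminf_not_top[of "\<lambda>n. 2^n * (d n x)\<^sup>2"] by simp
    have "summable (\<lambda>n. 2^n * (d n x)\<^sup>2 + (1/2)^n)"
      by (intro summable_add sm summable_geometric) simp
    then have "summable (\<lambda>n. d n x)"
    proof (rule summable_comparison_test'[where N = 0])
      fix n
      \<comment> \<open>Young's inequality, to be divided by 2^n: it bounds \<open>d n x\<close> by
        the weighted square plus a geometric term.\<close>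
      have "2 * ((2^n * d n x) * 1) \<le> (2^n * d n x)\<^sup>2 + 1"
        using sum_squares_bound[of "2^n * d n x" 1] by simp
      moreover have "0 \<le> (2^n * d n x)" by (simp add: d_def)
      ultimately have "2^n * d n x \<le> (2^n * d n x)\<^sup>2 + 1" by linarith
      moreover have "(2^n * d n x)\<^sup>2 + 1 = 2^n * (2^n * (d n x)\<^sup>2 + (1/2)^n)"
        by (simp add: power2_eq_square algebra_simps power_mult_distrib[symmetric])
      ultimately have "2^n * d n x \<le> 2^n * (2^n * (d n x)\<^sup>2 + (1/2)^n)" by simp
      then show "norm (d n x) \<le> 2^n * (d n x)\<^sup>2 + (1/2)^n" by (simp add: d_def)
    qed
    then have "summable (\<lambda>n. f (r (Suc n)) x - f (r n) x)"
      unfolding d_def by (rule summable_norm_cancel)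
    from summable_LIMSEQ[OF this] have "convergent (\<lambda>n. \<Sum>i<n. f (r (Suc i)) x - f (r i) x)"
      by (auto simp: convergent_def)
    then have "convergent (\<lambda>n. f (r n) x - f (r 0) x)"
      by (simp add: sum_lessThan_telescope[of "\<lambda>n. f (r n) x"])
    then have "convergent (\<lambda>n. (f (r n) x - f (r 0) x) + f (r 0) x)"
      by (intro convergent_add convergent_const)
    then show ?case by (simp add: Cauchy_convergent_iff)
  qed
  define g where "g x = (if Cauchy (\<lambda>n. f (r n) x) then lim (\<lambda>n. f (r n) x) else 0)" for x
  have [measurable]: "g \<in> borel_measurable M" unfolding g_def by measurable
  have aelim: "AE x in M. (\<lambda>n. f (r n) x) \<longlonglongrightarrow> g x"
    using ae by eventually_elim (auto simp: g_def Cauchy_convergent_iff convergent_LIMSEQ_iff)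
  \<comment> \<open>Fatou along a tail: the limit inherits every distance bound valid for large
    indices. The shift \<open>m\<close> moves all indices \<open>r (i + m)\<close> beyond
    \<open>L\<close>.\<close>
  have est: "(\<integral>\<^sup>+x. ennreal ((norm (g x - f j x))\<^sup>2) \<partial>M) \<le> ennreal (e\<^sup>2)"
    if e: "e \<ge> 0" and j: "\<And>i. i \<ge> L \<Longrightarrow> l2n M (\<lambda>x. f i x - f j x) \<le> e" and L: "\<And>i. r (i + m) \<ge> L"
    for j e L and m :: nat
  proof -
    have "(\<integral>\<^sup>+x. ennreal ((norm (g x - f j x))\<^sup>2) \<partial>M)
        = (\<integral>\<^sup>+x. liminf (\<lambda>n. ennreal ((norm (f (r (n + m)) x - f j x))\<^sup>2)) \<partial>M)"
    proof (rule nn_integral_cong_AE, use aelim in eventually_elim)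
      case (elim x)
      have "(\<lambda>n. ennreal ((norm (f (r (n + m)) x - f j x))\<^sup>2)) \<longlonglongrightarrow> ennreal ((norm (g x - f j x))\<^sup>2)"
        by (intro tendsto_ennrealI tendsto_intros LIMSEQ_ignore_initial_segment elim)
      from lim_imp_Liminf[OF _ this] show ?case by simp
    qed
    also have "\<dots> \<le> liminf (\<lambda>n. \<integral>\<^sup>+x. ennreal ((norm (f (r (n + m)) x - f j x))\<^sup>2) \<partial>M)"
      by (rule nn_integral_liminf) measurable
    also have "\<dots> \<le> liminf (\<lambda>n. ennreal (e\<^sup>2))"
    proof (intro Liminf_mono always_eventually allI)
      fix n
      show "(\<integral>\<^sup>+x. ennreal ((norm (f (r (n + m)) x - f j x))\<^sup>2) \<partial>M) \<le> ennreal (e\<^sup>2)"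
        using l2n_le_iff_nn_integral[OF sq_int_diff(1)[OF f f] e] j L by blast
    qed
    also have "\<dots> = ennreal (e\<^sup>2)" by (simp add: Liminf_const)
    finally show ?thesis .
  qed
  have "(\<integral>\<^sup>+x. ennreal ((norm (g x - f (N 0) x))\<^sup>2) \<partial>M) \<le> ennreal (1\<^sup>2)"
    by (rule est[where L = "N 0" and m = 0]) (use N[of 0] r_ge in \<open>auto intro: less_imp_le\<close>)
  then have "sq_int M (\<lambda>x. g x - f (N 0) x)"
    unfolding sq_int_def by (auto intro: le_less_trans)
  from sq_int_add(1)[OF this f[of "N 0"]] have g: "sq_int M g" by simp
  have "(\<lambda>j. l2n M (\<lambda>x. g x - f j x)) \<longlonglongrightarrow> 0"
  proof (rule LIMSEQ_I)
    fix e :: real assume e: "e > 0"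
    obtain n where n: "(1/2)^n < e" using e real_arch_pow_inv[of e "1/2"] by auto
    have "l2n M (\<lambda>x. g x - f j x) \<le> (1/2)^n" if "j \<ge> N n" for j
    proof -
      have "(\<integral>\<^sup>+x. ennreal ((norm (g x - f j x))\<^sup>2) \<partial>M) \<le> ennreal (((1/2)^n)\<^sup>2)"
        by (rule est[where L = "N n" and m = n]) (use N[of n] r_ge that in \<open>auto intro: less_imp_le\<close>)
      then show ?thesis
        using l2n_le_iff_nn_integral[OF sq_int_diff(1)[OF g f], of "(1/2)^n"] by simp
    qed
    with n show "\<exists>no. \<forall>j\<ge>no. norm (l2n M (\<lambda>x. g x - f j x) - 0) < e"
      by (auto intro!: exI[of _ "N n"] intro: le_less_trans)
  qed
  with g show ?thesis by blast
qed

subsection \<open>Smooth functions and test functions\<close>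

lemma cgrad_eqI:
  fixes f :: "'a::euclidean_space \<Rightarrow> real"
  assumes "(f has_derivative (\<lambda>v. g \<bullet> v)) (at x)"
  shows "cgrad f x = g"
  by (simp add: cgrad_def pderiv_dir_def frechet_derivative_at[OF assms, symmetric]
      euclidean_representation)

lemma has_derivative_cgrad:
  fixes f :: "'a::euclidean_space \<Rightarrow> real"
  assumes "f differentiable (at x)"
  shows "(f has_derivative (\<lambda>v. cgrad f x \<bullet> v)) (at x)"
proof -
  have D: "(f has_derivative frechet_derivative f (at x)) (at x)"
    using assms frechet_derivative_works by blast
  then interpret L: linear "frechet_derivative f (at x)"
    by (rule has_derivative_linear)
  have "frechet_derivative f (at x) v = cgrad f x \<bullet> v" for v
  proof -
    have "frechet_derivative f (at x) v = frechet_derivative f (at x) (\<Sum>i\<in>Basis. (v \<bullet> i) *\<^sub>R i)"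
      by (simp add: euclidean_representation)
    also have "\<dots> = cgrad f x \<bullet> v"
      unfolding cgrad_def pderiv_dir_def L.sum L.scale inner_sum_left inner_scaleR_left
      by (simp add: inner_commute mult.commute)
    finally show ?thesis .
  qed
  then have "frechet_derivative f (at x) = (\<lambda>v. cgrad f x \<bullet> v)" by auto
  with D show ?thesis by simp
qed

lemma pderiv_dir_eqI: "(f has_derivative f') (at x) \<Longrightarrow> pderiv_dir f i x = f' i"
  unfolding pderiv_dir_def by (simp add: frechet_derivative_at[symmetric])

lemma pderiv_dir_eq_cgrad: "f differentiable (at x) \<Longrightarrow> pderiv_dir f i x = cgrad f x \<bullet> i"
  by (rule pderiv_dir_eqI[OF has_derivative_cgrad])

lemma Ck_continuous: "Ck k f \<Longrightarrow> continuous_on UNIV f"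
  by (cases k) auto

lemma Ck_SucD: "Ck (Suc k) f \<Longrightarrow> Ck k f"
proof (induction k arbitrary: f)
  case 0 then show ?case by simp
next
  case (Suc k)
  then have "\<forall>i\<in>Basis. Ck k (pderiv_dir f i)" by simp
  with Suc show ?case by simp
qed

lemma Ck_const: "Ck k (\<lambda>x. c)"
proof (induction k arbitrary: c)
  case (Suc k)
  have "pderiv_dir (\<lambda>x. c) i = (\<lambda>x. 0)" for i :: 'a
    by (rule ext, rule pderiv_dir_eqI) (auto intro!: derivative_eq_intros)
  with Suc show ?case by simp
qed simp

text \<open>\<open>Ck\<close> recurs through \<open>frechet_derivative\<close>, a choice operator.
  Derivatives on the whole space are unique, so any exhibited \<open>f'\<close> may take its place;
  the closure properties below then become inductions over k.\<close>

lemma Ck_SucI: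
  assumes "\<And>x. (f has_derivative f' x) (at x)" "\<And>i. i \<in> Basis \<Longrightarrow> Ck k (\<lambda>x. f' x i)"
  shows "Ck (Suc k) f"
proof -
  have "pderiv_dir f i = (\<lambda>x. f' x i)" for i
    by (rule ext, rule pderiv_dir_eqI[OF assms(1)])
  moreover have "continuous_on UNIV f"
    using assms(1) by (meson UNIV_I continuous_at_imp_continuous_on has_derivative_continuous)
  ultimately show ?thesis using assms by (auto simp: differentiable_def)
qed

lemma Ck_SucE:
  assumes "Ck (Suc k) f"
  shows "(f has_derivative (\<lambda>v. cgrad f x \<bullet> v)) (at x)" "i \<in> Basis \<Longrightarrow> Ck k (\<lambda>x. cgrad f x \<bullet> i)"
proof -
  show "(f has_derivative (\<lambda>v. cgrad f x \<bullet> v)) (at x)"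
    using assms by (intro has_derivative_cgrad) auto
  have "pderiv_dir f i = (\<lambda>x. cgrad f x \<bullet> i)"
    using assms by (auto simp: pderiv_dir_eq_cgrad fun_eq_iff)
  then show "i \<in> Basis \<Longrightarrow> Ck k (\<lambda>x. cgrad f x \<bullet> i)"
    using assms by (metis Ck.simps(2))
qed

lemma Ck_add: "Ck k f \<Longrightarrow> Ck k g \<Longrightarrow> Ck k (\<lambda>x. f x + g x)"
proof (induction k arbitrary: f g)
  case 0 then show ?case by (auto intro: continuous_intros)
next
  case (Suc k)
  show ?case
    by (rule Ck_SucI[where f' = "\<lambda>x v. cgrad f x \<bullet> v + cgrad g x \<bullet> v"])
       (intro has_derivative_add Ck_SucE(1)[OF Suc.prems(1)] Ck_SucE(1)[OF Suc.prems(2)]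
          Suc.IH Ck_SucE(2)[OF Suc.prems(1)] Ck_SucE(2)[OF Suc.prems(2)] | assumption)+
qed

lemma Ck_mult: "Ck k f \<Longrightarrow> Ck k g \<Longrightarrow> Ck k (\<lambda>x. f x * g x)"
proof (induction k arbitrary: f g)
  case 0 then show ?case by (auto intro: continuous_intros)
next
  case (Suc k)
  show ?case
  proof (rule Ck_SucI[where f' = "\<lambda>x v. f x * (cgrad g x \<bullet> v) + (cgrad f x \<bullet> v) * g x"])
    show "((\<lambda>x. f x * g x) has_derivative (\<lambda>v. f x * (cgrad g x \<bullet> v) + (cgrad f x \<bullet> v) * g x)) (at x)" for x
      by (intro has_derivative_mult Ck_SucE(1)[OF Suc.prems(1)] Ck_SucE(1)[OF Suc.prems(2)])
    show "Ck k (\<lambda>x. f x * (cgrad g x \<bullet> i) + (cgrad f x \<bullet> i) * g x)" if "i \<in> Basis" for i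
      by (intro Ck_add Suc.IH Ck_SucE(2)[OF _ that] Suc.prems Ck_SucD)
  qed
qed

lemma Ck_sum: "finite I \<Longrightarrow> (\<And>i. i \<in> I \<Longrightarrow> Ck k (f i)) \<Longrightarrow> Ck k (\<lambda>x. \<Sum>i\<in>I. f i x)"
  by (induction I rule: finite_induct) (auto intro: Ck_const Ck_add)

text \<open>Slices, lines and coordinate projections are all compositions of this shape; the shift
  \<open>a\<close> lets a slice at height y be written with a linear embedding.\<close>

lemma Ck_affine:
  fixes f :: "'b::euclidean_space \<Rightarrow> real" and T :: "'a::euclidean_space \<Rightarrow> 'b"
  assumes T: "bounded_linear T"
  shows "Ck k f \<Longrightarrow> Ck k (\<lambda>y. f (a + T y))"
proof (induction k arbitrary: f)
  case 0
  then show ?case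
    using linear_continuous_on[OF T, of UNIV]
    by (auto intro!: continuous_on_compose2[of UNIV f UNIV] continuous_intros)
next
  case (Suc k)
  show ?case
  proof (rule Ck_SucI[where f' = "\<lambda>y v. \<Sum>j\<in>Basis. (cgrad f (a + T y) \<bullet> j) * (T v \<bullet> j)"])
    fix y
    have "((\<lambda>y. f (a + T y)) has_derivative (\<lambda>v. cgrad f (a + T y) \<bullet> (T v))) (at y)"
      by (rule has_derivative_compose[OF _ Ck_SucE(1)[OF Suc.prems]])
         (use has_derivative_add[OF has_derivative_const[of a] bounded_linear_imp_has_derivative[OF T, of "at y"]]
          in simp)
    then show "((\<lambda>y. f (a + T y)) has_derivative
        (\<lambda>v. \<Sum>j\<in>Basis. (cgrad f (a + T y) \<bullet> j) * (T v \<bullet> j))) (at y)"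
      by (simp only: euclidean_inner[of "cgrad f (a + T y)" "T _", symmetric])
    show "Ck k (\<lambda>y. \<Sum>j\<in>Basis. (cgrad f (a + T y) \<bullet> j) * (T i \<bullet> j))" for i
      by (intro Ck_sum Ck_mult Ck_const Suc.IH[where f = "\<lambda>x. cgrad f x \<bullet> _"] Ck_SucE Suc.prems) auto
  qed
qed

lemma Ck_linear:
  fixes T :: "'a::euclidean_space \<Rightarrow> real"
  assumes T: "bounded_linear T" shows "Ck k T"
proof (cases k)
  case 0 then show ?thesis using linear_continuous_on[OF T] by simp
next
  case (Suc m)
  have "Ck (Suc m) T"
    by (rule Ck_SucI[where f' = "\<lambda>_. T"])
       (auto intro: bounded_linear_imp_has_derivative T Ck_const)
  with Suc show ?thesis by simp
qed

text \<open>The derivative is a linear function times the Gaussian itself, so the induction closes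
  under products.\<close>

lemma Ck_gaussian: "Ck k (\<lambda>y::real. exp (- r * y\<^sup>2))"
proof (induction k)
  case 0 show ?case by (auto intro!: continuous_intros)
next
  case (Suc k)
  show ?case
  proof (rule Ck_SucI[where f' = "\<lambda>y v. v * ((- 2 * r * y) * exp (- r * y\<^sup>2))"])
    show "((\<lambda>y. exp (- r * y\<^sup>2)) has_derivative (\<lambda>v. v * ((- 2 * r * y) * exp (- r * y\<^sup>2)))) (at y)" for y
      by (auto intro!: derivative_eq_intros simp: fun_eq_iff)
    show "Ck k (\<lambda>y::real. i * ((- 2 * r * y) * exp (- r * y\<^sup>2)))" for i
      by (intro Ck_mult Ck_const Suc.IH Ck_linear bounded_linear_ident)
  qed
qed

lemma smooth_fun_intros:
  "smooth_fun (\<lambda>x. c)"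
  "smooth_fun f \<Longrightarrow> smooth_fun g \<Longrightarrow> smooth_fun (\<lambda>x. f x + g x)"
  "smooth_fun f \<Longrightarrow> smooth_fun g \<Longrightarrow> smooth_fun (\<lambda>x. f x * g x)"
  "smooth_fun (\<lambda>y::real. exp (- r * y\<^sup>2))"
  "bounded_linear T \<Longrightarrow> smooth_fun h \<Longrightarrow> smooth_fun (\<lambda>y. h (a + T y))"
  unfolding smooth_fun_def
      apply (rule allI, rule Ck_const)
     apply (rule allI, rule Ck_add; simp)
    apply (rule allI, rule Ck_mult; simp)
   apply (rule allI, rule Ck_gaussian)
  apply (rule allI, rule Ck_affine; simp)
  done

lemma smooth_has_derivative:
  "smooth_fun f \<Longrightarrow> (f has_derivative (\<lambda>v. cgrad f x \<bullet> v)) (at x)"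
  unfolding smooth_fun_def by (rule Ck_SucE(1)) blast

lemma smooth_continuous: "smooth_fun f \<Longrightarrow> continuous_on S f"
  unfolding smooth_fun_def by (rule continuous_on_subset[OF Ck_continuous]) auto

lemma smooth_continuous_cgrad: "smooth_fun f \<Longrightarrow> continuous_on S (cgrad f)"
proof -
  assume "smooth_fun f"
  then have "continuous_on UNIV (\<lambda>x. \<Sum>i\<in>Basis. (cgrad f x \<bullet> i) *\<^sub>R i)"
    unfolding smooth_fun_def by (auto intro!: continuous_intros Ck_continuous[of 0] Ck_SucE(2))
  then show ?thesis
    by (auto simp: euclidean_representation intro: continuous_on_subset)
qed

lemma test_fn_smooth: "test_fn U f \<Longrightarrow> smooth_fun f"
  by (simp add: test_fn_def)

lemma test_fnI:
  assumes "smooth_fun f" "compact K" "K \<subseteq> U" "\<And>x. x \<notin> K \<Longrightarrow> f x = 0"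
  shows "test_fn U f"
proof -
  have "tsupport f \<subseteq> K"
    unfolding tsupport_def using assms by (intro closure_minimal compact_imp_closed) auto
  moreover then have "compact (tsupport f)"
    using assms(2) unfolding tsupport_def by (metis closed_closure compact_Int_closed inf.absorb2)
  ultimately show ?thesis using assms by (auto simp: test_fn_def)
qed

lemma test_fn_zero_outside:
  assumes "test_fn U f" "x \<notin> tsupport f"
  shows "f x = 0" "cgrad f x = 0"
proof -
  have "f y = 0" if "y \<notin> tsupport f" for y
    using that closure_subset[of "{x. f x \<noteq> 0}"] by (auto simp: tsupport_def)
  then show "f x = 0" using assms by blast
  have "(f has_derivative (\<lambda>v. 0)) (at x)"
  proof (rule has_derivative_transform_within_open[OF has_derivative_const])
    show "open (- tsupport f)" unfolding tsupport_def by (rule open_Compl[OF closed_closure])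
  qed (use assms \<open>\<And>y. y \<notin> tsupport f \<Longrightarrow> f y = 0\<close> in auto)
  then show "cgrad f x = 0" by (simp add: cgrad_eqI)
qed

lemma test_fn_support:
  assumes "test_fn U f"
  obtains K where "compact K" "K \<subseteq> U" "\<And>x. x \<notin> K \<Longrightarrow> f x = 0 \<and> cgrad f x = 0"
proof (rule that)
  show "compact (tsupport f)" "tsupport f \<subseteq> U" using assms by (auto simp: test_fn_def)
  show "f x = 0 \<and> cgrad f x = 0" if "x \<notin> tsupport f" for x
    using test_fn_zero_outside[OF assms that] by simp
qed

lemma test_fn_zero: "test_fn U (\<lambda>x. 0)"
  by (rule test_fnI[of _ "{}"]) (auto intro: smooth_fun_intros)

lemma test_fn_add:
  assumes "test_fn U f" "test_fn U g" shows "test_fn U (\<lambda>x. f x + g x)"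
  by (rule test_fnI[of _ "tsupport f \<union> tsupport g"])
     (use assms in \<open>auto simp: test_fn_def test_fn_zero_outside[OF assms(1)]
        test_fn_zero_outside[OF assms(2)] intro!: smooth_fun_intros\<close>)

lemma test_fn_mult_smooth:
  assumes "test_fn U f" "smooth_fun g" shows "test_fn U (\<lambda>x. g x * f x)"
  by (rule test_fnI[of _ "tsupport f"])
     (use assms in \<open>auto simp: test_fn_def test_fn_zero_outside[OF assms(1)] intro!: smooth_fun_intros\<close>)

lemma test_fn_cmult: "test_fn U f \<Longrightarrow> test_fn U (\<lambda>x. c * f x)"
  by (rule test_fn_mult_smooth) (auto intro: smooth_fun_intros)

lemma test_fn_diff:
  assumes "test_fn U f" "test_fn U g" shows "test_fn U (\<lambda>x. f x - g x)"
  using test_fn_add[OF assms(1) test_fn_cmult[OF assms(2), of "-1"]] by simp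

lemma cgrad_add:
  assumes "smooth_fun f" "smooth_fun g"
  shows "cgrad (\<lambda>x. f x + g x) x = cgrad f x + cgrad g x"
    and "cgrad (\<lambda>x. f x - g x) x = cgrad f x - cgrad g x"
    and "cgrad (\<lambda>x. f x * g x) x = f x *\<^sub>R cgrad g x + g x *\<^sub>R cgrad f x"
    and "cgrad (\<lambda>x. c * f x) x = c *\<^sub>R cgrad f x"
proof -
  note D = smooth_has_derivative[OF assms(1), of x] smooth_has_derivative[OF assms(2), of x]
  show "cgrad (\<lambda>x. f x + g x) x = cgrad f x + cgrad g x"
    by (rule cgrad_eqI) (use has_derivative_add[OF D] in \<open>simp add: inner_add_left\<close>)
  show "cgrad (\<lambda>x. f x - g x) x = cgrad f x - cgrad g x"
    by (rule cgrad_eqI) (use has_derivative_diff[OF D] in \<open>simp add: inner_diff_left\<close>)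
  show "cgrad (\<lambda>x. f x * g x) x = f x *\<^sub>R cgrad g x + g x *\<^sub>R cgrad f x"
    by (rule cgrad_eqI) (use has_derivative_mult[OF D] in \<open>simp add: inner_add_left mult.commute\<close>)
  show "cgrad (\<lambda>x. c * f x) x = c *\<^sub>R cgrad f x"
    by (rule cgrad_eqI) (use has_derivative_mult_right[OF D(1), of c] in simp)
qed

lemma test_fn_slice:
  assumes \<psi>: "test_fn (U \<times> UNIV) \<psi>"
  shows "test_fn U (\<lambda>x. \<psi> (x, y))"
proof (rule test_fnI)
  have "smooth_fun (\<lambda>x. \<psi> ((0, y) + (x, 0)))"
    by (rule smooth_fun_intros) (use \<psi> in \<open>auto simp: test_fn_def
        intro!: bounded_linear_Pair bounded_linear_ident bounded_linear_zero\<close>)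
  then show "smooth_fun (\<lambda>x. \<psi> (x, y))" by simp
  show "compact (fst ` tsupport \<psi>)"
    using \<psi> by (auto simp: test_fn_def intro!: compact_continuous_image continuous_intros)
  show "fst ` tsupport \<psi> \<subseteq> U" using \<psi> by (auto simp: test_fn_def)
  show "\<psi> (x, y) = 0" if "x \<notin> fst ` tsupport \<psi>" for x
    using that by (intro test_fn_zero_outside[OF \<psi>]) force
qed

lemma cgrad_slice:
  assumes "smooth_fun \<psi>"
  shows "cgrad (\<lambda>x. \<psi> (x, y)) x = fst (cgrad \<psi> (x, y))"
proof (rule cgrad_eqI)
  have "((\<lambda>x. \<psi> (x, y)) has_derivative (\<lambda>v. cgrad \<psi> (x, y) \<bullet> (v, 0))) (at x)"
    by (rule has_derivative_compose[OF _ smooth_has_derivative[OF assms], of "\<lambda>x. (x, y)"])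
       (auto intro!: derivative_eq_intros)
  then show "((\<lambda>x. \<psi> (x, y)) has_derivative (\<lambda>v. fst (cgrad \<psi> (x, y)) \<bullet> v)) (at x)"
    by (simp add: inner_prod_def)
qed

lemma DERIV_slice:
  fixes \<psi> :: "'a::euclidean_space \<times> real \<Rightarrow> real"
  assumes "smooth_fun \<psi>"
  shows "((\<lambda>y. \<psi> (x, y)) has_real_derivative snd (cgrad \<psi> (x, y))) (at y)"
proof -
  have "((\<lambda>y. \<psi> (x, y)) has_derivative (\<lambda>v. cgrad \<psi> (x, y) \<bullet> (0, v))) (at y)"
    by (rule has_derivative_compose[OF _ smooth_has_derivative[OF assms], of "\<lambda>y. (x, y)"])
       (auto intro!: derivative_eq_intros)
  then show ?thesis by (simp add: inner_prod_def has_field_derivative_def)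
qed

lemma
  fixes \<eta> :: "real \<Rightarrow> real"
  assumes v: "test_fn U v" and \<eta>: "test_fn UNIV \<eta>"
  shows test_fn_tensor: "test_fn (U \<times> UNIV) (\<lambda>p. v (fst p) * \<eta> (snd p))"
    and cgrad_tensor: "cgrad (\<lambda>p. v (fst p) * \<eta> (snd p)) (x, y)
          = (\<eta> y *\<^sub>R cgrad v x, v x * cgrad \<eta> y)"
proof -
  have 1: "smooth_fun (\<lambda>p::'a\<times>real. v (0 + fst p))" "smooth_fun (\<lambda>p::'a\<times>real. \<eta> (0 + snd p))"
    by (rule smooth_fun_intros; use v \<eta> in
        \<open>auto simp: test_fn_def intro: bounded_linear_fst bounded_linear_snd\<close>)+
  show "test_fn (U \<times> UNIV) (\<lambda>p. v (fst p) * \<eta> (snd p))"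
  proof (rule test_fnI)
    show "smooth_fun (\<lambda>p. v (fst p) * \<eta> (snd p))"
      using smooth_fun_intros(3)[OF 1] by simp
    show "compact (tsupport v \<times> tsupport \<eta>)" "tsupport v \<times> tsupport \<eta> \<subseteq> U \<times> UNIV"
      using v \<eta> by (auto simp: test_fn_def intro!: compact_Times)
    show "v (fst p) * \<eta> (snd p) = 0" if "p \<notin> tsupport v \<times> tsupport \<eta>" for p
      using that test_fn_zero_outside[OF v, of "fst p"] test_fn_zero_outside[OF \<eta>, of "snd p"]
      by (cases p) auto
  qed
  have "((\<lambda>p. v (fst p)) has_derivative (\<lambda>w. cgrad v x \<bullet> fst w)) (at (x, y))"
    using has_derivative_compose[OF has_derivative_fst[OF has_derivative_ident], of v]
      smooth_has_derivative[OF test_fn_smooth[OF v], of x] by fastforce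
  moreover have "((\<lambda>p. \<eta> (snd p)) has_derivative (\<lambda>w. cgrad \<eta> y \<bullet> snd w)) (at (x, y))"
    using has_derivative_compose[OF has_derivative_snd[OF has_derivative_ident], of \<eta>]
      smooth_has_derivative[OF test_fn_smooth[OF \<eta>], of y] by fastforce
  ultimately have "((\<lambda>p. v (fst p) * \<eta> (snd p)) has_derivative
      (\<lambda>w. v (fst (x, y)) * (cgrad \<eta> y \<bullet> snd w) + (cgrad v x \<bullet> fst w) * \<eta> (snd (x, y)))) (at (x, y))"
    by (rule has_derivative_mult)
  then show "cgrad (\<lambda>p. v (fst p) * \<eta> (snd p)) (x, y) = (\<eta> y *\<^sub>R cgrad v x, v x * cgrad \<eta> y)"
    by (intro cgrad_eqI) (simp add: inner_prod_def algebra_simps)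
qed

text \<open>The parameter y is recovered continuously from the point
  \<open>a + y *\<^sub>R e\<close> by projecting onto e, so the support on the line lies in a
  continuous image of a compact set.\<close>

lemma test_fn_line:
  fixes \<zeta> :: "'a::euclidean_space \<Rightarrow> real"
  assumes \<zeta>: "test_fn U \<zeta>" and e: "e \<noteq> 0"
  shows "test_fn UNIV (\<lambda>y::real. \<zeta> (a + y *\<^sub>R e))"
proof (rule test_fnI)
  show "smooth_fun (\<lambda>y::real. \<zeta> (a + y *\<^sub>R e))"
    by (rule smooth_fun_intros) (use \<zeta> in \<open>auto simp: test_fn_def intro: bounded_linear_scaleR_left\<close>)
  let ?K = "(\<lambda>x. ((x - a) \<bullet> e) / (e \<bullet> e)) ` tsupport \<zeta>"
  show "compact ?K"
    using \<zeta> e by (auto simp: test_fn_def intro!: compact_continuous_image continuous_intros)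
  show "\<zeta> (a + y *\<^sub>R e) = 0" if "y \<notin> ?K" for y
  proof (rule test_fn_zero_outside[OF \<zeta>], rule notI)
    assume "a + y *\<^sub>R e \<in> tsupport \<zeta>"
    then have "(((a + y *\<^sub>R e) - a) \<bullet> e) / (e \<bullet> e) \<in> ?K" by (rule imageI)
    moreover have "(((a + y *\<^sub>R e) - a) \<bullet> e) / (e \<bullet> e) = y" using e by simp
    ultimately show False using that by simp
  qed
qed (rule subset_UNIV)

subsection \<open>Integration by parts, the Poincare inequality and weighted measures\<close>

lemma integrable_compact_support:
  fixes g :: "'a::euclidean_space \<Rightarrow> 'b::{banach, second_countable_topology}"
  assumes "continuous_on UNIV g" "compact K" "\<And>x. x \<notin> K \<Longrightarrow> g x = 0"
  shows "integrable lborel g"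
proof -
  have "integrable lborel (\<lambda>x. indicator K x *\<^sub>R g x)"
    using assms by (intro borel_integrable_compact) (auto intro: continuous_on_subset)
  moreover have "(\<lambda>x. indicator K x *\<^sub>R g x) = g"
    using assms(3) by (auto simp: fun_eq_iff indicator_def)
  ultimately show ?thesis by simp
qed

lemma bounded_compact_support:
  fixes g :: "'a::euclidean_space \<Rightarrow> 'b::real_normed_vector"
  assumes "continuous_on UNIV g" "compact K" "\<And>x. x \<notin> K \<Longrightarrow> g x = 0"
  obtains C where "C \<ge> 0" "\<And>x. norm (g x) \<le> C"
proof -
  have "bounded (g ` K)"
    using assms by (intro compact_imp_bounded compact_continuous_image) (auto intro: continuous_on_subset)
  then obtain C where "\<And>x. x \<in> K \<Longrightarrow> norm (g x) \<le> C" by (auto simp: bounded_iff)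
  then have "norm (g x) \<le> max C 0" for x
    by (cases "x \<in> K") (auto simp: assms(3) le_max_iff_disj)
  then show ?thesis by (intro that[of "max C 0"]) auto
qed

text \<open>Difference quotients integrate to 0 by translation invariance.\<close>

lemma integral_directional_derivative_eq_0:
  fixes g :: "'a::euclidean_space \<Rightarrow> real"
  assumes D: "\<And>x. (g has_derivative (\<lambda>v. G x \<bullet> v)) (at x)" and G: "continuous_on UNIV G"
    and K: "compact K" "\<And>x. x \<notin> K \<Longrightarrow> g x = 0" "\<And>x. x \<notin> K \<Longrightarrow> G x = 0"
  shows "(\<integral>x. G x \<bullet> v \<partial>lborel) = 0"
proof -
  have gc: "continuous_on UNIV g"
    using D by (meson UNIV_I continuous_at_imp_continuous_on has_derivative_continuous)
  note [measurable] = borel_measurable_continuous_onI[OF gc] borel_measurable_continuous_onI[OF G]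
  have gi: "integrable lborel g" by (rule integrable_compact_support[OF gc K(1,2)])
  obtain C where C: "C \<ge> 0" "\<And>x. norm (G x) \<le> C"
    using bounded_compact_support[OF G K(1,3)] by blast
  obtain R where R: "\<And>x. x \<in> K \<Longrightarrow> norm x \<le> R"
    using compact_imp_bounded[OF K(1)] by (auto simp: bounded_iff)
  define h where "h n = inverse (real (Suc n))" for n
  have h: "0 < h n" "h n \<le> 1" for n
    by (auto simp: h_def field_simps)
  define s where "s n x = (g (x + h n *\<^sub>R v) - g x) / h n" for n x
  have [measurable]: "s n \<in> borel_measurable lborel" for n unfolding s_def by measurable
  have tr: "integrable lborel (\<lambda>x. g (x + w))" "(\<integral>x. g (x + w) \<partial>lborel) = (\<integral>x. g x \<partial>lborel)" for w
  proof -
    have "integrable (distr lborel borel ((+) w)) g" "integral\<^sup>L (distr lborel borel ((+) w)) g = integral\<^sup>L lborel g"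
      using gi by (simp_all add: lborel_distr_plus)
    then show "integrable lborel (\<lambda>x. g (x + w))" "(\<integral>x. g (x + w) \<partial>lborel) = (\<integral>x. g x \<partial>lborel)"
      by (simp_all add: integrable_distr_eq integral_distr add.commute)
  qed
  have s0: "(\<integral>x. s n x \<partial>lborel) = 0" for n
    unfolding s_def using tr[of "h n *\<^sub>R v"] gi by simp
  have "(\<lambda>n. \<integral>x. s n x \<partial>lborel) \<longlonglongrightarrow> (\<integral>x. G x \<bullet> v \<partial>lborel)"
  proof (rule integral_dominated_convergence)
    \<comment> \<open>Since \<open>h n \<le> 1\<close>, the ball of radius \<open>R + norm v\<close>
      contains the supports of all difference quotients, and the gradient bound \<open>C\<close>
      makes them uniformly bounded there.\<close>
    show "integrable lborel (\<lambda>x. indicator (cball 0 (R + norm v)) x *\<^sub>R (C * norm v))"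
      by (intro borel_integrable_compact) auto
    show "AE x in lborel. (\<lambda>n. s n x) \<longlonglongrightarrow> G x \<bullet> v"
    proof (rule AE_I2)
      fix x
      have "((\<lambda>t. g (x + t *\<^sub>R v)) has_derivative (\<lambda>t. G x \<bullet> (t *\<^sub>R v))) (at 0)"
        by (rule has_derivative_compose[of "\<lambda>t. x + t *\<^sub>R v" "\<lambda>t. t *\<^sub>R v" 0 UNIV g "\<lambda>v. G x \<bullet> v"])
           (use D[of x] in \<open>auto intro!: derivative_eq_intros\<close>)
      then have "((\<lambda>t. g (x + t *\<^sub>R v)) has_field_derivative (G x \<bullet> v)) (at 0)"
        by (simp add: has_field_derivative_def mult_commute_abs)
      then have "((\<lambda>t. (g (x + t *\<^sub>R v) - g x) / t) \<longlongrightarrow> G x \<bullet> v) (at 0)"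
        by (simp add: DERIV_def)
      moreover have "filterlim h (at 0) sequentially"
        unfolding filterlim_at h_def using LIMSEQ_inverse_real_of_nat by auto
      ultimately have "(\<lambda>n. (g (x + h n *\<^sub>R v) - g x) / h n) \<longlonglongrightarrow> G x \<bullet> v"
        by (rule filterlim_compose)
      then show "(\<lambda>n. s n x) \<longlonglongrightarrow> G x \<bullet> v" by (simp add: s_def)
    qed
    show "AE x in lborel. norm (s n x) \<le> indicator (cball 0 (R + norm v)) x *\<^sub>R (C * norm v)" for n
    proof (rule AE_I2)
      fix x
      show "norm (s n x) \<le> indicator (cball 0 (R + norm v)) x *\<^sub>R (C * norm v)"
      proof (cases "x \<in> cball 0 (R + norm v)")
        case True
        have "norm (g (x + h n *\<^sub>R v) - g x) \<le> C * norm ((x + h n *\<^sub>R v) - x)"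
        proof (rule differentiable_bound[of UNIV g "\<lambda>x v. G x \<bullet> v"])
          show "onorm (\<lambda>v. G y \<bullet> v) \<le> C" for y
          proof (rule onorm_le)
            fix w have "\<bar>G y \<bullet> w\<bar> \<le> norm (G y) * norm w" by (rule Cauchy_Schwarz_ineq2)
            also have "\<dots> \<le> C * norm w" by (intro mult_right_mono C) auto
            finally show "norm (G y \<bullet> w) \<le> C * norm w" by simp
          qed
        qed (use D in auto)
        with h[of n] True show ?thesis by (auto simp: s_def field_simps)
      next
        case False
        then have *: "norm x > R + norm v" by simp
        then have "x \<notin> K" using R[of x] norm_ge_zero[of v] by linarith
        moreover have "x + h n *\<^sub>R v \<notin> K"
        proof
          assume "x + h n *\<^sub>R v \<in> K"
          then have "norm (x + h n *\<^sub>R v) \<le> R" by (rule R)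
          moreover have "norm (h n *\<^sub>R v) \<le> norm v"
            using h[of n] mult_right_mono[of "h n" 1 "norm v"] by simp
          moreover have "norm x \<le> norm (x + h n *\<^sub>R v) + norm (h n *\<^sub>R v)"
            by (metis add_diff_cancel norm_triangle_ineq4)
          ultimately show False using * by linarith
        qed
        ultimately show ?thesis using K C by (simp add: s_def)
      qed
    qed
  qed auto
  then show ?thesis by (simp add: s0 LIMSEQ_const_iff)
qed

lemma test_fn_integral_cgrad:
  assumes "test_fn U f" shows "(\<integral>x. cgrad f x \<bullet> v \<partial>lborel) = 0"
proof -
  obtain K where K: "compact K" "K \<subseteq> U" "\<And>x. x \<notin> K \<Longrightarrow> f x = 0 \<and> cgrad f x = 0"
    using test_fn_support[OF assms] by blast
  with test_fn_smooth[OF assms] show ?thesis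
    by (intro integral_directional_derivative_eq_0[of f _ K])
       (auto intro: smooth_has_derivative smooth_continuous_cgrad)
qed

lemma test_fn_integrable:
  fixes h :: "'a::euclidean_space \<Rightarrow> 'b::{banach, second_countable_topology}"
  assumes "test_fn U f" and h: "continuous_on UNIV h"
  shows "integrable lborel (\<lambda>x. f x *\<^sub>R h x)"
    and "continuous_on UNIV h' \<Longrightarrow> integrable lborel (\<lambda>x. h' x * (cgrad f x \<bullet> v))"
proof -
  obtain K where K: "compact K" "K \<subseteq> U" "\<And>x. x \<notin> K \<Longrightarrow> f x = 0 \<and> cgrad f x = 0"
    using test_fn_support[OF assms(1)] by blast
  note sm = test_fn_smooth[OF assms(1)]
  show "integrable lborel (\<lambda>x. f x *\<^sub>R h x)"
    by (rule integrable_compact_support[OF _ K(1)])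
       (use K(3) in \<open>auto intro!: continuous_intros h smooth_continuous sm\<close>)
  show "integrable lborel (\<lambda>x. h' x * (cgrad f x \<bullet> v))" if "continuous_on UNIV h'"
    by (rule integrable_compact_support[OF _ K(1)])
       (use K(3) that in \<open>auto intro!: continuous_intros smooth_continuous_cgrad sm\<close>)
qed

text \<open>The product of \<open>f\<close> with a test function is again a test function; its
  gradient integrates to 0, which is the defining identity after the product rule.\<close>

lemma smooth_weak_gradient:
  assumes f: "smooth_fun f" and U: "open U"
  shows "weak_gradient U f (cgrad f)"
  unfolding weak_gradient_def
proof (intro conjI allI impI ballI)
  show "f \<in> borel_measurable lborel" "cgrad f \<in> borel_measurable lborel"
    using smooth_continuous[OF f] smooth_continuous_cgrad[OF f]
    by (auto intro: borel_measurable_continuous_onI)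
  fix K :: "'a set" assume "compact K \<and> K \<subseteq> U"
  then show "set_integrable lborel K f" "set_integrable lborel K (cgrad f)"
    unfolding set_integrable_def
    using smooth_continuous[OF f, of K] smooth_continuous_cgrad[OF f, of K]
    by (auto intro: borel_integrable_compact simp del: real_scaleR_def)
next
  fix \<phi> :: "'a \<Rightarrow> real" and i :: 'a assume \<phi>: "test_fn U \<phi>" "i \<in> Basis"
  note sm = test_fn_smooth[OF \<phi>(1)]
  note c = smooth_continuous[OF f, of UNIV] smooth_continuous_cgrad[OF f, of UNIV]
  obtain K where K: "compact K" "K \<subseteq> U" "\<And>x. x \<notin> K \<Longrightarrow> \<phi> x = 0 \<and> cgrad \<phi> x = 0"
    using test_fn_support[OF \<phi>(1)] by blast
  have p: "pderiv_dir \<phi> i x = cgrad \<phi> x \<bullet> i" for x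
    using smooth_has_derivative[OF sm] by (rule pderiv_dir_eqI)
  have "test_fn U (\<lambda>x. f x * \<phi> x)" by (rule test_fn_mult_smooth[OF \<phi>(1) f])
  from test_fn_integral_cgrad[OF this, of i]
  have "0 = (\<integral>x. f x * (cgrad \<phi> x \<bullet> i) + \<phi> x *\<^sub>R (cgrad f x \<bullet> i) \<partial>lborel)"
    by (simp add: cgrad_add[OF f sm] inner_add_left)
  also have "\<dots> = (\<integral>x. f x * (cgrad \<phi> x \<bullet> i) \<partial>lborel) + (\<integral>x. \<phi> x *\<^sub>R (cgrad f x \<bullet> i) \<partial>lborel)"
    by (intro Bochner_Integration.integral_add test_fn_integrable[OF \<phi>(1)])
       (auto intro!: continuous_intros c borel_measurable_continuous_onI)
  finally have "(\<integral>x. f x * (cgrad \<phi> x \<bullet> i) \<partial>lborel) = - (\<integral>x. (cgrad f x \<bullet> i) * \<phi> x \<partial>lborel)"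
    by (simp add: mult.commute)
  moreover have "(\<lambda>x. indicator U x *\<^sub>R (f x * (cgrad \<phi> x \<bullet> i))) = (\<lambda>x. f x * (cgrad \<phi> x \<bullet> i))"
    "(\<lambda>x. indicator U x *\<^sub>R ((cgrad f x \<bullet> i) * \<phi> x)) = (\<lambda>x. (cgrad f x \<bullet> i) * \<phi> x)"
    using K by (fastforce simp: indicator_def fun_eq_iff)+
  ultimately show "set_lebesgue_integral lborel U (\<lambda>x. f x * pderiv_dir \<phi> i x) =
      - set_lebesgue_integral lborel U (\<lambda>x. cgrad f x \<bullet> i * \<phi> x)"
    by (simp add: set_lebesgue_integral_def p)
qed

lemma sq_int_compact_support:
  fixes g :: "'a::euclidean_space \<Rightarrow> 'b::euclidean_space"
  assumes g: "continuous_on UNIV g" and K: "compact K" "\<And>x. x \<notin> K \<Longrightarrow> g x = 0"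
  shows "sq_int lborel g"
proof -
  have "integrable lborel (\<lambda>x. (norm (g x))\<^sup>2)"
    by (rule integrable_compact_support[OF _ K(1)]) (auto intro!: continuous_intros g simp: K(2))
  with g show ?thesis by (simp add: sq_int_iff borel_measurable_continuous_onI)
qed

lemma test_fn_sq_int:
  assumes "test_fn U f" shows "sq_int lborel f" "sq_int lborel (cgrad f)"
proof -
  obtain K where K: "compact K" "K \<subseteq> U" "\<And>x. x \<notin> K \<Longrightarrow> f x = 0 \<and> cgrad f x = 0"
    using test_fn_support[OF assms] by blast
  then show "sq_int lborel f" "sq_int lborel (cgrad f)"
    by (auto intro!: sq_int_compact_support[of _ K] smooth_continuous smooth_continuous_cgrad
        test_fn_smooth[OF assms])
qed

text \<open>For a unit vector \<open>e\<close>, integrate the derivative of \<open>(x \<bullet> e) * (v x)^2\<close> in direction \<open>e\<close>.\<close>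

lemma poincare:
  fixes v :: "'a::euclidean_space \<Rightarrow> real"
  assumes v: "test_fn U v" and R: "\<And>x. x \<in> U \<Longrightarrow> norm x \<le> R" "R \<ge> 0"
  shows "l2n lborel v \<le> 2 * R * l2n lborel (cgrad v)"
proof -
  \<comment> \<open>Any basis direction will do: the bound \<open>R\<close> controls every
    coordinate on \<open>U\<close>.\<close>
  obtain e :: 'a where e: "e \<in> Basis" using nonempty_Basis by blast
  obtain K where K: "compact K" "K \<subseteq> U" "\<And>x. x \<notin> K \<Longrightarrow> v x = 0 \<and> cgrad v x = 0"
    using test_fn_support[OF v] by blast
  note sm = test_fn_smooth[OF v]
  have sme: "smooth_fun (\<lambda>x::'a. x \<bullet> e)"
    unfolding smooth_fun_def by (auto intro: Ck_linear bounded_linear_inner_left)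
  have cge: "cgrad (\<lambda>x::'a. x \<bullet> e) x = e" for x
    by (rule cgrad_eqI) (auto intro!: derivative_eq_intros simp: inner_commute)
  have tf: "test_fn U (\<lambda>x. (x \<bullet> e) * (v x * v x))"
    by (intro test_fn_mult_smooth v sm sme)
  define h where "h x = 2 * (x \<bullet> e) * v x * (cgrad v x \<bullet> e)" for x
  have hc: "continuous_on UNIV h" unfolding h_def
    by (intro continuous_intros smooth_continuous smooth_continuous_cgrad sm)
  have hb: "norm (h x) \<le> 2 * R * (norm (v x) * norm (cgrad v x))" for x
  proof (cases "x \<in> U")
    case True
    have "\<bar>x \<bullet> e\<bar> \<le> R" using Basis_le_norm[OF e, of x] R(1)[OF True] by simp
    moreover have "\<bar>cgrad v x \<bullet> e\<bar> \<le> norm (cgrad v x)" by (rule Basis_le_norm[OF e])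
    ultimately have "\<bar>x \<bullet> e\<bar> * (\<bar>v x\<bar> * \<bar>cgrad v x \<bullet> e\<bar>) \<le> R * (\<bar>v x\<bar> * norm (cgrad v x))"
      by (intro mult_mono mult_left_mono) auto
    then show ?thesis by (simp add: h_def abs_mult mult.assoc)
  next
    case False
    then have "x \<notin> K" using K(2) by blast
    with K(3) show ?thesis by (simp add: h_def)
  qed
  have hm: "h \<in> borel_measurable lborel" using borel_measurable_continuous_onI[OF hc] by simp
  have hi: "integrable lborel h" and hB: "norm (\<integral>x. h x \<partial>lborel) \<le> 2 * R * (l2n lborel v * l2n lborel (cgrad v))"
    by (rule integrable_prod_bound[OF test_fn_sq_int[OF v]]; use hm hb R in auto)+
  have cg: "cgrad (\<lambda>x. (x \<bullet> e) * (v x * v x)) x \<bullet> e = h x + (norm (v x))\<^sup>2" for x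
    unfolding cgrad_add(3)[OF sme smooth_fun_intros(3)[OF sm sm]] cgrad_add(3)[OF sm sm] cge h_def
    using e by (simp add: inner_add_left power2_eq_square inner_Basis algebra_simps)
  have vi: "integrable lborel (\<lambda>x. (norm (v x))\<^sup>2)"
    using test_fn_sq_int[OF v] by (simp add: sq_int_iff)
  have "0 = (\<integral>x. h x + (norm (v x))\<^sup>2 \<partial>lborel)"
    using test_fn_integral_cgrad[OF tf, of e] by (simp add: cg)
  also have "\<dots> = (\<integral>x. h x \<partial>lborel) + (l2n lborel v)\<^sup>2"
    unfolding l2n_sq by (rule Bochner_Integration.integral_add[OF hi vi])
  finally have "(l2n lborel v)\<^sup>2 \<le> 2 * R * (l2n lborel v * l2n lborel (cgrad v))"
    using hB by simp
  then have "l2n lborel v * l2n lborel v \<le> l2n lborel v * (2 * R * l2n lborel (cgrad v))"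
    by (simp add: power2_eq_square algebra_simps)
  then show ?thesis
    using l2n_nonneg[of lborel v] R(2) l2n_nonneg[of lborel "cgrad v"]
    by (cases "l2n lborel v = 0") (auto simp: mult_le_cancel_left)
qed

section \<open>Weighted measures on the domain, the half line and the cylinder\<close>

definition MO :: "'a::euclidean_space set \<Rightarrow> 'a measure" where
  "MO \<Omega> = density lborel (\<lambda>x. ennreal (indicat_real \<Omega> x))"

text \<open>Like \<open>MO\<close> a density on the whole space, with the half line entering through
  an indicator: sets and spaces stay those of \<open>borel\<close>, and the cylinder measure is a
  product to which Fubini applies.\<close>

definition MY :: "real \<Rightarrow> real measure" where
  "MY \<alpha> = density lborel (\<lambda>y. ennreal (indicat_real {0<..} y * y powr \<alpha>))"

definition MC :: "(real^'n) set \<Rightarrow> real \<Rightarrow> ((real^'n) \<times> real) measure" where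
  "MC \<Omega> \<alpha> = MO \<Omega> \<Otimes>\<^sub>M MY \<alpha>"

lemma sets_MO [measurable_cong, simp]: "sets (MO \<Omega>) = sets borel" by (simp add: MO_def)
lemma sets_MY [measurable_cong, simp]: "sets (MY \<alpha>) = sets borel" by (simp add: MY_def)
lemma space_MO [simp]: "space (MO \<Omega>) = UNIV" by (simp add: MO_def)
lemma space_MY [simp]: "space (MY \<alpha>) = UNIV" by (simp add: MY_def)
lemma sets_MC [measurable_cong, simp]: "sets (MC \<Omega> \<alpha>) = sets borel"
  unfolding MC_def by (simp add: borel_prod[symmetric] cong: sets_pair_measure_cong)
lemma space_MC [simp]: "space (MC \<Omega> \<alpha>) = UNIV" by (simp add: MC_def space_pair_measure)

lemma measurable_M [simp]:
  "borel_measurable (MO \<Omega>) = borel_measurable borel"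
  "borel_measurable (MY \<alpha>) = borel_measurable borel"
  "borel_measurable (MC \<Omega>' \<alpha>) = borel_measurable borel"
  by (auto cong: measurable_cong_sets)

lemma sigma_finite_MO:
  fixes \<Omega> :: "'a::euclidean_space set"
  assumes [measurable]: "\<Omega> \<in> sets borel" shows "sigma_finite_measure (MO \<Omega>)"
  unfolding MO_def by (subst sigma_finite_measure.sigma_finite_iff_density_finite[OF sigma_finite_lborel]) auto

lemma sigma_finite_MY: "sigma_finite_measure (MY \<alpha>)"
  unfolding MY_def by (subst sigma_finite_measure.sigma_finite_iff_density_finite[OF sigma_finite_lborel]) auto

lemma pair_sigma_finite_MO_MY:
  assumes "\<Omega> \<in> sets borel" shows "pair_sigma_finite (MO \<Omega>) (MY \<alpha>)"
  using sigma_finite_MO[OF assms] sigma_finite_MY by (rule pair_sigma_finite.intro)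

text \<open>Reconciles the product measure with the single weight on \<open>cyl \<Omega>\<close> in
  which \<open>H1w\<close>, \<open>wconv\<close> and \<open>a_ext\<close> are written.\<close>

lemma MC_density:
  fixes \<Omega> :: "(real^'n) set"
  assumes [measurable]: "\<Omega> \<in> sets borel"
  shows "MC \<Omega> \<alpha> = density lborel (\<lambda>p. ennreal (indicat_real (cyl \<Omega>) p * snd p powr \<alpha>))"
proof -
  have "MC \<Omega> \<alpha> = density (lborel \<Otimes>\<^sub>M lborel)
      (\<lambda>(x, y). ennreal (indicat_real \<Omega> x) * ennreal (indicat_real {0<..} y * y powr \<alpha>))"
    unfolding MC_def MO_def MY_def
    by (rule pair_measure_density) (use sigma_finite_MY in \<open>auto simp: MY_def lborel.sigma_finite_measure_axioms\<close>)
  also have "\<dots> = density lborel (\<lambda>p. ennreal (indicat_real (cyl \<Omega>) p * snd p powr \<alpha>))"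
    unfolding lborel_prod
    by (rule arg_cong[where f = "density lborel"])
       (auto simp: fun_eq_iff cyl_def indicator_def)
  finally show ?thesis .
qed

lemma cyl_measurable [measurable]: "\<Omega> \<in> sets borel \<Longrightarrow> cyl \<Omega> \<in> sets borel"
  unfolding cyl_def by (intro borel_Times) auto

lemma borel_measurable_fst_snd [measurable]:
  "(fst :: 'a::second_countable_topology \<times> 'b::second_countable_topology \<Rightarrow> 'a) \<in> borel_measurable borel"
  "(snd :: 'a::second_countable_topology \<times> 'b::second_countable_topology \<Rightarrow> 'b) \<in> borel_measurable borel"
  by (simp_all add: borel_prod[symmetric])

lemma set_lint_MO:
  fixes f :: "'a::euclidean_space \<Rightarrow> real"
  assumes [measurable]: "\<Omega> \<in> sets borel" "f \<in> borel_measurable borel"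
  shows "set_lebesgue_integral lborel \<Omega> f = (\<integral>x. f x \<partial>MO \<Omega>)"
  unfolding MO_def set_lebesgue_integral_def by (subst integral_density) auto

lemma set_nn_MO:
  fixes f :: "'a::euclidean_space \<Rightarrow> ennreal"
  assumes [measurable]: "\<Omega> \<in> sets borel" "f \<in> borel_measurable borel"
  shows "set_nn_integral lborel \<Omega> f = (\<integral>\<^sup>+x. f x \<partial>MO \<Omega>)"
  unfolding MO_def
  by (subst nn_integral_density) (auto simp: mult.commute ennreal_indicator)

lemma AE_MO:
  fixes \<Omega> :: "'a::euclidean_space set"
  assumes [measurable]: "\<Omega> \<in> sets borel"
  shows "(AE x in MO \<Omega>. P x) \<longleftrightarrow> (AE x in lborel. x \<in> \<Omega> \<longrightarrow> P x)"
  unfolding MO_def by (subst AE_density) (auto simp: indicator_def)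

lemma AE_MY: "(AE y in MY \<alpha>. P y) \<longleftrightarrow> (AE y in lborel. 0 < y \<longrightarrow> P y)"
  unfolding MY_def by (subst AE_density) (auto simp: indicator_def)

lemma AE_MC:
  fixes \<Omega> :: "(real^'n) set"
  assumes [measurable]: "\<Omega> \<in> sets borel"
  shows "(AE p in MC \<Omega> \<alpha>. P p) \<longleftrightarrow> (AE p in lborel. p \<in> cyl \<Omega> \<longrightarrow> P p)"
  unfolding MC_density[OF assms]
  by (subst AE_density, measurable) (auto simp: indicator_def cyl_def intro!: AE_cong)

lemma set_nn_MC:
  fixes f :: "(real^'n) \<times> real \<Rightarrow> real"
  assumes [measurable]: "\<Omega> \<in> sets borel" "f \<in> borel_measurable borel" and "\<And>p. f p \<ge> 0"
  shows "set_nn_integral lborel (cyl \<Omega>) (\<lambda>p. ennreal (snd p powr \<alpha> * f p)) = (\<integral>\<^sup>+p. ennreal (f p) \<partial>MC \<Omega> \<alpha>)"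
  unfolding MC_density[OF assms(1)]
  by (subst nn_integral_density)
     (auto simp: ennreal_mult assms mult_ac ennreal_indicator intro!: nn_integral_cong split: split_indicator)

lemma set_lint_MC:
  fixes f :: "(real^'n) \<times> real \<Rightarrow> real"
  assumes [measurable]: "\<Omega> \<in> sets borel" "f \<in> borel_measurable borel"
  shows "set_lebesgue_integral lborel (cyl \<Omega>) (\<lambda>p. snd p powr \<alpha> * f p) = (\<integral>p. f p \<partial>MC \<Omega> \<alpha>)"
  unfolding MC_density[OF assms(1)] set_lebesgue_integral_def
  by (subst integral_density) (auto simp: mult_ac)

text \<open>\<open>weak_gradient\<close> is stated for plain Lebesgue measure while all norms are
  weighted. On the open cylinder y > 0, so the weight can be undone by its inverse.\<close>

lemma MC_unweight:
  fixes f :: "(real^'n) \<times> real \<Rightarrow> 'b::{banach, second_countable_topology}"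
  assumes [measurable]: "\<Omega> \<in> sets borel" "f \<in> borel_measurable borel"
  shows "set_lebesgue_integral lborel (cyl \<Omega>) f = (\<integral>p. (snd p powr - \<alpha>) *\<^sub>R f p \<partial>MC \<Omega> \<alpha>)"
    and "set_integrable lborel (cyl \<Omega>) f \<longleftrightarrow> integrable (MC \<Omega> \<alpha>) (\<lambda>p. (snd p powr - \<alpha>) *\<^sub>R f p)"
proof -
  have eq: "(indicat_real (cyl \<Omega>) p * snd p powr \<alpha>) *\<^sub>R ((snd p powr - \<alpha>) *\<^sub>R f p) = indicat_real (cyl \<Omega>) p *\<^sub>R f p" for p
    by (cases "p \<in> cyl \<Omega>") (auto simp: cyl_def powr_minus)
  show "set_lebesgue_integral lborel (cyl \<Omega>) f = (\<integral>p. (snd p powr - \<alpha>) *\<^sub>R f p \<partial>MC \<Omega> \<alpha>)"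
    unfolding MC_density[OF assms(1)] set_lebesgue_integral_def
    by (subst integral_density) (auto simp only: eq intro!: AE_I2 mult_nonneg_nonneg, measurable)
  show "set_integrable lborel (cyl \<Omega>) f \<longleftrightarrow> integrable (MC \<Omega> \<alpha>) (\<lambda>p. (snd p powr - \<alpha>) *\<^sub>R f p)"
    unfolding MC_density[OF assms(1)] set_integrable_def
    by (subst integrable_density) (auto simp: eq simp del: scaleR_scaleR)
qed

subsection \<open>The trace inequality\<close>

lemma nn_integral_powr_0:
  assumes "\<beta> > -1" "b \<ge> (0::real)"
  shows "(\<integral>\<^sup>+y. ennreal (indicat_real {0<..b} y * y powr \<beta>) \<partial>lborel) = ennreal (b powr (\<beta> + 1) / (\<beta> + 1))"
proof -
  have "((\<lambda>x. x powr \<beta>) has_integral (b powr (\<beta> + 1) / (\<beta> + 1))) {0..b}"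
    using has_integral_powr_from_0[OF assms] .
  then have "(\<integral>\<^sup>+y. ennreal (indicat_real {0..b} y * y powr \<beta>) \<partial>lborel) = ennreal (b powr (\<beta> + 1) / (\<beta> + 1))"
    by (intro nn_integral_has_integral_lebesgue) auto
  \<comment> \<open>At y = 0 both integrands vanish, the right one because
    \<open>0 powr \<beta> = 0\<close>.\<close>
  moreover have "(\<integral>\<^sup>+y. ennreal (indicat_real {0<..b} y * y powr \<beta>) \<partial>lborel)
      = (\<integral>\<^sup>+y. ennreal (indicat_real {0..b} y * y powr \<beta>) \<partial>lborel)"
  proof (rule nn_integral_cong)
    fix y :: real
    show "ennreal (indicat_real {0<..b} y * y powr \<beta>) = ennreal (indicat_real {0..b} y * y powr \<beta>)"
      by (cases "y = 0") (auto simp: indicator_def)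
  qed
  ultimately show ?thesis by simp
qed

lemma nn_integral_MY:
  assumes [measurable]: "f \<in> borel_measurable borel" and "\<And>y. f y \<ge> 0"
  shows "(\<integral>\<^sup>+y. ennreal (f y) \<partial>MY \<alpha>) = (\<integral>\<^sup>+y. ennreal (indicat_real {0<..} y * y powr \<alpha> * f y) \<partial>lborel)"
  unfolding MY_def by (subst nn_integral_density) (auto simp: ennreal_mult assms)

text \<open>Write f 0 as f y minus the integral of \<open>f'\<close> over [0, y] and use
  Cauchy-Schwarz with the weight split off; the inverse weight y powr (2 s - 1) is integrable at 0
  because s > 0. Averaging over y in (0, \<delta>] replaces f y by a weighted norm. A small
  \<open>\<delta>\<close> makes the factor of the derivative small at the expense of the other
  one.\<close>

lemma trace_1d:
  fixes f f' :: "real \<Rightarrow> real"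
  assumes s: "0 < s" "s < 1" and \<delta>: "\<delta> > 0"
    and D: "\<And>y. (f has_real_derivative f' y) (at y)" and c: "continuous_on UNIV f'"
  shows "ennreal ((f 0)\<^sup>2) \<le> ennreal (2 * ((2 - 2 * s) / \<delta> powr (2 - 2 * s))) * (\<integral>\<^sup>+y. ennreal ((f y)\<^sup>2) \<partial>MY (1 - 2 * s))
      + ennreal (\<delta> powr (2 * s) / s) * (\<integral>\<^sup>+y. ennreal ((f' y)\<^sup>2) \<partial>MY (1 - 2 * s))"
proof -
  let ?\<alpha> = "1 - 2 * s"
  have fc: "continuous_on UNIV f"
    using D DERIV_isCont by (blast intro: continuous_at_imp_continuous_on)
  note [measurable] = borel_measurable_continuous_onI[OF fc] borel_measurable_continuous_onI[OF c]
  define E where "E = (\<integral>\<^sup>+y. ennreal ((f' y)\<^sup>2) \<partial>MY ?\<alpha>)"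
  \<comment> \<open>\<open>K\<close> is the integral of y powr (2 s - 1) over (0, \<delta>], and
    \<open>m\<close> is the mass of (0, \<delta>] under the weight y powr (1 - 2 s).\<close>
  define K where "K = \<delta> powr (2 * s) / (2 * s)"
  define m where "m = \<delta> powr (2 - 2 * s) / (2 - 2 * s)"
  have K: "K > 0" and m: "m > 0" using s \<delta> by (auto simp: K_def m_def)
  have diff: "ennreal ((f y - f 0)\<^sup>2) \<le> ennreal K * E" if y: "0 < y" "y \<le> \<delta>" for y
  proof -
    have FTC: "(\<integral>x. f' x * indicator {0..y} x \<partial>lborel) = f y - f 0"
      by (rule integral_FTC_Icc_real) (use y D c in \<open>auto simp: continuous_on_eq_continuous_at\<close>)
    have "integrable lborel (\<lambda>x. f' x * indicator {0..y} x)"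
      by (rule borel_integrable_atLeastAtMost)
         (use c in \<open>simp add: continuous_on_eq_continuous_at\<close>)
    from integral_norm_bound_ennreal[OF this]
    have "ennreal \<bar>f y - f 0\<bar> \<le> (\<integral>\<^sup>+x. ennreal \<bar>f' x * indicator {0..y} x\<bar> \<partial>lborel)"
      unfolding FTC by simp
    \<comment> \<open>Lebesgue measure becomes the weighted measure times the inverse weight; only
      the null set {0} is lost.\<close>
    also have "\<dots> = (\<integral>\<^sup>+x. ennreal (indicat_real {0<..y} x * x powr - ?\<alpha>) * ennreal \<bar>f' x\<bar> \<partial>MY ?\<alpha>)"
      unfolding MY_def
    proof (subst nn_integral_density)
      show "(\<integral>\<^sup>+x. ennreal \<bar>f' x * indicator {0..y} x\<bar> \<partial>lborel) =
        (\<integral>\<^sup>+x. ennreal (indicat_real {0<..} x * x powr ?\<alpha>) *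
           (ennreal (indicat_real {0<..y} x * x powr - ?\<alpha>) * ennreal \<bar>f' x\<bar>) \<partial>lborel)"
      proof (rule nn_integral_cong_AE, rule AE_mp[OF AE_lborel_singleton[of 0]], rule AE_I2, rule impI)
        fix x :: real assume x: "x \<noteq> 0"
        show "ennreal \<bar>f' x * indicator {0..y} x\<bar> = ennreal (indicat_real {0<..} x * x powr ?\<alpha>) *
           (ennreal (indicat_real {0<..y} x * x powr - ?\<alpha>) * ennreal \<bar>f' x\<bar>)"
        proof (cases "0 < x \<and> x \<le> y")
          case True
          then have "ennreal (x powr ?\<alpha>) * (ennreal (x powr - ?\<alpha>) * ennreal \<bar>f' x\<bar>)
              = ennreal ((x powr ?\<alpha> * x powr - ?\<alpha>) * \<bar>f' x\<bar>)"
            by (simp add: ennreal_mult mult.assoc)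
          also have "x powr ?\<alpha> * x powr - ?\<alpha> = 1" using True by (simp add: powr_add[symmetric])
          finally show ?thesis using True by simp
        qed (use x in \<open>auto simp: indicator_def\<close>)
      qed
    qed auto
    finally have "(ennreal \<bar>f y - f 0\<bar>)\<^sup>2 \<le>
        (\<integral>\<^sup>+x. ennreal (indicat_real {0<..y} x * x powr - ?\<alpha>) * ennreal \<bar>f' x\<bar> \<partial>MY ?\<alpha>)\<^sup>2"
      by (rule power_mono) simp
    also have "\<dots> \<le> (\<integral>\<^sup>+x. (ennreal (indicat_real {0<..y} x * x powr - ?\<alpha>))\<^sup>2 \<partial>MY ?\<alpha>) * (\<integral>\<^sup>+x. (ennreal \<bar>f' x\<bar>)\<^sup>2 \<partial>MY ?\<alpha>)"
      by (rule Cauchy_Schwarz_nn_integral) auto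
    also have "(\<integral>\<^sup>+x. (ennreal \<bar>f' x\<bar>)\<^sup>2 \<partial>MY ?\<alpha>) = E"
      by (simp add: E_def ennreal_power)
    also have "(\<integral>\<^sup>+x. (ennreal (indicat_real {0<..y} x * x powr - ?\<alpha>))\<^sup>2 \<partial>MY ?\<alpha>)
        = (\<integral>\<^sup>+x. ennreal (indicat_real {0<..y} x * x powr (- ?\<alpha>)) \<partial>lborel)"
    proof -
      have "(\<integral>\<^sup>+x. (ennreal (indicat_real {0<..y} x * x powr - ?\<alpha>))\<^sup>2 \<partial>MY ?\<alpha>)
         = (\<integral>\<^sup>+x. ennreal ((indicat_real {0<..y} x * x powr - ?\<alpha>)\<^sup>2) \<partial>MY ?\<alpha>)"
        by (intro nn_integral_cong) (simp add: ennreal_power)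
      also have "\<dots> = (\<integral>\<^sup>+x. ennreal (indicat_real {0<..y} x * x powr (- ?\<alpha>)) \<partial>lborel)"
      proof (subst nn_integral_MY)
        show "(\<integral>\<^sup>+x. ennreal (indicat_real {0<..} x * x powr ?\<alpha> * (indicat_real {0<..y} x * x powr - ?\<alpha>)\<^sup>2) \<partial>lborel)
          = (\<integral>\<^sup>+x. ennreal (indicat_real {0<..y} x * x powr (- ?\<alpha>)) \<partial>lborel)"
        proof (intro nn_integral_cong arg_cong[where f = ennreal])
          fix x :: real
          have "x powr ?\<alpha> * (x powr - ?\<alpha> * x powr - ?\<alpha>) = x powr - ?\<alpha>" if "x > 0"
            using that by (simp add: powr_add[symmetric])
          then show "indicat_real {0<..} x * x powr ?\<alpha> * (indicat_real {0<..y} x * x powr - ?\<alpha>)\<^sup>2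
             = indicat_real {0<..y} x * x powr (- ?\<alpha>)"
            by (auto simp: indicator_def power2_eq_square)
        qed
      qed auto
      finally show ?thesis .
    qed
    also have "\<dots> = ennreal (y powr (- ?\<alpha> + 1) / (- ?\<alpha> + 1))"
      using s y by (intro nn_integral_powr_0) auto
    also have "\<dots> \<le> ennreal K"
      unfolding K_def using s y by (intro ennreal_leI) (auto intro!: divide_right_mono powr_mono2)
    finally show ?thesis
      by (simp add: ennreal_power mult_right_mono)
  qed
  have pt: "ennreal ((f 0)\<^sup>2) \<le> 2 * ennreal ((f y)\<^sup>2) + 2 * (ennreal K * E)" if "0 < y" "y \<le> \<delta>" for y
  proof -
    have "(f 0)\<^sup>2 \<le> 2 * (f y)\<^sup>2 + 2 * (f y - f 0)\<^sup>2"
      using zero_le_power2[of "2 * f y - f 0"] by (simp add: power2_eq_square algebra_simps)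
    then have "ennreal ((f 0)\<^sup>2) \<le> ennreal (2 * (f y)\<^sup>2 + 2 * (f y - f 0)\<^sup>2)" by (rule ennreal_leI)
    also have "\<dots> = 2 * ennreal ((f y)\<^sup>2) + 2 * ennreal ((f y - f 0)\<^sup>2)"
      by (simp add: ennreal_mult ennreal_plus)
    also have "\<dots> \<le> 2 * ennreal ((f y)\<^sup>2) + 2 * (ennreal K * E)"
      by (intro add_left_mono mult_left_mono diff that) auto
    finally show ?thesis .
  qed
  have em: "(\<integral>\<^sup>+y. indicator {0<..\<delta>} y * c \<partial>MY ?\<alpha>) = ennreal m * c" for c
  proof -
    have "(\<integral>\<^sup>+y. indicator {0<..\<delta>} y \<partial>MY ?\<alpha>) = (\<integral>\<^sup>+y. ennreal (indicat_real {0<..\<delta>} y) \<partial>MY ?\<alpha>)"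
      by (simp add: ennreal_indicator)
    also have "\<dots> = (\<integral>\<^sup>+y. ennreal (indicat_real {0<..\<delta>} y * y powr ?\<alpha>) \<partial>lborel)"
      by (subst nn_integral_MY) (auto simp: indicator_def intro!: nn_integral_cong)
    also have "\<dots> = ennreal m"
      unfolding m_def using nn_integral_powr_0[of ?\<alpha> \<delta>] s \<delta> by simp
    finally show ?thesis by (subst nn_integral_multc) auto
  qed
  have "ennreal m * ennreal ((f 0)\<^sup>2) = (\<integral>\<^sup>+y. indicator {0<..\<delta>} y * ennreal ((f 0)\<^sup>2) \<partial>MY ?\<alpha>)"
    by (simp add: em)
  also have "\<dots> \<le> (\<integral>\<^sup>+y. 2 * ennreal ((f y)\<^sup>2) + indicator {0<..\<delta>} y * (2 * (ennreal K * E)) \<partial>MY ?\<alpha>)"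
    by (rule nn_integral_mono) (use pt in \<open>auto simp: indicator_def\<close>)
  also have "\<dots> = 2 * (\<integral>\<^sup>+y. ennreal ((f y)\<^sup>2) \<partial>MY ?\<alpha>) + ennreal m * (2 * (ennreal K * E))"
    by (subst nn_integral_add) (auto simp: em nn_integral_cmult)
  finally have "ennreal (1 / m) * (ennreal m * ennreal ((f 0)\<^sup>2)) \<le>
      ennreal (1 / m) * (2 * (\<integral>\<^sup>+y. ennreal ((f y)\<^sup>2) \<partial>MY ?\<alpha>) + ennreal m * (2 * (ennreal K * E)))"
    by (rule mult_left_mono) simp
  moreover have "ennreal (1 / m) * ennreal m = 1"
    using m by (simp add: ennreal_mult[symmetric])
  ultimately have "ennreal ((f 0)\<^sup>2) \<le> ennreal (1 / m) * 2 * (\<integral>\<^sup>+y. ennreal ((f y)\<^sup>2) \<partial>MY ?\<alpha>) + 2 * ennreal K * E"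
    by (simp add: distrib_left mult.assoc[symmetric])
  moreover have "ennreal (1 / m) * 2 = ennreal (2 * ((2 - 2 * s) / \<delta> powr (2 - 2 * s)))"
  proof -
    have "ennreal (1 / m) * 2 = ennreal (1 / m * 2)"
      using m ennreal_mult[of "1 / m" 2] by simp
    also have "1 / m * 2 = 2 * ((2 - 2 * s) / \<delta> powr (2 - 2 * s))" by (simp add: m_def)
    finally show ?thesis .
  qed
  moreover have "2 * ennreal K = ennreal (\<delta> powr (2 * s) / s)"
    using K s by (simp add: K_def ennreal_mult[symmetric] flip: ennreal_numeral)
  ultimately show ?thesis by (simp add: E_def)
qed

lemma nn_integral_MC_fst:
  assumes "\<Omega> \<in> sets borel" "f \<in> borel_measurable borel"
  shows "(\<integral>\<^sup>+p. f p \<partial>MC \<Omega> \<alpha>) = (\<integral>\<^sup>+x. (\<integral>\<^sup>+y. f (x, y) \<partial>MY \<alpha>) \<partial>MO \<Omega>)"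
proof -
  interpret pair_sigma_finite "MO \<Omega>" "MY \<alpha>" by (rule pair_sigma_finite_MO_MY[OF assms(1)])
  have "f \<in> borel_measurable (MC \<Omega> \<alpha>)" using assms(2) by simp
  then have "f \<in> borel_measurable (MO \<Omega> \<Otimes>\<^sub>M MY \<alpha>)" by (simp only: MC_def)
  from M2.nn_integral_fst[OF this] show ?thesis by (simp add: MC_def)
qed

lemma nn_integral_MC_times:
  assumes [measurable]: "\<Omega> \<in> sets borel" "f \<in> borel_measurable borel" "g \<in> borel_measurable borel"
  shows "(\<integral>\<^sup>+p. f (fst p) * g (snd p) \<partial>MC \<Omega> \<alpha>) = (\<integral>\<^sup>+x. f x \<partial>MO \<Omega>) * (\<integral>\<^sup>+y. g y \<partial>MY \<alpha>)"
  by (subst nn_integral_MC_fst) (auto simp: nn_integral_cmult nn_integral_multc)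

text \<open>Tonelli under a mere pointwise domination, so that it applies to jets of products as
  well as to bounded functions of bounded support.\<close>

lemma sq_int_MC_tensor:
  fixes F :: "(real^'n) \<times> real \<Rightarrow> 'c::real_normed_vector"
    and V :: "real^'n \<Rightarrow> 'a::real_normed_vector" and K :: "real \<Rightarrow> 'b::real_normed_vector"
  assumes \<Omega>: "\<Omega> \<in> sets borel" and V: "sq_int (MO \<Omega>) V" and K: "sq_int (MY \<alpha>) K"
    and F: "F \<in> borel_measurable borel" and b: "\<And>x y. norm (F (x, y)) \<le> norm (V x) * norm (K y)"
  shows "sq_int (MC \<Omega> \<alpha>) F" "l2n (MC \<Omega> \<alpha>) F \<le> l2n (MO \<Omega>) V * l2n (MY \<alpha>) K"
proof -
  have [measurable]: "V \<in> borel_measurable borel" "K \<in> borel_measurable borel"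
    using V K by (auto simp: sq_int_def)
  have "(\<integral>\<^sup>+p. ennreal ((norm (F p))\<^sup>2) \<partial>MC \<Omega> \<alpha>)
      \<le> (\<integral>\<^sup>+p. ennreal ((norm (V (fst p)))\<^sup>2) * ennreal ((norm (K (snd p)))\<^sup>2) \<partial>MC \<Omega> \<alpha>)"
    unfolding ennreal_mult[symmetric, OF zero_le_power2 zero_le_power2] power_mult_distrib[symmetric]
    by (intro nn_integral_mono ennreal_leI power_mono) (use b in auto)
  also have "\<dots> = ennreal ((l2n (MO \<Omega>) V)\<^sup>2) * ennreal ((l2n (MY \<alpha>) K)\<^sup>2)"
    by (subst nn_integral_MC_times) (auto simp: \<Omega> nn_integral_sq_eq[OF V] nn_integral_sq_eq[OF K])
  also have "\<dots> = ennreal ((l2n (MO \<Omega>) V * l2n (MY \<alpha>) K)\<^sup>2)"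
    by (simp add: ennreal_mult power_mult_distrib)
  finally have *: "(\<integral>\<^sup>+p. ennreal ((norm (F p))\<^sup>2) \<partial>MC \<Omega> \<alpha>) \<le> ennreal ((l2n (MO \<Omega>) V * l2n (MY \<alpha>) K)\<^sup>2)" .
  then show 1: "sq_int (MC \<Omega> \<alpha>) F"
    using F by (auto simp: sq_int_def intro: le_less_trans)
  show "l2n (MC \<Omega> \<alpha>) F \<le> l2n (MO \<Omega>) V * l2n (MY \<alpha>) K"
    using l2n_le_iff_nn_integral[OF 1, of "l2n (MO \<Omega>) V * l2n (MY \<alpha>) K"] * by simp
qed

lemma sq_int_MO_lborel:
  fixes f :: "'a::euclidean_space \<Rightarrow> 'b::real_normed_vector"
  assumes \<Omega>[measurable]: "\<Omega> \<in> sets borel" and f: "sq_int lborel f"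
  shows "sq_int (MO \<Omega>) f"
proof -
  have [measurable]: "f \<in> borel_measurable borel" using f by (simp add: sq_int_def)
  have "(\<integral>\<^sup>+x. ennreal ((norm (f x))\<^sup>2) \<partial>MO \<Omega>) \<le> (\<integral>\<^sup>+x. ennreal ((norm (f x))\<^sup>2) \<partial>lborel)"
    unfolding MO_def
    by (subst nn_integral_density) (auto intro!: nn_integral_mono simp: indicator_def)
  with f show ?thesis by (auto simp: sq_int_def intro: le_less_trans)
qed

lemma sq_int_indicator_MO:
  fixes \<Omega> :: "'a::euclidean_space set"
  assumes [measurable]: "\<Omega> \<in> sets borel" "B \<in> sets borel" and b: "bounded B"
  shows "sq_int (MO \<Omega>) (indicat_real B)"
proof (rule sq_int_MO_lborel)
  have "(\<integral>\<^sup>+x. ennreal ((norm (indicat_real B x))\<^sup>2) \<partial>lborel) = emeasure lborel B"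
  proof -
    have "(\<lambda>x. ennreal ((norm (indicat_real B x))\<^sup>2)) = indicator B"
      by (auto simp: fun_eq_iff split: split_indicator)
    then show ?thesis by simp
  qed
  with emeasure_bounded_finite[OF b] show "sq_int lborel (indicat_real B)"
    by (auto simp: sq_int_def)
qed simp

lemma sq_int_indicator_MY:
  assumes "\<alpha> > -1"
  shows "sq_int (MY \<alpha>) (indicat_real {..b})"
proof -
  have "(\<integral>\<^sup>+y. ennreal ((norm (indicat_real {..b} y))\<^sup>2) \<partial>MY \<alpha>)
      = (\<integral>\<^sup>+y. ennreal (indicat_real {0<..} y * y powr \<alpha> * (norm (indicat_real {..b} y))\<^sup>2) \<partial>lborel)"
    by (rule nn_integral_MY) auto
  also have "\<dots> \<le> (\<integral>\<^sup>+y. ennreal (indicat_real {0<..max b 0} y * y powr \<alpha>) \<partial>lborel)"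
    by (intro nn_integral_mono ennreal_leI) (auto simp: indicator_def)
  also have "\<dots> < \<infinity>" using nn_integral_powr_0[of \<alpha> "max b 0"] assms by simp
  finally show ?thesis by (simp add: sq_int_def)
qed

text \<open>The support may touch y = 0, where the weight can be singular; its mass near 0 is finite
  because \<open>\<alpha> > -1\<close>.\<close>

lemma sq_int_MC_compact_support:
  fixes g :: "(real^'n) \<times> real \<Rightarrow> 'b::real_normed_vector"
  assumes \<Omega>: "\<Omega> \<in> sets borel" and \<alpha>: "\<alpha> > -1" and g: "g \<in> borel_measurable borel"
    and C: "\<And>p. norm (g p) \<le> C" and K: "bounded K" "\<And>p. p \<notin> K \<Longrightarrow> g p = 0"
  shows "sq_int (MC \<Omega> \<alpha>) g"
proof -
  obtain R where R: "\<And>p. p \<in> K \<Longrightarrow> norm p \<le> R" using K(1) by (auto simp: bounded_iff)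
  have C0: "C \<ge> 0" using C[of undefined] norm_ge_zero[of "g undefined"] by linarith
  show ?thesis
  proof (rule sq_int_MC_tensor(1)[OF \<Omega>])
    show "sq_int (MO \<Omega>) (\<lambda>x. C *\<^sub>R indicat_real (cball 0 R) x)"
      by (intro sq_int_scaleR sq_int_indicator_MO \<Omega>) auto
    show "sq_int (MY \<alpha>) (indicat_real {..R})" by (rule sq_int_indicator_MY[OF \<alpha>])
    show "norm (g (x, y)) \<le> norm (C *\<^sub>R indicat_real (cball 0 R) x) * norm (indicat_real {..R} y)" for x y
    proof (cases "(x, y) \<in> K")
      case True
      have "norm x \<le> R" "\<bar>y\<bar> \<le> R"
        using R[OF True] norm_fst_le[of x y] norm_snd_le[of y x] by auto
      then show ?thesis using C[of "(x, y)"] C0 by simp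
    qed (use K(2) in simp)
  qed (rule g)
qed

text \<open>Function and gradient as one vector-valued map: weighted H1 convergence becomes L2
  convergence of a single map, and a pair of a function and a weak gradient is simply a limit of
  jets.\<close>

definition jet :: "('a::euclidean_space \<Rightarrow> real) \<Rightarrow> 'a \<Rightarrow> real \<times> 'a" where
  "jet f = (\<lambda>p. (f p, cgrad f p))"

lemma borel_measurable_jet: "smooth_fun f \<Longrightarrow> jet f \<in> borel_measurable borel"
  unfolding jet_def
  by (intro borel_measurable_continuous_onI continuous_intros smooth_continuous smooth_continuous_cgrad)

lemma sq_int_jet_MC:
  fixes \<psi> :: "(real^'n) \<times> real \<Rightarrow> real"
  assumes \<Omega>: "\<Omega> \<in> sets borel" and \<alpha>: "\<alpha> > -1" and \<psi>: "test_fn U \<psi>"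
  shows "sq_int (MC \<Omega> \<alpha>) (jet \<psi>)" "sq_int (MC \<Omega> \<alpha>) \<psi>" "sq_int (MC \<Omega> \<alpha>) (cgrad \<psi>)"
proof -
  obtain K where K: "compact K" "K \<subseteq> U" "\<And>x. x \<notin> K \<Longrightarrow> \<psi> x = 0 \<and> cgrad \<psi> x = 0"
    using test_fn_support[OF \<psi>] by blast
  note sm = test_fn_smooth[OF \<psi>]
  have c: "continuous_on UNIV (jet \<psi>)"
    unfolding jet_def by (intro continuous_intros smooth_continuous smooth_continuous_cgrad sm)
  have z: "\<And>x. x \<notin> K \<Longrightarrow> jet \<psi> x = 0" using K by (simp add: jet_def zero_prod_def)
  obtain C where C: "\<And>p. norm (jet \<psi> p) \<le> C" by (rule bounded_compact_support[OF c K(1) z]) blast+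
  show 1: "sq_int (MC \<Omega> \<alpha>) (jet \<psi>)"
    by (rule sq_int_MC_compact_support[OF \<Omega> \<alpha> borel_measurable_jet[OF sm] C compact_imp_bounded[OF K(1)] z])
  show "sq_int (MC \<Omega> \<alpha>) \<psi>" "sq_int (MC \<Omega> \<alpha>) (cgrad \<psi>)"
    using smooth_continuous[OF sm, of UNIV] smooth_continuous_cgrad[OF sm, of UNIV]
    by (auto intro!: sq_int_bound(1)[OF 1, where K = 1] borel_measurable_continuous_onI AE_I2
         simp: jet_def norm_Pair real_le_rsqrt)
qed

lemma norm_le_jet: "norm (f p) \<le> norm (jet f p)" "norm (cgrad f p) \<le> norm (jet f p)"
  unfolding jet_def by (rule norm_fst_le norm_snd_le)+

lemma L2_iff_sq_int: "\<Omega> \<in> sets borel \<Longrightarrow> L2 \<Omega> f \<longleftrightarrow> sq_int (MO \<Omega>) f"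
  unfolding L2_def sq_int_def by (auto simp: set_nn_MO)

text \<open>\<open>trace_1d\<close> on every vertical line, integrated over the base. The factor
  \<open>e\<close> of the jet is prescribed and \<open>C\<close> depends on it.\<close>

lemma trace_inequality:
  fixes \<Omega> :: "(real^'n) set"
  assumes \<Omega>: "\<Omega> \<in> sets borel" and s: "0 < s" "s < 1" and e: "e > 0"
  obtains C where "C \<ge> 0" "\<And>\<psi>. test_fn (\<Omega> \<times> UNIV) \<psi> \<Longrightarrow> sq_int (MO \<Omega>) (\<lambda>x. \<psi> (x, 0)) \<and>
      (l2n (MO \<Omega>) (\<lambda>x. \<psi> (x, 0)))\<^sup>2 \<le> C * (l2n (MC \<Omega> (1 - 2 * s)) \<psi>)\<^sup>2 + e * (l2n (MC \<Omega> (1 - 2 * s)) (jet \<psi>))\<^sup>2"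
proof -
  \<comment> \<open>Solves \<open>\<delta> powr (2 * s) / s = e\<close>, the factor of the
    derivative term in \<open>trace_1d\<close>.\<close>
  define \<delta> where "\<delta> = (e * s) powr (1 / (2 * s))"
  have \<delta>: "\<delta> > 0" using e s by (simp add: \<delta>_def)
  have de: "\<delta> powr (2 * s) / s = e" using e s by (simp add: \<delta>_def powr_powr)
  define C where "C = 2 * ((2 - 2 * s) / \<delta> powr (2 - 2 * s))"
  have C: "C \<ge> 0" using s by (simp add: C_def)
  let ?M = "MC \<Omega> (1 - 2 * s)"
  have main: "sq_int (MO \<Omega>) (\<lambda>x. \<psi> (x, 0)) \<and>
      (l2n (MO \<Omega>) (\<lambda>x. \<psi> (x, 0)))\<^sup>2 \<le> C * (l2n ?M \<psi>)\<^sup>2 + e * (l2n ?M (jet \<psi>))\<^sup>2"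
    if \<psi>: "test_fn (\<Omega> \<times> UNIV) \<psi>" for \<psi>
  proof -
    note sm = test_fn_smooth[OF \<psi>]
    note [measurable] = borel_measurable_continuous_onI[OF smooth_continuous[OF sm]]
      borel_measurable_continuous_onI[OF smooth_continuous_cgrad[OF sm]]
    have a: "1 - 2 * s > -1" using s by simp
    note si = sq_int_jet_MC[OF \<Omega> a \<psi>]
    have sq0: "sq_int (MO \<Omega>) (\<lambda>x. \<psi> (x, 0))"
      by (rule sq_int_MO_lborel[OF \<Omega> test_fn_sq_int(1)[OF test_fn_slice[OF \<psi>]]])
    have "ennreal ((l2n (MO \<Omega>) (\<lambda>x. \<psi> (x, 0)))\<^sup>2) = (\<integral>\<^sup>+x. ennreal ((\<psi> (x, 0))\<^sup>2) \<partial>MO \<Omega>)"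
      using nn_integral_sq_eq[OF sq0] by simp
    also have "\<dots> \<le> (\<integral>\<^sup>+x. ennreal C * (\<integral>\<^sup>+y. ennreal ((\<psi> (x, y))\<^sup>2) \<partial>MY (1 - 2 * s))
        + ennreal e * (\<integral>\<^sup>+y. ennreal ((snd (cgrad \<psi> (x, y)))\<^sup>2) \<partial>MY (1 - 2 * s)) \<partial>MO \<Omega>)"
      unfolding C_def de[symmetric]
    proof (intro nn_integral_mono trace_1d[OF s \<delta>] DERIV_slice[OF sm])
      fix x show "continuous_on UNIV (\<lambda>y. snd (cgrad \<psi> (x, y)))"
        by (intro continuous_intros continuous_on_compose2[OF smooth_continuous_cgrad[OF sm, of UNIV]]) auto
    qed
    also have "\<dots> = ennreal C * (\<integral>\<^sup>+p. ennreal ((\<psi> p)\<^sup>2) \<partial>?M) + ennreal e * (\<integral>\<^sup>+p. ennreal ((snd (cgrad \<psi> p))\<^sup>2) \<partial>?M)"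
    proof -
      interpret pair_sigma_finite "MO \<Omega>" "MY (1 - 2 * s)" by (rule pair_sigma_finite_MO_MY[OF \<Omega>])
      have [measurable]: "(\<lambda>x. \<integral>\<^sup>+y. ennreal ((\<psi> (x, y))\<^sup>2) \<partial>MY (1 - 2 * s)) \<in> borel_measurable borel"
        "(\<lambda>x. \<integral>\<^sup>+y. ennreal ((snd (cgrad \<psi> (x, y)))\<^sup>2) \<partial>MY (1 - 2 * s)) \<in> borel_measurable borel"
        by measurable
      show ?thesis
        by (subst nn_integral_add) (auto simp: nn_integral_cmult nn_integral_MC_fst[OF \<Omega>])
    qed
    also have "\<dots> \<le> ennreal C * ennreal ((l2n ?M \<psi>)\<^sup>2) + ennreal e * ennreal ((l2n ?M (jet \<psi>))\<^sup>2)"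
    proof (intro add_mono mult_left_mono)
      show "(\<integral>\<^sup>+p. ennreal ((\<psi> p)\<^sup>2) \<partial>?M) \<le> ennreal ((l2n ?M \<psi>)\<^sup>2)"
        using nn_integral_sq_eq[OF si(2)] by simp
      have "(\<integral>\<^sup>+p. ennreal ((snd (cgrad \<psi> p))\<^sup>2) \<partial>?M) \<le> (\<integral>\<^sup>+p. ennreal ((norm (jet \<psi> p))\<^sup>2) \<partial>?M)"
      proof (intro nn_integral_mono ennreal_leI)
        fix p
        have "\<bar>snd (cgrad \<psi> p)\<bar> \<le> norm (cgrad \<psi> p)"
          using norm_snd_le[of "snd (cgrad \<psi> p)" "fst (cgrad \<psi> p)"] by simp
        also have "\<dots> \<le> norm (jet \<psi> p)" by (rule norm_le_jet)
        finally show "(snd (cgrad \<psi> p))\<^sup>2 \<le> (norm (jet \<psi> p))\<^sup>2" by (rule abs_le_square_iff[THEN iffD1, of _ "norm _", simplified])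
      qed
      then show "(\<integral>\<^sup>+p. ennreal ((snd (cgrad \<psi> p))\<^sup>2) \<partial>?M) \<le> ennreal ((l2n ?M (jet \<psi>))\<^sup>2)"
        by (simp add: nn_integral_sq_eq[OF si(1)])
    qed auto
    also have "\<dots> = ennreal (C * (l2n ?M \<psi>)\<^sup>2 + e * (l2n ?M (jet \<psi>))\<^sup>2)"
      using C e by (simp add: ennreal_mult)
    finally have "(l2n (MO \<Omega>) (\<lambda>x. \<psi> (x, 0)))\<^sup>2 \<le> C * (l2n ?M \<psi>)\<^sup>2 + e * (l2n ?M (jet \<psi>))\<^sup>2"
      using C e by (subst (asm) ennreal_le_iff) auto
    with sq0 show ?thesis by blast
  qed
  show ?thesis by (rule that[OF C main])
qed

subsection \<open>Limits of smooth functions on the cylinder\<close>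

lemma norm_fst_snd_le:
  fixes p :: "'a::real_normed_vector \<times> 'b::real_normed_vector" and q :: "real \<times> 'b"
  shows "norm (fst p) \<le> norm p" "norm (snd p) \<le> norm p" "\<bar>fst q\<bar> \<le> norm q"
  using norm_fst_le[of "fst p" "snd p"] norm_snd_le[of "snd p" "fst p"] norm_fst_le[of "fst q" "snd q"]
  by auto

lemma sq_int_fst_snd:
  fixes F :: "'a \<Rightarrow> 'b::{real_normed_vector, second_countable_topology} \<times> 'c::{real_normed_vector, second_countable_topology}"
  assumes F: "sq_int M F"
  shows "sq_int M (\<lambda>x. fst (F x))" "l2n M (\<lambda>x. fst (F x)) \<le> l2n M F"
    "sq_int M (\<lambda>x. snd (F x))" "l2n M (\<lambda>x. snd (F x)) \<le> l2n M F"
proof -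
  have m: "(\<lambda>x. fst (F x)) \<in> borel_measurable M" "(\<lambda>x. snd (F x)) \<in> borel_measurable M"
    using F by (auto simp: sq_int_def intro: measurable_compose[OF _ borel_measurable_fst_snd(1)]
        measurable_compose[OF _ borel_measurable_fst_snd(2)])
  have b: "AE x in M. norm (fst (F x)) \<le> 1 * norm (F x)" "AE x in M. norm (snd (F x)) \<le> 1 * norm (F x)"
    by (simp_all add: norm_fst_snd_le)
  show "sq_int M (\<lambda>x. fst (F x))" "l2n M (\<lambda>x. fst (F x)) \<le> l2n M F"
    using sq_int_bound[OF F m(1) _ b(1)] by simp_all
  show "sq_int M (\<lambda>x. snd (F x))" "l2n M (\<lambda>x. snd (F x)) \<le> l2n M F"
    using sq_int_bound[OF F m(2) _ b(2)] by simp_all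
qed

lemma l2_inner:
  fixes F H :: "'a \<Rightarrow> 'b::euclidean_space"
  assumes F: "sq_int M F" and H: "sq_int M H"
  shows "integrable M (\<lambda>x. F x \<bullet> H x)" "\<bar>\<integral>x. F x \<bullet> H x \<partial>M\<bar> \<le> l2n M F * l2n M H"
proof -
  have m: "(\<lambda>x. F x \<bullet> H x) \<in> borel_measurable M"
    using F H by (auto simp: sq_int_def)
  have b: "AE x in M. norm (F x \<bullet> H x) \<le> 1 * (norm (F x) * norm (H x))"
    using Cauchy_Schwarz_ineq2 by auto
  show "integrable M (\<lambda>x. F x \<bullet> H x)" "\<bar>\<integral>x. F x \<bullet> H x \<partial>M\<bar> \<le> l2n M F * l2n M H"
    using integrable_prod_bound[OF F H m _ b] by auto
qed

lemma l2_inner_conv: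
  fixes F H :: "'a \<Rightarrow> 'b::euclidean_space"
  assumes F: "sq_int M F" and H: "sq_int M H" and f: "\<And>j. sq_int M (f j)"
    and lim: "(\<lambda>j. l2n M (\<lambda>x. F x - f j x)) \<longlonglongrightarrow> 0"
  shows "(\<lambda>j. \<integral>x. f j x \<bullet> H x \<partial>M) \<longlonglongrightarrow> (\<integral>x. F x \<bullet> H x \<partial>M)"
proof (rule LIM_zero_cancel, rule Lim_null_comparison)
  show "(\<lambda>j. l2n M (\<lambda>x. F x - f j x) * l2n M H) \<longlonglongrightarrow> 0"
    by (rule tendsto_mult_left_zero[OF lim])
  show "\<forall>\<^sub>F j in sequentially. norm ((\<integral>x. f j x \<bullet> H x \<partial>M) - (\<integral>x. F x \<bullet> H x \<partial>M))
      \<le> l2n M (\<lambda>x. F x - f j x) * l2n M H"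
  proof (rule always_eventually, rule allI)
    fix j
    have "(\<integral>x. (F x - f j x) \<bullet> H x \<partial>M) = (\<integral>x. F x \<bullet> H x \<partial>M) - (\<integral>x. f j x \<bullet> H x \<partial>M)"
      unfolding inner_diff_left
      by (rule Bochner_Integration.integral_diff) (intro l2_inner F H f)+
    with l2_inner(2)[OF sq_int_diff(1)[OF F f[of j]] H]
    show "norm ((\<integral>x. f j x \<bullet> H x \<partial>M) - (\<integral>x. F x \<bullet> H x \<partial>M))
      \<le> l2n M (\<lambda>x. F x - f j x) * l2n M H" by (simp add: abs_minus_commute)
  qed
qed

text \<open>A Riesz-type statement without completeness: a bounded functional is represented in the limit by
  a minimizing sequence of the quadratic functional.\<close>

lemma minimizing_sequence:
  fixes b :: "'f \<Rightarrow> 'f \<Rightarrow> real" and l :: "'f \<Rightarrow> real" and comb :: "'f \<Rightarrow> real \<Rightarrow> 'f \<Rightarrow> 'f"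
  assumes z: "P z" and closed: "\<And>f r g. P f \<Longrightarrow> P g \<Longrightarrow> P (comb f r g)"
    and lin: "\<And>f r g h. P f \<Longrightarrow> P g \<Longrightarrow> P h \<Longrightarrow> b (comb f r g) h = b f h + r * b g h"
    and llin: "\<And>f r g. P f \<Longrightarrow> P g \<Longrightarrow> l (comb f r g) = l f + r * l g"
    and sym: "\<And>f g. P f \<Longrightarrow> P g \<Longrightarrow> b f g = b g f"
    and pos: "\<And>f. P f \<Longrightarrow> b f f \<ge> 0"
    and bd: "\<And>f. P f \<Longrightarrow> \<bar>l f\<bar> \<le> C * sqrt (b f f)"
  obtains u where "\<And>j::nat. P (u j)"
    "\<And>e. e > 0 \<Longrightarrow> \<exists>N. \<forall>i\<ge>N. \<forall>j\<ge>N. b (comb (u i) (-1) (u j)) (comb (u i) (-1) (u j)) < e"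
    "\<And>g. P g \<Longrightarrow> (\<lambda>j. b (u j) g) \<longlonglongrightarrow> l g"
proof -
  \<comment> \<open>Twice the usual energy: its stationary points satisfy
    \<open>b f g = l g\<close>, and completing the square bounds it below by -C^2.\<close>
  define I where "I f = b f f - 2 * l f" for f
  have lower: "I f \<ge> - C\<^sup>2" if "P f" for f
  proof -
    have "(sqrt (b f f))\<^sup>2 = b f f" using pos[OF that] by simp
    moreover have "0 \<le> (sqrt (b f f) - C)\<^sup>2" by simp
    ultimately have "2 * (C * sqrt (b f f)) \<le> b f f + C\<^sup>2"
      by (simp add: power2_diff algebra_simps)
    then show ?thesis using bd[OF that] unfolding I_def by linarith
  qed
  define m where "m = Inf (I ` {f. P f})"
  have bdd: "bdd_below (I ` {f. P f})" using lower by (auto intro!: bdd_belowI)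
  have m: "m \<le> I f" if "P f" for f
    unfolding m_def using that bdd by (intro cInf_lower) auto
  have "\<exists>f. P f \<and> I f < m + inverse (real (Suc j))" for j
  proof -
    have "Inf (I ` {f. P f}) < m + inverse (real (Suc j))" by (simp add: m_def)
    then obtain y where "y \<in> I ` {f. P f}" "y < m + inverse (real (Suc j))"
      using cInf_lessD[of "I ` {f. P f}"] z by blast
    then show ?thesis by auto
  qed
  then obtain u where u: "\<And>j. P (u j)" "\<And>j. I (u j) < m + inverse (real (Suc j))" by metis
  define \<epsilon> where "\<epsilon> j = inverse (real (Suc j))" for j
  have \<epsilon>: "\<epsilon> \<longlonglongrightarrow> 0" unfolding \<epsilon>_def by (rule LIMSEQ_inverse_real_of_nat)
  have \<epsilon>pos: "\<epsilon> j > 0" for j by (simp add: \<epsilon>_def)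
  have D: "(b (u j) g - l g)\<^sup>2 \<le> \<epsilon> j * b g g" if g: "P g" for j g
  proof -
    define d where "d = b (u j) g - l g"
    \<comment> \<open>Near-minimality on the line through \<open>u j\<close> in direction
      \<open>g\<close>: for no r can the functional drop by more than
      \<open>\<epsilon> j\<close>.\<close>
    have *: "- 2 * r * d - r\<^sup>2 * b g g \<le> \<epsilon> j" for r
    proof -
      have c: "P (comb (u j) r g)" by (intro closed u g)
      have "b (comb (u j) r g) (comb (u j) r g) = b (u j) (u j) + 2 * r * b (u j) g + r\<^sup>2 * b g g"
        using lin[OF u(1)[of j] g c, of r] lin[OF u(1)[of j] g u(1)[of j], of r]
          lin[OF u(1)[of j] g g, of r] sym[OF u(1)[of j] c] sym[OF g c] sym[OF u(1)[of j] g]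
        by (simp add: power2_eq_square algebra_simps)
      then have "I (comb (u j) r g) = I (u j) + 2 * r * d + r\<^sup>2 * b g g"
        using llin[OF u(1)[of j] g, of r] by (simp add: I_def d_def algebra_simps)
      then show ?thesis using m[OF c] u(2)[of j] by (simp add: \<epsilon>_def)
    qed
    show ?thesis
    proof (cases "b g g = 0")
      case True
      have "d = 0"
      proof (rule ccontr)
        assume "d \<noteq> 0"
        \<comment> \<open>Without a quadratic term the choice r = - \<epsilon> / d would give 2
          \<epsilon> <= \<epsilon>.\<close>
        then show False using *[of "- \<epsilon> j / d"] \<epsilon>pos[of j] True by simp
      qed
      then show ?thesis using True by (simp add: d_def)
    next
      case False
      then have p: "b g g > 0" using pos[OF g] by simp
      \<comment> \<open>This r maximizes the left-hand side.\<close>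
      from *[of "- d / b g g"] p have "d\<^sup>2 / b g g \<le> \<epsilon> j"
        by (simp add: power2_eq_square field_simps)
      then show ?thesis using p by (simp add: d_def field_simps)
    qed
  qed
  have D': "\<bar>b (u j) g - l g\<bar> \<le> sqrt (\<epsilon> j) * sqrt (b g g)" if "P g" for j g
    using real_sqrt_le_mono[OF D[OF that, of j]] by (simp add: real_sqrt_mult)
  show ?thesis
  proof (rule that[of u])
    show "P (u j)" for j by (rule u)
    show "(\<lambda>j. b (u j) g) \<longlonglongrightarrow> l g" if "P g" for g
    proof (rule LIM_zero_cancel, rule Lim_null_comparison[OF always_eventually])
      show "\<forall>j. norm (b (u j) g - l g) \<le> sqrt (\<epsilon> j) * sqrt (b g g)" using D'[OF that] by simp
      show "(\<lambda>j. sqrt (\<epsilon> j) * sqrt (b g g)) \<longlonglongrightarrow> 0"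
        using tendsto_mult_left_zero[OF tendsto_real_sqrt[OF \<epsilon>, simplified]] .
    qed
    fix e :: real assume e: "e > 0"
    have "\<forall>\<^sub>F j in sequentially. \<epsilon> j < e / 4" using order_tendstoD(2)[OF \<epsilon>, of "e/4"] e by simp
    then obtain N where N: "\<And>j. j \<ge> N \<Longrightarrow> \<epsilon> j < e / 4" by (auto simp: eventually_sequentially)
    have "b (comb (u i) (-1) (u j)) (comb (u i) (-1) (u j)) < e" if ij: "i \<ge> N" "j \<ge> N" for i j
    proof -
      define w where "w = comb (u i) (-1) (u j)"
      have w: "P w" unfolding w_def by (intro closed u)
      \<comment> \<open>The first variations at both near-minimizers are tested with their own
        difference: \<open>l w\<close> cancels, and one factor sqrt (b w w) can then be divided out.
        The threshold e / 4 fits because 2 * sqrt (e / 4) = sqrt e.\<close>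
      have "b w w = (b (u i) w - l w) - (b (u j) w - l w)"
        using lin[OF u(1)[of i] u(1)[of j] w, of "-1"] by (simp add: w_def)
      also have "\<dots> \<le> (sqrt (\<epsilon> i) + sqrt (\<epsilon> j)) * sqrt (b w w)"
        using D'[OF w, of i] D'[OF w, of j] by (simp add: distrib_right)
      finally have "sqrt (b w w) * sqrt (b w w) \<le> (sqrt (\<epsilon> i) + sqrt (\<epsilon> j)) * sqrt (b w w)"
        using pos[OF w] by simp
      then have "sqrt (b w w) \<le> sqrt (\<epsilon> i) + sqrt (\<epsilon> j)"
      proof (cases "b w w = 0")
        case True
        then show ?thesis using \<epsilon>pos[of i] \<epsilon>pos[of j] by (simp add: add_nonneg_nonneg less_imp_le)
      next
        case False
        then have "0 < sqrt (b w w)" using pos[OF w] by simp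
        then show ?thesis
          using \<open>sqrt (b w w) * sqrt (b w w) \<le> _\<close> mult_le_cancel_right_pos by blast
      qed
      also have "\<dots> < sqrt (e / 4) + sqrt (e / 4)"
        using N[OF ij(1)] N[OF ij(2)] by (intro add_strict_mono real_sqrt_less_mono)
      also have "\<dots> = sqrt e" using real_sqrt_divide[of e 4] by simp
      finally show ?thesis by (simp add: w_def)
    qed
    then show "\<exists>N. \<forall>i\<ge>N. \<forall>j\<ge>N. b (comb (u i) (-1) (u j)) (comb (u i) (-1) (u j)) < e" by blast
  qed
qed

section \<open>Weighted Sobolev convergence expressed through jets\<close>

lemma wconv_iff:
  fixes \<Omega> :: "(real^'n) set"
  assumes \<Omega>[measurable]: "\<Omega> \<in> sets borel" and s: "0 < s" "s < 1"
    and [measurable]: "w \<in> borel_measurable borel" "G \<in> borel_measurable borel"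
    and \<psi>: "\<And>j. lat_test \<Omega> (\<psi> j)"
  shows "wconv \<Omega> (1 - 2 * s) w G \<psi> \<longleftrightarrow> sq_int (MC \<Omega> (1 - 2 * s)) (\<lambda>p. (w p, G p)) \<and>
      (\<lambda>j. l2n (MC \<Omega> (1 - 2 * s)) (\<lambda>p. (w p, G p) - jet (\<psi> j) p)) \<longlonglongrightarrow> 0"
proof -
  let ?M = "MC \<Omega> (1 - 2 * s)"
  have a: "1 - 2 * s > -1" using s by simp
  have si: "sq_int ?M (jet (\<psi> j))" for j
    using sq_int_jet_MC(1)[OF \<Omega> a \<psi>[of j, unfolded lat_test_def]] .
  note [measurable] = si[THEN sq_int_measurable, simplified]
  have [measurable]: "\<psi> j \<in> borel_measurable borel" "cgrad (\<psi> j) \<in> borel_measurable borel" for j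
    using \<psi>[of j] test_fn_smooth
    by (auto simp: lat_test_def intro!: borel_measurable_continuous_onI smooth_continuous smooth_continuous_cgrad)
  have eq: "(w p - \<psi> j p)\<^sup>2 + (norm (G p - cgrad (\<psi> j) p))\<^sup>2 = (norm ((w p, G p) - jet (\<psi> j) p))\<^sup>2" for j p
    by (simp add: jet_def norm_Pair)
  have "wconv \<Omega> (1 - 2 * s) w G \<psi> \<longleftrightarrow> (\<lambda>j. \<integral>\<^sup>+p. ennreal ((norm ((w p, G p) - jet (\<psi> j) p))\<^sup>2) \<partial>?M) \<longlonglongrightarrow> 0"
    unfolding wconv_def eq by (subst set_nn_MC) auto
  also have "\<dots> \<longleftrightarrow> sq_int ?M (\<lambda>p. (w p, G p)) \<and> (\<lambda>j. l2n ?M (\<lambda>p. (w p, G p) - jet (\<psi> j) p)) \<longlonglongrightarrow> 0"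
  proof
    assume L: "(\<lambda>j. \<integral>\<^sup>+p. ennreal ((norm ((w p, G p) - jet (\<psi> j) p))\<^sup>2) \<partial>?M) \<longlonglongrightarrow> 0"
    have "(\<lambda>p. (w p, G p)) \<in> borel_measurable ?M" by simp
    from sq_int_of_close[OF si this L] show "sq_int ?M (\<lambda>p. (w p, G p)) \<and>
        (\<lambda>j. l2n ?M (\<lambda>p. (w p, G p) - jet (\<psi> j) p)) \<longlonglongrightarrow> 0" by blast
  next
    assume *: "sq_int ?M (\<lambda>p. (w p, G p)) \<and> (\<lambda>j. l2n ?M (\<lambda>p. (w p, G p) - jet (\<psi> j) p)) \<longlonglongrightarrow> 0"
    then have "sq_int ?M (\<lambda>p. (w p, G p) - jet (\<psi> j) p)" for j by (intro sq_int_diff si) simp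
    from l2n_conv_nn_integral[of ?M "\<lambda>j p. (w p, G p) - jet (\<psi> j) p", OF this] *
    show "(\<lambda>j. \<integral>\<^sup>+p. ennreal ((norm ((w p, G p) - jet (\<psi> j) p))\<^sup>2) \<partial>?M) \<longlonglongrightarrow> 0" by blast
  qed
  finally show ?thesis .
qed

text \<open>A compact subset of the open cylinder keeps a positive distance from y = 0, so the
  inverse weight is bounded on it.\<close>

lemma cyl_compact_weight:
  fixes \<Omega> :: "(real^'n) set" and g :: "(real^'n) \<times> real \<Rightarrow> 'b::euclidean_space"
  assumes \<Omega>: "\<Omega> \<in> sets borel" and \<alpha>: "\<alpha> > -1" and K: "compact K" "K \<subseteq> cyl \<Omega>"
    and g: "g \<in> borel_measurable borel" "\<And>p. norm (g p) \<le> C" "\<And>p. p \<notin> K \<Longrightarrow> g p = 0"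
  shows "sq_int (MC \<Omega> \<alpha>) (\<lambda>p. (snd p powr - \<alpha>) *\<^sub>R g p)"
proof -
  have "continuous_on K (\<lambda>p. snd p powr - \<alpha>)"
    using K by (intro continuous_intros) (auto simp: cyl_def)
  then have "bounded ((\<lambda>p. snd p powr - \<alpha>) ` K)"
    using K by (intro compact_imp_bounded compact_continuous_image)
  then obtain B where B: "\<And>p. p \<in> K \<Longrightarrow> \<bar>snd p powr - \<alpha>\<bar> \<le> B" by (auto simp: bounded_iff)
  have C: "C \<ge> 0" using g(2)[of undefined] norm_ge_zero order_trans by blast
  show ?thesis
  proof (rule sq_int_MC_compact_support[OF \<Omega> \<alpha>, where C = "\<bar>B\<bar> * C"])
    show "norm ((snd p powr - \<alpha>) *\<^sub>R g p) \<le> \<bar>B\<bar> * C" for p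
    proof (cases "p \<in> K")
      case True
      show ?thesis unfolding norm_scaleR
        by (intro mult_mono g) (use B[OF True] in auto)
    qed (use C g(3) in simp)
    show "bounded K" by (rule compact_imp_bounded[OF K(1)])
  qed (use g in auto)
qed

text \<open>For a fixed test function the weak gradient identity is the vanishing of a pairing with
  one square integrable field. It holds for jets of smooth functions and survives L2 limits.\<close>

lemma jet_limit_HL:
  fixes \<Omega> :: "(real^'n) set"
  assumes \<Omega>: "open \<Omega>" and s: "0 < s" "s < 1"
    and \<psi>: "\<And>j. lat_test \<Omega> (\<psi> j)"
    and F: "sq_int (MC \<Omega> (1 - 2 * s)) F"
    and lim: "(\<lambda>j. l2n (MC \<Omega> (1 - 2 * s)) (\<lambda>p. F p - jet (\<psi> j) p)) \<longlonglongrightarrow> 0"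
  shows "HL \<Omega> (1 - 2 * s) (\<lambda>p. fst (F p)) (\<lambda>p. snd (F p))"
proof -
  let ?\<alpha> = "1 - 2 * s"
  let ?M = "MC \<Omega> ?\<alpha>"
  have \<Omega>m[measurable]: "\<Omega> \<in> sets borel" using \<Omega> by simp
  have a: "?\<alpha> > -1" using s by simp
  have Fm[measurable]: "F \<in> borel_measurable borel" using F by (simp add: sq_int_def)
  have si: "sq_int ?M (jet (\<psi> j))" for j
    using sq_int_jet_MC(1)[OF \<Omega>m a \<psi>[of j, unfolded lat_test_def]] .
  have sm: "smooth_fun (\<psi> j)" for j using \<psi>[of j] by (simp add: lat_test_def test_fn_def)
  have oc: "open (cyl \<Omega>)" unfolding cyl_def by (intro open_Times \<Omega>) auto
  have cm: "cyl \<Omega> \<in> sets borel" by (rule cyl_measurable[OF \<Omega>m])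
  have wc: "wconv \<Omega> ?\<alpha> (\<lambda>p. fst (F p)) (\<lambda>p. snd (F p)) \<psi>"
    by (subst wconv_iff[OF \<Omega>m s _ _ \<psi>]) (use F lim in auto)
  have "weak_gradient (cyl \<Omega>) (\<lambda>p. fst (F p)) (\<lambda>p. snd (F p))"
    unfolding weak_gradient_def
  proof (intro conjI allI impI ballI)
    fix K assume K: "compact K \<and> K \<subseteq> cyl \<Omega>"
    then have Km[measurable]: "K \<in> sets borel" by (simp add: compact_imp_closed)
    have sK: "sq_int ?M (\<lambda>p. (snd p powr - ?\<alpha>) *\<^sub>R indicat_real K p)"
      by (rule cyl_compact_weight[OF \<Omega>m a, where K = K and C = 1]) (use K in \<open>auto simp: indicator_def\<close>)
    \<comment> \<open>From weighted square integrability to unweighted integrability on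
      \<open>K\<close>: Cauchy-Schwarz against the inverse weight cut off to
      \<open>K\<close>.\<close>
    have *: "set_integrable lborel K f" if f[measurable]: "f \<in> borel_measurable borel"
       and b: "\<And>p. norm (f p) \<le> norm (F p)" for f :: "_ \<Rightarrow> 'z::euclidean_space"
    proof -
      have "integrable ?M (\<lambda>p. (snd p powr - ?\<alpha>) *\<^sub>R (indicat_real K p *\<^sub>R f p))"
      proof (rule integrable_prod_bound(1)[OF F sK, where K = 1])
        show "AE p in ?M. norm ((snd p powr - ?\<alpha>) *\<^sub>R (indicat_real K p *\<^sub>R f p))
            \<le> 1 * (norm (F p) * norm ((snd p powr - ?\<alpha>) *\<^sub>R indicat_real K p))"
          using b by (auto simp: indicator_def mult.commute intro!: AE_I2 mult_right_mono)
      qed auto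
      then have "set_integrable lborel (cyl \<Omega>) (\<lambda>p. indicat_real K p *\<^sub>R f p)"
        by (subst MC_unweight(2)[OF \<Omega>m, where \<alpha> = ?\<alpha>]) auto
      moreover have "(\<lambda>p. indicat_real (cyl \<Omega>) p *\<^sub>R (indicat_real K p *\<^sub>R f p)) = (\<lambda>p. indicat_real K p *\<^sub>R f p)"
        using K by (auto simp: indicator_def fun_eq_iff)
      ultimately show ?thesis unfolding set_integrable_def by (simp only:)
    qed
    show "set_integrable lborel K (\<lambda>p. fst (F p))"
      by (rule *) (auto simp: norm_fst_snd_le)
    show "set_integrable lborel K (\<lambda>p. snd (F p))"
      by (rule *) (auto simp: norm_fst_snd_le)
  next
    fix \<phi> :: "(real^'n) \<times> real \<Rightarrow> real" and i :: "(real^'n) \<times> real"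
    assume \<phi>: "test_fn (cyl \<Omega>) \<phi>" and i: "i \<in> Basis"
    note sp = test_fn_smooth[OF \<phi>]
    obtain K where K: "compact K" "K \<subseteq> cyl \<Omega>" "\<And>x. x \<notin> K \<Longrightarrow> \<phi> x = 0 \<and> cgrad \<phi> x = 0"
      using test_fn_support[OF \<phi>] by blast
    have p: "pderiv_dir \<phi> i x = cgrad \<phi> x \<bullet> i" for x
      using smooth_has_derivative[OF sp] by (rule pderiv_dir_eqI)
    \<comment> \<open>Pairing a pair (w, G) with \<open>h\<close> gives both sides of the weak
      gradient identity at once; \<open>H\<close> adds the inverse weight because that identity is
      unweighted.\<close>
    define h where "h p = (cgrad \<phi> p \<bullet> i, \<phi> p *\<^sub>R i)" for p
    define H where "H p = (snd p powr - ?\<alpha>) *\<^sub>R h p" for p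
    have hc: "continuous_on UNIV h" unfolding h_def
      by (intro continuous_intros smooth_continuous smooth_continuous_cgrad sp)
    have hz: "h x = 0" if "x \<notin> K" for x
    proof -
      have "h x = (0, 0)" using K(3)[OF that] by (simp add: h_def)
      then show ?thesis by (simp add: zero_prod_def)
    qed
    note [measurable] = borel_measurable_continuous_onI[OF hc]
    obtain C where C: "\<And>p. norm (h p) \<le> C" by (rule bounded_compact_support[OF hc K(1) hz]) blast+
    have H: "sq_int ?M H" unfolding H_def
      by (rule cyl_compact_weight[OF \<Omega>m a K(1,2) _ C hz]) auto
    have sums: "set_lebesgue_integral lborel (cyl \<Omega>) (\<lambda>x. fst (E x) * pderiv_dir \<phi> i x)
        + set_lebesgue_integral lborel (cyl \<Omega>) (\<lambda>x. (snd (E x) \<bullet> i) * \<phi> x) = (\<integral>p. E p \<bullet> H p \<partial>?M)"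
      if E: "sq_int ?M E" for E
    proof -
      have [measurable]: "E \<in> borel_measurable borel" using E by (simp add: sq_int_def)
      have [measurable]: "\<phi> \<in> borel_measurable borel" "cgrad \<phi> \<in> borel_measurable borel"
        by (intro borel_measurable_continuous_onI smooth_continuous smooth_continuous_cgrad sp)+
      have e1: "set_lebesgue_integral lborel (cyl \<Omega>) (\<lambda>x. fst (E x) * pderiv_dir \<phi> i x)
          = (\<integral>p. E p \<bullet> (fst (H p), 0) \<partial>?M)"
        unfolding p by (subst MC_unweight(1)[OF \<Omega>m, where \<alpha> = ?\<alpha>])
          (auto simp: H_def h_def inner_prod_def algebra_simps)
      have e2: "set_lebesgue_integral lborel (cyl \<Omega>) (\<lambda>x. (snd (E x) \<bullet> i) * \<phi> x)
          = (\<integral>p. E p \<bullet> (0, snd (H p)) \<partial>?M)"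
        by (subst MC_unweight(1)[OF \<Omega>m, where \<alpha> = ?\<alpha>])
          (auto simp: H_def h_def inner_prod_def algebra_simps)
      have [measurable]: "H \<in> borel_measurable borel" using H by (simp add: sq_int_def)
      have "sq_int ?M (\<lambda>p. (fst (H p), 0 :: (real^'n) \<times> real))" "sq_int ?M (\<lambda>p. (0::real, snd (H p)))"
        by (rule sq_int_bound(1)[OF H, where K = 1];
            simp add: norm_Pair norm_fst_snd_le measurable_M)+
      then have "(\<integral>p. E p \<bullet> (fst (H p), 0) \<partial>?M) + (\<integral>p. E p \<bullet> (0, snd (H p)) \<partial>?M)
          = (\<integral>p. E p \<bullet> (fst (H p), 0) + E p \<bullet> (0, snd (H p)) \<partial>?M)"
        by (intro Bochner_Integration.integral_add[symmetric] l2_inner(1)[OF E])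
      then show ?thesis unfolding e1 e2 by (simp add: inner_prod_def)
    qed
    have zero: "(\<integral>p. jet (\<psi> j) p \<bullet> H p \<partial>?M) = 0" for j
      using smooth_weak_gradient[OF sm[of j] oc] \<phi> i sums[OF si[of j]]
      unfolding weak_gradient_def jet_def by simp
    have "(\<lambda>j. \<integral>p. jet (\<psi> j) p \<bullet> H p \<partial>?M) \<longlonglongrightarrow> (\<integral>p. F p \<bullet> H p \<partial>?M)"
      by (rule l2_inner_conv[OF F H si lim])
    then have "(\<integral>p. F p \<bullet> H p \<partial>?M) = 0" by (simp add: zero LIMSEQ_const_iff)
    with sums[OF F] show "set_lebesgue_integral lborel (cyl \<Omega>) (\<lambda>x. fst (F x) * pderiv_dir \<phi> i x)
        = - set_lebesgue_integral lborel (cyl \<Omega>) (\<lambda>x. (snd (F x) \<bullet> i) * \<phi> x)" by simp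
  qed auto
  moreover have "set_nn_integral lborel (cyl \<Omega>)
       (\<lambda>p. ennreal (snd p powr ?\<alpha> * ((fst (F p))\<^sup>2 + (norm (snd (F p)))\<^sup>2))) < \<infinity>"
  proof (subst set_nn_MC[OF \<Omega>m])
    have "(fst (F p))\<^sup>2 + (norm (snd (F p)))\<^sup>2 = (norm (F p))\<^sup>2" for p
      by (cases "F p") (simp add: norm_Pair)
    with F show "(\<integral>\<^sup>+p. ennreal ((fst (F p))\<^sup>2 + (norm (snd (F p)))\<^sup>2) \<partial>?M) < \<infinity>"
      by (simp add: sq_int_def)
  qed auto
  ultimately show "HL \<Omega> ?\<alpha> (\<lambda>p. fst (F p)) (\<lambda>p. snd (F p))"
    unfolding HL_def H1w_def using wc \<psi> by auto
qed

section \<open>Existence and uniqueness of traces\<close>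

lemma jet_diff:
  assumes "smooth_fun f" "smooth_fun g"
  shows "jet (\<lambda>p. f p - g p) = (\<lambda>p. jet f p - jet g p)"
  using cgrad_add(2)[OF assms] by (simp add: jet_def)

text \<open>Plain continuity of the trace, for which the factor 1 is good enough. It makes traces of
  convergent sequences Cauchy and the load of the extended problem a bounded functional.\<close>

lemma trace_bound:
  fixes \<Omega> :: "(real^'n) set"
  assumes \<Omega>: "\<Omega> \<in> sets borel" and s: "0 < s" "s < 1"
  obtains C where "C \<ge> 0" "\<And>\<psi>. lat_test \<Omega> \<psi> \<Longrightarrow> l2n (MO \<Omega>) (\<lambda>x. \<psi> (x, 0)) \<le> C * l2n (MC \<Omega> (1 - 2 * s)) (jet \<psi>)"
proof -
  let ?M = "MC \<Omega> (1 - 2 * s)"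
  have a: "1 - 2 * s > -1" using s by simp
  obtain C where C: "C \<ge> 0" "\<And>\<psi>. test_fn (\<Omega> \<times> UNIV) \<psi> \<Longrightarrow> sq_int (MO \<Omega>) (\<lambda>x. \<psi> (x, 0)) \<and>
      (l2n (MO \<Omega>) (\<lambda>x. \<psi> (x, 0)))\<^sup>2 \<le> C * (l2n ?M \<psi>)\<^sup>2 + 1 * (l2n ?M (jet \<psi>))\<^sup>2"
    using trace_inequality[OF \<Omega> s zero_less_one] by blast
  have "l2n (MO \<Omega>) (\<lambda>x. \<psi> (x, 0)) \<le> sqrt (C + 1) * l2n ?M (jet \<psi>)" if "lat_test \<Omega> \<psi>" for \<psi>
  proof -
    have \<psi>: "test_fn (\<Omega> \<times> UNIV) \<psi>" using that by (simp add: lat_test_def)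
    have "l2n ?M \<psi> \<le> l2n ?M (jet \<psi>)"
      using sq_int_fst_snd(2)[OF sq_int_jet_MC(1)[OF \<Omega> a \<psi>]] by (simp add: jet_def)
    then have "C * (l2n ?M \<psi>)\<^sup>2 \<le> C * (l2n ?M (jet \<psi>))\<^sup>2"
      using C(1) by (intro mult_left_mono power_mono) auto
    with C(2)[OF \<psi>] have "(l2n (MO \<Omega>) (\<lambda>x. \<psi> (x, 0)))\<^sup>2 \<le> (C + 1) * (l2n ?M (jet \<psi>))\<^sup>2"
      by (simp add: distrib_right)
    from real_sqrt_le_mono[OF this] show ?thesis by (simp add: real_sqrt_mult)
  qed
  then show ?thesis using that[of "sqrt (C + 1)"] C(1) by simp
qed

lemma trace_Cauchy:
  fixes \<Omega> :: "(real^'n) set"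
  assumes \<Omega>: "\<Omega> \<in> sets borel" and s: "0 < s" "s < 1"
    and \<psi>: "\<And>j. lat_test \<Omega> (\<psi> j)" and F: "sq_int (MC \<Omega> (1 - 2 * s)) F"
    and lim: "(\<lambda>j. l2n (MC \<Omega> (1 - 2 * s)) (\<lambda>p. F p - jet (\<psi> j) p)) \<longlonglongrightarrow> 0"
  obtains t where "sq_int (MO \<Omega>) t" "(\<lambda>j. l2n (MO \<Omega>) (\<lambda>x. t x - \<psi> j (x, 0))) \<longlonglongrightarrow> 0"
proof -
  let ?M = "MC \<Omega> (1 - 2 * s)"
  have a: "1 - 2 * s > -1" using s by simp
  note \<psi>' = \<psi>[unfolded lat_test_def]
  have si: "sq_int ?M (jet (\<psi> j))" for j using sq_int_jet_MC(1)[OF \<Omega> a \<psi>'] .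
  have s0: "sq_int (MO \<Omega>) (\<lambda>x. \<psi> j (x, 0))" for j
    by (rule sq_int_MO_lborel[OF \<Omega> test_fn_sq_int(1)[OF test_fn_slice[OF \<psi>']]])
  obtain C where C: "C \<ge> 0" "\<And>\<psi>. lat_test \<Omega> \<psi> \<Longrightarrow> l2n (MO \<Omega>) (\<lambda>x. \<psi> (x, 0)) \<le> C * l2n ?M (jet \<psi>)"
    using trace_bound[OF \<Omega> s] by blast
  \<comment> \<open>\<open>C + 1\<close> rather than \<open>C\<close>, because the Cauchy threshold
    divides by this constant and \<open>C\<close> may be 0.\<close>
  have bd: "l2n (MO \<Omega>) (\<lambda>x. \<psi> i (x, 0) - \<psi> j (x, 0)) \<le> (C + 1) * l2n ?M (\<lambda>p. jet (\<psi> i) p - jet (\<psi> j) p)" for i j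
  proof -
    have "lat_test \<Omega> (\<lambda>p. \<psi> i p - \<psi> j p)"
      unfolding lat_test_def by (rule test_fn_diff[OF \<psi>' \<psi>'])
    from C(2)[OF this] have "l2n (MO \<Omega>) (\<lambda>x. \<psi> i (x, 0) - \<psi> j (x, 0)) \<le> C * l2n ?M (\<lambda>p. jet (\<psi> i) p - jet (\<psi> j) p)"
      by (simp add: jet_diff[OF test_fn_smooth[OF \<psi>'] test_fn_smooth[OF \<psi>']])
    then show ?thesis
      using l2n_nonneg[of ?M "\<lambda>p. jet (\<psi> i) p - jet (\<psi> j) p"] unfolding distrib_right by linarith
  qed
  have "\<exists>t. sq_int (MO \<Omega>) t \<and> (\<lambda>j. l2n (MO \<Omega>) (\<lambda>x. t x - \<psi> j (x, 0))) \<longlonglongrightarrow> 0"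
  proof (rule l2_complete)
    show "sq_int (MO \<Omega>) (\<lambda>x. \<psi> j (x, 0))" for j by (rule s0)
    fix e :: real assume e: "e > 0"
    define e' where "e' = e / 2 / (C + 1)"
    have c1: "C + 1 > 0" using C(1) by simp
    have e': "e' > 0" using e c1 by (simp add: e'_def)
    obtain N where N: "\<And>j. j \<ge> N \<Longrightarrow> l2n ?M (\<lambda>p. F p - jet (\<psi> j) p) < e'"
      using order_tendstoD(2)[OF lim e'] by (auto simp: eventually_sequentially)
    show "\<exists>N. \<forall>i\<ge>N. \<forall>j\<ge>N. l2n (MO \<Omega>) (\<lambda>x. \<psi> i (x, 0) - \<psi> j (x, 0)) < e"
    proof (intro exI allI impI)
      fix i j assume ij: "i \<ge> N" "j \<ge> N"
      have "l2n ?M (\<lambda>p. jet (\<psi> i) p - jet (\<psi> j) p) \<le>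
          l2n ?M (\<lambda>p. jet (\<psi> i) p - F p) + l2n ?M (\<lambda>p. F p - jet (\<psi> j) p)"
        by (rule l2n_diff_triangle[OF si F si])
      also have "\<dots> < 2 * e'"
        using N[OF ij(1)] N[OF ij(2)] by (simp add: l2n_minus_commute[of ?M "jet (\<psi> i)"])
      finally have "(C + 1) * l2n ?M (\<lambda>p. jet (\<psi> i) p - jet (\<psi> j) p) < (C + 1) * (2 * e')"
        using c1 by simp
      also have "\<dots> = 2 * (e' * (C + 1))" by (simp only: mult_ac)
      also have "e' * (C + 1) = e / 2" unfolding e'_def using c1 by (intro nonzero_eq_divide_eq[THEN iffD1]) auto
      also have "2 * (e / 2) = e" by simp
      finally show "l2n (MO \<Omega>) (\<lambda>x. \<psi> i (x, 0) - \<psi> j (x, 0)) < e" using bd[of i j] by linarith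
    qed
  qed
  then show ?thesis using that by blast
qed

text \<open>The gradients are merely bounded and need not tend to 0. This is where the small factor
  in \<open>trace_inequality\<close> pays: it absorbs the bound \<open>B\<close>, and convergence of
  the functions themselves does the rest.\<close>

lemma trace_vanishes:
  fixes \<Omega> :: "(real^'n) set"
  assumes \<Omega>: "\<Omega> \<in> sets borel" and s: "0 < s" "s < 1"
    and \<psi>: "\<And>j. lat_test \<Omega> (\<psi> j)"
    and lim: "(\<lambda>j. l2n (MC \<Omega> (1 - 2 * s)) (\<psi> j)) \<longlonglongrightarrow> 0"
    and bd: "\<And>j. l2n (MC \<Omega> (1 - 2 * s)) (jet (\<psi> j)) \<le> B"
  shows "(\<lambda>j. l2n (MO \<Omega>) (\<lambda>x. \<psi> j (x, 0))) \<longlonglongrightarrow> 0"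
proof -
  let ?M = "MC \<Omega> (1 - 2 * s)"
  have B: "B \<ge> 0" using bd[of 0] l2n_nonneg order_trans by blast
  have "(\<lambda>j. (l2n (MO \<Omega>) (\<lambda>x. \<psi> j (x, 0)))\<^sup>2) \<longlonglongrightarrow> 0"
  proof (rule LIMSEQ_I)
    fix e :: real assume e: "e > 0"
    \<comment> \<open>Fixed before \<open>C\<close> is obtained, since \<open>C\<close> depends on
      it; \<open>e' * B^2\<close> then stays below e / 2. The summand 1 guards against B =
      0.\<close>
    define e' where "e' = e / 2 / (B\<^sup>2 + 1)"
    have e': "e' > 0" using e by (simp add: e'_def add_nonneg_pos)
    obtain C where C: "C \<ge> 0" "\<And>\<psi>. test_fn (\<Omega> \<times> UNIV) \<psi> \<Longrightarrow> sq_int (MO \<Omega>) (\<lambda>x. \<psi> (x, 0)) \<and>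
      (l2n (MO \<Omega>) (\<lambda>x. \<psi> (x, 0)))\<^sup>2 \<le> C * (l2n ?M \<psi>)\<^sup>2 + e' * (l2n ?M (jet \<psi>))\<^sup>2"
      using trace_inequality[OF \<Omega> s e'] by blast
    have "(\<lambda>j. C * (l2n ?M (\<psi> j))\<^sup>2) \<longlonglongrightarrow> C * 0\<^sup>2"
      by (intro tendsto_intros lim)
    then obtain N where N: "\<And>j. j \<ge> N \<Longrightarrow> C * (l2n ?M (\<psi> j))\<^sup>2 < e / 2"
      using order_tendstoD(2)[of "\<lambda>j. C * (l2n ?M (\<psi> j))\<^sup>2" 0 sequentially "e / 2"] e
      by (auto simp: eventually_sequentially)
    have "norm ((l2n (MO \<Omega>) (\<lambda>x. \<psi> j (x, 0)))\<^sup>2 - 0) < e" if "j \<ge> N" for j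
    proof -
      have "e' * (l2n ?M (jet (\<psi> j)))\<^sup>2 \<le> e' * (B\<^sup>2 + 1)"
        using e' power_mono[OF bd[of j] l2n_nonneg, of 2] by (intro mult_left_mono) auto
      also have "\<dots> = e / 2"
      proof -
        have "B\<^sup>2 + 1 > 0" by (simp add: add_nonneg_pos)
        then show ?thesis using nonzero_eq_divide_eq[of "B\<^sup>2 + 1" e' "e / 2"] e'_def by simp
      qed
      finally show ?thesis using C(2)[OF \<psi>[of j, unfolded lat_test_def]] N[OF that] by simp
    qed
    then show "\<exists>N. \<forall>j\<ge>N. norm ((l2n (MO \<Omega>) (\<lambda>x. \<psi> j (x, 0)))\<^sup>2 - 0) < e" by blast
  qed
  from tendsto_real_sqrt[OF this] show ?thesis by simp
qed

text \<open>The gradients \<open>G\<close> and \<open>G'\<close> may be different, so the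
  differences of the two approximating sequences tend to 0 as functions while their jets are only
  bounded: exactly the situation of \<open>trace_vanishes\<close>.\<close>

lemma trace_unique:
  fixes \<Omega> :: "(real^'n) set"
  assumes \<Omega>: "\<Omega> \<in> sets borel" and s: "0 < s" "s < 1"
    and \<psi>: "\<And>j. lat_test \<Omega> (\<psi> j)" "\<And>j. lat_test \<Omega> (\<psi>' j)"
    and F: "sq_int (MC \<Omega> (1 - 2 * s)) (\<lambda>p. (w p, G p))" "sq_int (MC \<Omega> (1 - 2 * s)) (\<lambda>p. (w p, G' p))"
    and lim: "(\<lambda>j. l2n (MC \<Omega> (1 - 2 * s)) (\<lambda>p. (w p, G p) - jet (\<psi> j) p)) \<longlonglongrightarrow> 0"
    and lim': "(\<lambda>j. l2n (MC \<Omega> (1 - 2 * s)) (\<lambda>p. (w p, G' p) - jet (\<psi>' j) p)) \<longlonglongrightarrow> 0"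
    and t: "sq_int (MO \<Omega>) t" "(\<lambda>j. l2n (MO \<Omega>) (\<lambda>x. t x - \<psi>' j (x, 0))) \<longlonglongrightarrow> 0"
  shows "(\<lambda>j. l2n (MO \<Omega>) (\<lambda>x. t x - \<psi> j (x, 0))) \<longlonglongrightarrow> 0"
proof -
  let ?M = "MC \<Omega> (1 - 2 * s)"
  have a: "1 - 2 * s > -1" using s by simp
  note \<psi>t = \<psi>[unfolded lat_test_def]
  note si = sq_int_jet_MC[OF \<Omega> a \<psi>t(1)] and si' = sq_int_jet_MC[OF \<Omega> a \<psi>t(2)]
  define d where "d j p = \<psi>' j p - \<psi> j p" for j p
  have d: "test_fn (\<Omega> \<times> UNIV) (d j)" for j
    unfolding d_def by (rule test_fn_diff[OF \<psi>t(2) \<psi>t(1)])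
  have jd: "jet (d j) = (\<lambda>p. jet (\<psi>' j) p - jet (\<psi> j) p)" for j
    unfolding d_def by (rule jet_diff[OF test_fn_smooth[OF \<psi>t(2)] test_fn_smooth[OF \<psi>t(1)]])
  have wsq: "sq_int ?M w" using sq_int_fst_snd(1)[OF F(1)] by simp
  have near: "l2n ?M (\<lambda>p. w p - f p) \<le> l2n ?M (\<lambda>p. (w p, H p) - jet f p)"
    if "test_fn (\<Omega> \<times> UNIV) f" "sq_int ?M (\<lambda>p. (w p, H p))" for f H
    using sq_int_fst_snd(2)[OF sq_int_diff(1)[OF that(2) sq_int_jet_MC(1)[OF \<Omega> a that(1)]]]
    by (simp add: jet_def)
  have dl: "(\<lambda>j. l2n ?M (d j)) \<longlonglongrightarrow> 0"
  proof (rule tendsto_sandwich[OF always_eventually always_eventually tendsto_const tendsto_add_zero[OF lim' lim]], safe)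
    fix j
    have "l2n ?M (d j) \<le> l2n ?M (\<lambda>p. \<psi>' j p - w p) + l2n ?M (\<lambda>p. w p - \<psi> j p)"
      unfolding d_def by (rule l2n_diff_triangle[OF si'(2) wsq si(2)])
    with near[OF \<psi>t(2)[of j] F(2)] near[OF \<psi>t(1)[of j] F(1)]
    show "l2n ?M (d j) \<le> l2n ?M (\<lambda>p. (w p, G' p) - jet (\<psi>' j) p) + l2n ?M (\<lambda>p. (w p, G p) - jet (\<psi> j) p)"
      by (simp add: l2n_minus_commute[of ?M "\<psi>' j"])
  qed simp
  have conv_bd: "\<exists>B. \<forall>j. l2n ?M (f j) \<le> B"
    if L: "(\<lambda>j. l2n ?M (\<lambda>p. E p - f j p)) \<longlonglongrightarrow> 0" and E: "sq_int ?M E" and f: "\<And>j. sq_int ?M (f j)"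
    for f and E :: "_ \<Rightarrow> real \<times> ((real^'n) \<times> real)"
  proof -
    have "Bseq (\<lambda>j. l2n ?M (\<lambda>p. E p - f j p))" using L by (intro convergent_imp_Bseq) (auto simp: convergent_def)
    then obtain B where B: "\<And>j. l2n ?M (\<lambda>p. E p - f j p) \<le> B" by (auto simp: Bseq_def)
    have "l2n ?M (f j) \<le> l2n ?M E + B" for j
      using sq_int_diff(2)[OF E sq_int_diff(1)[OF E f[of j]]] B[of j] by simp
    then show ?thesis by blast
  qed
  obtain B B' where B: "\<And>j. l2n ?M (jet (\<psi> j)) \<le> B" "\<And>j. l2n ?M (jet (\<psi>' j)) \<le> B'"
    using conv_bd[OF lim F(1) si(1)] conv_bd[OF lim' F(2) si'(1)] by blast
  have dB: "l2n ?M (jet (d j)) \<le> B' + B" for j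
    unfolding jd using sq_int_diff(2)[OF si'(1)[of j] si(1)[of j]] B[of j] by linarith
  have tv: "(\<lambda>j. l2n (MO \<Omega>) (\<lambda>x. d j (x, 0))) \<longlonglongrightarrow> 0"
    by (rule trace_vanishes[OF \<Omega> s _ dl dB]) (simp add: lat_test_def d)
  have s0: "sq_int (MO \<Omega>) (\<lambda>x. f (x, 0))" if "test_fn (\<Omega> \<times> UNIV) f" for f
    by (rule sq_int_MO_lborel[OF \<Omega> test_fn_sq_int(1)[OF test_fn_slice[OF that]]])
  show ?thesis
  proof (rule tendsto_sandwich[OF always_eventually always_eventually tendsto_const tendsto_add_zero[OF t(2) tv]], safe)
    fix j
    show "l2n (MO \<Omega>) (\<lambda>x. t x - \<psi> j (x, 0)) \<le> l2n (MO \<Omega>) (\<lambda>x. t x - \<psi>' j (x, 0)) + l2n (MO \<Omega>) (\<lambda>x. d j (x, 0))"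
      unfolding d_def by (rule l2n_diff_triangle[OF t(1) s0[OF \<psi>t(2)] s0[OF \<psi>t(1)]])
  qed simp
qed

subsection \<open>The extended bilinear form and existence of extensions\<close>

lemma nn_integral_MO_support:
  fixes \<Omega> :: "'a::euclidean_space set"
  assumes [measurable]: "\<Omega> \<in> sets borel" "f \<in> borel_measurable borel" and z: "\<And>x. x \<notin> \<Omega> \<Longrightarrow> f x = 0"
  shows "(\<integral>\<^sup>+x. f x \<partial>MO \<Omega>) = (\<integral>\<^sup>+x. f x \<partial>lborel)"
  unfolding MO_def
  by (subst nn_integral_density) (auto intro!: nn_integral_cong simp: z indicator_def)

lemma l2n_MO_support:
  fixes f :: "'a::euclidean_space \<Rightarrow> 'b::real_normed_vector"
  assumes \<Omega>: "\<Omega> \<in> sets borel" and f: "sq_int lborel f" and z: "\<And>x. x \<notin> \<Omega> \<Longrightarrow> f x = 0"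
  shows "l2n (MO \<Omega>) f = l2n lborel f"
proof -
  have "(\<integral>\<^sup>+x. ennreal ((norm (f x))\<^sup>2) \<partial>MO \<Omega>) = (\<integral>\<^sup>+x. ennreal ((norm (f x))\<^sup>2) \<partial>lborel)"
    using f by (intro nn_integral_MO_support \<Omega>) (auto simp: z sq_int_def)
  then have "ennreal ((l2n (MO \<Omega>) f)\<^sup>2) = ennreal ((l2n lborel f)\<^sup>2)"
    using nn_integral_sq_eq[OF f] nn_integral_sq_eq[OF sq_int_MO_lborel[OF \<Omega> f]] by simp
  then show ?thesis by (simp add: ennreal_inj)
qed

lemma poincare_MO:
  fixes v :: "'a::euclidean_space \<Rightarrow> real"
  assumes \<Omega>: "\<Omega> \<in> sets borel" and v: "test_fn \<Omega> v" and R: "\<And>x. x \<in> \<Omega> \<Longrightarrow> norm x \<le> R" "R \<ge> 0"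
  shows "l2n (MO \<Omega>) v \<le> 2 * R * l2n (MO \<Omega>) (cgrad v)"
proof -
  obtain K where K: "compact K" "K \<subseteq> \<Omega>" "\<And>x. x \<notin> K \<Longrightarrow> v x = 0 \<and> cgrad v x = 0"
    using test_fn_support[OF v] by blast
  then have "v x = 0" "cgrad v x = 0" if "x \<notin> \<Omega>" for x using that by blast+
  then show ?thesis
    using poincare[OF v R] l2n_MO_support[OF \<Omega> test_fn_sq_int(1)[OF v]]
      l2n_MO_support[OF \<Omega> test_fn_sq_int(2)[OF v]] by simp
qed

text \<open>Poincare on each horizontal slice uses only the horizontal part of the gradient. Its
  constant is the same at every height y, so it can be integrated against any weight in y.\<close>

lemma poincare_MC:
  fixes \<Omega> :: "(real^'n) set"
  assumes \<Omega>: "\<Omega> \<in> sets borel" and \<alpha>: "\<alpha> > -1" and \<psi>: "test_fn (\<Omega> \<times> UNIV) \<psi>"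
    and R: "\<And>x. x \<in> \<Omega> \<Longrightarrow> norm x \<le> R" "R \<ge> 0"
  shows "l2n (MC \<Omega> \<alpha>) \<psi> \<le> 2 * R * l2n (MC \<Omega> \<alpha>) (cgrad \<psi>)"
proof -
  interpret pair_sigma_finite "MO \<Omega>" "MY \<alpha>" by (rule pair_sigma_finite_MO_MY[OF \<Omega>])
  note sm = test_fn_smooth[OF \<psi>]
  note si = sq_int_jet_MC[OF \<Omega> \<alpha> \<psi>]
  note [measurable] = borel_measurable_continuous_onI[OF smooth_continuous[OF sm]]
      borel_measurable_continuous_onI[OF smooth_continuous_cgrad[OF sm]]
  have swap: "(\<integral>\<^sup>+p. f p \<partial>MC \<Omega> \<alpha>) = (\<integral>\<^sup>+y. (\<integral>\<^sup>+x. f (x, y) \<partial>MO \<Omega>) \<partial>MY \<alpha>)"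
    if "f \<in> borel_measurable borel" for f :: "_ \<Rightarrow> ennreal"
  proof -
    have "f \<in> borel_measurable (MC \<Omega> \<alpha>)" using that by simp
    then have "f \<in> borel_measurable (MO \<Omega> \<Otimes>\<^sub>M MY \<alpha>)" by (simp only: MC_def)
    from nn_integral_snd[OF this] show ?thesis by (simp add: MC_def)
  qed
  have "ennreal ((l2n (MC \<Omega> \<alpha>) \<psi>)\<^sup>2) = (\<integral>\<^sup>+y. (\<integral>\<^sup>+x. ennreal ((norm (\<psi> (x, y)))\<^sup>2) \<partial>MO \<Omega>) \<partial>MY \<alpha>)"
    unfolding nn_integral_sq_eq[OF si(2), symmetric] by (rule swap) simp
  also have "\<dots> \<le> (\<integral>\<^sup>+y. (\<integral>\<^sup>+x. ennreal ((2 * R)\<^sup>2) * ennreal ((norm (cgrad \<psi> (x, y)))\<^sup>2) \<partial>MO \<Omega>) \<partial>MY \<alpha>)"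
  proof (rule nn_integral_mono)
    fix y
    let ?v = "\<lambda>x. \<psi> (x, y)"
    have v: "test_fn \<Omega> ?v" by (rule test_fn_slice[OF \<psi>])
    note sv = sq_int_MO_lborel[OF \<Omega> test_fn_sq_int(1)[OF v]] sq_int_MO_lborel[OF \<Omega> test_fn_sq_int(2)[OF v]]
    have "(\<integral>\<^sup>+x. ennreal ((norm (\<psi> (x, y)))\<^sup>2) \<partial>MO \<Omega>) = ennreal ((l2n (MO \<Omega>) ?v)\<^sup>2)"
      by (rule nn_integral_sq_eq[OF sv(1)])
    also have "\<dots> \<le> ennreal ((2 * R * l2n (MO \<Omega>) (cgrad ?v))\<^sup>2)"
      by (intro ennreal_leI power_mono poincare_MO[OF \<Omega> v R]) auto
    also have "\<dots> = ennreal ((2 * R)\<^sup>2) * (\<integral>\<^sup>+x. ennreal ((norm (cgrad ?v x))\<^sup>2) \<partial>MO \<Omega>)"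
      unfolding nn_integral_sq_eq[OF sv(2)] by (simp add: power_mult_distrib ennreal_mult)
    also have "\<dots> = (\<integral>\<^sup>+x. ennreal ((2 * R)\<^sup>2) * ennreal ((norm (cgrad ?v x))\<^sup>2) \<partial>MO \<Omega>)"
      by (rule nn_integral_cmult[symmetric]) (use sv(2) in \<open>auto simp: sq_int_def\<close>)
    also have "\<dots> \<le> (\<integral>\<^sup>+x. ennreal ((2 * R)\<^sup>2) * ennreal ((norm (cgrad \<psi> (x, y)))\<^sup>2) \<partial>MO \<Omega>)"
      unfolding cgrad_slice[OF sm]
      by (intro nn_integral_mono mult_left_mono ennreal_leI power_mono norm_fst_snd_le) auto
    finally show "(\<integral>\<^sup>+x. ennreal ((norm (\<psi> (x, y)))\<^sup>2) \<partial>MO \<Omega>)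
        \<le> (\<integral>\<^sup>+x. ennreal ((2 * R)\<^sup>2) * ennreal ((norm (cgrad \<psi> (x, y)))\<^sup>2) \<partial>MO \<Omega>)" .
  qed
  also have "\<dots> = (\<integral>\<^sup>+p. ennreal ((2 * R)\<^sup>2) * ennreal ((norm (cgrad \<psi> p))\<^sup>2) \<partial>MC \<Omega> \<alpha>)"
    by (rule swap[symmetric]) simp
  also have "\<dots> = ennreal ((2 * R * l2n (MC \<Omega> \<alpha>) (cgrad \<psi>))\<^sup>2)"
    by (subst nn_integral_cmult) (auto simp: nn_integral_sq_eq[OF si(3)] power_mult_distrib ennreal_mult)
  finally have "(l2n (MC \<Omega> \<alpha>) \<psi>)\<^sup>2 \<le> (2 * R * l2n (MC \<Omega> \<alpha>) (cgrad \<psi>))\<^sup>2"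
    by (simp add: ennreal_le_iff)
  then show ?thesis by (rule power2_le_imp_le) (use R in simp)
qed

section \<open>The bilinear form on jets: boundedness, symmetry and coercivity\<close>

locale extension_setting =
  fixes \<Omega> :: "(real^'n) set" and A :: "real^'n \<Rightarrow> real^'n^'n" and c :: "real^'n \<Rightarrow> real"
    and lam :: "nat \<Rightarrow> real" and phi :: "nat \<Rightarrow> real^'n \<Rightarrow> real" and s :: real
  assumes setting: "setting \<Omega> A c lam phi" and s: "0 < s" "s < 1"
begin

abbreviation "M \<equiv> MC \<Omega> (1 - 2 * s)"

lemma alpha: "1 - 2 * s > -1" using s by simp

lemma open_Omega: "open \<Omega>" using setting by (simp add: setting_def)
lemma Omega_borel [measurable]: "\<Omega> \<in> sets borel" using open_Omega by simp

lemma Omega_bound: obtains R where "R \<ge> 0" "\<And>x. x \<in> \<Omega> \<Longrightarrow> norm x \<le> R"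
proof -
  have "bounded \<Omega>" using setting by (simp add: setting_def)
  then obtain R where "\<And>x. x \<in> \<Omega> \<Longrightarrow> norm x \<le> R" by (auto simp: bounded_iff)
  then show ?thesis using that[of "max R 0"] by (auto simp: le_max_iff_disj)
qed

text \<open>The hypotheses constrain \<open>A\<close> on \<open>\<Omega>\<close> only. The cut-off
  is Borel and bounded on the whole space and agrees with \<open>A\<close> where the measures
  live.\<close>

definition AO :: "real^'n \<Rightarrow> real^'n^'n" where "AO x = indicat_real \<Omega> x *\<^sub>R A x"

lemma AO_eq: "x \<in> \<Omega> \<Longrightarrow> AO x = A x" by (simp add: AO_def)

lemma c_borel [measurable]: "c \<in> borel_measurable borel" using setting by (simp add: setting_def)

lemma AO_borel [measurable]: "AO \<in> borel_measurable borel"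
proof -
  obtain L where "lipschitz_on L \<Omega> A" using setting by (auto simp: setting_def)
  then have "continuous_on \<Omega> A" by (rule lipschitz_on_continuous_on)
  then show ?thesis unfolding AO_def by (intro borel_measurable_continuous_on_indicator) auto
qed

lemma AO_mult_borel [measurable]:
  assumes [measurable]: "f \<in> borel_measurable N" "g \<in> borel_measurable N"
  shows "(\<lambda>x. (f x :: real^'n^'n) *v g x) \<in> borel_measurable N"
  by (rule borel_measurable_continuous_Pair[OF assms])
     (auto simp: matrix_vector_mult_def intro!: continuous_intros)

text \<open>A Lipschitz map on a bounded set is bounded: compare with its value at one point of
  \<open>\<Omega>\<close>.\<close>

lemma AO_bound: obtains K where "K \<ge> 0" "\<And>x v. norm (AO x *v v) \<le> K * norm v"
proof -
  obtain L where L: "lipschitz_on L \<Omega> A" using setting by (auto simp: setting_def)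
  obtain R where R: "R \<ge> 0" "\<And>x. x \<in> \<Omega> \<Longrightarrow> norm x \<le> R" using Omega_bound by blast
  obtain x0 where x0: "x0 \<in> \<Omega>" using setting by (auto simp: setting_def)
  have L0: "L \<ge> 0" using L by (rule lipschitz_on_nonneg)
  define B where "B = norm (A x0) + L * (2 * R)"
  have B0: "B \<ge> 0" using L0 R(1) by (simp add: B_def)
  have AB: "norm (AO x) \<le> B" for x
  proof (cases "x \<in> \<Omega>")
    case True
    have "dist (A x) (A x0) \<le> L * dist x x0" using lipschitz_onD[OF L True x0] .
    also have "\<dots> \<le> L * (2 * R)"
      using norm_triangle_ineq4[of x x0] R(2)[OF True] R(2)[OF x0] L0
      by (intro mult_left_mono) (auto simp: dist_norm)
    finally have "norm (A x - A x0) \<le> L * (2 * R)" by (simp add: dist_norm)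
    then show ?thesis
      using norm_triangle_ineq[of "A x - A x0" "A x0"] AO_eq[OF True] by (simp add: B_def)
  qed (use B0 in \<open>simp add: AO_def\<close>)
  define K where "K = real CARD('n) * real CARD('n) * B"
  have "norm (AO x *v v) \<le> K * norm v" for x v
  proof -
    have "\<bar>AO x $ i $ j\<bar> \<le> B" for i j
      using component_le_norm_cart[of "AO x $ i" j] Finite_Cartesian_Product.norm_nth_le[of "AO x" i] AB[of x]
      by linarith
    then have "onorm ((*v) (AO x)) \<le> K"
      unfolding K_def by (rule onorm_le_matrix_component)
    then have "onorm ((*v) (AO x)) * norm v \<le> K * norm v" by (rule mult_right_mono) simp
    then show ?thesis
      using onorm[OF matrix_vector_mul_bounded_linear[of "AO x"], of v] by linarith
  qed
  then show ?thesis using that[of K] B0 by (simp add: K_def)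
qed

text \<open>The bounds on \<open>c\<close> hold only almost everywhere on the base and must be
  lifted to the product measure. Membership in \<open>\<Omega>\<close> is bundled in, because
  ellipticity and symmetry hold only there.\<close>

lemma c_bound: obtains m where "m \<ge> 0" "AE x in MO \<Omega>. 0 \<le> c x \<and> c x \<le> m" "AE p in M. fst p \<in> \<Omega> \<and> 0 \<le> c (fst p) \<and> c (fst p) \<le> m"
proof -
  obtain m where m: "AE x in lborel. x \<in> \<Omega> \<longrightarrow> 0 \<le> c x \<and> c x \<le> m"
    using setting by (auto simp: setting_def)
  then have m1: "AE x in MO \<Omega>. 0 \<le> c x \<and> c x \<le> max m 0" by (subst AE_MO) auto
  have m2: "AE x in MO \<Omega>. x \<in> \<Omega> \<and> 0 \<le> c x \<and> c x \<le> max m 0"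
    using m by (subst AE_MO) auto
  interpret pair_sigma_finite "MO \<Omega>" "MY (1 - 2 * s)" by (rule pair_sigma_finite_MO_MY) simp
  have "{p. fst p \<in> \<Omega> \<and> 0 \<le> c (fst p) \<and> c (fst p) \<le> max m 0} \<in> sets M"
    by simp measurable
  then have "AE p in M. fst p \<in> \<Omega> \<and> 0 \<le> c (fst p) \<and> c (fst p) \<le> max m 0"
    unfolding MC_def using m2
  proof (intro AE_pair_measure)
    show "AE x in MO \<Omega>. AE y in MY (1 - 2 * s). fst (x, y) \<in> \<Omega> \<and> 0 \<le> c (fst (x, y)) \<and> c (fst (x, y)) \<le> max m 0"
      using m2 by eventually_elim simp
  qed (auto simp: space_pair_measure MC_def)
  with m1 show ?thesis by (intro that[of "max m 0"]) auto
qed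

text \<open>All coefficients of the extended form as one linear map on jets, so that the form
  becomes an ordinary L2 pairing of \<open>form_op\<close> of one jet with another.\<close>

definition form_op :: "(real^'n) \<times> real \<Rightarrow> real \<times> ((real^'n) \<times> real) \<Rightarrow> real \<times> ((real^'n) \<times> real)" where
  "form_op p F = (c (fst p) * fst F, (AO (fst p) *v fst (snd F), snd (snd F)))"

lemma form_op_lin: "form_op p (F + r *\<^sub>R G) = form_op p F + r *\<^sub>R form_op p G"
  by (simp add: form_op_def algebra_simps matrix_vector_right_distrib matrix_vector_mult_scaleR)

lemma A_sym: "x \<in> \<Omega> \<Longrightarrow> (AO x *v u) \<bullet> v = u \<bullet> (AO x *v v)"
proof -
  assume x: "x \<in> \<Omega>"
  then have t: "transpose (AO x) = AO x" using setting by (simp add: setting_def AO_eq)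
  have "AO x *v u = u v* AO x" using transpose_matrix_vector[of "AO x" u] t by simp
  then show ?thesis by (simp add: dot_lmul_matrix)
qed

lemma form_op_sym: "fst p \<in> \<Omega> \<Longrightarrow> form_op p F \<bullet> H = form_op p H \<bullet> F"
  using A_sym[of "fst p" "fst (snd F)" "fst (snd H)"]
  by (simp add: form_op_def inner_prod_def inner_commute algebra_simps)

lemma form_op_bound: obtains K where "K \<ge> 0" "AE p in M. \<forall>F. norm (form_op p F) \<le> K * norm F"
proof -
  obtain K where K: "K \<ge> 0" "\<And>x v. norm (AO x *v v) \<le> K * norm v" using AO_bound by blast
  obtain m where m: "m \<ge> 0" "AE x in MO \<Omega>. 0 \<le> c x \<and> c x \<le> m"
    "AE p in M. fst p \<in> \<Omega> \<and> 0 \<le> c (fst p) \<and> c (fst p) \<le> m" using c_bound by blast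
  have "AE p in M. \<forall>F. norm (form_op p F) \<le> (m + K + 1) * norm F"
    using m(3)
  proof (eventually_elim, intro allI)
    fix p :: "(real^'n) \<times> real" and F :: "real \<times> ((real^'n) \<times> real)"
    assume p: "fst p \<in> \<Omega> \<and> 0 \<le> c (fst p) \<and> c (fst p) \<le> m"
    have 1: "norm (form_op p F) \<le> norm (c (fst p) * fst F) + (norm (AO (fst p) *v fst (snd F)) + norm (snd (snd F)))"
      unfolding form_op_def by (intro order_trans[OF norm_Pair_le] add_left_mono norm_Pair_le)
    have 2: "norm (c (fst p) * fst F) \<le> m * norm F"
      unfolding norm_mult using p by (intro mult_mono) (auto simp: norm_fst_snd_le)
    have 3: "norm (AO (fst p) *v fst (snd F)) \<le> K * norm F"
      by (rule order_trans[OF K(2)], intro mult_left_mono K order_trans[OF norm_fst_snd_le(1) norm_fst_snd_le(2)])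
    have 4: "norm (snd (snd F)) \<le> norm F"
      using norm_fst_snd_le(2)[of "snd F"] norm_fst_snd_le(2)[of F] by linarith
    have "norm (form_op p F) \<le> m * norm F + (K * norm F + norm F)" using 1 2 3 4 by linarith
    then show "norm (form_op p F) \<le> (m + K + 1) * norm F" by (simp add: algebra_simps)
  qed
  then show ?thesis using that[of "m + K + 1"] m K by simp
qed

lemma ellipticity: obtains \<theta> where "\<theta> > 0" "\<And>x \<xi>. x \<in> \<Omega> \<Longrightarrow> (AO x *v \<xi>) \<bullet> \<xi> \<ge> \<theta> * (norm \<xi>)\<^sup>2"
proof -
  obtain \<theta> where "\<theta> > 0" "\<forall>x\<in>\<Omega>. \<forall>\<xi>. \<xi> \<bullet> (A x *v \<xi>) \<ge> \<theta> * (norm \<xi>)\<^sup>2"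
    using setting by (auto simp: setting_def)
  then show ?thesis by (intro that[of \<theta>]) (auto simp: AO_eq inner_commute)
qed

text \<open>\<open>c\<close> may vanish, so only the gradient component is controlled; the function
  component is supplied later by Poincare. The minimum with 1 stems from the unit entry of the
  matrix in the y direction.\<close>

lemma form_op_coercive: obtains \<theta> where "\<theta> > 0" "AE p in M. \<forall>F. form_op p F \<bullet> F \<ge> \<theta> * (norm (snd F))\<^sup>2"
proof -
  obtain \<theta> where \<theta>: "\<theta> > 0" "\<And>x \<xi>. x \<in> \<Omega> \<Longrightarrow> (AO x *v \<xi>) \<bullet> \<xi> \<ge> \<theta> * (norm \<xi>)\<^sup>2" using ellipticity by blast
  obtain m where m: "m \<ge> 0" "AE x in MO \<Omega>. 0 \<le> c x \<and> c x \<le> m"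
    "AE p in M. fst p \<in> \<Omega> \<and> 0 \<le> c (fst p) \<and> c (fst p) \<le> m" using c_bound by blast
  have "AE p in M. \<forall>F. form_op p F \<bullet> F \<ge> min \<theta> 1 * (norm (snd F))\<^sup>2"
    using m(3)
  proof (eventually_elim, intro allI)
    fix p :: "(real^'n) \<times> real" and F :: "real \<times> ((real^'n) \<times> real)"
    assume p: "fst p \<in> \<Omega> \<and> 0 \<le> c (fst p) \<and> c (fst p) \<le> m"
    have "min \<theta> 1 * (norm (snd F))\<^sup>2 = min \<theta> 1 * (norm (fst (snd F)))\<^sup>2 + min \<theta> 1 * (snd (snd F))\<^sup>2"
      by (cases "snd F") (simp add: norm_Pair distrib_left)
    also have "\<dots> \<le> \<theta> * (norm (fst (snd F)))\<^sup>2 + 1 * (snd (snd F))\<^sup>2"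
      by (intro add_mono mult_right_mono) auto
    also have "\<dots> \<le> (AO (fst p) *v fst (snd F)) \<bullet> fst (snd F) + snd (snd F) * snd (snd F)"
      using \<theta>(2) p by (simp add: power2_eq_square)
    also have "\<dots> \<le> c (fst p) * (fst F * fst F) + ((AO (fst p) *v fst (snd F)) \<bullet> fst (snd F) + snd (snd F) * snd (snd F))"
      using p mult_nonneg_nonneg[of "c (fst p)" "fst F * fst F"] by simp
    also have "\<dots> = form_op p F \<bullet> F" by (simp add: form_op_def inner_prod_def mult.assoc)
    finally show "min \<theta> 1 * (norm (snd F))\<^sup>2 \<le> form_op p F \<bullet> F" .
  qed
  then show ?thesis using that[of "min \<theta> 1"] \<theta> by simp
qed

lemma form_op_borel [measurable]:
  assumes [measurable]: "F \<in> borel_measurable borel"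
  shows "(\<lambda>p. form_op p (F p)) \<in> borel_measurable borel"
  unfolding form_op_def by measurable

lemma form_op_sq_int:
  obtains K where "K \<ge> 0" "\<And>F. sq_int M F \<Longrightarrow> sq_int M (\<lambda>p. form_op p (F p)) \<and> l2n M (\<lambda>p. form_op p (F p)) \<le> K * l2n M F"
proof -
  obtain K where K: "K \<ge> 0" "AE p in M. \<forall>F. norm (form_op p F) \<le> K * norm F" using form_op_bound by blast
  have "sq_int M (\<lambda>p. form_op p (F p)) \<and> l2n M (\<lambda>p. form_op p (F p)) \<le> K * l2n M F" if F: "sq_int M F" for F
  proof -
    have m: "(\<lambda>p. form_op p (F p)) \<in> borel_measurable M"
      using F by (auto simp: sq_int_def intro: form_op_borel)
    have "AE p in M. norm (form_op p (F p)) \<le> K * norm (F p)" using K(2) by eventually_elim blast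
    from sq_int_bound[OF F m K(1) this] show ?thesis by blast
  qed
  then show ?thesis using that K(1) by blast
qed

text \<open>The form without the prefactor \<open>1 / d_s s\<close>; this is why
  \<open>d_s s\<close> stands in front of the load in all identities below.\<close>

definition B :: "((real^'n) \<times> real \<Rightarrow> real \<times> ((real^'n) \<times> real)) \<Rightarrow> ((real^'n) \<times> real \<Rightarrow> real \<times> ((real^'n) \<times> real)) \<Rightarrow> real" where
  "B F H = (\<integral>p. form_op p (F p) \<bullet> H p \<partial>M)"

lemma B_integrable: "sq_int M F \<Longrightarrow> sq_int M H \<Longrightarrow> integrable M (\<lambda>p. form_op p (F p) \<bullet> H p)"
  using form_op_sq_int l2_inner(1) by metis

lemma B_bound: obtains K where "K \<ge> 0" "\<And>F H. sq_int M F \<Longrightarrow> sq_int M H \<Longrightarrow> \<bar>B F H\<bar> \<le> K * (l2n M F * l2n M H)"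
proof -
  obtain K where K: "K \<ge> 0" "\<And>F. sq_int M F \<Longrightarrow> sq_int M (\<lambda>p. form_op p (F p)) \<and> l2n M (\<lambda>p. form_op p (F p)) \<le> K * l2n M F"
    using form_op_sq_int by blast
  have "\<bar>B F H\<bar> \<le> K * (l2n M F * l2n M H)" if F: "sq_int M F" and H: "sq_int M H" for F H
  proof -
    have "\<bar>B F H\<bar> \<le> l2n M (\<lambda>p. form_op p (F p)) * l2n M H"
      unfolding B_def using K(2)[OF F] H by (intro l2_inner) auto
    also have "\<dots> \<le> (K * l2n M F) * l2n M H" using K(2)[OF F] by (intro mult_right_mono) auto
    finally show ?thesis by (simp add: mult.assoc)
  qed
  then show ?thesis using that K(1) by blast
qed

lemma B_lin:
  assumes "sq_int M F" "sq_int M G" "sq_int M H"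
  shows "B (\<lambda>p. F p + r *\<^sub>R G p) H = B F H + r * B G H"
  unfolding B_def form_op_lin inner_add_left inner_scaleR_left
  using B_integrable[OF assms(1,3)] B_integrable[OF assms(2,3)]
  by (subst Bochner_Integration.integral_add) auto

lemma B_diff:
  assumes "sq_int M F" "sq_int M G" "sq_int M H"
  shows "B (\<lambda>p. F p - G p) H = B F H - B G H"
  using B_lin[OF assms, of "-1"] by simp

lemma B_sym:
  assumes "sq_int M F" "sq_int M H"
  shows "B F H = B H F"
  unfolding B_def
proof (rule integral_cong_AE)
  show "AE p in M. form_op p (F p) \<bullet> H p = form_op p (H p) \<bullet> F p"
  proof -
    have "AE p in M. fst p \<in> \<Omega>" using c_bound by (metis (mono_tags, lifting) eventually_mono)
    then show ?thesis by eventually_elim (rule form_op_sym)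
  qed
qed (use B_integrable[OF assms] B_integrable[OF assms(2,1)] in auto)

lemma B_conv:
  assumes F: "sq_int M F" and H: "sq_int M H" and f: "\<And>j. sq_int M (f j)"
    and lim: "(\<lambda>j. l2n M (\<lambda>p. F p - f j p)) \<longlonglongrightarrow> 0"
  shows "(\<lambda>j. B (f j) H) \<longlonglongrightarrow> B F H" "(\<lambda>j. B H (f j)) \<longlonglongrightarrow> B H F"
proof -
  obtain K where K: "K \<ge> 0" "\<And>F H. sq_int M F \<Longrightarrow> sq_int M H \<Longrightarrow> \<bar>B F H\<bar> \<le> K * (l2n M F * l2n M H)"
    using B_bound by blast
  show 1: "(\<lambda>j. B (f j) H) \<longlonglongrightarrow> B F H"
  proof (rule LIM_zero_cancel, rule Lim_null_comparison)
    show "(\<lambda>j. K * (l2n M (\<lambda>p. F p - f j p) * l2n M H)) \<longlonglongrightarrow> 0"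
      by (intro tendsto_mult_right_zero tendsto_mult_left_zero lim)
    show "\<forall>\<^sub>F j in sequentially. norm (B (f j) H - B F H) \<le> K * (l2n M (\<lambda>p. F p - f j p) * l2n M H)"
      using K(2)[OF sq_int_diff(1)[OF F f] H] B_diff[OF F f H]
      by (intro always_eventually allI) (simp add: abs_minus_commute)
  qed
  then show "(\<lambda>j. B H (f j)) \<longlonglongrightarrow> B H F"
    using B_sym[OF f H] B_sym[OF F H] by simp
qed

lemma jet_sq_int: "lat_test \<Omega> \<psi> \<Longrightarrow> sq_int M (jet \<psi>)"
  unfolding lat_test_def by (rule sq_int_jet_MC(1)[OF Omega_borel alpha])

lemma B_coercive:
  obtains \<kappa> where "\<kappa> > 0" "\<And>\<psi>. lat_test \<Omega> \<psi> \<Longrightarrow> \<kappa> * (l2n M (jet \<psi>))\<^sup>2 \<le> B (jet \<psi>) (jet \<psi>)"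
proof -
  obtain \<theta> where \<theta>: "\<theta> > 0" "AE p in M. \<forall>F. form_op p F \<bullet> F \<ge> \<theta> * (norm (snd F))\<^sup>2" using form_op_coercive by blast
  obtain R where R: "R \<ge> 0" "\<And>x. x \<in> \<Omega> \<Longrightarrow> norm x \<le> R" using Omega_bound by blast
  \<comment> \<open>Splits the squared jet norm: (2 R)^2 for the function by Poincare, 1 for the
    gradient itself.\<close>
  define k where "k = (2 * R)\<^sup>2 + 1"
  have k: "k > 0" by (simp add: k_def add_nonneg_pos)
  have "\<theta> / k * (l2n M (jet \<psi>))\<^sup>2 \<le> B (jet \<psi>) (jet \<psi>)" if "lat_test \<Omega> \<psi>" for \<psi>
  proof -
    have \<psi>: "test_fn (\<Omega> \<times> UNIV) \<psi>" using that by (simp add: lat_test_def)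
    note si = sq_int_jet_MC[OF Omega_borel alpha \<psi>]
    have i: "integrable M (\<lambda>p. (\<psi> p)\<^sup>2)" "integrable M (\<lambda>p. (norm (cgrad \<psi> p))\<^sup>2)"
      using si(2,3) by (auto simp: sq_int_iff)
    have "(l2n M (jet \<psi>))\<^sup>2 = (l2n M \<psi>)\<^sup>2 + (l2n M (cgrad \<psi>))\<^sup>2"
      unfolding l2n_sq using i by (simp add: jet_def norm_Pair)
    also have "(l2n M \<psi>)\<^sup>2 \<le> (2 * R * l2n M (cgrad \<psi>))\<^sup>2"
      by (intro power_mono poincare_MC[OF Omega_borel alpha \<psi> R(2,1)]) auto
    finally have 1: "(l2n M (jet \<psi>))\<^sup>2 \<le> k * (l2n M (cgrad \<psi>))\<^sup>2"
      by (simp add: k_def power_mult_distrib algebra_simps)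
    have "\<theta> * (l2n M (cgrad \<psi>))\<^sup>2 = (\<integral>p. \<theta> * (norm (cgrad \<psi> p))\<^sup>2 \<partial>M)"
      by (simp add: l2n_sq)
    also have "\<dots> \<le> B (jet \<psi>) (jet \<psi>)"
      unfolding B_def
    proof (rule integral_mono_AE)
      show "AE p in M. \<theta> * (norm (cgrad \<psi> p))\<^sup>2 \<le> form_op p (jet \<psi> p) \<bullet> jet \<psi> p"
        using \<theta>(2)
      proof eventually_elim
        case (elim p)
        from spec[OF elim, of "jet \<psi> p"] show ?case by (simp add: jet_def)
      qed
    qed (use i B_integrable[OF si(1) si(1)] in auto)
    finally have 2: "\<theta> * (l2n M (cgrad \<psi>))\<^sup>2 \<le> B (jet \<psi>) (jet \<psi>)" .
    have "\<theta> / k * (l2n M (jet \<psi>))\<^sup>2 \<le> \<theta> / k * (k * (l2n M (cgrad \<psi>))\<^sup>2)"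
      using 1 \<theta> k by (intro mult_left_mono) auto
    also have "\<dots> = \<theta> * (l2n M (cgrad \<psi>))\<^sup>2" using k by simp
    finally show ?thesis using 2 by linarith
  qed
  then show ?thesis using that[of "\<theta> / k"] \<theta> k by simp
qed

lemma ds_pos: "d_s s > 0"
  using s by (simp add: d_s_def Gamma_real_pos)

lemma a_ext_eq_B:
  assumes [measurable]: "w \<in> borel_measurable borel" "G \<in> borel_measurable borel"
    "v \<in> borel_measurable borel" "H \<in> borel_measurable borel"
  shows "a_ext \<Omega> A c s w G v H = 1 / d_s s * B (\<lambda>p. (w p, G p)) (\<lambda>p. (v p, H p))"
proof -
  have "set_lebesgue_integral lborel (cyl \<Omega>)
      (\<lambda>p. snd p powr (1 - 2 * s) *
         ((A (fst p) *v fst (G p)) \<bullet> fst (H p) + snd (G p) * snd (H p) + c (fst p) * w p * v p))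
    = set_lebesgue_integral lborel (cyl \<Omega>)
      (\<lambda>p. snd p powr (1 - 2 * s) * (form_op p (w p, G p) \<bullet> (v p, H p)))"
    by (rule set_lebesgue_integral_cong)
       (auto simp: cyl_def AO_eq form_op_def inner_prod_def intro: borel_Times)
  also have "\<dots> = B (\<lambda>p. (w p, G p)) (\<lambda>p. (v p, H p))"
    unfolding B_def by (rule set_lint_MC) auto
  finally show ?thesis by (simp add: a_ext_def)
qed

lemma HL_sequence:
  assumes "HL \<Omega> (1 - 2 * s) w G"
  obtains \<psi> where "\<And>j. lat_test \<Omega> (\<psi> j)" "w \<in> borel_measurable borel" "G \<in> borel_measurable borel"
    "sq_int M (\<lambda>p. (w p, G p))" "(\<lambda>j. l2n M (\<lambda>p. (w p, G p) - jet (\<psi> j) p)) \<longlonglongrightarrow> 0"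
proof -
  have m: "w \<in> borel_measurable borel" "G \<in> borel_measurable borel"
    using assms by (auto simp: HL_def H1w_def weak_gradient_def)
  obtain \<psi> where \<psi>: "\<And>j. lat_test \<Omega> (\<psi> j)" "wconv \<Omega> (1 - 2 * s) w G \<psi>"
    using assms by (auto simp: HL_def)
  from \<psi>(2) show ?thesis
    unfolding wconv_iff[OF Omega_borel s m \<psi>(1)] by (intro that[of \<psi>] \<psi>(1) m) auto
qed

lemma trace_sq_int: "lat_test \<Omega> \<psi> \<Longrightarrow> sq_int (MO \<Omega>) (\<lambda>x. \<psi> (x, 0))"
  unfolding lat_test_def
  by (rule sq_int_MO_lborel[OF Omega_borel test_fn_sq_int(1)[OF test_fn_slice]])

lemma trace_ofI:
  assumes \<psi>: "\<And>j. lat_test \<Omega> (\<psi> j)" and HL: "HL \<Omega> (1 - 2 * s) w G"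
    and lim: "(\<lambda>j. l2n M (\<lambda>p. (w p, G p) - jet (\<psi> j) p)) \<longlonglongrightarrow> 0"
    and t: "sq_int (MO \<Omega>) t" "(\<lambda>j. l2n (MO \<Omega>) (\<lambda>x. t x - \<psi> j (x, 0))) \<longlonglongrightarrow> 0"
  shows "trace_of \<Omega> (1 - 2 * s) w t"
  unfolding trace_of_def
proof (intro conjI exI)
  show "L2 \<Omega> t" using t by (simp add: L2_iff_sq_int)
  show "HL \<Omega> (1 - 2 * s) w G" by fact
  show "\<forall>j. lat_test \<Omega> (\<psi> j)" using \<psi> by blast
  obtain \<psi>' where m: "w \<in> borel_measurable borel" "G \<in> borel_measurable borel" "sq_int M (\<lambda>p. (w p, G p))"
    using HL_sequence[OF HL] by blast
  show "wconv \<Omega> (1 - 2 * s) w G \<psi>"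
    unfolding wconv_iff[OF Omega_borel s m(1,2) \<psi>] using m lim by blast
  have "(\<lambda>j. \<integral>\<^sup>+x. ennreal ((norm (t x - \<psi> j (x, 0)))\<^sup>2) \<partial>MO \<Omega>) \<longlonglongrightarrow> 0"
    using t(2) by (subst l2n_conv_nn_integral[OF sq_int_diff(1)[OF t(1) trace_sq_int[OF \<psi>]]])
  moreover have "set_nn_integral lborel \<Omega> (\<lambda>x. ennreal ((\<psi> j (x, 0) - t x)\<^sup>2))
      = (\<integral>\<^sup>+x. ennreal ((norm (t x - \<psi> j (x, 0)))\<^sup>2) \<partial>MO \<Omega>)" for j
    using t(1) trace_sq_int[OF \<psi>[of j]]
    by (subst set_nn_MO) (auto simp: sq_int_def power2_commute)
  ultimately show "(\<lambda>j. set_nn_integral lborel \<Omega> (\<lambda>x. ennreal ((\<psi> j (x, 0) - t x)\<^sup>2))) \<longlonglongrightarrow> 0"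
    by simp
qed

lemma trace_ofE:
  assumes "trace_of \<Omega> (1 - 2 * s) w t"
  obtains G \<psi> where "\<And>j. lat_test \<Omega> (\<psi> j)" "sq_int M (\<lambda>p. (w p, G p))"
    "(\<lambda>j. l2n M (\<lambda>p. (w p, G p) - jet (\<psi> j) p)) \<longlonglongrightarrow> 0"
    "sq_int (MO \<Omega>) t" "(\<lambda>j. l2n (MO \<Omega>) (\<lambda>x. t x - \<psi> j (x, 0))) \<longlonglongrightarrow> 0"
proof -
  have t: "sq_int (MO \<Omega>) t" using assms by (simp add: trace_of_def L2_iff_sq_int)
  obtain G \<psi> where *: "HL \<Omega> (1 - 2 * s) w G" "\<And>j. lat_test \<Omega> (\<psi> j)" "wconv \<Omega> (1 - 2 * s) w G \<psi>"
    "(\<lambda>j. set_nn_integral lborel \<Omega> (\<lambda>x. ennreal ((\<psi> j (x, 0) - t x)\<^sup>2))) \<longlonglongrightarrow> 0"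
    using assms by (auto simp: trace_of_def)
  have m: "w \<in> borel_measurable borel" "G \<in> borel_measurable borel"
    using *(1) by (auto simp: HL_def H1w_def weak_gradient_def)
  have "set_nn_integral lborel \<Omega> (\<lambda>x. ennreal ((\<psi> j (x, 0) - t x)\<^sup>2))
      = (\<integral>\<^sup>+x. ennreal ((norm (t x - \<psi> j (x, 0)))\<^sup>2) \<partial>MO \<Omega>)" for j
    using t trace_sq_int[OF *(2)[of j]]
    by (subst set_nn_MO) (auto simp: sq_int_def power2_commute)
  with *(4) have "(\<lambda>j. l2n (MO \<Omega>) (\<lambda>x. t x - \<psi> j (x, 0))) \<longlonglongrightarrow> 0"
    using l2n_conv_nn_integral[OF sq_int_diff(1)[OF t trace_sq_int[OF *(2)]]] by simp
  with *(2,3) t show ?thesis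
    unfolding wconv_iff[OF Omega_borel s m *(2)] by (intro that[of \<psi> G]) auto
qed

lemma lat_test_HL:
  assumes \<psi>: "lat_test \<Omega> \<psi>"
  shows "HL \<Omega> (1 - 2 * s) \<psi> (cgrad \<psi>)" "trace_of \<Omega> (1 - 2 * s) \<psi> (\<lambda>x. \<psi> (x, 0))"
proof -
  have 1: "(\<lambda>j::nat. l2n M (\<lambda>p. jet \<psi> p - jet \<psi> p)) \<longlonglongrightarrow> 0" by simp
  show HL: "HL \<Omega> (1 - 2 * s) \<psi> (cgrad \<psi>)"
    using jet_limit_HL[OF open_Omega s \<psi> jet_sq_int[OF \<psi>] 1] by (simp add: jet_def)
  show "trace_of \<Omega> (1 - 2 * s) \<psi> (\<lambda>x. \<psi> (x, 0))"
    by (rule trace_ofI[of "\<lambda>_. \<psi>", OF \<psi> HL _ trace_sq_int[OF \<psi>]]) (simp_all add: jet_def)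
qed

lemma MO_inner_conv:
  fixes q t :: "real^'n \<Rightarrow> real" and f :: "nat \<Rightarrow> real^'n \<Rightarrow> real"
  assumes q: "sq_int (MO \<Omega>) q" and t: "sq_int (MO \<Omega>) t" and f: "\<And>j. sq_int (MO \<Omega>) (f j)"
    and lim: "(\<lambda>j. l2n (MO \<Omega>) (\<lambda>x. t x - f j x)) \<longlonglongrightarrow> 0"
  shows "(\<lambda>j. \<integral>x. q x * f j x \<partial>MO \<Omega>) \<longlonglongrightarrow> (\<integral>x. q x * t x \<partial>MO \<Omega>)"
  using l2_inner_conv[OF t q f lim] by (simp add: mult.commute)

text \<open>The energy is minimized over smooth functions only. Their jets converge in L2, the limit
  satisfies the equation against smooth functions, and density extends it to all admissible test
  functions together with their traces.\<close>

theorem ext_state_exists: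
  assumes q: "L2 \<Omega> q"
  obtains W where "ext_state \<Omega> A c s q W"
proof -
  have q': "sq_int (MO \<Omega>) q" using q by (simp add: L2_iff_sq_int)
  define l where "l \<psi> = d_s s * (\<integral>x. q x * \<psi> (x, 0::real) \<partial>MO \<Omega>)" for \<psi> :: "(real^'n) \<times> real \<Rightarrow> real"
  define comb where "comb f r g = (\<lambda>p. f p + r * g p)" for f g :: "(real^'n) \<times> real \<Rightarrow> real" and r :: real
  obtain \<kappa> where \<kappa>: "\<kappa> > 0" "\<And>\<psi>. lat_test \<Omega> \<psi> \<Longrightarrow> \<kappa> * (l2n M (jet \<psi>))\<^sup>2 \<le> B (jet \<psi>) (jet \<psi>)"
    using B_coercive by blast
  obtain C where C: "C \<ge> 0" "\<And>\<psi>. lat_test \<Omega> \<psi> \<Longrightarrow> l2n (MO \<Omega>) (\<lambda>x. \<psi> (x, 0)) \<le> C * l2n M (jet \<psi>)"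
    using trace_bound[OF Omega_borel s] by blast
  have sm: "smooth_fun \<psi>" if "lat_test \<Omega> \<psi>" for \<psi> using that by (simp add: lat_test_def test_fn_def)
  have jc: "jet (comb f r g) = (\<lambda>p. jet f p + r *\<^sub>R jet g p)" if "lat_test \<Omega> f" "lat_test \<Omega> g" for f r g
    using cgrad_add(1)[OF sm[OF that(1)] smooth_fun_intros(3)[OF smooth_fun_intros(1) sm[OF that(2)]]]
      cgrad_add(4)[OF sm[OF that(2)] sm[OF that(2)]]
    by (simp add: jet_def comb_def)
  have l2n_le: "l2n M (jet f) \<le> sqrt (1 / \<kappa>) * sqrt (B (jet f) (jet f))" if "lat_test \<Omega> f" for f
  proof -
    have "(l2n M (jet f))\<^sup>2 \<le> 1 / \<kappa> * B (jet f) (jet f)"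
      using \<kappa>(2)[OF that] \<kappa>(1) by (simp add: field_simps)
    from real_sqrt_le_mono[OF this] show ?thesis by (simp add: real_sqrt_mult[symmetric])
  qed
  obtain u where u: "\<And>j::nat. lat_test \<Omega> (u j)"
    "\<And>e. e > 0 \<Longrightarrow> \<exists>N. \<forall>i\<ge>N. \<forall>j\<ge>N. B (jet (comb (u i) (-1) (u j))) (jet (comb (u i) (-1) (u j))) < e"
    "\<And>g. lat_test \<Omega> g \<Longrightarrow> (\<lambda>j. B (jet (u j)) (jet g)) \<longlonglongrightarrow> l g"
  \<comment> \<open>The bound of the functional multiplies three estimates: Cauchy-Schwarz with
    \<open>q\<close>, the trace bound \<open>C\<close>, and coercivity, which contributes sqrt (1 /
    \<kappa>).\<close>
  proof (rule minimizing_sequence[of "lat_test \<Omega>" "\<lambda>_. 0" comb "\<lambda>f g. B (jet f) (jet g)" l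
        "d_s s * (l2n (MO \<Omega>) q * (C * sqrt (1 / \<kappa>)))"])
    show "lat_test \<Omega> (\<lambda>_. 0)" unfolding lat_test_def by (rule test_fn_zero)
    show "lat_test \<Omega> (comb f r g)" if "lat_test \<Omega> f" "lat_test \<Omega> g" for f r g
      using that unfolding lat_test_def comb_def by (intro test_fn_add test_fn_cmult)
    show "B (jet (comb f r g)) (jet h) = B (jet f) (jet h) + r * B (jet g) (jet h)"
      if "lat_test \<Omega> f" "lat_test \<Omega> g" "lat_test \<Omega> h" for f r g h
      unfolding jc[OF that(1,2)] by (intro B_lin jet_sq_int that)
    show "l (comb f r g) = l f + r * l g" if "lat_test \<Omega> f" "lat_test \<Omega> g" for f r g
    proof -
      have "integrable (MO \<Omega>) (\<lambda>x. q x * \<psi> (x, 0))" if "lat_test \<Omega> \<psi>" for \<psi>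
        using l2_inner(1)[OF q' trace_sq_int[OF that]] by simp
      from this[OF that(1)] this[OF that(2)] show ?thesis
        by (simp add: l_def comb_def distrib_left mult.left_commute[of _ r])
    qed
    show "B (jet f) (jet g) = B (jet g) (jet f)" if "lat_test \<Omega> f" "lat_test \<Omega> g" for f g
      by (intro B_sym jet_sq_int that)
    show "0 \<le> B (jet f) (jet f)" if "lat_test \<Omega> f" for f
      using \<kappa>(2)[OF that] \<kappa>(1) by (meson less_imp_le mult_nonneg_nonneg order_trans zero_le_power2)
    show "\<bar>l f\<bar> \<le> d_s s * (l2n (MO \<Omega>) q * (C * sqrt (1 / \<kappa>))) * sqrt (B (jet f) (jet f))" if "lat_test \<Omega> f" for f
    proof -
      have "\<bar>\<integral>x. q x * f (x, 0) \<partial>MO \<Omega>\<bar> \<le> l2n (MO \<Omega>) q * l2n (MO \<Omega>) (\<lambda>x. f (x, 0))"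
        using l2_inner(2)[OF q' trace_sq_int[OF that]] by simp
      also have "\<dots> \<le> l2n (MO \<Omega>) q * (C * (sqrt (1 / \<kappa>) * sqrt (B (jet f) (jet f))))"
        by (intro mult_left_mono order_trans[OF C(2)[OF that]] l2n_le that C) auto
      finally have "d_s s * \<bar>\<integral>x. q x * f (x, 0) \<partial>MO \<Omega>\<bar>
          \<le> d_s s * (l2n (MO \<Omega>) q * (C * (sqrt (1 / \<kappa>) * sqrt (B (jet f) (jet f)))))"
        using ds_pos by (intro mult_left_mono) auto
      then show ?thesis using ds_pos by (simp add: l_def abs_mult mult_ac)
    qed
  qed blast
  have jd: "jet (comb (u i) (-1) (u j)) = (\<lambda>p. jet (u i) p - jet (u j) p)" for i j
    using jc[OF u(1) u(1), of i "-1" j] by simp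
  have lc: "lat_test \<Omega> (comb (u i) (-1) (u j))" for i j
    using u(1) unfolding lat_test_def comb_def by (intro test_fn_add test_fn_cmult) auto
  have "\<exists>F. sq_int M F \<and> (\<lambda>j. l2n M (\<lambda>p. F p - jet (u j) p)) \<longlonglongrightarrow> 0"
  proof (rule l2_complete)
    show "sq_int M (jet (u j))" for j by (rule jet_sq_int[OF u(1)])
    fix e :: real assume e: "e > 0"
    obtain N where N: "\<And>i j. i \<ge> N \<Longrightarrow> j \<ge> N \<Longrightarrow>
        B (jet (comb (u i) (-1) (u j))) (jet (comb (u i) (-1) (u j))) < \<kappa> * e\<^sup>2"
      using u(2)[of "\<kappa> * e\<^sup>2"] e \<kappa>(1) by auto
    have "l2n M (\<lambda>p. jet (u i) p - jet (u j) p) < e" if "i \<ge> N" "j \<ge> N" for i j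
    proof -
      have "\<kappa> * (l2n M (jet (comb (u i) (-1) (u j))))\<^sup>2 < \<kappa> * e\<^sup>2"
        using \<kappa>(2)[OF lc] N[OF that] by (rule le_less_trans)
      then have "(l2n M (\<lambda>p. jet (u i) p - jet (u j) p))\<^sup>2 < e\<^sup>2"
        using \<kappa>(1) by (simp add: jd)
      then show ?thesis by (rule power2_less_imp_less) (use e in simp)
    qed
    then show "\<exists>N. \<forall>i\<ge>N. \<forall>j\<ge>N. l2n M (\<lambda>p. jet (u i) p - jet (u j) p) < e" by blast
  qed
  then obtain F where F: "sq_int M F" "(\<lambda>j. l2n M (\<lambda>p. F p - jet (u j) p)) \<longlonglongrightarrow> 0" by blast
  have BF: "B F (jet g) = l g" if g: "lat_test \<Omega> g" for g
    using LIMSEQ_unique[OF B_conv(1)[OF F(1) jet_sq_int[OF g] jet_sq_int[OF u(1)] F(2)] u(3)[OF g]] .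
  have "ext_state \<Omega> A c s q (\<lambda>p. fst (F p))"
    unfolding ext_state_def
  proof (intro exI conjI allI impI)
    show "HL \<Omega> (1 - 2 * s) (\<lambda>p. fst (F p)) (\<lambda>p. snd (F p))"
      by (rule jet_limit_HL[OF open_Omega s u(1) F])
    fix v G t assume "HL \<Omega> (1 - 2 * s) v G \<and> trace_of \<Omega> (1 - 2 * s) v t"
    then have HL: "HL \<Omega> (1 - 2 * s) v G" and tr: "trace_of \<Omega> (1 - 2 * s) v t" by auto
    obtain \<psi> where \<psi>: "\<And>j. lat_test \<Omega> (\<psi> j)" "v \<in> borel_measurable borel" "G \<in> borel_measurable borel"
      "sq_int M (\<lambda>p. (v p, G p))" "(\<lambda>j. l2n M (\<lambda>p. (v p, G p) - jet (\<psi> j) p)) \<longlonglongrightarrow> 0"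
      using HL_sequence[OF HL] by blast
    obtain G' \<psi>' where \<psi>': "\<And>j. lat_test \<Omega> (\<psi>' j)" "sq_int M (\<lambda>p. (v p, G' p))"
      "(\<lambda>j. l2n M (\<lambda>p. (v p, G' p) - jet (\<psi>' j) p)) \<longlonglongrightarrow> 0"
      "sq_int (MO \<Omega>) t" "(\<lambda>j. l2n (MO \<Omega>) (\<lambda>x. t x - \<psi>' j (x, 0))) \<longlonglongrightarrow> 0"
      using trace_ofE[OF tr] by blast
    \<comment> \<open>The trace \<open>t\<close> was given along \<psi>', possibly with another
      gradient; it must be reached along the sequence \<psi> that approximates the gradient
      \<open>G\<close> appearing in the form.\<close>
    have "(\<lambda>j. l2n (MO \<Omega>) (\<lambda>x. t x - \<psi> j (x, 0))) \<longlonglongrightarrow> 0"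
      by (rule trace_unique[OF Omega_borel s \<psi>(1) \<psi>'(1) \<psi>(4) \<psi>'(2) \<psi>(5) \<psi>'(3-5)])
    from MO_inner_conv[OF q' \<psi>'(4) trace_sq_int[OF \<psi>(1)] this]
    have "(\<lambda>j. l (\<psi> j)) \<longlonglongrightarrow> d_s s * (\<integral>x. q x * t x \<partial>MO \<Omega>)"
      unfolding l_def by (rule tendsto_mult_left)
    moreover have "(\<lambda>j. l (\<psi> j)) \<longlonglongrightarrow> B F (\<lambda>p. (v p, G p))"
      using B_conv(2)[OF \<psi>(4) F(1) jet_sq_int[OF \<psi>(1)] \<psi>(5)] BF[OF \<psi>(1)] by simp
    ultimately have "B F (\<lambda>p. (v p, G p)) = d_s s * (\<integral>x. q x * t x \<partial>MO \<Omega>)"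
      by (metis LIMSEQ_unique)
    moreover have "F \<in> borel_measurable borel" using F by (simp add: sq_int_def)
    ultimately show "a_ext \<Omega> A c s (\<lambda>p. fst (F p)) (\<lambda>p. snd (F p)) v G = set_lebesgue_integral lborel \<Omega> (\<lambda>x. q x * t x)"
      using q' \<psi>'(4) \<psi>(2,3) ds_pos
      by (subst a_ext_eq_B) (auto simp: sq_int_def set_lint_MO)
  qed
  then show ?thesis using that by blast
qed

end

subsection \<open>Gaussian integrals\<close>

lemma has_bochner_integral_of_HK:
  fixes f :: "real \<Rightarrow> real"
  assumes [measurable]: "f \<in> borel_measurable borel" "S \<in> sets borel" and nn: "\<And>x. x \<in> S \<Longrightarrow> 0 \<le> f x"
    and I: "(f has_integral I) S"
  shows "has_bochner_integral lborel (\<lambda>x. indicat_real S x * f x) I"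
proof (rule has_bochner_integral_nn_integral)
  show "(\<integral>\<^sup>+x. ennreal (indicat_real S x * f x) \<partial>lborel) = ennreal I"
    using nn_integral_has_integral_lebesgue[OF nn I] by simp
  show "0 \<le> I" by (rule has_integral_nonneg[OF I nn])
qed (use nn in \<open>auto simp: indicator_def\<close>)

text \<open>The endpoint 0 is removed because the substitutions below are bijections of the open
  half line.\<close>

lemma Gamma_absolutely_integrable:
  assumes "b > (0::real)"
  shows "(\<lambda>u. u powr (b - 1) / exp u) absolutely_integrable_on {0<..}"
    "integral {0<..} (\<lambda>u. u powr (b - 1) / exp u) = Gamma b"
proof -
  have "((\<lambda>t. t powr (b - 1) / exp t) has_integral Gamma b) {0<..}"
  proof (rule has_integral_spike_set_eq[THEN iffD1, OF _ _ Gamma_integral_real[OF assms]])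
    show "negligible {x \<in> {0..} - {0<..}. x powr (b - 1) / exp x \<noteq> 0}"
      by (rule negligible_subset[of "{0}"]) auto
    show "negligible {x \<in> {0<..} - {0..}. x powr (b - 1) / exp x \<noteq> 0}"
      by (rule negligible_subset[of "{0}"]) auto
  qed
  then show "(\<lambda>u. u powr (b - 1) / exp u) absolutely_integrable_on {0<..}"
    "integral {0<..} (\<lambda>u. u powr (b - 1) / exp u) = Gamma b"
    by (auto intro!: nonnegative_absolutely_integrable_1 simp: has_integral_integrable integral_unique)
qed

lemma gamma_scaled:
  assumes b: "b > (0::real)" and l: "l > 0"
  shows "has_bochner_integral lborel (\<lambda>t. indicat_real {0<..} t * (t powr (b - 1) * exp (- l * t))) (Gamma b / l powr b)"
proof -
  have img: "(\<lambda>t. l * t) ` {0<..} = {0<..}"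
    using l by (force intro: image_eqI[of _ _ "_ / l"])
  have "(\<lambda>t. \<bar>l\<bar> * ((l * t) powr (b - 1) / exp (l * t))) absolutely_integrable_on {0<..} \<and>
      integral {0<..} (\<lambda>t. \<bar>l\<bar> * ((l * t) powr (b - 1) / exp (l * t))) = Gamma b"
    by (subst has_absolute_integral_change_of_variables_1'[where g = "\<lambda>t. l * t" and f = "\<lambda>u. u powr (b - 1) / exp u"])
       (use l Gamma_absolutely_integrable[OF b] in \<open>auto simp: img inj_on_def intro!: derivative_eq_intros\<close>)
  then have "((\<lambda>t. \<bar>l\<bar> * ((l * t) powr (b - 1) / exp (l * t))) has_integral Gamma b) {0<..}"
    by (simp only: has_integral_iff absolutely_integrable_on_def)
  then have "((\<lambda>t. (\<bar>l\<bar> * ((l * t) powr (b - 1) / exp (l * t))) / l powr b) has_integral Gamma b / l powr b) {0<..}"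
    by (rule has_integral_divide)
  then have "((\<lambda>t. t powr (b - 1) * exp (- l * t)) has_integral Gamma b / l powr b) {0<..}"
  proof (rule has_integral_eq[rotated])
    fix t :: real assume t: "t \<in> {0<..}"
    have "l powr b = l * l powr (b - 1)" using l by (simp add: powr_diff)
    then show "\<bar>l\<bar> * ((l * t) powr (b - 1) / exp (l * t)) / l powr b = t powr (b - 1) * exp (- l * t)"
      using l t by (simp add: powr_mult exp_minus field_simps)
  qed
  then show ?thesis by (intro has_bochner_integral_of_HK) auto
qed

text \<open>Substitute u = a y^2 in Euler's integral; the Jacobian 2 a y turns the exponent b - 1 of
  u into 2 b - 1 = \<beta> for y.\<close>

lemma gauss_moment:
  assumes \<beta>: "\<beta> > (-1::real)" and a: "a > 0"
  shows "has_bochner_integral lborel (\<lambda>y. indicat_real {0<..} y * (y powr \<beta> * exp (- a * y\<^sup>2)))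
     (Gamma ((\<beta> + 1) / 2) / (2 * a powr ((\<beta> + 1) / 2)))"
proof -
  define b where "b = (\<beta> + 1) / 2"
  have b: "b > 0" using \<beta> by (simp add: b_def)
  have img: "(\<lambda>y::real. a * y\<^sup>2) ` {0<..} = {0<..}"
  proof (intro equalityI subsetI)
    fix u :: real assume "u \<in> {0<..}"
    then show "u \<in> (\<lambda>y. a * y\<^sup>2) ` {0<..}" using a by (intro image_eqI[of _ _ "sqrt (u / a)"]) auto
  qed (use a in auto)
  have inj: "inj_on (\<lambda>y::real. a * y\<^sup>2) {0<..}"
    using a by (auto simp: inj_on_def power2_eq_iff)
  have "(\<lambda>y. \<bar>2 * a * y\<bar> * ((a * y\<^sup>2) powr (b - 1) / exp (a * y\<^sup>2))) absolutely_integrable_on {0<..} \<and>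
      integral {0<..} (\<lambda>y. \<bar>2 * a * y\<bar> * ((a * y\<^sup>2) powr (b - 1) / exp (a * y\<^sup>2))) = Gamma b"
    by (subst has_absolute_integral_change_of_variables_1'[where g = "\<lambda>y. a * y\<^sup>2" and f = "\<lambda>u. u powr (b - 1) / exp u"])
       (use Gamma_absolutely_integrable[OF b] inj in \<open>auto simp: img intro!: derivative_eq_intros\<close>)
  then have "((\<lambda>y. \<bar>2 * a * y\<bar> * ((a * y\<^sup>2) powr (b - 1) / exp (a * y\<^sup>2))) has_integral Gamma b) {0<..}"
    by (simp only: has_integral_iff absolutely_integrable_on_def)
  then have "((\<lambda>y. (\<bar>2 * a * y\<bar> * ((a * y\<^sup>2) powr (b - 1) / exp (a * y\<^sup>2))) / (2 * a powr b)) has_integral Gamma b / (2 * a powr b)) {0<..}"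
    by (rule has_integral_divide)
  then have "((\<lambda>y. y powr \<beta> * exp (- a * y\<^sup>2)) has_integral Gamma b / (2 * a powr b)) {0<..}"
  proof (rule has_integral_eq[rotated])
    fix y :: real assume y: "y \<in> {0<..}"
    have 1: "a powr b = a * a powr (b - 1)" using a by (simp add: powr_diff)
    have "\<beta> = 1 + 2 * (b - 1)" unfolding b_def by argo
    then have "y powr \<beta> = y powr (1 + 2 * (b - 1))" by simp
    also have "\<dots> = y * (y\<^sup>2) powr (b - 1)"
    proof -
      have "(y\<^sup>2) powr (b - 1) = y powr (2 * (b - 1))" using powr_powr[of y 2 "b - 1"] y by simp
      then show ?thesis using y by (simp only: powr_add) simp
    qed
    finally show "\<bar>2 * a * y\<bar> * ((a * y\<^sup>2) powr (b - 1) / exp (a * y\<^sup>2)) / (2 * a powr b) = y powr \<beta> * exp (- a * y\<^sup>2)"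
      using a y 1 by (simp add: powr_mult exp_minus field_simps)
  qed
  then show ?thesis unfolding b_def[symmetric] by (intro has_bochner_integral_of_HK) auto
qed

lemma has_bochner_integral_MY:
  fixes f :: "real \<Rightarrow> real"
  assumes [measurable]: "f \<in> borel_measurable borel"
  shows "has_bochner_integral (MY \<alpha>) f I \<longleftrightarrow> has_bochner_integral lborel (\<lambda>y. indicat_real {0<..} y * y powr \<alpha> * f y) I"
  unfolding MY_def has_bochner_integral_iff by (subst integrable_density integral_density; simp)+

text \<open>Used for n = 0, 1, 2: mass and first moment of the profile for small t, and the norms of
  the profile and its derivative.\<close>

lemma gauss_MY:
  assumes \<alpha>: "\<alpha> > (-1::real)" and a: "a > 0"
  shows "has_bochner_integral (MY \<alpha>) (\<lambda>y. y ^ n * exp (- a * y\<^sup>2))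
     (Gamma ((\<alpha> + n + 1) / 2) / (2 * a powr ((\<alpha> + n + 1) / 2)))"
proof (subst has_bochner_integral_MY)
  have "indicat_real {0<..} y * (y powr (\<alpha> + n) * exp (- a * y\<^sup>2)) = indicat_real {0<..} y * y powr \<alpha> * (y ^ n * exp (- a * y\<^sup>2))" for y :: real
    by (cases "y > 0") (auto simp: powr_add powr_realpow)
  then show "has_bochner_integral lborel (\<lambda>y. indicat_real {0<..} y * y powr \<alpha> * (y ^ n * exp (- a * y\<^sup>2)))
      (Gamma ((\<alpha> + n + 1) / 2) / (2 * a powr ((\<alpha> + n + 1) / 2)))"
    using gauss_moment[of "\<alpha> + n" a] \<alpha> a by (simp only: add.assoc)
qed simp

text \<open>The unnormalized heat profile; \<open>gauss'\<close> below is its y-derivative.\<close>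

definition gauss :: "real \<Rightarrow> real \<Rightarrow> real" where "gauss t y = exp (- (1 / (4 * t)) * y\<^sup>2)"
definition gauss' :: "real \<Rightarrow> real \<Rightarrow> real" where "gauss' t y = - (y / (2 * t)) * gauss t y"

lemma gauss_borel [measurable]: "gauss t \<in> borel_measurable borel" "gauss' t \<in> borel_measurable borel"
  unfolding gauss_def gauss'_def by measurable

lemma gauss_continuous: "continuous_on S (gauss t)" "continuous_on S (gauss' t)"
  unfolding gauss_def gauss'_def divide_inverse by (intro continuous_intros)+

lemma gauss_deriv: "(gauss t has_real_derivative gauss' t y) (at y)"
proof -
  have "((\<lambda>y. exp (- r * y\<^sup>2)) has_real_derivative - (2 * r * y) * exp (- r * y\<^sup>2)) (at y)" for r :: real
    by (auto intro!: derivative_eq_intros)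
  from this[of "1 / (4 * t)"] have "(gauss t has_real_derivative - (2 * (1 / (4 * t)) * y) * gauss t y) (at y)"
    unfolding gauss_def .
  moreover have "- (2 * (1 / (4 * t)) * y) * gauss t y = gauss' t y" by (simp add: gauss'_def)
  ultimately show ?thesis by simp
qed

lemma gauss_nonneg [simp]: "gauss t y \<ge> 0" by (simp add: gauss_def)
lemma gauss_le_1: "t > 0 \<Longrightarrow> gauss t y \<le> 1" by (simp add: gauss_def)

lemma gauss_sq: "(gauss t y)\<^sup>2 = exp (- (1 / (2 * t)) * y\<^sup>2)"
  unfolding gauss_def power2_eq_square exp_add[symmetric] by (rule arg_cong[where f = exp]) (simp add: field_simps)

text \<open>The explicit rate matters: it will be integrated in t against t powr (s - 1) * exp (-
  lam k * t). The singularity t powr (- s / 2) at 0 leaves t powr (s / 2 - 1), which is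
  integrable.\<close>

lemma gauss_pair_sq_int:
  assumes s: "0 < s" "s < (1::real)"
  obtains C where "C \<ge> 0" "\<And>t. t > 0 \<Longrightarrow> sq_int (MY (1 - 2 * s)) (\<lambda>y. (gauss t y, gauss' t y)) \<and>
     l2n (MY (1 - 2 * s)) (\<lambda>y. (gauss t y, gauss' t y)) \<le> C * ((1 + t) * t powr (- s / 2))"
proof -
  \<comment> \<open>Moments with rate a = 1 / (2 t), the exponent being doubled by squaring:
    \<open>c1\<close> belongs to the profile, \<open>c2\<close> to its derivative, including the
    factor 1 / (4 t^2).\<close>
  define c1 where "c1 = Gamma (1 - s) / 2 * 2 powr (1 - s)"
  define c2 where "c2 = Gamma (2 - s) / 8 * 2 powr (2 - s)"
  have c: "c1 \<ge> 0" "c2 \<ge> 0" using s by (auto simp: c1_def c2_def intro!: mult_nonneg_nonneg divide_nonneg_nonneg less_imp_le[OF Gamma_real_pos])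
  define C where "C = sqrt (c1 + c2)"
  have main: "sq_int (MY (1 - 2 * s)) (\<lambda>y. (gauss t y, gauss' t y)) \<and>
     l2n (MY (1 - 2 * s)) (\<lambda>y. (gauss t y, gauss' t y)) \<le> C * ((1 + t) * t powr (- s / 2))" if t: "t > 0" for t
  proof -
    let ?N = "MY (1 - 2 * s)"
    define a where "a = 1 / (2 * t)"
    have a: "a > 0" using t by (simp add: a_def)
    have 0: "has_bochner_integral ?N (\<lambda>y. y ^ 0 * exp (- a * y\<^sup>2)) (Gamma (1 - s) / (2 * a powr (1 - s)))"
      using gauss_MY[of "1 - 2 * s" a 0] s a by (simp add: diff_divide_distrib)
    have 2: "has_bochner_integral ?N (\<lambda>y. y ^ 2 * exp (- a * y\<^sup>2)) (Gamma (2 - s) / (2 * a powr (2 - s)))"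
      using gauss_MY[of "1 - 2 * s" a 2] s a by (simp add: diff_divide_distrib)
    have sq: "(norm (gauss t y, gauss' t y))\<^sup>2 = y ^ 0 * exp (- a * y\<^sup>2) + 1 / (4 * t\<^sup>2) * (y ^ 2 * exp (- a * y\<^sup>2))" for y
      using t by (simp add: norm_Pair gauss'_def power_mult_distrib gauss_sq a_def power_divide)
    have I: "has_bochner_integral ?N (\<lambda>y. (norm (gauss t y, gauss' t y))\<^sup>2)
       (Gamma (1 - s) / (2 * a powr (1 - s)) + 1 / (4 * t\<^sup>2) * (Gamma (2 - s) / (2 * a powr (2 - s))))"
      unfolding sq by (intro has_bochner_integral_add has_bochner_integral_mult_right 0 2)
    then have si: "sq_int ?N (\<lambda>y. (gauss t y, gauss' t y))"
      by (auto simp: sq_int_iff has_bochner_integral_iff)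
    have p1: "1 / a powr (1 - s) = 2 powr (1 - s) * t powr (1 - s)"
      using t by (simp add: a_def powr_divide powr_mult)
    have p2: "1 / (4 * t\<^sup>2) * (1 / a powr (2 - s)) = 2 powr (2 - s) / 4 * t powr (- s)"
    proof -
      have "t powr (2 - s) = t\<^sup>2 * t powr (- s)"
        using t by (simp add: powr_diff powr_minus divide_inverse)
      then show ?thesis using t by (simp add: a_def powr_divide powr_mult field_simps)
    qed
    have "(l2n ?N (\<lambda>y. (gauss t y, gauss' t y)))\<^sup>2 = Gamma (1 - s) / 2 * (1 / a powr (1 - s)) + Gamma (2 - s) / 2 * (1 / (4 * t\<^sup>2) * (1 / a powr (2 - s)))"
      using I by (simp add: l2n_sq has_bochner_integral_iff)
    also have "\<dots> = c1 * t powr (1 - s) + c2 * t powr (- s)"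
      unfolding p1 p2 c1_def c2_def by simp
    also have "t powr (1 - s) = t * t powr (- s)"
      using t powr_add[of t 1 "- s"] by simp
    \<comment> \<open>(1 + t)^2 dominates both t and 1, so a single bound covers small and large
      t.\<close>
    also have "c1 * (t * t powr (- s)) + c2 * t powr (- s) \<le> (c1 + c2) * ((1 + t)\<^sup>2 * t powr (- s))"
    proof -
      have "t \<le> (1 + t)\<^sup>2" "1 \<le> (1 + t)\<^sup>2" using t by (auto simp: power2_eq_square algebra_simps)
      then have "c1 * (t * t powr (- s)) \<le> c1 * ((1 + t)\<^sup>2 * t powr (- s))"
        "c2 * (1 * t powr (- s)) \<le> c2 * ((1 + t)\<^sup>2 * t powr (- s))"
        using c by (intro mult_left_mono mult_right_mono; simp)+
      then show ?thesis by (simp add: distrib_right)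
    qed
    also have "\<dots> = (C * ((1 + t) * t powr (- s / 2)))\<^sup>2"
    proof -
      have "t powr (- s) = (t powr (- s / 2))\<^sup>2"
        using t by (simp add: power2_eq_square powr_add[symmetric])
      then show ?thesis using c by (simp add: C_def power_mult_distrib)
    qed
    finally have "l2n ?N (\<lambda>y. (gauss t y, gauss' t y)) \<le> C * ((1 + t) * t powr (- s / 2))"
      by (rule power2_le_imp_le) (use c t in \<open>auto simp: C_def\<close>)
    with si show ?thesis by blast
  qed
  show ?thesis by (rule that[OF _ main]) (use c in \<open>auto simp: C_def\<close>)
qed

lemma integrable_MY_compact:
  fixes g :: "real \<Rightarrow> real"
  assumes \<alpha>: "\<alpha> > -1" and g: "continuous_on UNIV g" and z: "\<And>y. b < y \<Longrightarrow> g y = 0"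
  shows "integrable (MY \<alpha>) g"
proof -
  have [measurable]: "g \<in> borel_measurable borel" by (rule borel_measurable_continuous_onI[OF g])
  have "bounded (g ` {0..max b 0})"
    by (intro compact_imp_bounded compact_continuous_image continuous_on_subset[OF g]) auto
  then have "\<exists>C. \<forall>y\<in>{0..max b 0}. \<bar>g y\<bar> \<le> C" by (auto simp: bounded_iff)
  then obtain C where C: "\<And>y. y \<in> {0..max b 0} \<Longrightarrow> \<bar>g y\<bar> \<le> C" by blast
  have C0: "C \<ge> 0" using C[of 0] by simp
  have "integrable (MY \<alpha>) (indicat_real {..b})"
  proof -
    have "(\<lambda>y. (norm (indicat_real {..b} y))\<^sup>2) = indicat_real {..b}"
      by (auto simp: fun_eq_iff split: split_indicator)
    then show ?thesis using sq_int_indicator_MY[OF \<alpha>, of b] by (simp only: sq_int_iff)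
  qed
  then have i: "integrable (MY \<alpha>) (\<lambda>y. C * indicat_real {..b} y)" by simp
  show ?thesis
  proof (rule Bochner_Integration.integrable_bound[OF i])
    have "0 < y \<longrightarrow> norm (g y) \<le> norm (C * indicat_real {..b} y)" for y
      using C[of y] C0 z[of y] by (cases "y \<le> b") auto
    then show "AE y in MY \<alpha>. norm (g y) \<le> norm (C * indicat_real {..b} y)"
      by (subst AE_MY) auto
  qed simp
qed

text \<open>Integrate the derivative of y powr (2 - 2 s) * gauss t y * f y. The extra factor y
  contained in \<open>gauss'\<close> raises the weight to the positive power 2 - 2 s, so nothing is
  left at y = 0 whatever f 0 is.\<close>

lemma gauss_parts:
  assumes s: "0 < s" "s < 1" and t: "t > (0::real)"
    and D: "\<And>y. (f has_real_derivative f' y) (at y)" and c: "continuous_on UNIV f'"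
    and z: "\<And>y. b < y \<Longrightarrow> f y = 0" "\<And>y. b < y \<Longrightarrow> f' y = 0"
  shows "(\<integral>y. gauss' t y * f' y \<partial>MY (1 - 2 * s)) = (\<integral>y. ((1 - s) / t - y\<^sup>2 / (4 * t\<^sup>2)) * gauss t y * f y \<partial>MY (1 - 2 * s))"
proof -
  let ?\<alpha> = "1 - 2 * s"
  have a: "?\<alpha> > -1" using s by simp
  have fc: "continuous_on UNIV f"
    using D DERIV_isCont by (blast intro: continuous_at_imp_continuous_on)
  define E where "E y = (2 - 2 * s - y\<^sup>2 / (2 * t)) * gauss t y * f y + y * gauss t y * f' y" for y
  have Ec: "continuous_on UNIV E"
    unfolding E_def using t by (intro continuous_intros gauss_continuous fc c) auto
  have Ez: "E y = 0" if "max b 0 + 1 < y" for y using z[of y] that by (simp add: E_def)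
  have Ei: "integrable (MY ?\<alpha>) E" by (rule integrable_MY_compact[OF a Ec Ez])
  have [measurable]: "E \<in> borel_measurable borel" by (rule borel_measurable_continuous_onI[OF Ec])
  define P where "P y = y powr (2 - 2 * s) * (gauss t y * f y)" for y
  define d where "d = max b 0 + 2"
  \<comment> \<open>Only interior derivatives are used: the integrand may be singular at 0, while
    the primitive \<open>P\<close> is continuous there because 2 - 2 s > 0.\<close>
  have hk: "((\<lambda>y. y powr ?\<alpha> * E y) has_integral (P d - P 0)) {0..d}"
  proof (rule fundamental_theorem_of_calculus_interior)
    show "continuous_on {0..d} P"
      unfolding P_def using s by (intro continuous_on_mult continuous_on_powr' continuous_intros gauss_continuous continuous_on_subset[OF fc]) auto
    fix y assume "y \<in> {0<..<d}"
    then have y: "y > 0" by simp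
    have "(P has_real_derivative (2 - 2 * s) * y powr (2 - 2 * s - 1) * (gauss t y * f y) + (gauss' t y * f y + f' y * gauss t y) * y powr (2 - 2 * s)) (at y)"
      unfolding P_def
      by (rule DERIV_mult[OF has_real_derivative_powr[OF y] DERIV_mult[OF gauss_deriv D]])
    moreover have "y powr (2 - 2 * s) = y powr ?\<alpha> * y" using y powr_add[of y ?\<alpha> 1] by simp
    moreover have "2 - 2 * s - 1 = ?\<alpha>" by simp
    ultimately have "(P has_real_derivative y powr ?\<alpha> * E y) (at y)"
      by (simp add: E_def gauss'_def power2_eq_square algebra_simps)
    then show "(P has_vector_derivative y powr ?\<alpha> * E y) (at y)"
      by (simp add: has_real_derivative_iff_has_vector_derivative)
  qed (simp add: d_def)
  have "P d - P 0 = 0" using z[of d] s by (simp add: P_def d_def)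
  with hk have "((\<lambda>y. if y \<in> {0..d} then y powr ?\<alpha> * E y else 0) has_integral 0) UNIV"
    by (simp only: has_integral_restrict_UNIV)
  moreover have "(\<lambda>y. if y \<in> {0..d} then y powr ?\<alpha> * E y else 0) = (\<lambda>y. indicat_real {0<..} y * y powr ?\<alpha> * E y)"
  proof
    fix y show "(if y \<in> {0..d} then y powr ?\<alpha> * E y else 0) = indicat_real {0<..} y * y powr ?\<alpha> * E y"
      using Ez[of y] by (cases "y = 0") (auto simp: d_def indicator_def)
  qed
  ultimately have h0: "((\<lambda>y. indicat_real {0<..} y * y powr ?\<alpha> * E y) has_integral 0) UNIV" by simp
  have bi: "has_bochner_integral lborel (\<lambda>y. indicat_real {0<..} y * y powr ?\<alpha> * E y) (\<integral>y. E y \<partial>MY ?\<alpha>)"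
    using Ei by (subst has_bochner_integral_MY[symmetric]) (auto simp: has_bochner_integral_iff)
  have "((\<lambda>y. indicat_real {0<..} y * y powr ?\<alpha> * E y) has_integral (\<integral>y. E y \<partial>MY ?\<alpha>)) UNIV"
    using has_integral_integral_lborel[of "\<lambda>y. indicat_real {0<..} y * y powr ?\<alpha> * E y"] bi
    by (simp add: has_bochner_integral_iff)
  with h0 have E0: "(\<integral>y. E y \<partial>MY ?\<alpha>) = 0" using has_integral_unique by blast
  have i1: "integrable (MY ?\<alpha>) (\<lambda>y. gauss' t y * f' y)"
    by (rule integrable_MY_compact[OF a, where b = b]) (use z in \<open>auto intro!: continuous_intros gauss_continuous c\<close>)
  have i2: "integrable (MY ?\<alpha>) (\<lambda>y. ((1 - s) / t - y\<^sup>2 / (4 * t\<^sup>2)) * gauss t y * f y)"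
    by (rule integrable_MY_compact[OF a, where b = b]) (use z t in \<open>auto intro!: continuous_intros gauss_continuous fc\<close>)
  have "(\<lambda>y. ((1 - s) / t - y\<^sup>2 / (4 * t\<^sup>2)) * gauss t y * f y - gauss' t y * f' y) = (\<lambda>y. 1 / (2 * t) * E y)"
    using t by (simp add: fun_eq_iff E_def gauss'_def field_simps power2_eq_square)
  then have "(\<integral>y. ((1 - s) / t - y\<^sup>2 / (4 * t\<^sup>2)) * gauss t y * f y - gauss' t y * f' y \<partial>MY ?\<alpha>) = 0"
    using E0 by simp
  then show ?thesis using i1 i2 by simp
qed

lemma l2n_dominated:
  fixes f :: "nat \<Rightarrow> 'a \<Rightarrow> 'b::real_normed_vector"
  assumes g: "sq_int M g" and f: "\<And>i. f i \<in> borel_measurable M" and K: "K \<ge> 0"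
    and b: "\<And>i x. norm (f i x) \<le> K * norm (g x)" and lim: "\<And>x. (\<lambda>i. f i x) \<longlonglongrightarrow> 0"
  shows "(\<lambda>i. l2n M (f i)) \<longlonglongrightarrow> 0"
proof -
  have "(\<lambda>i. \<integral>x. (norm (f i x))\<^sup>2 \<partial>M) \<longlonglongrightarrow> (\<integral>x. 0 \<partial>M)"
  proof (rule integral_dominated_convergence)
    show "integrable M (\<lambda>x. K\<^sup>2 * (norm (g x))\<^sup>2)" using g by (simp add: sq_int_iff)
    show "AE x in M. (\<lambda>i. (norm (f i x))\<^sup>2) \<longlonglongrightarrow> 0"
      using tendsto_power[OF tendsto_norm_zero[OF lim], where n = 2] by simp
    show "AE x in M. norm ((norm (f i x))\<^sup>2) \<le> K\<^sup>2 * (norm (g x))\<^sup>2" for i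
      using power_mono[OF b[of i] norm_ge_zero, where n = 2] by (simp add: power_mult_distrib)
  qed (use f in auto)
  from tendsto_real_sqrt[OF this] show ?thesis by (simp add: l2n_def)
qed

text \<open>The bracket is precisely the factor that the bilinear form produces in
  \<open>B_gauss\<close>; multiplied by the Gamma weight it is a total t-derivative.\<close>

lemma gauss_t_deriv:
  assumes t: "t > 0"
  shows "((\<lambda>t. - (t powr (s - 1) * exp (- l * t) * gauss t y)) has_real_derivative
      t powr (s - 1) * exp (- l * t) * ((l + (1 - s) / t - y\<^sup>2 / (4 * t\<^sup>2)) * gauss t y)) (at t)"
proof -
  have g: "((\<lambda>t. gauss t y) has_real_derivative y\<^sup>2 / (4 * t\<^sup>2) * gauss t y) (at t)"
    unfolding gauss_def using t by (auto intro!: derivative_eq_intros simp: field_simps power2_eq_square)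
  have p: "((\<lambda>t. t powr (s - 1)) has_real_derivative (s - 1) / t * t powr (s - 1)) (at t)"
    by (rule DERIV_cong[OF has_real_derivative_powr[OF t]]) (use t in \<open>simp add: powr_diff power2_eq_square\<close>)
  have e: "((\<lambda>t. exp (- l * t)) has_real_derivative - l * exp (- l * t)) (at t)"
    by (auto intro!: derivative_eq_intros)
  show ?thesis
    by (rule DERIV_cong[OF DERIV_minus[OF DERIV_mult[OF DERIV_mult[OF p e] g]]])
       (simp add: algebra_simps diff_divide_distrib)
qed

lemma gauss_t_integral:
  assumes d: "0 < \<delta>" "\<delta> \<le> T"
  shows "(\<integral>t. indicat_real {\<delta>..T} t * (t powr (s - 1) * exp (- l * t) * ((l + (1 - s) / t - y\<^sup>2 / (4 * t\<^sup>2)) * gauss t y)) \<partial>lborel)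
    = \<delta> powr (s - 1) * exp (- l * \<delta>) * gauss \<delta> y - T powr (s - 1) * exp (- l * T) * gauss T y"
proof -
  let ?g = "\<lambda>t. t powr (s - 1) * exp (- l * t) * ((l + (1 - s) / t - y\<^sup>2 / (4 * t\<^sup>2)) * gauss t y)"
  have "(\<integral>t. ?g t * indicator {\<delta>..T} t \<partial>lborel) =
     - (T powr (s - 1) * exp (- l * T) * gauss T y) - - (\<delta> powr (s - 1) * exp (- l * \<delta>) * gauss \<delta> y)"
  proof (rule integral_FTC_Icc_real[OF d(2)])
    fix t assume "\<delta> \<le> t" "t \<le> T"
    then have t: "t > 0" using d by simp
    show "((\<lambda>t. - (t powr (s - 1) * exp (- l * t) * gauss t y)) has_real_derivative ?g t) (at t)"
      by (rule gauss_t_deriv[OF t])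
    show "isCont ?g t"
      unfolding gauss_def using t by (intro continuous_intros) auto
  qed
  then show ?thesis by (simp add: mult.commute)
qed

subsection \<open>Eigenfunctions\<close>

lemma l2n_conv:
  fixes F :: "'a \<Rightarrow> 'b::euclidean_space"
  assumes F: "sq_int M F" and f: "\<And>j. sq_int M (f j)"
    and lim: "(\<lambda>j. l2n M (\<lambda>x. F x - f j x)) \<longlonglongrightarrow> 0"
  shows "(\<lambda>j. l2n M (f j)) \<longlonglongrightarrow> l2n M F"
proof (rule LIM_zero_cancel, rule Lim_null_comparison[OF _ lim], intro always_eventually allI)
  fix j
  have "l2n M (f j) \<le> l2n M F + l2n M (\<lambda>x. F x - f j x)"
    using sq_int_diff(2)[OF F sq_int_diff(1)[OF F f[of j]]] by simp
  moreover have "l2n M F \<le> l2n M (f j) + l2n M (\<lambda>x. F x - f j x)"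
    using sq_int_add(2)[OF f[of j] sq_int_diff(1)[OF F f[of j]]] by simp
  ultimately show "norm (l2n M (f j) - l2n M F) \<le> l2n M (\<lambda>x. F x - f j x)" by simp
qed

lemma integral_MC:
  fixes f :: "(real^'n) \<times> real \<Rightarrow> real"
  assumes \<Omega>: "\<Omega> \<in> sets borel" and f: "integrable (MC \<Omega> \<alpha>) f"
  shows "(\<integral>p. f p \<partial>MC \<Omega> \<alpha>) = (\<integral>x. (\<integral>y. f (x, y) \<partial>MY \<alpha>) \<partial>MO \<Omega>)"
    "(\<integral>p. f p \<partial>MC \<Omega> \<alpha>) = (\<integral>y. (\<integral>x. f (x, y) \<partial>MO \<Omega>) \<partial>MY \<alpha>)"
proof -
  interpret pair_sigma_finite "MO \<Omega>" "MY \<alpha>" by (rule pair_sigma_finite_MO_MY[OF \<Omega>])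
  have f': "integrable (MO \<Omega> \<Otimes>\<^sub>M MY \<alpha>) f" using f by (simp add: MC_def)
  show "(\<integral>p. f p \<partial>MC \<Omega> \<alpha>) = (\<integral>x. (\<integral>y. f (x, y) \<partial>MY \<alpha>) \<partial>MO \<Omega>)"
    using integral_fst'[OF f'] by (simp add: MC_def)
  show "(\<integral>p. f p \<partial>MC \<Omega> \<alpha>) = (\<integral>y. (\<integral>x. f (x, y) \<partial>MO \<Omega>) \<partial>MY \<alpha>)"
    using integral_snd[of "\<lambda>x y. f (x, y)"] f' by (simp add: MC_def)
qed

lemma MC_prod:
  fixes f :: "real^'n \<Rightarrow> real" and g :: "real \<Rightarrow> real"
  assumes \<Omega>: "\<Omega> \<in> sets borel" and f: "integrable (MO \<Omega>) f" and g: "integrable (MY \<alpha>) g"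
  shows "integrable (MC \<Omega> \<alpha>) (\<lambda>p. f (fst p) * g (snd p))"
    "(\<integral>p. f (fst p) * g (snd p) \<partial>MC \<Omega> \<alpha>) = (\<integral>x. f x \<partial>MO \<Omega>) * (\<integral>y. g y \<partial>MY \<alpha>)"
proof -
  have [measurable]: "f \<in> borel_measurable borel" "g \<in> borel_measurable borel"
    using borel_measurable_integrable[OF f] borel_measurable_integrable[OF g] by auto
  have "(\<integral>\<^sup>+p. ennreal (norm (f (fst p) * g (snd p))) \<partial>MC \<Omega> \<alpha>)
      = (\<integral>\<^sup>+x. ennreal \<bar>f x\<bar> \<partial>MO \<Omega>) * (\<integral>\<^sup>+y. ennreal \<bar>g y\<bar> \<partial>MY \<alpha>)"
    by (subst nn_integral_MC_times[symmetric]) (auto simp: \<Omega> abs_mult ennreal_mult)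
  also have "\<dots> < \<infinity>"
    using f g by (auto simp: integrable_iff_bounded ennreal_mult_less_top)
  finally show i: "integrable (MC \<Omega> \<alpha>) (\<lambda>p. f (fst p) * g (snd p))"
    by (intro integrableI_bounded) auto
  show "(\<integral>p. f (fst p) * g (snd p) \<partial>MC \<Omega> \<alpha>) = (\<integral>x. f x \<partial>MO \<Omega>) * (\<integral>y. g y \<partial>MY \<alpha>)"
    by (subst integral_MC(1)[OF \<Omega> i]) simp
qed

text \<open>The jet of a product v(x) * \<eta>(y) in terms of the two jets. It also makes sense for
  limits of jets such as an eigenfunction with its weak gradient, where no classical derivative is
  at hand.\<close>

definition tens :: "('a::real_normed_vector \<Rightarrow> real \<times> 'a) \<Rightarrow> (real \<Rightarrow> real \<times> real) \<Rightarrow> 'a \<times> real \<Rightarrow> real \<times> ('a \<times> real)" where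
  "tens V N p = (fst (V (fst p)) * fst (N (snd p)),
     (fst (N (snd p)) *\<^sub>R snd (V (fst p)), fst (V (fst p)) * snd (N (snd p))))"

text \<open>The product of the squared norms exceeds the squared norm of the tensor exactly by the
  mixed term of both gradients.\<close>

lemma tens_norm: "norm (tens V N (x, y)) \<le> norm (V x) * norm (N y)"
proof (rule power2_le_imp_le)
  obtain u g where V: "V x = (u, g)" by fastforce
  obtain k k' where N: "N y = (k, k')" by fastforce
  have "(norm (tens V N (x, y)))\<^sup>2 = u\<^sup>2 * k\<^sup>2 + (k\<^sup>2 * (norm g)\<^sup>2 + u\<^sup>2 * k'\<^sup>2)"
    by (simp add: tens_def V N norm_Pair power_mult_distrib)
  also have "\<dots> \<le> (u\<^sup>2 + (norm g)\<^sup>2) * (k\<^sup>2 + k'\<^sup>2)"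
    by (simp add: algebra_simps)
  also have "\<dots> = (norm (V x) * norm (N y))\<^sup>2"
    by (simp add: V N norm_Pair power_mult_distrib)
  finally show "(norm (tens V N (x, y)))\<^sup>2 \<le> (norm (V x) * norm (N y))\<^sup>2" .
qed simp

lemma tens_borel:
  fixes V :: "'a::euclidean_space \<Rightarrow> real \<times> 'a"
  assumes [measurable]: "V \<in> borel_measurable borel" "N \<in> borel_measurable borel"
  shows "tens V N \<in> borel_measurable borel"
  unfolding tens_def by measurable

lemma tens_sq_int:
  fixes V :: "real^'n \<Rightarrow> real \<times> (real^'n)"
  assumes \<Omega>: "\<Omega> \<in> sets borel" and V: "sq_int (MO \<Omega>) V" and N: "sq_int (MY \<alpha>) N"
  shows "sq_int (MC \<Omega> \<alpha>) (tens V N)" "l2n (MC \<Omega> \<alpha>) (tens V N) \<le> l2n (MO \<Omega>) V * l2n (MY \<alpha>) N"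
  by (rule sq_int_MC_tensor[OF \<Omega> V N tens_borel tens_norm]; use V N in \<open>simp add: sq_int_def\<close>)+

lemma tens_diff:
  "tens V N p - tens V' N p = tens (\<lambda>x. V x - V' x) N p"
  "tens V N p - tens V N' p = tens V (\<lambda>y. N y - N' y) p"
  by (auto simp: tens_def algebra_simps)

lemma jet_tensor:
  fixes \<eta> :: "real \<Rightarrow> real"
  assumes "test_fn U v" "test_fn UNIV \<eta>"
  shows "jet (\<lambda>p. v (fst p) * \<eta> (snd p)) = tens (jet v) (jet \<eta>)"
  using cgrad_tensor[OF assms] by (auto simp: jet_def tens_def fun_eq_iff)

context extension_setting
begin

definition form_op_base :: "real^'n \<Rightarrow> real \<times> (real^'n) \<Rightarrow> real \<times> (real^'n)" where
  "form_op_base x F = (c x * fst F, AO x *v snd F)"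

lemma form_op_base_borel [measurable]:
  assumes [measurable]: "F \<in> borel_measurable borel"
  shows "(\<lambda>x. form_op_base x (F x)) \<in> borel_measurable borel"
  unfolding form_op_base_def by measurable

lemma form_op_base_sq_int:
  assumes V: "sq_int (MO \<Omega>) V"
  shows "sq_int (MO \<Omega>) (\<lambda>x. form_op_base x (V x))"
proof -
  obtain K where K: "K \<ge> 0" "\<And>x v. norm (AO x *v v) \<le> K * norm v" using AO_bound by blast
  obtain m where m: "m \<ge> 0" "AE x in MO \<Omega>. 0 \<le> c x \<and> c x \<le> m"
    "AE p in M. fst p \<in> \<Omega> \<and> 0 \<le> c (fst p) \<and> c (fst p) \<le> m" using c_bound by blast
  have "AE x in MO \<Omega>. norm (form_op_base x (V x)) \<le> (m + K) * norm (V x)"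
    using m(2)
  proof eventually_elim
    case (elim x)
    have 1: "norm (form_op_base x (V x)) \<le> norm (c x * fst (V x)) + norm (AO x *v snd (V x))"
      unfolding form_op_base_def by (rule norm_Pair_le)
    have 2: "norm (c x * fst (V x)) \<le> m * norm (V x)"
      unfolding norm_mult using elim by (intro mult_mono) (auto simp: norm_fst_snd_le)
    have 3: "norm (AO x *v snd (V x)) \<le> K * norm (V x)"
      by (rule order_trans[OF K(2)], intro mult_left_mono K norm_fst_snd_le)
    show ?case using 1 2 3 by (simp add: distrib_right)
  qed
  then show ?thesis
    using V K m by (intro sq_int_bound(1)[OF V, of _ "m + K"]) (auto simp: sq_int_def)
qed

lemma test_fn_MO:
  assumes v: "test_fn \<Omega> v"
  shows "sq_int (MO \<Omega>) (jet v)" "sq_int (MO \<Omega>) v" "sq_int (MO \<Omega>) (cgrad v)" "H10 \<Omega> v (cgrad v)"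
proof -
  note sm = test_fn_smooth[OF v]
  show v2: "sq_int (MO \<Omega>) v" and g2: "sq_int (MO \<Omega>) (cgrad v)"
    by (rule sq_int_MO_lborel[OF Omega_borel] test_fn_sq_int[OF v])+
  have jm: "jet v \<in> borel_measurable borel" by (rule borel_measurable_jet[OF sm])
  have "integrable (MO \<Omega>) (\<lambda>x. (v x)\<^sup>2 + (norm (cgrad v x))\<^sup>2)"
    using v2 g2 by (auto simp: sq_int_iff)
  then show "sq_int (MO \<Omega>) (jet v)"
    using jm by (simp add: sq_int_iff jet_def norm_Pair)
  have "H1 \<Omega> v (cgrad v)"
    unfolding H1_def
  proof (intro conjI)
    show "L2 \<Omega> v" using v2 by (simp add: L2_iff_sq_int)
    show "weak_gradient \<Omega> v (cgrad v)" by (rule smooth_weak_gradient[OF sm open_Omega])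
    show "set_nn_integral lborel \<Omega> (\<lambda>x. ennreal ((norm (cgrad v x))\<^sup>2)) < \<infinity>"
      using g2 by (subst set_nn_MO) (auto simp: sq_int_def)
  qed
  then show "H10 \<Omega> v (cgrad v)"
    unfolding H10_def using v by (auto intro!: exI[of _ "\<lambda>_. v"])
qed

text \<open>Packs everything needed about an eigenpair: a jet whose first component is
  \<open>phi k\<close> pointwise, its approximability by smooth jets, and the eigenvalue equation
  restricted to smooth test functions, where it can be applied slice by slice.\<close>

lemma eigen_jet:
  obtains V where "sq_int (MO \<Omega>) V" "\<And>x. fst (V x) = phi k x"
    "\<exists>v. (\<forall>j. test_fn \<Omega> (v j)) \<and> (\<lambda>j. l2n (MO \<Omega>) (\<lambda>x. V x - jet (v j) x)) \<longlonglongrightarrow> 0"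
    "\<And>v. test_fn \<Omega> v \<Longrightarrow> (\<integral>x. form_op_base x (V x) \<bullet> jet v x \<partial>MO \<Omega>) = lam k * (\<integral>x. phi k x * v x \<partial>MO \<Omega>)"
proof -
  obtain G where G: "H10 \<Omega> (phi k) G" "\<And>v Gv. H10 \<Omega> v Gv \<Longrightarrow>
      a_Omega \<Omega> A c (phi k) G v Gv = lam k * set_lebesgue_integral lborel \<Omega> (\<lambda>x. phi k x * v x)"
    using setting unfolding setting_def by metis
  define V where "V x = (phi k x, G x)" for x
  have H1: "H1 \<Omega> (phi k) G" using G by (simp add: H10_def)
  have [measurable]: "phi k \<in> borel_measurable borel" "G \<in> borel_measurable borel"
    using H1 by (auto simp: H1_def weak_gradient_def)
  have p2: "sq_int (MO \<Omega>) (phi k)" using H1 by (simp add: H1_def L2_iff_sq_int)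
  have "(\<integral>\<^sup>+x. ennreal ((norm (G x))\<^sup>2) \<partial>MO \<Omega>) < \<infinity>"
    using H1 by (subst set_nn_MO[symmetric]) (auto simp: H1_def)
  then have g2: "sq_int (MO \<Omega>) G" by (simp add: sq_int_def)
  have "integrable (MO \<Omega>) (\<lambda>x. (phi k x)\<^sup>2 + (norm (G x))\<^sup>2)"
    using p2 g2 by (auto simp: sq_int_iff)
  moreover have Vm: "V \<in> borel_measurable borel" unfolding V_def by measurable
  ultimately have V2: "sq_int (MO \<Omega>) V" by (simp add: sq_int_iff) (simp add: V_def norm_Pair)
  obtain v where v: "\<And>j. test_fn \<Omega> (v j)" "(\<lambda>j. set_nn_integral lborel \<Omega>
           (\<lambda>x. ennreal ((phi k x - v j x)\<^sup>2 + (norm (G x - cgrad (v j) x))\<^sup>2))) \<longlonglongrightarrow> 0"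
    using G(1) by (auto simp: H10_def)
  note sj = test_fn_MO(1)[OF v(1)]
  have "set_nn_integral lborel \<Omega> (\<lambda>x. ennreal ((phi k x - v j x)\<^sup>2 + (norm (G x - cgrad (v j) x))\<^sup>2))
      = (\<integral>\<^sup>+x. ennreal ((norm (V x - jet (v j) x))\<^sup>2) \<partial>MO \<Omega>)" for j
    using test_fn_MO(2,3)[OF v(1)[of j]]
    by (subst set_nn_MO) (auto simp: V_def jet_def norm_Pair sq_int_def)
  with v(2) have "(\<lambda>j. l2n (MO \<Omega>) (\<lambda>x. V x - jet (v j) x)) \<longlonglongrightarrow> 0"
    using l2n_conv_nn_integral[OF sq_int_diff(1)[OF V2 sj]] by simp
  moreover have "(\<integral>x. form_op_base x (V x) \<bullet> jet v x \<partial>MO \<Omega>) = lam k * (\<integral>x. phi k x * v x \<partial>MO \<Omega>)" if v: "test_fn \<Omega> v" for v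
  proof -
    have [measurable]: "v \<in> borel_measurable borel" "cgrad v \<in> borel_measurable borel" "jet v \<in> borel_measurable borel"
      using test_fn_MO(1-3)[OF v] by (auto simp: sq_int_def)
    have [measurable]: "V \<in> borel_measurable borel" using V2 by (simp add: sq_int_def)
    have "(\<integral>x. form_op_base x (V x) \<bullet> jet v x \<partial>MO \<Omega>) = set_lebesgue_integral lborel \<Omega> (\<lambda>x. form_op_base x (V x) \<bullet> jet v x)"
      by (subst set_lint_MO) auto
    also have "\<dots> = a_Omega \<Omega> A c (phi k) G v (cgrad v)"
      unfolding a_Omega_def
      by (rule set_lebesgue_integral_cong) (auto simp: form_op_base_def V_def jet_def AO_eq mult.assoc)
    also have "\<dots> = lam k * (\<integral>x. phi k x * v x \<partial>MO \<Omega>)"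
      using G(2)[OF test_fn_MO(4)[OF v]] by (simp add: set_lint_MO)
    finally show ?thesis .
  qed
  ultimately show ?thesis
    using V2 v(1) by (intro that[of V]) (auto simp: V_def)
qed

lemma phi_sq_int: "sq_int (MO \<Omega>) (phi k)"
proof -
  obtain G where "H10 \<Omega> (phi k) G" using setting unfolding setting_def by metis
  then show ?thesis by (simp add: H10_def H1_def L2_iff_sq_int)
qed

lemma phi_norm: "(\<integral>x. (phi k x)\<^sup>2 \<partial>MO \<Omega>) = 1" "l2n (MO \<Omega>) (phi k) = 1"
proof -
  have "set_lebesgue_integral lborel \<Omega> (\<lambda>x. phi k x * phi k x) = 1"
    using setting unfolding setting_def by (metis (no_types, lifting))
  then show "(\<integral>x. (phi k x)\<^sup>2 \<partial>MO \<Omega>) = 1"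
    using phi_sq_int[of k] by (subst (asm) set_lint_MO) (auto simp: sq_int_def power2_eq_square)
  then show "l2n (MO \<Omega>) (phi k) = 1" by (simp add: l2n_def)
qed

text \<open>\<open>lam k\<close> is the energy of the normalized eigenfunction and so at least the
  ellipticity constant times the squared gradient norm. Positivity is what lets
  \<open>lam k powr s\<close> be cancelled and the Gamma integral converge.\<close>

lemma lam_pos: "lam k > 0"
proof -
  obtain V where V: "sq_int (MO \<Omega>) V" "\<And>x. fst (V x) = phi k x"
    "\<exists>v. (\<forall>j. test_fn \<Omega> (v j)) \<and> (\<lambda>j. l2n (MO \<Omega>) (\<lambda>x. V x - jet (v j) x)) \<longlonglongrightarrow> 0"
    "\<And>v. test_fn \<Omega> v \<Longrightarrow> (\<integral>x. form_op_base x (V x) \<bullet> jet v x \<partial>MO \<Omega>) = lam k * (\<integral>x. phi k x * v x \<partial>MO \<Omega>)"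
    using eigen_jet[of k] by blast
  obtain v where v: "\<And>j. test_fn \<Omega> (v j)" "(\<lambda>j. l2n (MO \<Omega>) (\<lambda>x. V x - jet (v j) x)) \<longlonglongrightarrow> 0"
    using V(3) by blast
  note sj = test_fn_MO[OF v(1)]
  have [measurable]: "V \<in> borel_measurable borel" using V(1) by (simp add: sq_int_def)
  let ?G = "\<lambda>x. snd (V x)"
  have G2: "sq_int (MO \<Omega>) ?G" by (rule sq_int_fst_snd(3)[OF V(1)])
  have near: "(\<lambda>j. l2n (MO \<Omega>) (\<lambda>x. phi k x - v j x)) \<longlonglongrightarrow> 0" "(\<lambda>j. l2n (MO \<Omega>) (\<lambda>x. ?G x - cgrad (v j) x)) \<longlonglongrightarrow> 0"
  proof -
    have "l2n (MO \<Omega>) (\<lambda>x. phi k x - v j x) \<le> l2n (MO \<Omega>) (\<lambda>x. V x - jet (v j) x)"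
      "l2n (MO \<Omega>) (\<lambda>x. ?G x - cgrad (v j) x) \<le> l2n (MO \<Omega>) (\<lambda>x. V x - jet (v j) x)" for j
      using sq_int_fst_snd(2,4)[OF sq_int_diff(1)[OF V(1) sj(1)[of j]]] by (simp_all add: jet_def V(2))
    then show "(\<lambda>j. l2n (MO \<Omega>) (\<lambda>x. phi k x - v j x)) \<longlonglongrightarrow> 0" "(\<lambda>j. l2n (MO \<Omega>) (\<lambda>x. ?G x - cgrad (v j) x)) \<longlonglongrightarrow> 0"
      by (intro Lim_null_comparison[OF _ v(2)] always_eventually; simp)+
  qed
  obtain R where R: "R \<ge> 0" "\<And>x. x \<in> \<Omega> \<Longrightarrow> norm x \<le> R" using Omega_bound by blast
  \<comment> \<open>Poincare is available for test functions, hence applied to the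
    \<open>v j\<close> and passed to the limit; with norm 1 for \<open>phi k\<close> it excludes a
    vanishing gradient.\<close>
  have "1 \<le> 2 * R * l2n (MO \<Omega>) ?G"
  proof (rule LIMSEQ_le)
    show "(\<lambda>j. l2n (MO \<Omega>) (v j)) \<longlonglongrightarrow> 1"
      using l2n_conv[OF phi_sq_int sj(2) near(1)] by (simp add: phi_norm)
    show "(\<lambda>j. 2 * R * l2n (MO \<Omega>) (cgrad (v j))) \<longlonglongrightarrow> 2 * R * l2n (MO \<Omega>) ?G"
      by (intro tendsto_mult_left l2n_conv[OF G2 sj(3) near(2)])
    show "\<exists>N. \<forall>n\<ge>N. l2n (MO \<Omega>) (v n) \<le> 2 * R * l2n (MO \<Omega>) (cgrad (v n))"
      using poincare_MO[OF Omega_borel v(1) R(2,1)] by blast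
  qed
  then have "l2n (MO \<Omega>) ?G \<noteq> 0" by auto
  then have Gp: "l2n (MO \<Omega>) ?G > 0" using l2n_nonneg[of "MO \<Omega>" ?G] by linarith
  \<comment> \<open>The eigenvalue equation is tested with the approximants \<open>v j\<close>; in
    the limit it becomes the energy identity of \<open>phi k\<close>.\<close>
  have "(\<lambda>j. \<integral>x. form_op_base x (V x) \<bullet> jet (v j) x \<partial>MO \<Omega>) \<longlonglongrightarrow> (\<integral>x. form_op_base x (V x) \<bullet> V x \<partial>MO \<Omega>)"
    using l2_inner_conv[OF V(1) form_op_base_sq_int[OF V(1)] sj(1) v(2)] by (simp add: inner_commute)
  moreover have "(\<lambda>j. lam k * (\<integral>x. phi k x * v j x \<partial>MO \<Omega>)) \<longlonglongrightarrow> lam k * (\<integral>x. phi k x * phi k x \<partial>MO \<Omega>)"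
    by (intro tendsto_mult_left MO_inner_conv[OF phi_sq_int phi_sq_int sj(2) near(1)])
  ultimately have eq: "(\<integral>x. form_op_base x (V x) \<bullet> V x \<partial>MO \<Omega>) = lam k"
    using phi_norm(1)[of k] V(4)[OF v(1)] LIMSEQ_unique by (force simp: power2_eq_square)
  obtain \<theta> where \<theta>: "\<theta> > 0" "\<And>x \<xi>. x \<in> \<Omega> \<Longrightarrow> (AO x *v \<xi>) \<bullet> \<xi> \<ge> \<theta> * (norm \<xi>)\<^sup>2" using ellipticity by blast
  obtain m where m: "m \<ge> 0" "AE x in MO \<Omega>. 0 \<le> c x \<and> c x \<le> m"
    "AE p in M. fst p \<in> \<Omega> \<and> 0 \<le> c (fst p) \<and> c (fst p) \<le> m" using c_bound by blast
  have inO: "AE x in MO \<Omega>. x \<in> \<Omega>" by (subst AE_MO) auto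
  have "\<theta> * (l2n (MO \<Omega>) ?G)\<^sup>2 = (\<integral>x. \<theta> * (norm (?G x))\<^sup>2 \<partial>MO \<Omega>)" by (simp add: l2n_sq)
  also have "\<dots> \<le> (\<integral>x. form_op_base x (V x) \<bullet> V x \<partial>MO \<Omega>)"
  proof (rule integral_mono_AE)
    show "integrable (MO \<Omega>) (\<lambda>x. \<theta> * (norm (?G x))\<^sup>2)" using G2 by (simp add: sq_int_iff)
    show "integrable (MO \<Omega>) (\<lambda>x. form_op_base x (V x) \<bullet> V x)" by (rule l2_inner(1)[OF form_op_base_sq_int[OF V(1)] V(1)])
    show "AE x in MO \<Omega>. \<theta> * (norm (?G x))\<^sup>2 \<le> form_op_base x (V x) \<bullet> V x"
      using m(2) inO
    proof eventually_elim
      case (elim x)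
      have "0 \<le> c x * (fst (V x) * fst (V x))" using elim mult_nonneg_nonneg[OF _ zero_le_square] by blast
      moreover have "form_op_base x (V x) \<bullet> V x = c x * (fst (V x) * fst (V x)) + (AO x *v ?G x) \<bullet> ?G x"
        by (simp add: form_op_base_def inner_prod_def mult.assoc)
      moreover have "\<theta> * (norm (?G x))\<^sup>2 \<le> (AO x *v ?G x) \<bullet> ?G x" using \<theta>(2) elim by blast
      ultimately show ?case by linarith
    qed
  qed
  finally have "\<theta> * (l2n (MO \<Omega>) ?G)\<^sup>2 \<le> lam k" by (simp add: eq)
  moreover have "\<theta> * (l2n (MO \<Omega>) ?G)\<^sup>2 > 0" using \<theta> Gp by simp
  ultimately show ?thesis by linarith
qed

text \<open>Restricting a nonzero test function on \<open>\<Omega>\<close> to a line avoids an explicit construction.\<close>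

lemma bump: obtains \<zeta> :: "real \<Rightarrow> real" where "test_fn UNIV \<zeta>" "\<zeta> 0 = 1"
proof -
  obtain V where V: "sq_int (MO \<Omega>) V" "\<And>x. fst (V x) = phi 0 x"
    "\<exists>v. (\<forall>j. test_fn \<Omega> (v j)) \<and> (\<lambda>j. l2n (MO \<Omega>) (\<lambda>x. V x - jet (v j) x)) \<longlonglongrightarrow> 0"
    "\<And>v. test_fn \<Omega> v \<Longrightarrow> (\<integral>x. form_op_base x (V x) \<bullet> jet v x \<partial>MO \<Omega>) = lam 0 * (\<integral>x. phi 0 x * v x \<partial>MO \<Omega>)"
    using eigen_jet[of 0] by blast
  obtain v where v: "\<And>j. test_fn \<Omega> (v j)" "(\<lambda>j. l2n (MO \<Omega>) (\<lambda>x. V x - jet (v j) x)) \<longlonglongrightarrow> 0"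
    using V(3) by blast
  \<comment> \<open>If all approximants vanished they would stay at distance at least 1 from the
    normalized eigenfunction.\<close>
  have "\<exists>j x. v j x \<noteq> 0"
  proof (rule ccontr)
    assume "\<not> ?thesis"
    then have z: "v j x = 0" for j x by blast
    have "1 \<le> l2n (MO \<Omega>) (\<lambda>x. V x - jet (v j) x)" for j
    proof -
      have "l2n (MO \<Omega>) (phi 0) \<le> l2n (MO \<Omega>) (\<lambda>x. V x - jet (v j) x)"
        using sq_int_fst_snd(2)[OF sq_int_diff(1)[OF V(1) test_fn_MO(1)[OF v(1)[of j]]]] by (simp add: jet_def V(2) z)
      then show ?thesis by (simp add: phi_norm)
    qed
    then have "(1::real) \<le> 0" by (intro LIMSEQ_le_const[OF v(2)]) blast
    then show False by simp
  qed
  then obtain j x where jx: "v j x \<noteq> 0" by blast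
  obtain e :: "real^'n" where e: "e \<in> Basis" using nonempty_Basis by blast
  have "test_fn UNIV (\<lambda>y::real. (1 / v j x) * v j (x + y *\<^sub>R e))"
    by (rule test_fn_cmult[OF test_fn_line[OF v(1)]]) (use e in auto)
  then show ?thesis by (rule that) (use jx in simp)
qed

end

subsection \<open>Testing with Gaussian profiles\<close>

context extension_setting
begin

text \<open>A function of x alone need not be square integrable on the infinite cylinder; cutting it
  off at a height \<open>R\<close> above which \<open>g\<close> vanishes changes nothing and makes
  it so.\<close>

lemma integrable_MC_inner:
  fixes P :: "real^'n \<Rightarrow> 'b::euclidean_space" and g :: "(real^'n) \<times> real \<Rightarrow> 'b"
  assumes P: "sq_int (MO \<Omega>) P" and g: "continuous_on UNIV g"
    and K: "compact K" "\<And>p. p \<notin> K \<Longrightarrow> g p = 0"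
  shows "integrable M (\<lambda>p. P (fst p) \<bullet> g p)"
proof -
  have [measurable]: "P \<in> borel_measurable borel" using P by (simp add: sq_int_def)
  have [measurable]: "g \<in> borel_measurable borel" by (rule borel_measurable_continuous_onI[OF g])
  obtain R where R: "\<And>p. p \<in> K \<Longrightarrow> norm p \<le> R"
    using compact_imp_bounded[OF K(1)] by (auto simp: bounded_iff)
  obtain C where C: "\<And>p. norm (g p) \<le> C" by (rule bounded_compact_support[OF g K]) blast+
  have gs: "sq_int M g"
    by (rule sq_int_MC_compact_support[OF Omega_borel alpha _ C compact_imp_bounded[OF K(1)] K(2)]) auto
  have "sq_int M (\<lambda>p. indicat_real {..R} (snd p) *\<^sub>R P (fst p))"
    by (rule sq_int_MC_tensor(1)[OF Omega_borel P sq_int_indicator_MY[OF alpha, of R]]) auto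
  from l2_inner(1)[OF this gs]
  have "integrable M (\<lambda>p. (indicat_real {..R} (snd p) *\<^sub>R P (fst p)) \<bullet> g p)" .
  moreover have "(indicat_real {..R} (snd p) *\<^sub>R P (fst p)) \<bullet> g p = P (fst p) \<bullet> g p" for p
  proof (cases "p \<in> K")
    case True
    have "snd p \<le> R" using R[OF True] norm_fst_snd_le(2)[of p] by (simp add: abs_le_iff)
    then show ?thesis by simp
  qed (simp add: K(2))
  ultimately show ?thesis by (simp only:)
qed

lemma integrable_phi_psi:
  assumes \<psi>: "lat_test \<Omega> \<psi>" and h: "continuous_on UNIV h"
  shows "integrable M (\<lambda>p. phi k (fst p) * (\<psi> p * h (snd p)))"
    "integrable M (\<lambda>p. phi k (fst p) * (h (snd p) * snd (cgrad \<psi> p)))"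
proof -
  have \<psi>': "test_fn (\<Omega> \<times> UNIV) \<psi>" using \<psi> by (simp add: lat_test_def)
  note sm = test_fn_smooth[OF \<psi>']
  obtain K where K: "compact K" "K \<subseteq> \<Omega> \<times> UNIV" "\<And>x. x \<notin> K \<Longrightarrow> \<psi> x = 0 \<and> cgrad \<psi> x = 0"
    using test_fn_support[OF \<psi>'] by blast
  have hc: "continuous_on UNIV (\<lambda>p::(real^'n) \<times> real. h (snd p))"
    by (intro continuous_on_compose2[OF h] continuous_intros) auto
  have "integrable M (\<lambda>p. phi k (fst p) \<bullet> (\<psi> p * h (snd p)))"
    by (rule integrable_MC_inner[OF phi_sq_int _ K(1)])
       (use K(3) in \<open>auto intro!: continuous_on_mult smooth_continuous[OF sm] hc\<close>)
  then show "integrable M (\<lambda>p. phi k (fst p) * (\<psi> p * h (snd p)))" by simp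
  have "integrable M (\<lambda>p. phi k (fst p) \<bullet> (h (snd p) * snd (cgrad \<psi> p)))"
    by (rule integrable_MC_inner[OF phi_sq_int _ K(1)])
       (use K(3) in \<open>auto intro!: continuous_intros hc smooth_continuous_cgrad sm\<close>)
  then show "integrable M (\<lambda>p. phi k (fst p) * (h (snd p) * snd (cgrad \<psi> p)))" by simp
qed

text \<open>Fubini is used in both orders. With x inside, the eigenvalue equation on each slice
  turns the horizontal part into \<open>lam k\<close>; with y inside, \<open>gauss_parts\<close> on
  each vertical line removes the derivative of \<psi>.\<close>

lemma B_gauss:
  assumes V: "sq_int (MO \<Omega>) V" "\<And>x. fst (V x) = phi k x"
    "\<And>v. test_fn \<Omega> v \<Longrightarrow> (\<integral>x. form_op_base x (V x) \<bullet> jet v x \<partial>MO \<Omega>) = lam k * (\<integral>x. phi k x * v x \<partial>MO \<Omega>)"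
    and t: "t > 0" and \<psi>: "lat_test \<Omega> \<psi>"
  shows "B (tens V (\<lambda>y. (gauss t y, gauss' t y))) (jet \<psi>)
    = (\<integral>p. phi k (fst p) * (\<psi> p * ((lam k + (1 - s) / t - (snd p)\<^sup>2 / (4 * t\<^sup>2)) * gauss t (snd p))) \<partial>M)"
proof -
  have \<psi>': "test_fn (\<Omega> \<times> UNIV) \<psi>" using \<psi> by (simp add: lat_test_def)
  note sm = test_fn_smooth[OF \<psi>']
  obtain K where K: "compact K" "K \<subseteq> \<Omega> \<times> UNIV" "\<And>x. x \<notin> K \<Longrightarrow> \<psi> x = 0 \<and> cgrad \<psi> x = 0"
    using test_fn_support[OF \<psi>'] by blast
  obtain R where R: "\<And>p. p \<in> K \<Longrightarrow> norm p \<le> R"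
    using compact_imp_bounded[OF K(1)] by (auto simp: bounded_iff)
  have zR: "\<psi> (x, y) = 0" "cgrad \<psi> (x, y) = 0" if "y > R" for x y
  proof -
    have "(x, y) \<notin> K" using R[of "(x, y)"] norm_fst_snd_le(2)[of "(x, y)"] that by auto
    then show "\<psi> (x, y) = 0" "cgrad \<psi> (x, y) = 0" using K(3) by blast+
  qed
  have gc: "continuous_on UNIV (\<lambda>p::(real^'n) \<times> real. gauss t (snd p))"
    by (intro continuous_on_compose2[OF gauss_continuous(1)] continuous_intros) auto
  \<comment> \<open>The horizontal share of the jet of \<psi>, weighted by the profile: on each
    slice it is \<open>gauss t y\<close> times the jet of the slice.\<close>
  define g where "g p = gauss t (snd p) *\<^sub>R (\<psi> p, fst (cgrad \<psi> p))" for p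
  have gcont: "continuous_on UNIV g"
    unfolding g_def by (intro continuous_intros gc smooth_continuous smooth_continuous_cgrad sm)
  have gz: "g p = 0" if "p \<notin> K" for p
  proof -
    have "g p = gauss t (snd p) *\<^sub>R (0, 0)" using K(3)[OF that] by (simp add: g_def)
    then show ?thesis by (simp add: zero_prod_def)
  qed
  have i1: "integrable M (\<lambda>p. form_op_base (fst p) (V (fst p)) \<bullet> g p)"
    by (rule integrable_MC_inner[OF form_op_base_sq_int[OF V(1)] gcont K(1) gz])
  have i2: "integrable M (\<lambda>p. phi k (fst p) * (gauss' t (snd p) * snd (cgrad \<psi> p)))"
    by (rule integrable_phi_psi(2)[OF \<psi> gauss_continuous(2)])
  have i3: "integrable M (\<lambda>p. phi k (fst p) * (\<psi> p * (lam k * gauss t (snd p))))"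
    by (rule integrable_phi_psi(1)[OF \<psi>]) (intro continuous_intros gauss_continuous)
  have i4: "integrable M (\<lambda>p. phi k (fst p) * (\<psi> p * (((1 - s) / t - (snd p)\<^sup>2 / (4 * t\<^sup>2)) * gauss t (snd p))))"
    by (rule integrable_phi_psi(1)[OF \<psi>, of "\<lambda>y. ((1 - s) / t - y\<^sup>2 / (4 * t\<^sup>2)) * gauss t y"])
       (use t in \<open>intro continuous_intros gauss_continuous; simp\<close>)
  have "B (tens V (\<lambda>y. (gauss t y, gauss' t y))) (jet \<psi>)
    = (\<integral>p. form_op_base (fst p) (V (fst p)) \<bullet> g p + phi k (fst p) * (gauss' t (snd p) * snd (cgrad \<psi> p)) \<partial>M)"
    unfolding B_def
    by (rule Bochner_Integration.integral_cong)
       (auto simp: form_op_def form_op_base_def tens_def g_def jet_def inner_prod_def V(2) matrix_vector_mult_scaleR algebra_simps)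
  also have "\<dots> = (\<integral>p. form_op_base (fst p) (V (fst p)) \<bullet> g p \<partial>M) + (\<integral>p. phi k (fst p) * (gauss' t (snd p) * snd (cgrad \<psi> p)) \<partial>M)"
    by (rule Bochner_Integration.integral_add[OF i1 i2])
  also have "(\<integral>p. form_op_base (fst p) (V (fst p)) \<bullet> g p \<partial>M) = (\<integral>p. phi k (fst p) * (\<psi> p * (lam k * gauss t (snd p))) \<partial>M)"
  proof -
    have "(\<integral>p. form_op_base (fst p) (V (fst p)) \<bullet> g p \<partial>M) = (\<integral>y. (\<integral>x. form_op_base x (V x) \<bullet> g (x, y) \<partial>MO \<Omega>) \<partial>MY (1 - 2 * s))"
      using integral_MC(2)[OF Omega_borel i1] by simp
    also have "\<dots> = (\<integral>y. (\<integral>x. phi k x * (\<psi> (x, y) * (lam k * gauss t y)) \<partial>MO \<Omega>) \<partial>MY (1 - 2 * s))"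
    proof (rule Bochner_Integration.integral_cong[OF refl])
      fix y
      let ?v = "\<lambda>x. \<psi> (x, y)"
      have v: "test_fn \<Omega> ?v" by (rule test_fn_slice[OF \<psi>'])
      have "g (x, y) = gauss t y *\<^sub>R jet ?v x" for x
        by (simp add: g_def jet_def cgrad_slice[OF sm])
      then have "(\<integral>x. form_op_base x (V x) \<bullet> g (x, y) \<partial>MO \<Omega>) = gauss t y * (lam k * (\<integral>x. phi k x * ?v x \<partial>MO \<Omega>))"
        using V(3)[OF v] by simp
      also have "\<dots> = (\<integral>x. (gauss t y * lam k) * (phi k x * ?v x) \<partial>MO \<Omega>)" by simp
      also have "\<dots> = (\<integral>x. phi k x * (\<psi> (x, y) * (lam k * gauss t y)) \<partial>MO \<Omega>)"
        by (simp only: mult_ac)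
      finally show "(\<integral>x. form_op_base x (V x) \<bullet> g (x, y) \<partial>MO \<Omega>) = (\<integral>x. phi k x * (\<psi> (x, y) * (lam k * gauss t y)) \<partial>MO \<Omega>)" .
    qed
    also have "\<dots> = (\<integral>p. phi k (fst p) * (\<psi> p * (lam k * gauss t (snd p))) \<partial>M)"
      using integral_MC(2)[OF Omega_borel i3] by simp
    finally show ?thesis .
  qed
  also have "(\<integral>p. phi k (fst p) * (gauss' t (snd p) * snd (cgrad \<psi> p)) \<partial>M)
     = (\<integral>p. phi k (fst p) * (\<psi> p * (((1 - s) / t - (snd p)\<^sup>2 / (4 * t\<^sup>2)) * gauss t (snd p))) \<partial>M)"
  proof -
    have "(\<integral>p. phi k (fst p) * (gauss' t (snd p) * snd (cgrad \<psi> p)) \<partial>M)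
        = (\<integral>x. phi k x * (\<integral>y. gauss' t y * snd (cgrad \<psi> (x, y)) \<partial>MY (1 - 2 * s)) \<partial>MO \<Omega>)"
      using integral_MC(1)[OF Omega_borel i2] by simp
    also have "\<dots> = (\<integral>x. phi k x * (\<integral>y. ((1 - s) / t - y\<^sup>2 / (4 * t\<^sup>2)) * gauss t y * \<psi> (x, y) \<partial>MY (1 - 2 * s)) \<partial>MO \<Omega>)"
    proof (rule Bochner_Integration.integral_cong[OF refl])
      fix x
      have "(\<integral>y. gauss' t y * snd (cgrad \<psi> (x, y)) \<partial>MY (1 - 2 * s)) =
          (\<integral>y. ((1 - s) / t - y\<^sup>2 / (4 * t\<^sup>2)) * gauss t y * \<psi> (x, y) \<partial>MY (1 - 2 * s))"
      proof (rule gauss_parts[OF s t DERIV_slice[OF sm], where b = R])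
        show "continuous_on UNIV (\<lambda>y. snd (cgrad \<psi> (x, y)))"
          by (intro continuous_intros continuous_on_compose2[OF smooth_continuous_cgrad[OF sm, of UNIV]]) auto
      qed (simp_all add: zR)
      then show "phi k x * (\<integral>y. gauss' t y * snd (cgrad \<psi> (x, y)) \<partial>MY (1 - 2 * s)) =
          phi k x * (\<integral>y. ((1 - s) / t - y\<^sup>2 / (4 * t\<^sup>2)) * gauss t y * \<psi> (x, y) \<partial>MY (1 - 2 * s))" by simp
    qed
    also have "\<dots> = (\<integral>p. phi k (fst p) * (\<psi> p * (((1 - s) / t - (snd p)\<^sup>2 / (4 * t\<^sup>2)) * gauss t (snd p))) \<partial>M)"
      using integral_MC(1)[OF Omega_borel i4] by (simp add: mult.commute)
    finally show ?thesis .
  qed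
  also have "(\<integral>p. phi k (fst p) * (\<psi> p * (lam k * gauss t (snd p))) \<partial>M)
     + (\<integral>p. phi k (fst p) * (\<psi> p * (((1 - s) / t - (snd p)\<^sup>2 / (4 * t\<^sup>2)) * gauss t (snd p))) \<partial>M)
     = (\<integral>p. phi k (fst p) * (\<psi> p * ((lam k + (1 - s) / t - (snd p)\<^sup>2 / (4 * t\<^sup>2)) * gauss t (snd p))) \<partial>M)"
    by (subst Bochner_Integration.integral_add[OF i3 i4, symmetric])
       (rule Bochner_Integration.integral_cong, auto simp: algebra_simps)
  finally show ?thesis .
qed

text \<open>Up to a constant, and apart from the decay in \<open>lam k\<close>, the radial heat
  kernel in the fractional dimension 2 - 2 s, whose radial volume weight is y powr (1 - 2
  s).\<close>

definition heat :: "nat \<Rightarrow> real \<Rightarrow> real \<Rightarrow> real" where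
  "heat k t y = t powr (s - 1) * exp (- lam k * t) * gauss t y"

lemma heat_continuous: "continuous_on S (heat k t)"
  unfolding heat_def by (intro continuous_intros gauss_continuous)

lemma sigma_finite_M: "sigma_finite_measure M"
proof -
  interpret pair_sigma_finite "MO \<Omega>" "MY (1 - 2 * s)" by (rule pair_sigma_finite_MO_MY) simp
  show ?thesis unfolding MC_def by unfold_locales
qed

text \<open>Exchange the t-integral with the integral over the cylinder and apply the fundamental
  theorem in t. Truncation to [\<delta>, T] keeps the integrand bounded on the support of \<psi>,
  which justifies Fubini.\<close>

lemma B_gauss_integrated:
  assumes V: "sq_int (MO \<Omega>) V" "\<And>x. fst (V x) = phi k x"
    "\<And>v. test_fn \<Omega> v \<Longrightarrow> (\<integral>x. form_op_base x (V x) \<bullet> jet v x \<partial>MO \<Omega>) = lam k * (\<integral>x. phi k x * v x \<partial>MO \<Omega>)"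
    and d: "0 < \<delta>" "\<delta> \<le> T" and \<psi>: "lat_test \<Omega> \<psi>"
  defines "b t \<equiv> B (tens V (\<lambda>y. (gauss t y, gauss' t y))) (jet \<psi>)"
  shows "integrable lborel (\<lambda>t. indicat_real {\<delta>..T} t * (t powr (s - 1) * exp (- lam k * t) * b t))"
    and "(\<integral>t. indicat_real {\<delta>..T} t * (t powr (s - 1) * exp (- lam k * t) * b t) \<partial>lborel)
      = (\<integral>p. phi k (fst p) * (\<psi> p * (heat k \<delta> (snd p) - heat k T (snd p))) \<partial>M)"
proof -
  have \<psi>': "test_fn (\<Omega> \<times> UNIV) \<psi>" using \<psi> by (simp add: lat_test_def)
  note sm = test_fn_smooth[OF \<psi>']
  obtain K where K: "compact K" "K \<subseteq> \<Omega> \<times> UNIV" "\<And>x. x \<notin> K \<Longrightarrow> \<psi> x = 0 \<and> cgrad \<psi> x = 0"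
    using test_fn_support[OF \<psi>'] by blast
  obtain R where R: "\<And>p. p \<in> K \<Longrightarrow> norm p \<le> R"
    using compact_imp_bounded[OF K(1)] by (auto simp: bounded_iff)
  have [measurable]: "phi k \<in> borel_measurable borel" using phi_sq_int[of k] by (simp add: sq_int_def)
  have [measurable]: "\<psi> \<in> borel_measurable borel" by (rule borel_measurable_continuous_onI[OF smooth_continuous[OF sm]])
  interpret Q: pair_sigma_finite M lborel
    using sigma_finite_M sigma_finite_lborel by (rule pair_sigma_finite.intro)
  define f where "f p = phi k (fst p) * \<psi> p" for p
  define w where "w t = t powr (s - 1) * exp (- lam k * t)" for t
  define g where "g t y = (lam k + (1 - s) / t - y\<^sup>2 / (4 * t\<^sup>2)) * gauss t y" for t y
  define F where "F p t = f p * (indicat_real {\<delta>..T} t * (w t * g t (snd p)))" for p t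
  have [measurable]: "f \<in> borel_measurable borel" unfolding f_def by measurable
  have fi: "integrable M f" using integrable_phi_psi(1)[OF \<psi>, of "\<lambda>_. 1" k] unfolding f_def by simp
  \<comment> \<open>Termwise bound for t >= \<delta> on the support: the weight is at most \<delta>
    powr (s - 1), (1 - s) / t at most 1 / \<delta>, and the last summand at most R^2 / (4
    \<delta>^2).\<close>
  define C where "C = \<delta> powr (s - 1) * (lam k + 1 / \<delta> + R\<^sup>2 / (4 * \<delta>\<^sup>2))"
  have C: "C \<ge> 0" unfolding C_def using d lam_pos[of k] by (intro mult_nonneg_nonneg add_nonneg_nonneg) auto
  have bnd: "\<bar>F p t\<bar> \<le> \<bar>f p\<bar> * (C * indicat_real {\<delta>..T} t)" for p t
  proof (cases "t \<in> {\<delta>..T} \<and> p \<in> K")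
    case True
    then have t: "t \<ge> \<delta>" "t > 0" using d by auto
    have "(snd p)\<^sup>2 \<le> R\<^sup>2"
      using R[of p] True norm_fst_snd_le(2)[of p] by (intro abs_le_square_iff[THEN iffD1]) auto
    have w0: "0 \<le> w t" "w t \<le> \<delta> powr (s - 1)"
    proof -
      show "0 \<le> w t" by (simp add: w_def)
      have "t powr (s - 1) \<le> \<delta> powr (s - 1)" using t d s by (intro powr_mono2') auto
      moreover have "exp (- lam k * t) \<le> 1" using t lam_pos[of k] by simp
      ultimately have "t powr (s - 1) * exp (- lam k * t) \<le> \<delta> powr (s - 1) * 1" by (intro mult_mono) auto
      then show "w t \<le> \<delta> powr (s - 1)" by (simp add: w_def)
    qed
    have g0: "\<bar>g t (snd p)\<bar> \<le> lam k + 1 / \<delta> + R\<^sup>2 / (4 * \<delta>\<^sup>2)"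
    proof -
      have 1: "\<bar>(1 - s) / t\<bar> \<le> 1 / \<delta>" using t d s by (simp add: frac_le)
      have 2: "\<bar>(snd p)\<^sup>2 / (4 * t\<^sup>2)\<bar> \<le> R\<^sup>2 / (4 * \<delta>\<^sup>2)"
        using t d \<open>(snd p)\<^sup>2 \<le> R\<^sup>2\<close> by (auto intro!: frac_le mult_left_mono power_mono)
      have "\<bar>lam k + (1 - s) / t - (snd p)\<^sup>2 / (4 * t\<^sup>2)\<bar> \<le> lam k + 1 / \<delta> + R\<^sup>2 / (4 * \<delta>\<^sup>2)"
        using 1 2 lam_pos[of k] by linarith
      moreover have "\<bar>gauss t (snd p)\<bar> \<le> 1" using gauss_le_1[OF t(2)] by simp
      ultimately have "\<bar>lam k + (1 - s) / t - (snd p)\<^sup>2 / (4 * t\<^sup>2)\<bar> * \<bar>gauss t (snd p)\<bar> \<le> (lam k + 1 / \<delta> + R\<^sup>2 / (4 * \<delta>\<^sup>2)) * 1"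
        by (intro mult_mono) auto
      then show ?thesis by (simp add: g_def abs_mult)
    qed
    have "w t * \<bar>g t (snd p)\<bar> \<le> C"
      unfolding C_def using w0 g0 by (intro mult_mono) auto
    then have "\<bar>f p\<bar> * (w t * \<bar>g t (snd p)\<bar>) \<le> \<bar>f p\<bar> * C" by (rule mult_left_mono) simp
    then show ?thesis using True w0(1) by (simp add: F_def abs_mult)
  next
    case False
    then have "F p t = 0" using K(3)[of p] by (auto simp: F_def f_def)
    then show ?thesis using C by simp
  qed
  have Fm: "case_prod F \<in> borel_measurable (M \<Otimes>\<^sub>M lborel)"
    unfolding F_def w_def g_def gauss_def case_prod_unfold by measurable
  have Fi: "integrable (M \<Otimes>\<^sub>M lborel) (case_prod F)"
  proof (rule Bochner_Integration.integrable_bound)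
    show "integrable (M \<Otimes>\<^sub>M lborel) (\<lambda>z. \<bar>f (fst z)\<bar> * (C * indicat_real {\<delta>..T} (snd z)))"
    proof (rule Q.Fubini_integrable)
      have "integrable lborel (\<lambda>t. C * indicat_real {\<delta>..T} t)"
        by (intro integrable_mult_right integrable_real_indicator) (use d in auto)
      then show "AE p in M. integrable lborel (\<lambda>t. \<bar>f (fst (p, t))\<bar> * (C * indicat_real {\<delta>..T} (snd (p, t))))" by simp
      have "(\<integral>t. norm (\<bar>f (fst (p, t))\<bar> * (C * indicat_real {\<delta>..T} (snd (p, t)))) \<partial>lborel) = \<bar>f p\<bar> * (C * (T - \<delta>))" for p
        using C d by (simp add: abs_mult)
      then show "integrable M (\<lambda>p. \<integral>t. norm (\<bar>f (fst (p, t))\<bar> * (C * indicat_real {\<delta>..T} (snd (p, t)))) \<partial>lborel)"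
        using fi by simp
    qed measurable
    show "AE z in M \<Otimes>\<^sub>M lborel. norm (case_prod F z) \<le> norm (\<bar>f (fst z)\<bar> * (C * indicat_real {\<delta>..T} (snd z)))"
      using bnd C by (intro AE_I2) (auto simp: abs_mult)
  qed (rule Fm)
  have inner: "(\<integral>p. F p t \<partial>M) = indicat_real {\<delta>..T} t * (t powr (s - 1) * exp (- lam k * t) * b t)" for t
  proof (cases "t \<in> {\<delta>..T}")
    case True
    then have t: "t > 0" using d by simp
    have "(\<integral>p. F p t \<partial>M) = (\<integral>p. w t * (phi k (fst p) * (\<psi> p * g t (snd p))) \<partial>M)"
      using True by (intro Bochner_Integration.integral_cong) (auto simp: F_def f_def)
    also have "\<dots> = w t * b t" using B_gauss[OF V t \<psi>] by (simp add: b_def g_def)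
    finally show ?thesis using True by (simp add: w_def)
  qed (simp add: F_def)
  show "integrable lborel (\<lambda>t. indicat_real {\<delta>..T} t * (t powr (s - 1) * exp (- lam k * t) * b t))"
    using Q.integrable_snd[OF Fi] by (simp add: inner)
  have inner2: "(\<integral>t. F p t \<partial>lborel) = phi k (fst p) * (\<psi> p * (heat k \<delta> (snd p) - heat k T (snd p)))" for p
    using gauss_t_integral[OF d, of s "lam k" "snd p"] by (simp add: F_def f_def w_def g_def heat_def)
  show "(\<integral>t. indicat_real {\<delta>..T} t * (t powr (s - 1) * exp (- lam k * t) * b t) \<partial>lborel)
      = (\<integral>p. phi k (fst p) * (\<psi> p * (heat k \<delta> (snd p) - heat k T (snd p))) \<partial>M)"
    using Q.Fubini_integral[OF Fi] by (simp add: inner inner2)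
qed

end

subsection \<open>Limits in the heat parameter\<close>

context extension_setting
begin

text \<open>The mass of t powr (s - 1) * gauss t for the weight y powr (1 - 2 s), the same for every
  t > 0. It equals \<open>d_s s * Gamma s\<close>, which is why the final constants cancel.\<close>

definition trace_const :: real where "trace_const = 2 powr (1 - 2 * s) * Gamma (1 - s)"

text \<open>The kernels form an approximate identity at y = 0: constant mass, and a first moment of
  order sqrt t. As \<psi> is Lipschitz in y, freezing it at y = 0 costs no more than the first
  moment.\<close>

lemma heat_limit_0:
  assumes \<psi>: "lat_test \<Omega> \<psi>" and d: "\<And>n. 0 < d n" "d \<longlonglongrightarrow> 0"
  shows "(\<lambda>n. \<integral>p. phi k (fst p) * (\<psi> p * heat k (d n) (snd p)) \<partial>M) \<longlonglongrightarrow> trace_const * (\<integral>x. phi k x * \<psi> (x, 0) \<partial>MO \<Omega>)"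
proof -
  let ?N = "MY (1 - 2 * s)"
  have \<psi>': "test_fn (\<Omega> \<times> UNIV) \<psi>" using \<psi> by (simp add: lat_test_def)
  note sm = test_fn_smooth[OF \<psi>']
  obtain K where K: "compact K" "K \<subseteq> \<Omega> \<times> UNIV" "\<And>x. x \<notin> K \<Longrightarrow> \<psi> x = 0 \<and> cgrad \<psi> x = 0"
    using test_fn_support[OF \<psi>'] by blast
  obtain R where R: "\<And>p. p \<in> K \<Longrightarrow> norm p \<le> R"
    using compact_imp_bounded[OF K(1)] by (auto simp: bounded_iff)
  obtain L where L: "L \<ge> 0" "\<And>p. norm (cgrad \<psi> p) \<le> L"
    using bounded_compact_support[OF smooth_continuous_cgrad[OF sm] K(1)] K(3) by blast
  have pm[measurable]: "phi k \<in> borel_measurable borel" using phi_sq_int[of k] by (simp add: sq_int_def)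
  have [measurable]: "\<psi> \<in> borel_measurable borel" by (rule borel_measurable_continuous_onI[OF smooth_continuous[OF sm]])
  \<comment> \<open>The error of freezing \<psi> at height 0; it is supported over a ball of the
    base and at most L * |y|.\<close>
  define E where "E p = \<psi> p - \<psi> (fst p, 0)" for p
  have [measurable]: "E \<in> borel_measurable borel" unfolding E_def by measurable
  have Eb: "\<bar>E (x, y)\<bar> \<le> indicat_real (cball 0 R) x * (L * \<bar>y\<bar>)" for x y
  proof (cases "norm x \<le> R")
    case True
    have "norm (\<psi> (x, y) - \<psi> (x, 0)) \<le> L * norm ((x, y) - (x, 0))"
    proof (rule differentiable_bound[of UNIV \<psi> "\<lambda>p v. cgrad \<psi> p \<bullet> v"])
      show "onorm (\<lambda>v. cgrad \<psi> p \<bullet> v) \<le> L" for p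
      proof (rule onorm_le)
        fix w have "\<bar>cgrad \<psi> p \<bullet> w\<bar> \<le> norm (cgrad \<psi> p) * norm w" by (rule Cauchy_Schwarz_ineq2)
        also have "\<dots> \<le> L * norm w" by (intro mult_right_mono L) auto
        finally show "norm (cgrad \<psi> p \<bullet> w) \<le> L * norm w" by simp
      qed
    qed (use smooth_has_derivative[OF sm] in auto)
    then show ?thesis using True by (simp add: E_def norm_Pair)
  next
    case False
    have "(x, z) \<notin> K" for z
      using R[of "(x, z)"] norm_fst_snd_le(1)[of "(x, z)"] False by auto
    then show ?thesis using K(3) False by (simp add: E_def)
  qed
  define Q where "Q = (\<integral>x. \<bar>phi k x\<bar> * (indicat_real (cball 0 R) x * L) \<partial>MO \<Omega>)"
  have Qi: "integrable (MO \<Omega>) (\<lambda>x. \<bar>phi k x\<bar> * (indicat_real (cball 0 R) x * L))"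
  proof -
    have "sq_int (MO \<Omega>) (\<lambda>x. indicat_real (cball 0 R) x * L)"
      using sq_int_scaleR(1)[OF sq_int_indicator_MO[OF Omega_borel, of "cball 0 R"], of L] by (simp add: mult.commute)
    moreover have "sq_int (MO \<Omega>) (\<lambda>x. \<bar>phi k x\<bar>)"
      using phi_sq_int[of k] by (auto simp: sq_int_def)
    ultimately show ?thesis using l2_inner(1)[of "MO \<Omega>" "\<lambda>x. \<bar>phi k x\<bar>"] by force
  qed
  \<comment> \<open>\<open>w\<close> is the time weight; \<open>m\<close> and \<open>m1\<close> are
    the zeroth and first moments of the profile.\<close>
  define w where "w n = d n powr (s - 1) * exp (- lam k * d n)" for n
  define m where "m n = Gamma (1 - s) / (2 * (1 / (4 * d n)) powr (1 - s))" for n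
  define m1 where "m1 n = Gamma (3/2 - s) / (2 * (1 / (4 * d n)) powr (3/2 - s))" for n
  have hm: "has_bochner_integral ?N (gauss (d n)) (m n)" for n
    using gauss_MY[of "1 - 2 * s" "1 / (4 * d n)" 0] s d(1)[of n]
    by (simp add: m_def gauss_def[abs_def] diff_divide_distrib)
  have hm1: "has_bochner_integral ?N (\<lambda>y. y * gauss (d n) y) (m1 n)" for n
  proof -
    have e: "((1 - 2 * s) + real 1 + 1) / 2 = 3/2 - s" by simp
    show ?thesis
      using gauss_MY[of "1 - 2 * s" "1 / (4 * d n)" 1] s d(1)[of n] unfolding e
      by (simp add: m1_def gauss_def)
  qed
  have p0: "integrable (MO \<Omega>) (\<lambda>x. phi k x * \<psi> (x, 0))"
    using l2_inner(1)[OF phi_sq_int trace_sq_int[OF \<psi>]] by simp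
  have int_eq: "(\<integral>p. phi k (fst p) * (\<psi> p * gauss (d n) (snd p)) \<partial>M)
      = (\<integral>x. phi k x * \<psi> (x, 0) \<partial>MO \<Omega>) * m n + (\<integral>p. phi k (fst p) * (E p * gauss (d n) (snd p)) \<partial>M)"
    and err: "\<bar>\<integral>p. phi k (fst p) * (E p * gauss (d n) (snd p)) \<partial>M\<bar> \<le> Q * m1 n" for n
  proof -
    have i0: "integrable M (\<lambda>p. phi k (fst p) * (\<psi> p * gauss (d n) (snd p)))"
      by (rule integrable_phi_psi(1)[OF \<psi> gauss_continuous(1)])
    have gi: "integrable ?N (gauss (d n))" "(\<integral>y. gauss (d n) y \<partial>?N) = m n"
      using hm[of n] by (auto simp: has_bochner_integral_iff)
    note i1 = MC_prod(1)[OF Omega_borel p0 gi(1)]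
    have eq: "phi k (fst p) * (E p * gauss (d n) (snd p)) = phi k (fst p) * (\<psi> p * gauss (d n) (snd p)) - (phi k (fst p) * \<psi> (fst p, 0)) * gauss (d n) (snd p)" for p
      by (simp add: E_def algebra_simps)
    have i2: "integrable M (\<lambda>p. phi k (fst p) * (E p * gauss (d n) (snd p)))"
      unfolding eq by (rule Bochner_Integration.integrable_diff[OF i0 i1])
    have "(\<integral>p. phi k (fst p) * (E p * gauss (d n) (snd p)) \<partial>M) = (\<integral>p. phi k (fst p) * (\<psi> p * gauss (d n) (snd p)) \<partial>M)
        - (\<integral>x. phi k x * \<psi> (x, 0) \<partial>MO \<Omega>) * m n"
      unfolding eq Bochner_Integration.integral_diff[OF i0 i1] MC_prod(2)[OF Omega_borel p0 gi(1)] gi(2) ..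
    then show "(\<integral>p. phi k (fst p) * (\<psi> p * gauss (d n) (snd p)) \<partial>M)
      = (\<integral>x. phi k x * \<psi> (x, 0) \<partial>MO \<Omega>) * m n + (\<integral>p. phi k (fst p) * (E p * gauss (d n) (snd p)) \<partial>M)" by simp
    have gi1: "integrable ?N (\<lambda>y. y * gauss (d n) y)" "(\<integral>y. y * gauss (d n) y \<partial>?N) = m1 n"
      using hm1[of n] by (auto simp: has_bochner_integral_iff)
    note i3 = MC_prod[OF Omega_borel Qi gi1(1)]
    have ypos: "AE p in M. snd p > 0"
      by (subst AE_MC) (auto simp: cyl_def)
    have "\<bar>\<integral>p. phi k (fst p) * (E p * gauss (d n) (snd p)) \<partial>M\<bar> \<le> (\<integral>p. \<bar>phi k (fst p) * (E p * gauss (d n) (snd p))\<bar> \<partial>M)"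
      by (rule integral_abs_bound)
    also have "\<dots> \<le> (\<integral>p. (\<bar>phi k (fst p)\<bar> * (indicat_real (cball 0 R) (fst p) * L)) * (snd p * gauss (d n) (snd p)) \<partial>M)"
    proof (rule integral_mono_AE)
      show "AE p in M. \<bar>phi k (fst p) * (E p * gauss (d n) (snd p))\<bar> \<le> (\<bar>phi k (fst p)\<bar> * (indicat_real (cball 0 R) (fst p) * L)) * (snd p * gauss (d n) (snd p))"
        using ypos
      proof eventually_elim
        case (elim p)
        have "\<bar>E p\<bar> * gauss (d n) (snd p) \<le> (indicat_real (cball 0 R) (fst p) * (L * snd p)) * gauss (d n) (snd p)"
          using Eb[of "fst p" "snd p"] elim by (intro mult_right_mono) auto
        then have "\<bar>phi k (fst p)\<bar> * (\<bar>E p\<bar> * gauss (d n) (snd p)) \<le> \<bar>phi k (fst p)\<bar> * ((indicat_real (cball 0 R) (fst p) * (L * snd p)) * gauss (d n) (snd p))"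
          by (rule mult_left_mono) simp
        then show ?case by (simp add: abs_mult mult_ac)
      qed
    qed (use i2 i3 in auto)
    also have "\<dots> = Q * m1 n" unfolding i3(2) gi1(2) Q_def ..
    finally show "\<bar>\<integral>p. phi k (fst p) * (E p * gauss (d n) (snd p)) \<partial>M\<bar> \<le> Q * m1 n" .
  qed
  have el: "(\<lambda>n. exp (- lam k * d n)) \<longlonglongrightarrow> 1"
    using tendsto_exp[OF tendsto_mult_left[OF d(2), of "- lam k"]] by simp
  have wm: "w n * m n = exp (- lam k * d n) * trace_const" for n
  proof -
    have "d n powr (s - 1) * (1 / (1 / (4 * d n)) powr (1 - s)) = d n powr (s - 1) * (4 powr (1 - s) * d n powr (1 - s))"
      using d(1)[of n] by (simp add: powr_divide powr_mult)
    also have "\<dots> = 4 powr (1 - s) * (d n powr (s - 1) * d n powr (1 - s))" by simp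
    also have "d n powr (s - 1) * d n powr (1 - s) = 1"
      using d(1)[of n] by (simp add: powr_add[symmetric])
    finally have 1: "d n powr (s - 1) * (1 / (1 / (4 * d n)) powr (1 - s)) = 4 powr (1 - s)" by simp
    \<comment> \<open>The factor 2 split off here cancels the 1/2 in the Gaussian moment.\<close>
    have "(4::real) powr (1 - s) = (2 powr 2) powr (1 - s)" by simp
    also have "\<dots> = 2 powr (1 + (1 - 2 * s))" unfolding powr_powr by (rule arg_cong[where f = "(powr) 2"]) simp
    also have "\<dots> = 2 * 2 powr (1 - 2 * s)" by (subst powr_add) simp
    finally have 2: "(4::real) powr (1 - s) = 2 * 2 powr (1 - 2 * s)" .
    have "w n * m n = exp (- lam k * d n) * (Gamma (1 - s) / 2 * (d n powr (s - 1) * (1 / (1 / (4 * d n)) powr (1 - s))))"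
      by (simp add: w_def m_def)
    also have "\<dots> = exp (- lam k * d n) * trace_const" unfolding 1 2 by (simp add: trace_const_def)
    finally show ?thesis .
  qed
  \<comment> \<open>The exponents s - 1 and 3/2 - s add up to 1/2, so the weighted first moment is
    \<open>q1 * sqrt (d n)\<close> up to the exponential.\<close>
  define q1 where "q1 = Gamma (3/2 - s) / 2 * 4 powr (3/2 - s)"
  have wm1: "w n * m1 n = exp (- lam k * d n) * (q1 * sqrt (d n))" for n
  proof -
    have "d n powr (s - 1) * (1 / (1 / (4 * d n)) powr (3/2 - s)) = d n powr (s - 1) * (4 powr (3/2 - s) * d n powr (3/2 - s))"
      using d(1)[of n] by (simp add: powr_divide powr_mult)
    also have "\<dots> = 4 powr (3/2 - s) * (d n powr (s - 1) * d n powr (3/2 - s))" by simp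
    also have "d n powr (s - 1) * d n powr (3/2 - s) = sqrt (d n)"
      using d(1)[of n] by (simp add: powr_add[symmetric] powr_half_sqrt)
    finally have 1: "d n powr (s - 1) * (1 / (1 / (4 * d n)) powr (3/2 - s)) = 4 powr (3/2 - s) * sqrt (d n)" .
    have "w n * m1 n = exp (- lam k * d n) * (Gamma (3/2 - s) / 2 * (d n powr (s - 1) * (1 / (1 / (4 * d n)) powr (3/2 - s))))"
      by (simp add: w_def m1_def)
    also have "\<dots> = exp (- lam k * d n) * (q1 * sqrt (d n))" unfolding 1 by (simp add: q1_def)
    finally show ?thesis .
  qed
  have "(\<lambda>n. w n * (\<integral>p. phi k (fst p) * (E p * gauss (d n) (snd p)) \<partial>M)) \<longlonglongrightarrow> 0"
  proof (rule Lim_null_comparison[OF always_eventually])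
    show "\<forall>n. norm (w n * (\<integral>p. phi k (fst p) * (E p * gauss (d n) (snd p)) \<partial>M)) \<le> Q * (exp (- lam k * d n) * (q1 * sqrt (d n)))"
    proof
      fix n
      have "w n \<ge> 0" by (simp add: w_def)
      then have "norm (w n * (\<integral>p. phi k (fst p) * (E p * gauss (d n) (snd p)) \<partial>M)) \<le> w n * (Q * m1 n)"
        using err[of n] by (simp add: abs_mult mult_left_mono)
      also have "\<dots> = Q * (w n * m1 n)" by simp
      finally show "norm (w n * (\<integral>p. phi k (fst p) * (E p * gauss (d n) (snd p)) \<partial>M)) \<le> Q * (exp (- lam k * d n) * (q1 * sqrt (d n)))"
        unfolding wm1 .
    qed
    have "(\<lambda>n. Q * (exp (- lam k * d n) * (q1 * sqrt (d n)))) \<longlonglongrightarrow> Q * (1 * (q1 * sqrt 0))"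
      by (intro tendsto_intros el d(2))
    then show "(\<lambda>n. Q * (exp (- lam k * d n) * (q1 * sqrt (d n)))) \<longlonglongrightarrow> 0" by simp
  qed
  moreover have "(\<lambda>n. (\<integral>x. phi k x * \<psi> (x, 0) \<partial>MO \<Omega>) * (exp (- lam k * d n) * trace_const)) \<longlonglongrightarrow> (\<integral>x. phi k x * \<psi> (x, 0) \<partial>MO \<Omega>) * (1 * trace_const)"
    by (intro tendsto_intros el)
  ultimately have "(\<lambda>n. (\<integral>x. phi k x * \<psi> (x, 0) \<partial>MO \<Omega>) * (exp (- lam k * d n) * trace_const)
      + w n * (\<integral>p. phi k (fst p) * (E p * gauss (d n) (snd p)) \<partial>M)) \<longlonglongrightarrow> (\<integral>x. phi k x * \<psi> (x, 0) \<partial>MO \<Omega>) * (1 * trace_const) + 0"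
    by (intro tendsto_add)
  moreover have "(\<integral>x. phi k x * \<psi> (x, 0) \<partial>MO \<Omega>) * (exp (- lam k * d n) * trace_const)
      + w n * (\<integral>p. phi k (fst p) * (E p * gauss (d n) (snd p)) \<partial>M) = (\<integral>p. phi k (fst p) * (\<psi> p * heat k (d n) (snd p)) \<partial>M)" for n
  proof -
    have "(\<integral>p. phi k (fst p) * (\<psi> p * heat k (d n) (snd p)) \<partial>M) = (\<integral>p. w n * (phi k (fst p) * (\<psi> p * gauss (d n) (snd p))) \<partial>M)"
      by (rule Bochner_Integration.integral_cong) (auto simp: heat_def w_def)
    also have "\<dots> = w n * ((\<integral>x. phi k x * \<psi> (x, 0) \<partial>MO \<Omega>) * m n + (\<integral>p. phi k (fst p) * (E p * gauss (d n) (snd p)) \<partial>M))"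
      by (simp add: int_eq)
    also have "\<dots> = (\<integral>x. phi k x * \<psi> (x, 0) \<partial>MO \<Omega>) * (w n * m n) + w n * (\<integral>p. phi k (fst p) * (E p * gauss (d n) (snd p)) \<partial>M)"
      by (simp add: algebra_simps)
    finally show ?thesis unfolding wm by simp
  qed
  ultimately show ?thesis by (simp add: mult.commute)
qed

text \<open>The decay comes from exp (- lam k * t) alone; for t >= 1 the power and the profile are
  at most 1.\<close>

lemma heat_limit_infinity:
  assumes \<psi>: "lat_test \<Omega> \<psi>"
  shows "(\<lambda>n. \<integral>p. phi k (fst p) * (\<psi> p * heat k (real (Suc n)) (snd p)) \<partial>M) \<longlonglongrightarrow> 0"
proof (rule Lim_null_comparison[OF always_eventually])
  define f where "f p = phi k (fst p) * \<psi> p" for p :: "(real^'n) \<times> real"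
  have fi: "integrable M f" unfolding f_def using integrable_phi_psi(1)[OF \<psi>, of "\<lambda>_. 1" k] by simp
  show "\<forall>n. norm (\<integral>p. phi k (fst p) * (\<psi> p * heat k (real (Suc n)) (snd p)) \<partial>M) \<le> exp (- lam k * real (Suc n)) * (\<integral>p. \<bar>f p\<bar> \<partial>M)"
  proof
    fix n
    have i: "integrable M (\<lambda>p. phi k (fst p) * (\<psi> p * heat k (real (Suc n)) (snd p)))"
      by (rule integrable_phi_psi(1)[OF \<psi> heat_continuous])
    have "norm (\<integral>p. phi k (fst p) * (\<psi> p * heat k (real (Suc n)) (snd p)) \<partial>M) \<le> (\<integral>p. norm (phi k (fst p) * (\<psi> p * heat k (real (Suc n)) (snd p))) \<partial>M)"
      by (rule integral_norm_bound)
    also have "\<dots> \<le> (\<integral>p. exp (- lam k * real (Suc n)) * \<bar>f p\<bar> \<partial>M)"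
    proof (rule integral_mono)
      fix p :: "(real^'n) \<times> real"
      have "real (Suc n) powr (s - 1) \<le> real (Suc n) powr 0" using s by (intro powr_mono) auto
      then have "real (Suc n) powr (s - 1) \<le> 1" by simp
      then have "real (Suc n) powr (s - 1) * exp (- lam k * real (Suc n)) * gauss (real (Suc n)) (snd p) \<le> 1 * exp (- lam k * real (Suc n)) * 1"
        using gauss_le_1[of "real (Suc n)" "snd p"] by (intro mult_mono) auto
      then have h: "heat k (real (Suc n)) (snd p) \<le> exp (- lam k * real (Suc n))" by (simp add: heat_def)
      have h0: "heat k (real (Suc n)) (snd p) \<ge> 0" by (simp add: heat_def)
      have "norm (phi k (fst p) * (\<psi> p * heat k (real (Suc n)) (snd p))) = heat k (real (Suc n)) (snd p) * \<bar>f p\<bar>"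
        using h0 by (simp add: f_def abs_mult mult_ac)
      also have "\<dots> \<le> exp (- lam k * real (Suc n)) * \<bar>f p\<bar>" by (rule mult_right_mono[OF h]) simp
      finally show "norm (phi k (fst p) * (\<psi> p * heat k (real (Suc n)) (snd p))) \<le> exp (- lam k * real (Suc n)) * \<bar>f p\<bar>" .
    qed (use i fi in auto)
    finally show "norm (\<integral>p. phi k (fst p) * (\<psi> p * heat k (real (Suc n)) (snd p)) \<partial>M) \<le> exp (- lam k * real (Suc n)) * (\<integral>p. \<bar>f p\<bar> \<partial>M)"
      by simp
  qed
  have "filterlim (\<lambda>n. - lam k * real (Suc n)) at_bot sequentially"
    by (rule filterlim_tendsto_neg_mult_at_bot[OF tendsto_const _
          filterlim_compose[OF filterlim_real_sequentially filterlim_Suc]]) (simp add: lam_pos)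
  then have "(\<lambda>n. exp (- lam k * real (Suc n))) \<longlonglongrightarrow> 0" by (rule filterlim_compose[OF exp_at_bot])
  then show "(\<lambda>n. exp (- lam k * real (Suc n)) * (\<integral>p. \<bar>f p\<bar> \<partial>M)) \<longlonglongrightarrow> 0"
    by (rule tendsto_mult_left_zero)
qed

text \<open>Dominated by the full Gamma integrand; the same truncations serve the two limits of the
  heat integral.\<close>

lemma gamma_weight_limit:
  "(\<lambda>n. \<integral>t. indicat_real {1 / real (Suc n)..real (Suc n)} t * (t powr (s - 1) * exp (- lam k * t)) \<partial>lborel)
     \<longlonglongrightarrow> Gamma s / lam k powr s"
proof -
  have g: "has_bochner_integral lborel (\<lambda>t. indicat_real {0<..} t * (t powr (s - 1) * exp (- lam k * t))) (Gamma s / lam k powr s)"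
    by (rule gamma_scaled[OF s(1) lam_pos])
  have "(\<lambda>n. \<integral>t. indicat_real {1 / real (Suc n)..real (Suc n)} t * (t powr (s - 1) * exp (- lam k * t)) \<partial>lborel)
     \<longlonglongrightarrow> (\<integral>t. indicat_real {0<..} t * (t powr (s - 1) * exp (- lam k * t)) \<partial>lborel)"
  proof (rule integral_dominated_convergence)
    show "integrable lborel (\<lambda>t. indicat_real {0<..} t * (t powr (s - 1) * exp (- lam k * t)))"
      using g by (simp add: has_bochner_integral_iff)
    show "AE t in lborel. (\<lambda>n. indicat_real {1 / real (Suc n)..real (Suc n)} t * (t powr (s - 1) * exp (- lam k * t)))
       \<longlonglongrightarrow> indicat_real {0<..} t * (t powr (s - 1) * exp (- lam k * t))"
    proof (rule AE_I2, intro tendsto_mult tendsto_const)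
      fix t :: real
      show "(\<lambda>n. indicat_real {1 / real (Suc n)..real (Suc n)} t) \<longlonglongrightarrow> indicat_real {0<..} t"
      proof (cases "t > 0")
        case True
        obtain N1 where N1: "real N1 > t" using reals_Archimedean2 by blast
        obtain N2 where N2: "real N2 > 1 / t" using reals_Archimedean2 by blast
        show ?thesis
        proof (rule tendsto_eventually, rule eventually_sequentiallyI[of "max N1 N2"])
          fix n assume n: "max N1 N2 \<le> n"
          have "real (Suc n) > t" "real (Suc n) > 1 / t" using n N1 N2 by auto
          then have "1 / real (Suc n) \<le> t" using True by (simp add: field_simps)
          with \<open>real (Suc n) > t\<close> True show "indicat_real {1 / real (Suc n)..real (Suc n)} t = indicat_real {0<..} t" by simp
        qed
      next
        case False
        have "t \<notin> {1 / real (Suc n)..real (Suc n)}" for n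
        proof -
          have "0 < 1 / real (Suc n)" by simp
          with False show ?thesis unfolding atLeastAtMost_iff by linarith
        qed
        with False show ?thesis by simp
      qed
    qed
    show "AE t in lborel. norm (indicat_real {1 / real (Suc n)..real (Suc n)} t * (t powr (s - 1) * exp (- lam k * t)))
       \<le> indicat_real {0<..} t * (t powr (s - 1) * exp (- lam k * t))" for n
    proof (rule AE_I2)
      fix t :: real
      have "t > 0" if "t \<in> {1 / real (Suc n)..real (Suc n)}"
      proof -
        have "0 < 1 / real (Suc n)" by simp
        with that show ?thesis unfolding atLeastAtMost_iff by linarith
      qed
      then show "norm (indicat_real {1 / real (Suc n)..real (Suc n)} t * (t powr (s - 1) * exp (- lam k * t)))
       \<le> indicat_real {0<..} t * (t powr (s - 1) * exp (- lam k * t))"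
        by (cases "t \<in> {1 / real (Suc n)..real (Suc n)}") auto
    qed
  qed (auto simp: indicator_def)
  then show ?thesis using g by (simp add: has_bochner_integral_iff)
qed

text \<open>The integrand splits into t powr (s / 2 - 1) and t powr (s / 2), each times the
  exponential: two Gamma integrals bounding all truncations uniformly.\<close>

lemma error_weight:
  obtains D where "D \<ge> 0" "\<And>\<delta> T. 0 < \<delta> \<Longrightarrow>
    integrable lborel (\<lambda>t. indicat_real {\<delta>..T} t * (t powr (s - 1) * exp (- lam k * t) * ((1 + t) * t powr (- s / 2)))) \<and>
    (\<integral>t. indicat_real {\<delta>..T} t * (t powr (s - 1) * exp (- lam k * t) * ((1 + t) * t powr (- s / 2))) \<partial>lborel) \<le> D"
proof -
  define h where "h t = indicat_real {0<..} t * (t powr (s / 2 - 1) * exp (- lam k * t))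
     + indicat_real {0<..} t * (t powr ((s / 2 + 1) - 1) * exp (- lam k * t))" for t
  have hi: "integrable lborel h"
    unfolding h_def using gamma_scaled[of "s / 2" "lam k"] gamma_scaled[of "s / 2 + 1" "lam k"] s lam_pos[of k]
    by (intro Bochner_Integration.integrable_add) (auto simp: has_bochner_integral_iff)
  have h0: "h t \<ge> 0" for t by (simp add: h_def)
  have eq: "t powr (s - 1) * exp (- lam k * t) * ((1 + t) * t powr (- s / 2)) = h t" if "t > 0" for t
  proof -
    have 1: "t powr (s - 1) * t powr (- s / 2) = t powr (s / 2 - 1)" unfolding powr_add[symmetric] by (rule arg_cong[where f = "(powr) t"]) simp
    have 2: "t * t powr (s / 2 - 1) = t powr ((s / 2 + 1) - 1)" using that powr_add[of t 1 "s / 2 - 1"] by simp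
    have "t powr (s - 1) * exp (- lam k * t) * ((1 + t) * t powr (- s / 2)) = (t powr (s - 1) * t powr (- s / 2)) * exp (- lam k * t) + (t * (t powr (s - 1) * t powr (- s / 2))) * exp (- lam k * t)"
      by (simp add: algebra_simps)
    also have "\<dots> = h t" unfolding 1 2 using that by (simp add: h_def)
    finally show ?thesis .
  qed
  have "integrable lborel (\<lambda>t. indicat_real {\<delta>..T} t * (t powr (s - 1) * exp (- lam k * t) * ((1 + t) * t powr (- s / 2)))) \<and>
    (\<integral>t. indicat_real {\<delta>..T} t * (t powr (s - 1) * exp (- lam k * t) * ((1 + t) * t powr (- s / 2))) \<partial>lborel) \<le> (\<integral>t. h t \<partial>lborel)"
    if d: "0 < \<delta>" for \<delta> T
  proof -
    have b: "0 \<le> indicat_real {\<delta>..T} t * (t powr (s - 1) * exp (- lam k * t) * ((1 + t) * t powr (- s / 2)))"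
      "indicat_real {\<delta>..T} t * (t powr (s - 1) * exp (- lam k * t) * ((1 + t) * t powr (- s / 2))) \<le> h t" for t
      using eq[of t] d h0[of t] by (auto simp: indicator_def)
    have i: "integrable lborel (\<lambda>t. indicat_real {\<delta>..T} t * (t powr (s - 1) * exp (- lam k * t) * ((1 + t) * t powr (- s / 2))))"
      by (rule Bochner_Integration.integrable_bound[OF hi]) (use b h0 in auto)
    show ?thesis by (intro conjI i integral_mono hi b)
  qed
  moreover have "(\<integral>t. h t \<partial>lborel) \<ge> 0" using h0 by (intro Bochner_Integration.integral_nonneg) auto
  ultimately show ?thesis using that by blast
qed

text \<open>A stability version of the spectral identity: if testing \<psi> with every Gaussian
  gives nearly the same number \<beta>, then its trace coefficient is nearly determined by \<beta>.
  \<open>D\<close> is chosen before \<psi>, so the estimate can be applied along a sequence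
  converging to the extension.\<close>

lemma trace_coef_estimate:
  assumes V: "sq_int (MO \<Omega>) V" "\<And>x. fst (V x) = phi k x"
    "\<And>v. test_fn \<Omega> v \<Longrightarrow> (\<integral>x. form_op_base x (V x) \<bullet> jet v x \<partial>MO \<Omega>) = lam k * (\<integral>x. phi k x * v x \<partial>MO \<Omega>)"
  obtains D where "\<And>\<psi> \<beta> \<epsilon>. lat_test \<Omega> \<psi> \<Longrightarrow> \<epsilon> \<ge> 0 \<Longrightarrow>
      (\<And>t. t > 0 \<Longrightarrow> \<bar>B (tens V (\<lambda>y. (gauss t y, gauss' t y))) (jet \<psi>) - \<beta>\<bar> \<le> \<epsilon> * ((1 + t) * t powr (- s / 2))) \<Longrightarrow>
      \<bar>trace_const * (\<integral>x. phi k x * \<psi> (x, 0) \<partial>MO \<Omega>) - \<beta> * (Gamma s / lam k powr s)\<bar> \<le> D * \<epsilon>"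
proof -
  obtain D where D: "D \<ge> 0" "\<And>\<delta> T. 0 < \<delta> \<Longrightarrow>
    integrable lborel (\<lambda>t. indicat_real {\<delta>..T} t * (t powr (s - 1) * exp (- lam k * t) * ((1 + t) * t powr (- s / 2)))) \<and>
    (\<integral>t. indicat_real {\<delta>..T} t * (t powr (s - 1) * exp (- lam k * t) * ((1 + t) * t powr (- s / 2))) \<partial>lborel) \<le> D"
    using error_weight[of k] by blast
  have main: "\<bar>trace_const * (\<integral>x. phi k x * \<psi> (x, 0) \<partial>MO \<Omega>) - \<beta> * (Gamma s / lam k powr s)\<bar> \<le> D * \<epsilon>"
    if \<psi>: "lat_test \<Omega> \<psi>" and \<epsilon>: "\<epsilon> \<ge> 0"
      and b: "\<And>t. t > 0 \<Longrightarrow> \<bar>B (tens V (\<lambda>y. (gauss t y, gauss' t y))) (jet \<psi>) - \<beta>\<bar> \<le> \<epsilon> * ((1 + t) * t powr (- s / 2))"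
    for \<psi> \<beta> \<epsilon>
  proof -
    define bt where "bt t = B (tens V (\<lambda>y. (gauss t y, gauss' t y))) (jet \<psi>)" for t
    define w where "w t = t powr (s - 1) * exp (- lam k * t)" for t
    define d where "d n = 1 / real (Suc n)" for n
    define T where "T n = real (Suc n)" for n
    have d: "0 < d n" "d n \<le> T n" for n by (auto simp: d_def T_def field_simps)
    define H where "H t = (\<integral>p. phi k (fst p) * (\<psi> p * heat k t (snd p)) \<partial>M)" for t
    define G where "G n = (\<integral>t. indicat_real {d n..T n} t * w t \<partial>lborel)" for n
    have est: "\<bar>H (d n) - H (T n) - \<beta> * G n\<bar> \<le> D * \<epsilon>" for n
    proof -
      note I = B_gauss_integrated[OF V d[of n] \<psi>, folded bt_def w_def]
      have i1: "integrable lborel (\<lambda>t. indicat_real {d n..T n} t * (w t * bt t))"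
        and e1: "(\<integral>t. indicat_real {d n..T n} t * (w t * bt t) \<partial>lborel) = H (d n) - H (T n)"
      proof -
        show "integrable lborel (\<lambda>t. indicat_real {d n..T n} t * (w t * bt t))" by (rule I(1))
        have "(\<integral>p. phi k (fst p) * (\<psi> p * (heat k (d n) (snd p) - heat k (T n) (snd p))) \<partial>M) = H (d n) - H (T n)"
          unfolding H_def right_diff_distrib
          by (rule Bochner_Integration.integral_diff; rule integrable_phi_psi(1)[OF \<psi> heat_continuous])
        then show "(\<integral>t. indicat_real {d n..T n} t * (w t * bt t) \<partial>lborel) = H (d n) - H (T n)" using I(2) by simp
      qed
      have i2: "integrable lborel (\<lambda>t. indicat_real {d n..T n} t * w t)"
      proof (rule Bochner_Integration.integrable_bound)
        show "integrable lborel (\<lambda>t. indicat_real {0<..} t * (t powr (s - 1) * exp (- lam k * t)))"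
          using gamma_scaled[OF s(1) lam_pos[of k]] by (simp add: has_bochner_integral_iff)
        show "AE t in lborel. norm (indicat_real {d n..T n} t * w t) \<le> norm (indicat_real {0<..} t * (t powr (s - 1) * exp (- lam k * t)))"
          using d(1)[of n] by (intro AE_I2) (auto simp: w_def indicator_def)
      qed (simp add: w_def)
      let ?e = "\<lambda>t. indicat_real {d n..T n} t * (t powr (s - 1) * exp (- lam k * t) * ((1 + t) * t powr (- s / 2)))"
      have i3: "integrable lborel ?e" "(\<integral>t. ?e t \<partial>lborel) \<le> D" using D(2)[OF d(1)] by blast+
      have eq: "H (d n) - H (T n) - \<beta> * G n = (\<integral>t. indicat_real {d n..T n} t * (w t * bt t) - \<beta> * (indicat_real {d n..T n} t * w t) \<partial>lborel)"
        using i1 i2 by (simp add: e1 G_def)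
      have "\<bar>H (d n) - H (T n) - \<beta> * G n\<bar> \<le> (\<integral>t. \<bar>indicat_real {d n..T n} t * (w t * bt t) - \<beta> * (indicat_real {d n..T n} t * w t)\<bar> \<partial>lborel)"
        unfolding eq by (rule integral_abs_bound)
      also have "\<dots> \<le> (\<integral>t. \<epsilon> * ?e t \<partial>lborel)"
      proof (rule integral_mono)
        fix t :: real
        show "\<bar>indicat_real {d n..T n} t * (w t * bt t) - \<beta> * (indicat_real {d n..T n} t * w t)\<bar> \<le> \<epsilon> * ?e t"
        proof (cases "t \<in> {d n..T n}")
          case True
          then have t: "t > 0" using d(1)[of n] by (auto intro: less_le_trans)
          have w0: "w t \<ge> 0" by (simp add: w_def)
          have "w t * \<bar>bt t - \<beta>\<bar> \<le> w t * (\<epsilon> * ((1 + t) * t powr (- s / 2)))"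
            using b[OF t] w0 by (intro mult_left_mono) (auto simp: bt_def)
          moreover have "\<bar>w t * bt t - \<beta> * w t\<bar> = w t * \<bar>bt t - \<beta>\<bar>"
            using w0 by (simp add: abs_mult right_diff_distrib[symmetric] mult.commute[of \<beta>])
          ultimately show ?thesis using True by (simp add: w_def mult_ac)
        qed simp
      qed (use i1 i2 i3 in auto)
      also have "\<dots> = \<epsilon> * (\<integral>t. ?e t \<partial>lborel)" by (rule integral_mult_right_zero)
      also have "\<dots> \<le> \<epsilon> * D" by (rule mult_left_mono[OF i3(2) \<epsilon>])
      finally show ?thesis by (simp add: mult.commute)
    qed
    have "(\<lambda>n. H (d n) - H (T n) - \<beta> * G n) \<longlonglongrightarrow> trace_const * (\<integral>x. phi k x * \<psi> (x, 0) \<partial>MO \<Omega>) - 0 - \<beta> * (Gamma s / lam k powr s)"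
    proof (intro tendsto_diff tendsto_mult_left)
      have "d \<longlonglongrightarrow> 0" unfolding d_def using LIMSEQ_inverse_real_of_nat by (simp add: inverse_eq_divide)
      then show "(\<lambda>n. H (d n)) \<longlonglongrightarrow> trace_const * (\<integral>x. phi k x * \<psi> (x, 0) \<partial>MO \<Omega>)"
        unfolding H_def by (rule heat_limit_0[OF \<psi> d(1)])
      show "(\<lambda>n. H (T n)) \<longlonglongrightarrow> 0" unfolding H_def T_def by (rule heat_limit_infinity[OF \<psi>])
      show "G \<longlonglongrightarrow> Gamma s / lam k powr s" unfolding G_def d_def T_def w_def by (rule gamma_weight_limit)
    qed
    then have "(\<lambda>n. \<bar>H (d n) - H (T n) - \<beta> * G n\<bar>) \<longlonglongrightarrow> \<bar>trace_const * (\<integral>x. phi k x * \<psi> (x, 0) \<partial>MO \<Omega>) - 0 - \<beta> * (Gamma s / lam k powr s)\<bar>"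
      by (rule tendsto_rabs)
    from LIMSEQ_le_const2[OF this, of "D * \<epsilon>"] est show ?thesis by simp
  qed
  show ?thesis by (rule that[OF main])
qed

end

subsection \<open>Equivalence of the two problems\<close>

lemma sq_int_jet_MY:
  fixes \<eta> :: "real \<Rightarrow> real"
  assumes \<alpha>: "\<alpha> > -1" and \<eta>: "test_fn UNIV \<eta>"
  shows "sq_int (MY \<alpha>) (jet \<eta>)"
proof -
  note sm = test_fn_smooth[OF \<eta>]
  obtain K where K: "compact K" "K \<subseteq> UNIV" "\<And>x. x \<notin> K \<Longrightarrow> \<eta> x = 0 \<and> cgrad \<eta> x = 0"
    using test_fn_support[OF \<eta>] by blast
  obtain R where R: "\<And>y. y \<in> K \<Longrightarrow> norm y \<le> R"
    using compact_imp_bounded[OF K(1)] by (auto simp: bounded_iff)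
  have z: "(norm (jet \<eta> y))\<^sup>2 = 0" if "R < y" for y
  proof -
    have "y \<notin> K" using R[of y] that by auto
    then show ?thesis using K(3) by (simp add: jet_def)
  qed
  have c: "continuous_on UNIV (\<lambda>y. (norm (jet \<eta> y))\<^sup>2)"
    unfolding jet_def by (intro continuous_intros smooth_continuous smooth_continuous_cgrad sm)
  show ?thesis
    using integrable_MY_compact[OF \<alpha> c z] borel_measurable_jet[OF sm] by (simp add: sq_int_iff)
qed

lemma smooth_has_real_derivative:
  fixes \<eta> :: "real \<Rightarrow> real"
  assumes "smooth_fun \<eta>" shows "(\<eta> has_real_derivative cgrad \<eta> y) (at y)"
  using smooth_has_derivative[OF assms, of y] by (simp add: has_field_derivative_def)

lemma cgrad_real_eqI: "((\<eta> :: real \<Rightarrow> real) has_real_derivative d) (at y) \<Longrightarrow> cgrad \<eta> y = d"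
  by (rule cgrad_eqI) (simp add: has_field_derivative_def)

context extension_setting
begin

text \<open>The equation is known for smooth tests only. Products \<open>v j\<close> times \<eta>
  are such tests, and their jets converge to the tensor of the eigenjet with the jet of
  \<eta>.\<close>

lemma B_tensor_test:
  assumes F: "sq_int M F" and q: "sq_int (MO \<Omega>) q"
    and BF: "\<And>\<omega>. lat_test \<Omega> \<omega> \<Longrightarrow> B F (jet \<omega>) = d_s s * (\<integral>x. q x * \<omega> (x, 0) \<partial>MO \<Omega>)"
    and V: "sq_int (MO \<Omega>) V" "\<And>x. fst (V x) = phi k x"
    and v: "\<And>j. test_fn \<Omega> (v j)" "(\<lambda>j. l2n (MO \<Omega>) (\<lambda>x. V x - jet (v j) x)) \<longlonglongrightarrow> 0"
    and \<eta>: "test_fn UNIV \<eta>"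
  shows "B F (tens V (jet \<eta>)) = d_s s * (\<eta> 0 * (\<integral>x. q x * phi k x \<partial>MO \<Omega>))"
proof -
  note sj = test_fn_MO(1,2)[OF v(1)]
  have sN: "sq_int (MY (1 - 2 * s)) (jet \<eta>)" by (rule sq_int_jet_MY[OF alpha \<eta>])
  have lt: "lat_test \<Omega> (\<lambda>p. v j (fst p) * \<eta> (snd p))" for j
    unfolding lat_test_def by (rule test_fn_tensor[OF v(1) \<eta>])
  have "(\<lambda>j. B F (tens (jet (v j)) (jet \<eta>))) \<longlonglongrightarrow> B F (tens V (jet \<eta>))"
  proof (rule B_conv(2)[OF _ F])
    show "sq_int M (tens V (jet \<eta>))" by (rule tens_sq_int(1)[OF Omega_borel V(1) sN])
    show "sq_int M (tens (jet (v j)) (jet \<eta>))" for j by (rule tens_sq_int(1)[OF Omega_borel sj(1) sN])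
    show "(\<lambda>j. l2n M (\<lambda>p. tens V (jet \<eta>) p - tens (jet (v j)) (jet \<eta>) p)) \<longlonglongrightarrow> 0"
    proof (rule Lim_null_comparison[OF always_eventually])
      show "\<forall>j. norm (l2n M (\<lambda>p. tens V (jet \<eta>) p - tens (jet (v j)) (jet \<eta>) p))
          \<le> l2n (MO \<Omega>) (\<lambda>x. V x - jet (v j) x) * l2n (MY (1 - 2 * s)) (jet \<eta>)"
        unfolding tens_diff(1)
        using tens_sq_int(2)[OF Omega_borel sq_int_diff(1)[OF V(1) sj(1)] sN] by simp
      show "(\<lambda>j. l2n (MO \<Omega>) (\<lambda>x. V x - jet (v j) x) * l2n (MY (1 - 2 * s)) (jet \<eta>)) \<longlonglongrightarrow> 0"
        by (rule tendsto_mult_left_zero[OF v(2)])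
    qed
  qed
  moreover have "B F (tens (jet (v j)) (jet \<eta>)) = d_s s * (\<eta> 0 * (\<integral>x. q x * v j x \<partial>MO \<Omega>))" for j
  proof -
    have "B F (tens (jet (v j)) (jet \<eta>)) = d_s s * (\<integral>x. q x * (v j x * \<eta> 0) \<partial>MO \<Omega>)"
      using BF[OF lt[of j]] by (simp add: jet_tensor[OF v(1) \<eta>])
    also have "(\<integral>x. q x * (v j x * \<eta> 0) \<partial>MO \<Omega>) = (\<integral>x. \<eta> 0 * (q x * v j x) \<partial>MO \<Omega>)"
      by (rule Bochner_Integration.integral_cong) auto
    finally show ?thesis by simp
  qed
  moreover have "(\<lambda>j. d_s s * (\<eta> 0 * (\<integral>x. q x * v j x \<partial>MO \<Omega>))) \<longlonglongrightarrow> d_s s * (\<eta> 0 * (\<integral>x. q x * phi k x \<partial>MO \<Omega>))"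
  proof (intro tendsto_mult_left MO_inner_conv[OF q phi_sq_int sj(2)])
    show "(\<lambda>j. l2n (MO \<Omega>) (\<lambda>x. phi k x - v j x)) \<longlonglongrightarrow> 0"
    proof (rule Lim_null_comparison[OF always_eventually v(2)], rule allI)
      fix j
      have "l2n (MO \<Omega>) (\<lambda>x. phi k x - v j x) \<le> l2n (MO \<Omega>) (\<lambda>x. V x - jet (v j) x)"
        using sq_int_fst_snd(2)[OF sq_int_diff(1)[OF V(1) sj(1)[of j]]] by (simp add: jet_def V(2))
      then show "norm (l2n (MO \<Omega>) (\<lambda>x. phi k x - v j x)) \<le> l2n (MO \<Omega>) (\<lambda>x. V x - jet (v j) x)" by simp
    qed
  qed
  ultimately show ?thesis using LIMSEQ_unique by simp
qed

text \<open>The Gaussian lacks compact support, so it is multiplied by a slowly varying cut-off. The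
  profile has value 1 at y = 0 for every t, hence a right-hand side without t.\<close>

lemma B_gauss_test:
  assumes F: "sq_int M F" and q: "sq_int (MO \<Omega>) q"
    and BF: "\<And>\<omega>. lat_test \<Omega> \<omega> \<Longrightarrow> B F (jet \<omega>) = d_s s * (\<integral>x. q x * \<omega> (x, 0) \<partial>MO \<Omega>)"
    and V: "sq_int (MO \<Omega>) V" "\<And>x. fst (V x) = phi k x"
    and v: "\<And>j. test_fn \<Omega> (v j)" "(\<lambda>j. l2n (MO \<Omega>) (\<lambda>x. V x - jet (v j) x)) \<longlonglongrightarrow> 0"
    and t: "t > 0"
  shows "B F (tens V (\<lambda>y. (gauss t y, gauss' t y))) = d_s s * (\<integral>x. q x * phi k x \<partial>MO \<Omega>)"
proof -
  let ?N = "\<lambda>y. (gauss t y, gauss' t y)" and ?MY = "MY (1 - 2 * s)"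
  have sN: "sq_int ?MY ?N" using gauss_pair_sq_int[OF s] t by metis
  obtain \<zeta> :: "real \<Rightarrow> real" where \<zeta>: "test_fn UNIV \<zeta>" "\<zeta> 0 = 1" using bump by blast
  note smz = test_fn_smooth[OF \<zeta>(1)]
  obtain K where K: "compact K" "\<And>x. x \<notin> K \<Longrightarrow> \<zeta> x = 0" "\<And>x. x \<notin> K \<Longrightarrow> cgrad \<zeta> x = 0"
    using test_fn_support[OF \<zeta>(1)] by metis
  obtain C where C: "C \<ge> 0" "\<And>y. norm (\<zeta> y) \<le> C"
    using bounded_compact_support[OF smooth_continuous[OF smz] K(1,2)] by blast
  obtain C' where C': "C' \<ge> 0" "\<And>y. norm (cgrad \<zeta> y) \<le> C'"
    using bounded_compact_support[OF smooth_continuous_cgrad[OF smz] K(1,3)] by blast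
  \<comment> \<open>Dilating the bump by these factors spreads it out; its derivative gains the
    factor \<open>r i\<close> and disappears in the limit.\<close>
  define r where "r i = 1 / real (Suc i)" for i
  have r: "0 < r i" "r i \<le> 1" for i by (auto simp: r_def)
  have rlim: "r \<longlonglongrightarrow> 0" unfolding r_def using LIMSEQ_inverse_real_of_nat by (simp add: inverse_eq_divide)
  define \<eta> where "\<eta> i y = gauss t y * \<zeta> (0 + y *\<^sub>R r i)" for i y
  have \<eta>: "test_fn UNIV (\<eta> i)" for i
  proof -
    have "test_fn UNIV (\<lambda>y::real. \<zeta> (0 + y *\<^sub>R r i))" by (rule test_fn_line[OF \<zeta>(1)]) (use r(1)[of i] in simp)
    moreover have "smooth_fun (gauss t)" unfolding gauss_def[abs_def] by (rule smooth_fun_intros)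
    ultimately show ?thesis unfolding \<eta>_def by (rule test_fn_mult_smooth)
  qed
  have cg: "cgrad (\<eta> i) y = gauss' t y * \<zeta> (y * r i) + gauss t y * (r i * cgrad \<zeta> (y * r i))" for i y
  proof (rule cgrad_real_eqI)
    have z: "((\<lambda>y. \<zeta> (0 + y *\<^sub>R r i)) has_real_derivative cgrad \<zeta> (0 + y *\<^sub>R r i) * r i) (at y)"
      by (rule DERIV_chain2[OF smooth_has_real_derivative[OF smz]]) (auto intro!: derivative_eq_intros)
    show "(\<eta> i has_real_derivative gauss' t y * \<zeta> (y * r i) + gauss t y * (r i * cgrad \<zeta> (y * r i))) (at y)"
      unfolding \<eta>_def by (rule DERIV_cong[OF DERIV_mult[OF gauss_deriv z]]) simp
  qed
  have je: "?N y - jet (\<eta> i) y = (gauss t y * (1 - \<zeta> (y * r i)), gauss' t y * (1 - \<zeta> (y * r i)) - gauss t y * (r i * cgrad \<zeta> (y * r i)))" for i y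
    by (simp add: jet_def cg) (simp add: \<eta>_def algebra_simps)
  have sj: "sq_int ?MY (jet (\<eta> i))" for i by (rule sq_int_jet_MY[OF alpha \<eta>])
  have nlim: "(\<lambda>i. l2n ?MY (\<lambda>y. ?N y - jet (\<eta> i) y)) \<longlonglongrightarrow> 0"
  \<comment> \<open>One 1 + C for the function component, another for the term with
    \<open>gauss'\<close>, and \<open>C'\<close> for the derivative of the cut-off, where
    \<open>r i \<le> 1\<close> is used.\<close>
  proof (rule l2n_dominated[OF sN, where K = "2 * (1 + C) + C'"])
    show "(\<lambda>y. ?N y - jet (\<eta> i) y) \<in> borel_measurable ?MY" for i
      using sq_int_diff(1)[OF sN sj[of i]] by (simp add: sq_int_def)
    show "2 * (1 + C) + C' \<ge> 0" using C C' by simp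
    show "norm (?N y - jet (\<eta> i) y) \<le> (2 * (1 + C) + C') * norm (?N y)" for i y
    proof -
      have g: "\<bar>gauss t y\<bar> \<le> norm (?N y)" "\<bar>gauss' t y\<bar> \<le> norm (?N y)"
        using norm_fst_le[of "gauss t y" "gauss' t y"] norm_snd_le[of "gauss' t y" "gauss t y"] by auto
      have z: "\<bar>1 - \<zeta> (y * r i)\<bar> \<le> 1 + C" using C(2)[of "y * r i"] by (simp add: abs_le_iff)
      have z': "\<bar>r i * cgrad \<zeta> (y * r i)\<bar> \<le> C'"
      proof -
        have "r i * \<bar>cgrad \<zeta> (y * r i)\<bar> \<le> 1 * C'" using r[of i] C'(2)[of "y * r i"] by (intro mult_mono) auto
        then show ?thesis using r(1)[of i] by (simp add: abs_mult)
      qed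
      have 1: "\<bar>gauss t y * (1 - \<zeta> (y * r i))\<bar> \<le> norm (?N y) * (1 + C)"
        unfolding abs_mult using g z by (intro mult_mono) auto
      have 2: "\<bar>gauss' t y * (1 - \<zeta> (y * r i))\<bar> \<le> norm (?N y) * (1 + C)"
        unfolding abs_mult using g z by (intro mult_mono) auto
      have 3: "\<bar>gauss t y * (r i * cgrad \<zeta> (y * r i))\<bar> \<le> norm (?N y) * C'"
        unfolding abs_mult[of "gauss t y"] using g z' by (intro mult_mono) auto
      have "norm (?N y - jet (\<eta> i) y) \<le> \<bar>gauss t y * (1 - \<zeta> (y * r i))\<bar> + \<bar>gauss' t y * (1 - \<zeta> (y * r i)) - gauss t y * (r i * cgrad \<zeta> (y * r i))\<bar>"
        unfolding je using norm_Pair_le[of "gauss t y * (1 - \<zeta> (y * r i))" "gauss' t y * (1 - \<zeta> (y * r i)) - gauss t y * (r i * cgrad \<zeta> (y * r i))"] by simp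
      also have "\<dots> \<le> norm (?N y) * (1 + C) + (norm (?N y) * (1 + C) + norm (?N y) * C')"
        using 1 2 3 by linarith
      finally show ?thesis by (simp add: algebra_simps)
    qed
    show "(\<lambda>i. ?N y - jet (\<eta> i) y) \<longlonglongrightarrow> 0" for y
    proof -
      have yr: "(\<lambda>i. y * r i) \<longlonglongrightarrow> 0" by (rule tendsto_mult_right_zero[OF rlim])
      have a: "(\<lambda>i. \<zeta> (y * r i)) \<longlonglongrightarrow> 1"
      proof -
        have "isCont \<zeta> 0" using smooth_continuous[OF smz, of UNIV] by (simp add: continuous_on_eq_continuous_at)
        from isCont_tendsto_compose[OF this yr] show ?thesis by (simp add: \<zeta>(2))
      qed
      have b: "(\<lambda>i. r i * cgrad \<zeta> (y * r i)) \<longlonglongrightarrow> 0"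
      proof -
        have "isCont (cgrad \<zeta>) 0" using smooth_continuous_cgrad[OF smz, of UNIV] by (simp add: continuous_on_eq_continuous_at)
        from tendsto_mult[OF rlim isCont_tendsto_compose[OF this yr]] show ?thesis by simp
      qed
      have "(\<lambda>i. (gauss t y * (1 - \<zeta> (y * r i)), gauss' t y * (1 - \<zeta> (y * r i)) - gauss t y * (r i * cgrad \<zeta> (y * r i))))
          \<longlonglongrightarrow> (gauss t y * (1 - 1), gauss' t y * (1 - 1) - gauss t y * 0)"
        by (intro tendsto_intros a b)
      then show ?thesis unfolding je by (simp add: zero_prod_def)
    qed
  qed
  have "(\<lambda>i. B F (tens V (jet (\<eta> i)))) \<longlonglongrightarrow> B F (tens V ?N)"
  proof (rule B_conv(2)[OF _ F])
    show "sq_int M (tens V ?N)" by (rule tens_sq_int(1)[OF Omega_borel V(1) sN])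
    show "sq_int M (tens V (jet (\<eta> i)))" for i by (rule tens_sq_int(1)[OF Omega_borel V(1) sj])
    show "(\<lambda>i. l2n M (\<lambda>p. tens V ?N p - tens V (jet (\<eta> i)) p)) \<longlonglongrightarrow> 0"
    proof (rule Lim_null_comparison[OF always_eventually])
      show "\<forall>i. norm (l2n M (\<lambda>p. tens V ?N p - tens V (jet (\<eta> i)) p)) \<le> l2n (MO \<Omega>) V * l2n ?MY (\<lambda>y. ?N y - jet (\<eta> i) y)"
        unfolding tens_diff(2)
        using tens_sq_int(2)[OF Omega_borel V(1) sq_int_diff(1)[OF sN sj]] by simp
      show "(\<lambda>i. l2n (MO \<Omega>) V * l2n ?MY (\<lambda>y. ?N y - jet (\<eta> i) y)) \<longlonglongrightarrow> 0"
        by (rule tendsto_mult_right_zero[OF nlim])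
    qed
  qed
  moreover have "\<eta> i 0 = 1" for i by (simp add: \<eta>_def gauss_def \<zeta>(2))
  then have "B F (tens V (jet (\<eta> i))) = d_s s * (\<integral>x. q x * phi k x \<partial>MO \<Omega>)" for i
    using B_tensor_test[OF F q BF V v \<eta>[of i]] by simp
  ultimately show ?thesis by (simp add: LIMSEQ_const_iff)
qed

text \<open>Testing the limit \<open>F\<close> with every Gaussian gives one and the same number
  \<beta>, so for the smooth approximants the pairing deviates from \<beta> by an amount controlled
  through the profile norm. \<open>trace_coef_estimate\<close> converts this into convergence of
  trace coefficients.\<close>

lemma extension_coef:
  assumes F: "sq_int M F" and q: "sq_int (MO \<Omega>) q" and t: "sq_int (MO \<Omega>) t"
    and BF: "\<And>\<omega>. lat_test \<Omega> \<omega> \<Longrightarrow> B F (jet \<omega>) = d_s s * (\<integral>x. q x * \<omega> (x, 0) \<partial>MO \<Omega>)"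
    and \<psi>: "\<And>j. lat_test \<Omega> (\<psi> j)" "(\<lambda>j. l2n M (\<lambda>p. F p - jet (\<psi> j) p)) \<longlonglongrightarrow> 0"
    and tr: "(\<lambda>j. l2n (MO \<Omega>) (\<lambda>x. t x - \<psi> j (x, 0))) \<longlonglongrightarrow> 0"
  shows "lam k powr s * (\<integral>x. phi k x * t x \<partial>MO \<Omega>) = (\<integral>x. q x * phi k x \<partial>MO \<Omega>)"
proof -
  obtain V where V: "sq_int (MO \<Omega>) V" "\<And>x. fst (V x) = phi k x"
    "\<exists>v. (\<forall>j. test_fn \<Omega> (v j)) \<and> (\<lambda>j. l2n (MO \<Omega>) (\<lambda>x. V x - jet (v j) x)) \<longlonglongrightarrow> 0"
    "\<And>v. test_fn \<Omega> v \<Longrightarrow> (\<integral>x. form_op_base x (V x) \<bullet> jet v x \<partial>MO \<Omega>) = lam k * (\<integral>x. phi k x * v x \<partial>MO \<Omega>)"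
    using eigen_jet[of k] by blast
  obtain v where v: "\<And>j. test_fn \<Omega> (v j)" "(\<lambda>j. l2n (MO \<Omega>) (\<lambda>x. V x - jet (v j) x)) \<longlonglongrightarrow> 0"
    using V(3) by blast
  obtain D where D: "\<And>\<psi> \<beta> \<epsilon>. lat_test \<Omega> \<psi> \<Longrightarrow> \<epsilon> \<ge> 0 \<Longrightarrow>
      (\<And>t. t > 0 \<Longrightarrow> \<bar>B (tens V (\<lambda>y. (gauss t y, gauss' t y))) (jet \<psi>) - \<beta>\<bar> \<le> \<epsilon> * ((1 + t) * t powr (- s / 2))) \<Longrightarrow>
      \<bar>trace_const * (\<integral>x. phi k x * \<psi> (x, 0) \<partial>MO \<Omega>) - \<beta> * (Gamma s / lam k powr s)\<bar> \<le> D * \<epsilon>"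
    using trace_coef_estimate[OF V(1,2,4)] by blast
  obtain C where C: "C \<ge> 0" "\<And>t. t > 0 \<Longrightarrow> sq_int (MY (1 - 2 * s)) (\<lambda>y. (gauss t y, gauss' t y)) \<and>
     l2n (MY (1 - 2 * s)) (\<lambda>y. (gauss t y, gauss' t y)) \<le> C * ((1 + t) * t powr (- s / 2))"
    using gauss_pair_sq_int[OF s] by blast
  obtain K where K: "K \<ge> 0" "\<And>F H. sq_int M F \<Longrightarrow> sq_int M H \<Longrightarrow> \<bar>B F H\<bar> \<le> K * (l2n M F * l2n M H)"
    using B_bound by blast
  define \<beta> where "\<beta> = d_s s * (\<integral>x. q x * phi k x \<partial>MO \<Omega>)"
  \<comment> \<open>Distance of the approximant times the bounds of the form, the eigenjet and the
    profile; the dependence on t is kept apart as the explicit rate.\<close>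
  define \<epsilon> where "\<epsilon> j = l2n M (\<lambda>p. F p - jet (\<psi> j) p) * (K * (l2n (MO \<Omega>) V * C))" for j
  have \<epsilon>0: "\<epsilon> j \<ge> 0" for j unfolding \<epsilon>_def using K C by (intro mult_nonneg_nonneg) auto
  have est: "\<bar>B (tens V (\<lambda>y. (gauss t y, gauss' t y))) (jet (\<psi> j)) - \<beta>\<bar> \<le> \<epsilon> j * ((1 + t) * t powr (- s / 2))" if t: "t > 0" for j t
  proof -
    let ?N = "\<lambda>y. (gauss t y, gauss' t y)"
    note N = C(2)[OF t]
    have sT: "sq_int M (tens V ?N)" using N by (intro tens_sq_int(1)[OF Omega_borel V(1)]) blast
    have dF: "sq_int M (\<lambda>p. F p - jet (\<psi> j) p)" by (rule sq_int_diff(1)[OF F jet_sq_int[OF \<psi>(1)]])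
    have "B (tens V ?N) (jet (\<psi> j)) - \<beta> = B (jet (\<psi> j)) (tens V ?N) - B F (tens V ?N)"
      using B_gauss_test[OF F q BF V(1,2) v t] B_sym[OF sT jet_sq_int[OF \<psi>(1)]] by (simp add: \<beta>_def)
    then have "\<bar>B (tens V ?N) (jet (\<psi> j)) - \<beta>\<bar> = \<bar>B (\<lambda>p. F p - jet (\<psi> j) p) (tens V ?N)\<bar>"
      using B_diff[OF F jet_sq_int[OF \<psi>(1)] sT] by simp
    also have "\<dots> \<le> K * (l2n M (\<lambda>p. F p - jet (\<psi> j) p) * l2n M (tens V ?N))" by (rule K(2)[OF dF sT])
    also have "\<dots> \<le> K * (l2n M (\<lambda>p. F p - jet (\<psi> j) p) * (l2n (MO \<Omega>) V * (C * ((1 + t) * t powr (- s / 2)))))"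
    proof (intro mult_left_mono K(1))
      have "l2n M (tens V ?N) \<le> l2n (MO \<Omega>) V * l2n (MY (1 - 2 * s)) ?N"
        using N by (intro tens_sq_int(2)[OF Omega_borel V(1)]) blast
      also have "\<dots> \<le> l2n (MO \<Omega>) V * (C * ((1 + t) * t powr (- s / 2)))" using N by (intro mult_left_mono) auto
      finally show "l2n M (tens V ?N) \<le> l2n (MO \<Omega>) V * (C * ((1 + t) * t powr (- s / 2)))" .
    qed simp
    also have "\<dots> = \<epsilon> j * ((1 + t) * t powr (- s / 2))" by (simp add: \<epsilon>_def mult_ac)
    finally show ?thesis .
  qed
  have "(\<lambda>j. trace_const * (\<integral>x. phi k x * \<psi> j (x, 0) \<partial>MO \<Omega>) - \<beta> * (Gamma s / lam k powr s)) \<longlonglongrightarrow> 0"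
  proof (rule Lim_null_comparison[OF always_eventually])
    show "\<forall>j. norm (trace_const * (\<integral>x. phi k x * \<psi> j (x, 0) \<partial>MO \<Omega>) - \<beta> * (Gamma s / lam k powr s)) \<le> D * \<epsilon> j"
      using D[OF \<psi>(1) \<epsilon>0 est] by simp
    show "(\<lambda>j. D * \<epsilon> j) \<longlonglongrightarrow> 0"
      unfolding \<epsilon>_def by (intro tendsto_mult_right_zero tendsto_mult_left_zero \<psi>(2))
  qed
  moreover have "(\<lambda>j. trace_const * (\<integral>x. phi k x * \<psi> j (x, 0) \<partial>MO \<Omega>) - \<beta> * (Gamma s / lam k powr s))
      \<longlonglongrightarrow> trace_const * (\<integral>x. phi k x * t x \<partial>MO \<Omega>) - \<beta> * (Gamma s / lam k powr s)"
    by (intro tendsto_diff tendsto_mult_left tendsto_const MO_inner_conv[OF phi_sq_int t trace_sq_int[OF \<psi>(1)] tr])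
  ultimately have e: "trace_const * (\<integral>x. phi k x * t x \<partial>MO \<Omega>) = \<beta> * (Gamma s / lam k powr s)"
    using LIMSEQ_unique by fastforce
  \<comment> \<open>The definition of \<open>d_s\<close> is exactly the quotient of
    \<open>trace_const\<close> by \<open>Gamma s\<close>.\<close>
  have kd: "d_s s * Gamma s = trace_const" "trace_const > 0"
    using s by (auto simp: d_s_def trace_const_def Gamma_real_pos less_imp_neq[symmetric])
  have "\<beta> * (Gamma s / lam k powr s) = (d_s s * Gamma s) * ((\<integral>x. q x * phi k x \<partial>MO \<Omega>) / lam k powr s)"
    by (simp add: \<beta>_def)
  with e have "trace_const * (\<integral>x. phi k x * t x \<partial>MO \<Omega>) = trace_const * ((\<integral>x. q x * phi k x \<partial>MO \<Omega>) / lam k powr s)"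
    unfolding kd(1) by (rule trans)
  then have "(\<integral>x. phi k x * t x \<partial>MO \<Omega>) = (\<integral>x. q x * phi k x \<partial>MO \<Omega>) / lam k powr s"
    by (rule mult_left_cancel[THEN iffD1, rotated]) (use kd(2) in auto)
  then show ?thesis using lam_pos[of k] by simp
qed

section \<open>Spectral coefficients, uniqueness of states and the midpoint of two controls\<close>

lemma coef_eq: "sq_int (MO \<Omega>) f \<Longrightarrow> coef \<Omega> phi f k = (\<integral>x. f x * phi k x \<partial>MO \<Omega>)"
  unfolding coef_def using phi_sq_int[of k] by (intro set_lint_MO) (auto simp: sq_int_def)

lemma parseval:
  assumes "sq_int (MO \<Omega>) f" shows "(\<lambda>k. (coef \<Omega> phi f k)\<^sup>2) sums (l2n (MO \<Omega>) f)\<^sup>2"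
proof -
  have "(\<lambda>k. (coef \<Omega> phi f k)\<^sup>2) sums set_lebesgue_integral lborel \<Omega> (\<lambda>x. (f x)\<^sup>2)"
    using setting assms unfolding setting_def coef_def by (simp add: L2_iff_sq_int)
  then show ?thesis using assms by (subst (asm) set_lint_MO) (auto simp: sq_int_def l2n_sq)
qed

text \<open>Regularity of the state comes for free: each term of its \<open>Hsig\<close> series is
  the product of a coefficient of u and one of z, and both sequences are square summable by
  Parseval.\<close>

lemma frac_stateI:
  assumes u: "sq_int (MO \<Omega>) u" and z: "sq_int (MO \<Omega>) z"
    and eq: "\<And>k. lam k powr s * coef \<Omega> phi u k = coef \<Omega> phi z k"
  shows "frac_state \<Omega> lam phi s z u"
proof -
  have "summable (\<lambda>k. (coef \<Omega> phi z k)\<^sup>2 + (coef \<Omega> phi u k)\<^sup>2)"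
    using parseval[OF u] parseval[OF z] by (intro summable_add) (auto simp: sums_iff)
  then have "summable (\<lambda>k. coef \<Omega> phi z k * coef \<Omega> phi u k)"
  proof (rule summable_comparison_test'[where N = 0])
    fix k
    have "2 * \<bar>coef \<Omega> phi z k\<bar> * \<bar>coef \<Omega> phi u k\<bar> \<le> (coef \<Omega> phi z k)\<^sup>2 + (coef \<Omega> phi u k)\<^sup>2"
      using sum_squares_bound[of "\<bar>coef \<Omega> phi z k\<bar>" "\<bar>coef \<Omega> phi u k\<bar>"] by simp
    moreover have "0 \<le> \<bar>coef \<Omega> phi z k\<bar> * \<bar>coef \<Omega> phi u k\<bar>" by simp
    ultimately show "norm (coef \<Omega> phi z k * coef \<Omega> phi u k) \<le> (coef \<Omega> phi z k)\<^sup>2 + (coef \<Omega> phi u k)\<^sup>2"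
      unfolding real_norm_def abs_mult by linarith
  qed
  moreover have "lam k powr s * (coef \<Omega> phi u k)\<^sup>2 = coef \<Omega> phi z k * coef \<Omega> phi u k" for k
    by (simp add: eq[symmetric] power2_eq_square)
  ultimately show ?thesis
    unfolding frac_state_def Hsig_def using u eq by (simp add: L2_iff_sq_int)
qed

text \<open>The trace is built along the very sequence that approximates the extension, so the same
  sequence yields its existence and its spectral identity.\<close>

lemma ext_state_trace:
  assumes q: "sq_int (MO \<Omega>) q" and ext: "ext_state \<Omega> A c s q W"
  obtains t where "trace_of \<Omega> (1 - 2 * s) W t" "sq_int (MO \<Omega>) t" "frac_state \<Omega> lam phi s q t"
proof -
  obtain G where G: "HL \<Omega> (1 - 2 * s) W G" "\<And>v H t. HL \<Omega> (1 - 2 * s) v H \<Longrightarrow> trace_of \<Omega> (1 - 2 * s) v t \<Longrightarrow>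
      a_ext \<Omega> A c s W G v H = set_lebesgue_integral lborel \<Omega> (\<lambda>x. q x * t x)"
    using ext unfolding ext_state_def by blast
  obtain \<psi> where \<psi>: "\<And>j. lat_test \<Omega> (\<psi> j)" "W \<in> borel_measurable borel" "G \<in> borel_measurable borel"
    "sq_int M (\<lambda>p. (W p, G p))" "(\<lambda>j. l2n M (\<lambda>p. (W p, G p) - jet (\<psi> j) p)) \<longlonglongrightarrow> 0"
    using HL_sequence[OF G(1)] by blast
  obtain t where t: "sq_int (MO \<Omega>) t" "(\<lambda>j. l2n (MO \<Omega>) (\<lambda>x. t x - \<psi> j (x, 0))) \<longlonglongrightarrow> 0"
    using trace_Cauchy[OF Omega_borel s \<psi>(1,4,5)] by blast
  have BF: "B (\<lambda>p. (W p, G p)) (jet \<omega>) = d_s s * (\<integral>x. q x * \<omega> (x, 0) \<partial>MO \<Omega>)" if \<omega>: "lat_test \<Omega> \<omega>" for \<omega>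
  proof -
    have sm: "smooth_fun \<omega>" using \<omega> by (simp add: lat_test_def test_fn_def)
    have "1 / d_s s * B (\<lambda>p. (W p, G p)) (jet \<omega>) = set_lebesgue_integral lborel \<Omega> (\<lambda>x. q x * \<omega> (x, 0))"
      using G(2)[OF lat_test_HL[OF \<omega>]] \<psi>(2,3)
      by (subst (asm) a_ext_eq_B) (auto simp: jet_def intro!: borel_measurable_continuous_onI smooth_continuous smooth_continuous_cgrad sm)
    also have "\<dots> = (\<integral>x. q x * \<omega> (x, 0) \<partial>MO \<Omega>)"
      using q trace_sq_int[OF \<omega>] by (intro set_lint_MO) (auto simp: sq_int_def)
    finally show ?thesis using ds_pos by (simp add: field_simps)
  qed
  have "lam k powr s * coef \<Omega> phi t k = coef \<Omega> phi q k" for k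
    using extension_coef[OF \<psi>(4) q t(1) BF \<psi>(1,5) t(2)] by (simp add: coef_eq q t(1) mult.commute)
  then have "frac_state \<Omega> lam phi s q t" by (rule frac_stateI[OF t(1) q])
  moreover have "trace_of \<Omega> (1 - 2 * s) W t" by (rule trace_ofI[OF \<psi>(1) G(1) \<psi>(5) t])
  ultimately show ?thesis using that t(1) by blast
qed

lemma l2n_zero_AE: "sq_int (MO \<Omega>) (f :: real^'n \<Rightarrow> real) \<Longrightarrow> l2n (MO \<Omega>) f = 0 \<Longrightarrow> AE x in MO \<Omega>. f x = 0"
proof -
  assume f: "sq_int (MO \<Omega>) f" and z: "l2n (MO \<Omega>) f = 0"
  have "(\<integral>x. (norm (f x))\<^sup>2 \<partial>MO \<Omega>) = 0" using z l2n_sq[of "MO \<Omega>" f] by simp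
  then have "AE x in MO \<Omega>. (norm (f x))\<^sup>2 = 0"
    using f by (subst (asm) integral_nonneg_eq_0_iff_AE) (auto simp: sq_int_iff)
  then show ?thesis by simp
qed

lemma coef_lin:
  assumes "sq_int (MO \<Omega>) f" "sq_int (MO \<Omega>) g"
  shows "coef \<Omega> phi (\<lambda>x. r * f x + r' * g x) k = r * coef \<Omega> phi f k + r' * coef \<Omega> phi g k"
proof -
  have s: "sq_int (MO \<Omega>) (\<lambda>x. r * f x + r' * g x)"
    using sq_int_add(1)[OF sq_int_scaleR(1)[OF assms(1), of r] sq_int_scaleR(1)[OF assms(2), of r']] by simp
  have i: "integrable (MO \<Omega>) (\<lambda>x. f x * phi k x)" "integrable (MO \<Omega>) (\<lambda>x. g x * phi k x)"
    using l2_inner(1)[OF assms(1) phi_sq_int] l2_inner(1)[OF assms(2) phi_sq_int] by auto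
  have "(\<integral>x. (r * f x + r' * g x) * phi k x \<partial>MO \<Omega>) = (\<integral>x. r * (f x * phi k x) + r' * (g x * phi k x) \<partial>MO \<Omega>)"
    by (rule Bochner_Integration.integral_cong) (auto simp: algebra_simps)
  then show ?thesis using i by (simp add: coef_eq s assms)
qed

text \<open>All coefficients of the difference vanish because \<open>lam k powr s\<close> is
  nonzero; Parseval then makes its norm 0.\<close>

lemma frac_state_unique:
  assumes "frac_state \<Omega> lam phi s z u" "frac_state \<Omega> lam phi s z' u'" "\<And>k. coef \<Omega> phi z k = coef \<Omega> phi z' k"
  shows "AE x in MO \<Omega>. u x = u' x"
proof -
  have u: "sq_int (MO \<Omega>) u" "sq_int (MO \<Omega>) u'"
    using assms by (auto simp: frac_state_def Hsig_def L2_iff_sq_int)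
  have d: "sq_int (MO \<Omega>) (\<lambda>x. u x - u' x)" by (rule sq_int_diff(1)[OF u])
  have "coef \<Omega> phi (\<lambda>x. u x - u' x) k = 0" for k
  proof -
    have "lam k powr s * coef \<Omega> phi u k = lam k powr s * coef \<Omega> phi u' k"
      using assms by (simp add: frac_state_def)
    then have "coef \<Omega> phi u k = coef \<Omega> phi u' k" using lam_pos[of k] by simp
    then show ?thesis using coef_lin[OF u, of 1 "-1" k] by simp
  qed
  then have "(\<lambda>k::nat. 0) sums (l2n (MO \<Omega>) (\<lambda>x. u x - u' x))\<^sup>2"
    using parseval[OF d] by simp
  from sums_unique2[OF this sums_zero] have "(l2n (MO \<Omega>) (\<lambda>x. u x - u' x))\<^sup>2 = 0" .
  then have "AE x in MO \<Omega>. u x - u' x = 0" by (intro l2n_zero_AE d) simp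
  then show ?thesis by simp
qed

lemma Jcost_eq:
  assumes "sq_int (MO \<Omega>) ud" "sq_int (MO \<Omega>) u" "sq_int (MO \<Omega>) z"
  shows "Jcost \<Omega> \<mu> ud u z = 1/2 * (l2n (MO \<Omega>) (\<lambda>x. u x - ud x))\<^sup>2 + \<mu>/2 * (l2n (MO \<Omega>) z)\<^sup>2"
proof -
  have [measurable]: "ud \<in> borel_measurable borel" "u \<in> borel_measurable borel" "z \<in> borel_measurable borel"
    using assms by (auto simp: sq_int_def)
  have "set_lebesgue_integral lborel \<Omega> (\<lambda>x. (u x - ud x)\<^sup>2) = (l2n (MO \<Omega>) (\<lambda>x. u x - ud x))\<^sup>2"
    "set_lebesgue_integral lborel \<Omega> (\<lambda>x. (z x)\<^sup>2) = (l2n (MO \<Omega>) z)\<^sup>2"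
    by (subst set_lint_MO; simp add: l2n_sq)+
  then show ?thesis by (simp add: Jcost_def)
qed

text \<open>The parallelogram law; the subtracted term is the quantitative strict convexity behind
  uniqueness of the control.\<close>

lemma l2n_midpoint:
  fixes f g :: "real^'n \<Rightarrow> real"
  assumes f: "sq_int (MO \<Omega>) f" and g: "sq_int (MO \<Omega>) g"
  shows "(l2n (MO \<Omega>) (\<lambda>x. 1/2 * f x + 1/2 * g x))\<^sup>2
    = 1/2 * (l2n (MO \<Omega>) f)\<^sup>2 + 1/2 * (l2n (MO \<Omega>) g)\<^sup>2 - 1/4 * (l2n (MO \<Omega>) (\<lambda>x. f x - g x))\<^sup>2"
proof -
  have i: "integrable (MO \<Omega>) (\<lambda>x. (f x)\<^sup>2)" "integrable (MO \<Omega>) (\<lambda>x. (g x)\<^sup>2)" "integrable (MO \<Omega>) (\<lambda>x. (f x - g x)\<^sup>2)"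
    using f g sq_int_diff(1)[OF f g] by (auto simp: sq_int_iff)
  have "(\<integral>x. (1/2 * f x + 1/2 * g x)\<^sup>2 \<partial>MO \<Omega>) = (\<integral>x. 1/2 * (f x)\<^sup>2 + 1/2 * (g x)\<^sup>2 - 1/4 * (f x - g x)\<^sup>2 \<partial>MO \<Omega>)"
    by (rule Bochner_Integration.integral_cong) (auto simp: power2_eq_square field_simps)
  then show ?thesis using i by (simp add: l2n_sq)
qed

lemma midpoint_sq_int:
  fixes f g :: "real^'n \<Rightarrow> real"
  assumes f: "sq_int (MO \<Omega>) f" and g: "sq_int (MO \<Omega>) g"
  shows "sq_int (MO \<Omega>) (\<lambda>x. 1/2 * f x + 1/2 * g x)"
  using sq_int_add(1)[OF sq_int_scaleR(1)[OF f, of "1/2"] sq_int_scaleR(1)[OF g, of "1/2"]] by simp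

end

theorem theorem3p12:
  fixes \<Omega> :: "(real^'n) set"
    and A :: "real^'n \<Rightarrow> real^'n^'n"
    and c :: "real^'n \<Rightarrow> real"
    and lam :: "nat \<Rightarrow> real" and phi :: "nat \<Rightarrow> real^'n \<Rightarrow> real"
    and s \<mu> :: real
    and ud a b zbar ubar qbar :: "real^'n \<Rightarrow> real"
    and Ubar :: "(real^'n) \<times> real \<Rightarrow> real"
  assumes set: "setting \<Omega> A c lam phi"
    and s: "0 < s" "s < 1"
    and mu: "\<mu> > 0"
    and ud: "L2 \<Omega> ud" and ab: "L2 \<Omega> a" "L2 \<Omega> b"
    and aleb: "AE x in lborel. x \<in> \<Omega> \<longrightarrow> a x \<le> b x"
    \<comment> \<open>(ubar, zbar) is the optimal solution of the fractional problem\<close>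
    and zopt: "zbar \<in> Zad \<Omega> a b" "frac_state \<Omega> lam phi s zbar ubar"
      "\<And>z u. z \<in> Zad \<Omega> a b \<Longrightarrow> frac_state \<Omega> lam phi s z u \<Longrightarrow>
          Jcost \<Omega> \<mu> ud ubar zbar \<le> Jcost \<Omega> \<mu> ud u z"
    \<comment> \<open>(Ubar, qbar) is the optimal solution of the extended problem\<close>
    and qopt: "qbar \<in> Zad \<Omega> a b" "ext_state \<Omega> A c s qbar Ubar"
      "\<And>q W tW tU. q \<in> Zad \<Omega> a b \<Longrightarrow> ext_state \<Omega> A c s q W \<Longrightarrow>
          trace_of \<Omega> (1 - 2 * s) W tW \<Longrightarrow> trace_of \<Omega> (1 - 2 * s) Ubar tU \<Longrightarrow>
          Jcost \<Omega> \<mu> ud tU qbar \<le> Jcost \<Omega> \<mu> ud tW q"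
  shows "(AE x in lborel. x \<in> \<Omega> \<longrightarrow> zbar x = qbar x) \<and>
         (\<exists>t. trace_of \<Omega> (1 - 2 * s) Ubar t \<and> (AE x in lborel. x \<in> \<Omega> \<longrightarrow> t x = ubar x))"
proof -
  interpret extension_setting \<Omega> A c lam phi s
    using set s by unfold_locales
  have sq: "sq_int (MO \<Omega>) zbar" "sq_int (MO \<Omega>) qbar" "sq_int (MO \<Omega>) ud" "sq_int (MO \<Omega>) ubar"
    using zopt(1,2) qopt(1) ud by (auto simp: Zad_def L2_iff_sq_int frac_state_def Hsig_def)
  obtain t0 where t0: "trace_of \<Omega> (1 - 2 * s) Ubar t0" "sq_int (MO \<Omega>) t0" "frac_state \<Omega> lam phi s qbar t0"
    using ext_state_trace[OF sq(2) qopt(2)] by blast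
  \<comment> \<open>\<open>zbar\<close> can compete in the extended problem only through some
    extension of it.\<close>
  obtain W where W: "ext_state \<Omega> A c s zbar W"
    using ext_state_exists[of zbar] zopt(1) by (auto simp: Zad_def)
  obtain t1 where t1: "trace_of \<Omega> (1 - 2 * s) W t1" "sq_int (MO \<Omega>) t1" "frac_state \<Omega> lam phi s zbar t1"
    using ext_state_trace[OF sq(1) W] by blast
  \<comment> \<open>The trace of this extension and \<open>ubar\<close> solve the same spectral
    equation, so they agree almost everywhere and cost the same: optimality in the extended problem
    becomes an inequality against \<open>ubar\<close>.\<close>
  have "AE x in MO \<Omega>. t1 x = ubar x" by (rule frac_state_unique[OF t1(3) zopt(2)]) simp
  then have "AE x in MO \<Omega>. (norm (t1 x - ud x))\<^sup>2 = (norm (ubar x - ud x))\<^sup>2" by eventually_elim simp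
  then have "(l2n (MO \<Omega>) (\<lambda>x. t1 x - ud x))\<^sup>2 = (l2n (MO \<Omega>) (\<lambda>x. ubar x - ud x))\<^sup>2"
    unfolding l2n_sq using sq_int_diff(1)[OF t1(2) sq(3)] sq_int_diff(1)[OF sq(4) sq(3)]
    by (intro integral_cong_AE) (auto simp: sq_int_def)
  then have J1: "Jcost \<Omega> \<mu> ud t0 qbar \<le> Jcost \<Omega> \<mu> ud ubar zbar"
    using qopt(3)[OF zopt(1) W t1(1) t0(1)] by (simp add: Jcost_eq sq t1(2))
  \<comment> \<open>By linearity the midpoint of the two states is the state of the midpoint of the
    controls. The two optimality statements give J(t0, qbar) <= J(ubar, zbar) <= J(um, zm).\<close>
  define zm where "zm x = 1/2 * zbar x + 1/2 * qbar x" for x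
  define um where "um x = 1/2 * ubar x + 1/2 * t0 x" for x
  have sm: "sq_int (MO \<Omega>) zm" "sq_int (MO \<Omega>) um"
    unfolding zm_def um_def by (intro midpoint_sq_int sq t0)+
  have "zm \<in> Zad \<Omega> a b"
  proof -
    have "AE x in lborel. x \<in> \<Omega> \<longrightarrow> a x \<le> zbar x \<and> zbar x \<le> b x" "AE x in lborel. x \<in> \<Omega> \<longrightarrow> a x \<le> qbar x \<and> qbar x \<le> b x"
      using zopt(1) qopt(1) by (auto simp: Zad_def)
    then have "AE x in lborel. x \<in> \<Omega> \<longrightarrow> a x \<le> zm x \<and> zm x \<le> b x"
    proof eventually_elim
      case (elim x)
      then show ?case unfolding zm_def by (intro impI conjI) (auto simp: field_simps)
    qed
    then show ?thesis using sm(1) by (simp add: Zad_def L2_iff_sq_int)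
  qed
  moreover have "frac_state \<Omega> lam phi s zm um"
  proof (rule frac_stateI[OF sm(2,1)])
    fix k
    show "lam k powr s * coef \<Omega> phi um k = coef \<Omega> phi zm k"
      using zopt(2) t0(3) unfolding zm_def um_def coef_lin[OF sq(4) t0(2)] coef_lin[OF sq(1,2)]
      by (simp add: frac_state_def distrib_left mult.left_commute[of _ "1/2"])
  qed
  ultimately have J2: "Jcost \<Omega> \<mu> ud ubar zbar \<le> Jcost \<Omega> \<mu> ud um zm" by (rule zopt(3))
  have "(\<lambda>x. um x - ud x) = (\<lambda>x. 1/2 * (ubar x - ud x) + 1/2 * (t0 x - ud x))"
    by (auto simp: um_def field_simps)
  then have 1: "(l2n (MO \<Omega>) (\<lambda>x. um x - ud x))\<^sup>2 \<le> 1/2 * (l2n (MO \<Omega>) (\<lambda>x. ubar x - ud x))\<^sup>2 + 1/2 * (l2n (MO \<Omega>) (\<lambda>x. t0 x - ud x))\<^sup>2"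
    using l2n_midpoint[OF sq_int_diff(1)[OF sq(4,3)] sq_int_diff(1)[OF t0(2) sq(3)]] by simp
  have 2: "(l2n (MO \<Omega>) zm)\<^sup>2 = 1/2 * (l2n (MO \<Omega>) zbar)\<^sup>2 + 1/2 * (l2n (MO \<Omega>) qbar)\<^sup>2 - 1/4 * (l2n (MO \<Omega>) (\<lambda>x. zbar x - qbar x))\<^sup>2"
    unfolding zm_def by (rule l2n_midpoint[OF sq(1,2)])
  \<comment> \<open>The gain \<mu>/8 is \<mu>/2 times the 1/4 of the parallelogram law for the
    controls; the corresponding gain of the tracking term is dropped.\<close>
  have "Jcost \<Omega> \<mu> ud um zm \<le> 1/2 * Jcost \<Omega> \<mu> ud ubar zbar + 1/2 * Jcost \<Omega> \<mu> ud t0 qbar - \<mu>/8 * (l2n (MO \<Omega>) (\<lambda>x. zbar x - qbar x))\<^sup>2"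
    using 1 by (simp add: Jcost_eq sq sm t0(2) 2 algebra_simps)
  with J1 J2 have "\<mu>/8 * (l2n (MO \<Omega>) (\<lambda>x. zbar x - qbar x))\<^sup>2 \<le> 0" by linarith
  then have "(l2n (MO \<Omega>) (\<lambda>x. zbar x - qbar x))\<^sup>2 \<le> 0"
    using mu by (simp add: mult_le_0_iff)
  then have "l2n (MO \<Omega>) (\<lambda>x. zbar x - qbar x) = 0" by simp
  then have "AE x in MO \<Omega>. zbar x - qbar x = 0" by (intro l2n_zero_AE sq_int_diff sq)
  then have zq: "AE x in MO \<Omega>. zbar x = qbar x" by simp
  \<comment> \<open>With equal controls the trace \<open>t0\<close> and \<open>ubar\<close> solve
    the same spectral equation, so uniqueness identifies them.\<close>
  have "coef \<Omega> phi qbar k = coef \<Omega> phi zbar k" for k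
    unfolding coef_eq[OF sq(1)] coef_eq[OF sq(2)]
  proof (rule integral_cong_AE)
    show "AE x in MO \<Omega>. qbar x * phi k x = zbar x * phi k x" using zq by eventually_elim simp
  qed (use sq phi_sq_int[of k] in \<open>auto simp: sq_int_def\<close>)
  then have "AE x in MO \<Omega>. t0 x = ubar x" by (rule frac_state_unique[OF t0(3) zopt(2)])
  with zq t0(1) show ?thesis by (auto simp: AE_MO)
qed

end
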